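(* Let $R$ be a commutative ring, $B$ an $R$-algebra, and let $\mathscr V$ be the category $\mathbf{Mod}_R$ of $R$-modules. Let $\mathscr A$ be a small additive $R$-linear category, equipped with an $R$-linear functor $w\colon\mathscr A\to\mathbf{Mod}_B$ into the category of left $B$-modules such that $w(A)$ is finitely generated and projective for all $A\in\mathscr A$. Suppose the following conditions are satisfied: (i) the functor $w_0$ is faithful and reflects isomorphisms; (ii) the category $\operatorname{el}(w_0)$ of elements of $w_0$ is cofiltered; and (iii) if the cokernel of $w_0(f)$ is finitely generated and projective, then the cokernel of $f$ exists and is preserved by $w_0$. Then the $w$-component $N\colon\mathscr A\to\operatorname{Rep}(L(w))$ of the unit of the Tannakian adjunction is an equivalence of categories. Moreover, the comonad $L(w)\colon\mathbf{Mod}_B\to\mathbf{Mod}_B$ preserves finite limits, that is, the corresponding $B$-$B$-bimodule is flat as a right $B$-module.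
   Context: $w_0$ denotes the underlying ordinary functor of $w$. The comonad $L(w)$ on $\mathbf{Mod}_B$ is $L\otimes_B-$ for the $B$-$B$-bimodule $$L=\int^{A\in\mathscr A}w(A)\otimes_R w(A)^\vee,\qquad w(A)^\vee=\operatorname{Hom}_B(w(A),B),$$ with left $B$-action from $w(A)$ and right $B$-action from $w(A)^\vee$ (equivalently, it is the comonad $L_w\widetilde w$ of the adjunction between the left Kan extension $L_w\colon[\mathscr A^{\mathrm{op}},\mathbf{Mod}_R]\to\mathbf{Mod}_B$ of $w$ along the Yoneda embedding and its right adjoint $\widetilde w(X)=\operatorname{Hom}_B(w-,X)$). Its comultiplication is $[m\otimes\varphi]\mapsto\sum_i[m\otimes e_i^*]\otimes[e_i\otimes\varphi]$, for $(e_i,e_i^* )$ a dual basis of $w(A)$, and its counit is $[m\otimes\varphi]\mapsto\varphi(m)$. $\operatorname{Rep}(L(w))$ is the category of $L$-comodules ($M\to L\otimes_BM$, coassociative and counital) whose underlying left $B$-module is finitely generated projective. The $w$-component of the unit of the Tannakian adjunction is the functor $N\colon\mathscr A\to\operatorname{Rep}(L(w))$ sending $A$ to $w(A)$ with coaction $m\mapsto\sum_i[m\otimes e_i^*]\otimes e_i$. $\operatorname{el}(w_0)$ has objects the pairs $(A,x)$ with $A\in\mathscr A$, $x\in w(A)$, and morphisms $(A,x)\to(A',x')$ the morphisms $f\colon A\to A'$ with $w(f)(x)=x'$. *)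

theory Defs
  imports "HOL-Library.Infinite_Typeclass" "HOL-Algebra.Free_Abelian_Groups"
    "HOL-Algebra.Generated_Groups" "HOL-Algebra.Module"
begin

section \<open>Categories\<close>

text \<open>Hom-sets are indexed by source and target and need not be disjoint, so composition
  and the action of functors on arrows take the objects involved as arguments:
  \<open>Cmp C X Y Z g f\<close> is the composite of \<open>f : X \<rightarrow> Y\<close> and \<open>g : Y \<rightarrow> Z\<close>.\<close>

record ('o, 'a) cat =
  Ob :: "'o set"
  Ar :: "'o \<Rightarrow> 'o \<Rightarrow> 'a set"
  Cmp :: "'o \<Rightarrow> 'o \<Rightarrow> 'o \<Rightarrow> 'a \<Rightarrow> 'a \<Rightarrow> 'a"
  Idn :: "'o \<Rightarrow> 'a"

locale category =
  fixes C :: "('o, 'a) cat"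
  assumes Idn_closed: "X \<in> Ob C \<Longrightarrow> Idn C X \<in> Ar C X X"
    and Cmp_closed: "\<lbrakk>X \<in> Ob C; Y \<in> Ob C; Z \<in> Ob C; f \<in> Ar C X Y; g \<in> Ar C Y Z\<rbrakk>
      \<Longrightarrow> Cmp C X Y Z g f \<in> Ar C X Z"
    and Cmp_Idn_right: "\<lbrakk>X \<in> Ob C; Y \<in> Ob C; f \<in> Ar C X Y\<rbrakk> \<Longrightarrow> Cmp C X X Y f (Idn C X) = f"
    and Cmp_Idn_left: "\<lbrakk>X \<in> Ob C; Y \<in> Ob C; f \<in> Ar C X Y\<rbrakk> \<Longrightarrow> Cmp C X Y Y (Idn C Y) f = f"
    and Cmp_assoc: "\<lbrakk>W \<in> Ob C; X \<in> Ob C; Y \<in> Ob C; Z \<in> Ob C;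
        f \<in> Ar C W X; g \<in> Ar C X Y; h \<in> Ar C Y Z\<rbrakk>
      \<Longrightarrow> Cmp C W X Z (Cmp C X Y Z h g) f = Cmp C W Y Z h (Cmp C W X Y g f)"

definition is_iso :: "('o, 'a) cat \<Rightarrow> 'o \<Rightarrow> 'o \<Rightarrow> 'a \<Rightarrow> bool" where
  "is_iso C X Y f \<longleftrightarrow> f \<in> Ar C X Y \<and>
    (\<exists>g\<in>Ar C Y X. Cmp C X Y X g f = Idn C X \<and> Cmp C Y X Y f g = Idn C Y)"

record ('o, 'a, 'p, 'c) ftor =
  fob :: "'o \<Rightarrow> 'p"
  far :: "'o \<Rightarrow> 'o \<Rightarrow> 'a \<Rightarrow> 'c"

locale is_functor = C: category C + D: category D
  for C :: "('o, 'a) cat" and D :: "('p, 'c) cat" +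
  fixes F :: "('o, 'a, 'p, 'c) ftor"
  assumes fob_closed: "X \<in> Ob C \<Longrightarrow> fob F X \<in> Ob D"
    and far_closed: "\<lbrakk>X \<in> Ob C; Y \<in> Ob C; f \<in> Ar C X Y\<rbrakk>
      \<Longrightarrow> far F X Y f \<in> Ar D (fob F X) (fob F Y)"
    and far_Idn: "X \<in> Ob C \<Longrightarrow> far F X X (Idn C X) = Idn D (fob F X)"
    and far_Cmp: "\<lbrakk>X \<in> Ob C; Y \<in> Ob C; Z \<in> Ob C; f \<in> Ar C X Y; g \<in> Ar C Y Z\<rbrakk>
      \<Longrightarrow> far F X Z (Cmp C X Y Z g f)
        = Cmp D (fob F X) (fob F Y) (fob F Z) (far F Y Z g) (far F X Y f)"

definition id_functor :: "('o, 'a, 'o, 'a) ftor" where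
  "id_functor = \<lparr>fob = (\<lambda>X. X), far = (\<lambda>X Y f. f)\<rparr>"

definition comp_functor ::
    "('p, 'c, 'q, 'd) ftor \<Rightarrow> ('o, 'a, 'p, 'c) ftor \<Rightarrow> ('o, 'a, 'q, 'd) ftor" where
  "comp_functor G F = \<lparr>fob = (\<lambda>X. fob G (fob F X)),
     far = (\<lambda>X Y f. far G (fob F X) (fob F Y) (far F X Y f))\<rparr>"

definition nat_iso :: "('o, 'a) cat \<Rightarrow> ('p, 'c) cat \<Rightarrow> ('o, 'a, 'p, 'c) ftor \<Rightarrow>
    ('o, 'a, 'p, 'c) ftor \<Rightarrow> ('o \<Rightarrow> 'c) \<Rightarrow> bool" where
  "nat_iso C D F G \<alpha> \<longleftrightarrow>
     (\<forall>X\<in>Ob C. is_iso D (fob F X) (fob G X) (\<alpha> X)) \<and>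
     (\<forall>X\<in>Ob C. \<forall>Y\<in>Ob C. \<forall>f\<in>Ar C X Y.
        Cmp D (fob F X) (fob F Y) (fob G Y) (\<alpha> Y) (far F X Y f)
        = Cmp D (fob F X) (fob G X) (fob G Y) (far G X Y f) (\<alpha> X))"

definition equivalence_of_categories ::
    "('o, 'a) cat \<Rightarrow> ('p, 'c) cat \<Rightarrow> ('o, 'a, 'p, 'c) ftor \<Rightarrow> bool" where
  "equivalence_of_categories C D F \<longleftrightarrow> is_functor C D F \<and>
     (\<exists>G \<eta> \<epsilon>. is_functor D C G
        \<and> nat_iso C C id_functor (comp_functor G F) \<eta>
        \<and> nat_iso D D (comp_functor F G) id_functor \<epsilon>)"

definition faithful_functor ::
    "('o, 'a) cat \<Rightarrow> ('p, 'c) cat \<Rightarrow> ('o, 'a, 'p, 'c) ftor \<Rightarrow> bool" where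
  "faithful_functor C D F \<longleftrightarrow>
     is_functor C D F \<and> (\<forall>X\<in>Ob C. \<forall>Y\<in>Ob C. inj_on (far F X Y) (Ar C X Y))"

definition reflects_isos ::
    "('o, 'a) cat \<Rightarrow> ('p, 'c) cat \<Rightarrow> ('o, 'a, 'p, 'c) ftor \<Rightarrow> bool" where
  "reflects_isos C D F \<longleftrightarrow> (\<forall>X\<in>Ob C. \<forall>Y\<in>Ob C. \<forall>f\<in>Ar C X Y.
     is_iso D (fob F X) (fob F Y) (far F X Y f) \<longrightarrow> is_iso C X Y f)"

definition cofiltered :: "('o, 'a) cat \<Rightarrow> bool" where
  "cofiltered C \<longleftrightarrow> Ob C \<noteq> {} \<and>
     (\<forall>X\<in>Ob C. \<forall>Y\<in>Ob C. \<exists>Z\<in>Ob C. Ar C Z X \<noteq> {} \<and> Ar C Z Y \<noteq> {}) \<and>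
     (\<forall>X\<in>Ob C. \<forall>Y\<in>Ob C. \<forall>f\<in>Ar C X Y. \<forall>g\<in>Ar C X Y.
        \<exists>Z\<in>Ob C. \<exists>h\<in>Ar C Z X. Cmp C Z X Y f h = Cmp C Z X Y g h)"

definition is_cone :: "('j, 'u) cat \<Rightarrow> ('o, 'a) cat \<Rightarrow> ('j, 'u, 'o, 'a) ftor \<Rightarrow>
    'o \<Rightarrow> ('j \<Rightarrow> 'a) \<Rightarrow> bool" where
  "is_cone J C D P \<pi> \<longleftrightarrow> P \<in> Ob C \<and> (\<forall>j\<in>Ob J. \<pi> j \<in> Ar C P (fob D j)) \<and>
     (\<forall>i\<in>Ob J. \<forall>j\<in>Ob J. \<forall>u\<in>Ar J i j. Cmp C P (fob D i) (fob D j) (far D i j u) (\<pi> i) = \<pi> j)"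

definition is_limit :: "('j, 'u) cat \<Rightarrow> ('o, 'a) cat \<Rightarrow> ('j, 'u, 'o, 'a) ftor \<Rightarrow>
    'o \<Rightarrow> ('j \<Rightarrow> 'a) \<Rightarrow> bool" where
  "is_limit J C D P \<pi> \<longleftrightarrow> is_cone J C D P \<pi> \<and>
     (\<forall>Q \<sigma>. is_cone J C D Q \<sigma> \<longrightarrow>
        (\<exists>!h. h \<in> Ar C Q P \<and> (\<forall>j\<in>Ob J. Cmp C Q P (fob D j) (\<pi> j) h = \<sigma> j)))"

definition finite_category :: "('j, 'u) cat \<Rightarrow> bool" where
  "finite_category J \<longleftrightarrow> category J \<and> finite (Ob J) \<and> (\<forall>i\<in>Ob J. \<forall>j\<in>Ob J. finite (Ar J i j))"

text \<open>Every finite category is isomorphic to one whose objects and arrows are natural numbers.\<close>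

definition preserves_finite_limits ::
    "('o, 'a) cat \<Rightarrow> ('p, 'c) cat \<Rightarrow> ('o, 'a, 'p, 'c) ftor \<Rightarrow> bool" where
  "preserves_finite_limits C D F \<longleftrightarrow> is_functor C D F \<and>
     (\<forall>(J :: (nat, nat) cat) G P \<pi>.
        finite_category J \<and> is_functor J C G \<and> is_limit J C G P \<pi> \<longrightarrow>
        is_limit J D (comp_functor F G) (fob F P) (\<lambda>j. far F P (fob G j) (\<pi> j)))"


section \<open>Linear categories\<close>

text \<open>Only the additive group and the scalar multiplication of a \<^typ>\<open>('r, 'a) module\<close> record
  matter for a module; its ring multiplication and unit are ignored.\<close>

record ('o, 'a, 'r) lin_cat =
  LOb :: "'o set"
  LHom :: "'o \<Rightarrow> 'o \<Rightarrow> ('r, 'a) module"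
  LCmp :: "'o \<Rightarrow> 'o \<Rightarrow> 'o \<Rightarrow> 'a \<Rightarrow> 'a \<Rightarrow> 'a"
  LIdn :: "'o \<Rightarrow> 'a"

definition ordinary :: "('o, 'a, 'r) lin_cat \<Rightarrow> ('o, 'a) cat" where
  "ordinary C = \<lparr>Ob = LOb C, Ar = (\<lambda>X Y. carrier (LHom C X Y)), Cmp = LCmp C, Idn = LIdn C\<rparr>"

locale linear_category = R: cring R + category "ordinary C"
  for R :: "'r ring" and C :: "('o, 'a, 'r) lin_cat" +
  assumes LHom_module: "\<lbrakk>X \<in> LOb C; Y \<in> LOb C\<rbrakk> \<Longrightarrow> Module.module R (LHom C X Y)"
    and LCmp_add_left: "\<lbrakk>X \<in> LOb C; Y \<in> LOb C; Z \<in> LOb C; f \<in> carrier (LHom C X Y);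
        g \<in> carrier (LHom C Y Z); g' \<in> carrier (LHom C Y Z)\<rbrakk>
      \<Longrightarrow> LCmp C X Y Z (g \<oplus>\<^bsub>LHom C Y Z\<^esub> g') f = LCmp C X Y Z g f \<oplus>\<^bsub>LHom C X Z\<^esub> LCmp C X Y Z g' f"
    and LCmp_add_right: "\<lbrakk>X \<in> LOb C; Y \<in> LOb C; Z \<in> LOb C; f \<in> carrier (LHom C X Y);
        f' \<in> carrier (LHom C X Y); g \<in> carrier (LHom C Y Z)\<rbrakk>
      \<Longrightarrow> LCmp C X Y Z g (f \<oplus>\<^bsub>LHom C X Y\<^esub> f') = LCmp C X Y Z g f \<oplus>\<^bsub>LHom C X Z\<^esub> LCmp C X Y Z g f'"
    and LCmp_smult_left: "\<lbrakk>X \<in> LOb C; Y \<in> LOb C; Z \<in> LOb C; r \<in> carrier R;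
        f \<in> carrier (LHom C X Y); g \<in> carrier (LHom C Y Z)\<rbrakk>
      \<Longrightarrow> LCmp C X Y Z (r \<odot>\<^bsub>LHom C Y Z\<^esub> g) f = r \<odot>\<^bsub>LHom C X Z\<^esub> LCmp C X Y Z g f"
    and LCmp_smult_right: "\<lbrakk>X \<in> LOb C; Y \<in> LOb C; Z \<in> LOb C; r \<in> carrier R;
        f \<in> carrier (LHom C X Y); g \<in> carrier (LHom C Y Z)\<rbrakk>
      \<Longrightarrow> LCmp C X Y Z g (r \<odot>\<^bsub>LHom C X Y\<^esub> f) = r \<odot>\<^bsub>LHom C X Z\<^esub> LCmp C X Y Z g f"

definition has_zero_object :: "('o, 'a, 'r) lin_cat \<Rightarrow> bool" where
  "has_zero_object C \<longleftrightarrow> (\<exists>Z\<in>LOb C. LIdn C Z = \<zero>\<^bsub>LHom C Z Z\<^esub>)"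

definition is_biproduct :: "('o, 'a, 'r) lin_cat \<Rightarrow> 'o \<Rightarrow> 'o \<Rightarrow> 'o \<Rightarrow> 'a \<Rightarrow> 'a \<Rightarrow> 'a \<Rightarrow> 'a \<Rightarrow> bool" where
  "is_biproduct C X Y P i j p q \<longleftrightarrow> P \<in> LOb C \<and>
     i \<in> carrier (LHom C X P) \<and> j \<in> carrier (LHom C Y P) \<and>
     p \<in> carrier (LHom C P X) \<and> q \<in> carrier (LHom C P Y) \<and>
     LCmp C X P X p i = LIdn C X \<and> LCmp C Y P Y q j = LIdn C Y \<and>
     LCmp C Y P X p j = \<zero>\<^bsub>LHom C Y X\<^esub> \<and> LCmp C X P Y q i = \<zero>\<^bsub>LHom C X Y\<^esub> \<and>
     LCmp C P X P i p \<oplus>\<^bsub>LHom C P P\<^esub> LCmp C P Y P j q = LIdn C P"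

locale additive_linear_category = linear_category +
  assumes zero_object: "has_zero_object C"
    and biproducts: "\<lbrakk>X \<in> LOb C; Y \<in> LOb C\<rbrakk> \<Longrightarrow> \<exists>P i j p q. is_biproduct C X Y P i j p q"

locale linear_functor = C: linear_category R C + D: linear_category R D
    + is_functor "ordinary C" "ordinary D" F
  for R :: "'r ring" and C :: "('o, 'a, 'r) lin_cat" and D :: "('p, 'c, 'r) lin_cat"
    and F :: "('o, 'a, 'p, 'c) ftor" +
  assumes far_add: "\<lbrakk>X \<in> LOb C; Y \<in> LOb C; f \<in> carrier (LHom C X Y); g \<in> carrier (LHom C X Y)\<rbrakk>
      \<Longrightarrow> far F X Y (f \<oplus>\<^bsub>LHom C X Y\<^esub> g) = far F X Y f \<oplus>\<^bsub>LHom D (fob F X) (fob F Y)\<^esub> far F X Y g"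
    and far_smult: "\<lbrakk>X \<in> LOb C; Y \<in> LOb C; r \<in> carrier R; f \<in> carrier (LHom C X Y)\<rbrakk>
      \<Longrightarrow> far F X Y (r \<odot>\<^bsub>LHom C X Y\<^esub> f) = r \<odot>\<^bsub>LHom D (fob F X) (fob F Y)\<^esub> far F X Y f"

definition is_cokernel :: "('o, 'a, 'r) lin_cat \<Rightarrow> 'o \<Rightarrow> 'o \<Rightarrow> 'a \<Rightarrow> 'o \<Rightarrow> 'a \<Rightarrow> bool" where
  "is_cokernel C X Y f Q q \<longleftrightarrow> Q \<in> LOb C \<and> q \<in> carrier (LHom C Y Q) \<and>
     LCmp C X Y Q q f = \<zero>\<^bsub>LHom C X Q\<^esub> \<and>
     (\<forall>Z\<in>LOb C. \<forall>g\<in>carrier (LHom C Y Z). LCmp C X Y Z g f = \<zero>\<^bsub>LHom C X Z\<^esub> \<longrightarrow>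
        (\<exists>!h. h \<in> carrier (LHom C Q Z) \<and> LCmp C Y Q Z h q = g))"


section \<open>Algebras and modules over noncommutative rings\<close>

text \<open>The locale \<^locale>\<open>Module.algebra\<close> of the library covers commutative algebras only, and
  \<^locale>\<open>Module.module\<close> only modules over commutative rings.\<close>

locale assoc_algebra = Module.module R B + ring B
  for R :: "'r ring" and B :: "('r, 'b) module" +
  assumes smult_mult_left: "\<lbrakk>r \<in> carrier R; x \<in> carrier B; y \<in> carrier B\<rbrakk>
      \<Longrightarrow> (r \<odot>\<^bsub>B\<^esub> x) \<otimes>\<^bsub>B\<^esub> y = r \<odot>\<^bsub>B\<^esub> (x \<otimes>\<^bsub>B\<^esub> y)"
    and smult_mult_right: "\<lbrakk>r \<in> carrier R; x \<in> carrier B; y \<in> carrier B\<rbrakk>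
      \<Longrightarrow> x \<otimes>\<^bsub>B\<^esub> (r \<odot>\<^bsub>B\<^esub> y) = r \<odot>\<^bsub>B\<^esub> (x \<otimes>\<^bsub>B\<^esub> y)"

locale left_module = B: ring B + M: abelian_group M
  for B :: "('b, 'y) ring_scheme" and M :: "('b, 'm, 'z) module_scheme" +
  assumes smult_closed: "\<lbrakk>b \<in> carrier B; x \<in> carrier M\<rbrakk> \<Longrightarrow> b \<odot>\<^bsub>M\<^esub> x \<in> carrier M"
    and smult_l_distr: "\<lbrakk>b \<in> carrier B; c \<in> carrier B; x \<in> carrier M\<rbrakk>
      \<Longrightarrow> (b \<oplus>\<^bsub>B\<^esub> c) \<odot>\<^bsub>M\<^esub> x = b \<odot>\<^bsub>M\<^esub> x \<oplus>\<^bsub>M\<^esub> c \<odot>\<^bsub>M\<^esub> x"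
    and smult_r_distr: "\<lbrakk>b \<in> carrier B; x \<in> carrier M; y \<in> carrier M\<rbrakk>
      \<Longrightarrow> b \<odot>\<^bsub>M\<^esub> (x \<oplus>\<^bsub>M\<^esub> y) = b \<odot>\<^bsub>M\<^esub> x \<oplus>\<^bsub>M\<^esub> b \<odot>\<^bsub>M\<^esub> y"
    and smult_assoc: "\<lbrakk>b \<in> carrier B; c \<in> carrier B; x \<in> carrier M\<rbrakk>
      \<Longrightarrow> (b \<otimes>\<^bsub>B\<^esub> c) \<odot>\<^bsub>M\<^esub> x = b \<odot>\<^bsub>M\<^esub> (c \<odot>\<^bsub>M\<^esub> x)"
    and smult_one: "x \<in> carrier M \<Longrightarrow> \<one>\<^bsub>B\<^esub> \<odot>\<^bsub>M\<^esub> x = x"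

text \<open>Homomorphisms are extensional functions, so that equal maps are equal as functions.\<close>

definition mod_hom :: "('b, 'y) ring_scheme \<Rightarrow> ('b, 'm, 'z) module_scheme \<Rightarrow>
    ('b, 'n, 'v) module_scheme \<Rightarrow> ('m \<Rightarrow> 'n) set" where
  "mod_hom B M N = {f \<in> carrier M \<rightarrow>\<^sub>E carrier N.
     (\<forall>x\<in>carrier M. \<forall>y\<in>carrier M. f (x \<oplus>\<^bsub>M\<^esub> y) = f x \<oplus>\<^bsub>N\<^esub> f y) \<and>
     (\<forall>b\<in>carrier B. \<forall>x\<in>carrier M. f (b \<odot>\<^bsub>M\<^esub> x) = b \<odot>\<^bsub>N\<^esub> f x)}"

text \<open>The scalar \<open>r \<in> R\<close> acts on a \<open>B\<close>-module as the central element \<open>r \<cdot> 1\<close> of \<open>B\<close>.\<close>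

definition scalar :: "('r, 'b) module \<Rightarrow> 'r \<Rightarrow> 'b" where
  "scalar B r = r \<odot>\<^bsub>B\<^esub> \<one>\<^bsub>B\<^esub>"

text \<open>The \<open>R\<close>-linear category of left \<open>B\<close>-modules with carrier in the type \<^typ>\<open>'m\<close>, which
  plays the role of the universe.\<close>

definition Mod_cat :: "('r, 'b) module \<Rightarrow> (('b, 'm) module, 'm \<Rightarrow> 'm, 'r) lin_cat" where
  "Mod_cat B = \<lparr>LOb = {M. left_module B M},
     LHom = (\<lambda>M N. \<lparr>carrier = mod_hom B M N, mult = undefined, one = undefined,
        zero = (\<lambda>x\<in>carrier M. \<zero>\<^bsub>N\<^esub>),
        add = (\<lambda>f g. \<lambda>x\<in>carrier M. f x \<oplus>\<^bsub>N\<^esub> g x),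
        smult = (\<lambda>r f. \<lambda>x\<in>carrier M. scalar B r \<odot>\<^bsub>N\<^esub> f x)\<rparr>),
     LCmp = (\<lambda>M N P g f. compose (carrier M) g f),
     LIdn = (\<lambda>M. \<lambda>x\<in>carrier M. x)\<rparr>"

definition finitely_generated ::
    "('b, 'y) ring_scheme \<Rightarrow> ('b, 'm, 'z) module_scheme \<Rightarrow> bool" where
  "finitely_generated B M \<longleftrightarrow> (\<exists>S. finite S \<and> S \<subseteq> carrier M \<and>
     (\<forall>x\<in>carrier M. \<exists>c\<in>S \<rightarrow> carrier B. x = (\<Oplus>\<^bsub>M\<^esub>s\<in>S. c s \<odot>\<^bsub>M\<^esub> s)))"

definition free_module :: "('b, 'y) ring_scheme \<Rightarrow> 'x set \<Rightarrow> ('b, 'x \<Rightarrow> 'b) module" where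
  "free_module B X = \<lparr>carrier = {c \<in> X \<rightarrow>\<^sub>E carrier B. finite {x\<in>X. c x \<noteq> \<zero>\<^bsub>B\<^esub>}},
     mult = undefined, one = undefined,
     zero = (\<lambda>x\<in>X. \<zero>\<^bsub>B\<^esub>), add = (\<lambda>c d. \<lambda>x\<in>X. c x \<oplus>\<^bsub>B\<^esub> d x),
     smult = (\<lambda>b c. \<lambda>x\<in>X. b \<otimes>\<^bsub>B\<^esub> c x)\<rparr>"

text \<open>Projective means being a direct summand of a free module. A projective \<open>M\<close> is always a
  summand of the free module on a generating subset, so free modules on
  subsets of \<^typ>\<open>'m\<close> suffice.\<close>

definition projective ::
    "('b, 'y) ring_scheme \<Rightarrow> ('b, 'm, 'z) module_scheme \<Rightarrow> bool" where
  "projective B M \<longleftrightarrow> (\<exists>(X :: 'm set). \<exists>i\<in>mod_hom B M (free_module B X).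
     \<exists>p\<in>mod_hom B (free_module B X) M. \<forall>x\<in>carrier M. p (i x) = x)"

definition fg_projective ::
    "('b, 'y) ring_scheme \<Rightarrow> ('b, 'm, 'z) module_scheme \<Rightarrow> bool" where
  "fg_projective B M \<longleftrightarrow> left_module B M \<and> finitely_generated B M \<and> projective B M"

definition left_regular :: "('b, 'y) ring_scheme \<Rightarrow> ('b, 'b) module" where
  "left_regular B = \<lparr>carrier = carrier B, mult = mult B, one = one B,
     zero = zero B, add = add B, smult = mult B\<rparr>"

definition dual :: "('b, 'y) ring_scheme \<Rightarrow> ('b, 'm, 'z) module_scheme \<Rightarrow> ('m \<Rightarrow> 'b) set" where
  "dual B M = mod_hom B M (left_regular B)"

definition is_dual_basis :: "('b, 'y) ring_scheme \<Rightarrow> ('b, 'm, 'z) module_scheme \<Rightarrow>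
    nat \<times> (nat \<Rightarrow> 'm) \<times> (nat \<Rightarrow> 'm \<Rightarrow> 'b) \<Rightarrow> bool" where
  "is_dual_basis B M = (\<lambda>(n, e, d). e \<in> {..<n} \<rightarrow> carrier M \<and> d \<in> {..<n} \<rightarrow> dual B M \<and>
     (\<forall>x\<in>carrier M. x = (\<Oplus>\<^bsub>M\<^esub>i\<in>{..<n}. d i x \<odot>\<^bsub>M\<^esub> e i)))"

definition dual_basis :: "('b, 'y) ring_scheme \<Rightarrow> ('b, 'm, 'z) module_scheme \<Rightarrow>
    nat \<times> (nat \<Rightarrow> 'm) \<times> (nat \<Rightarrow> 'm \<Rightarrow> 'b)" where
  "dual_basis B M = (SOME t. is_dual_basis B M t)"


section \<open>Abelian groups by generators and relations\<close>

definition pres_class :: "'s set \<Rightarrow> ('s \<Rightarrow>\<^sub>0 int) set \<Rightarrow> 's \<Rightarrow> ('s \<Rightarrow>\<^sub>0 int) set" where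
  "pres_class S E s = generate (free_Abelian_group S) E #>\<^bsub>free_Abelian_group S\<^esub> frag_of s"

definition pres_group :: "'s set \<Rightarrow> ('s \<Rightarrow>\<^sub>0 int) set \<Rightarrow> ('s \<Rightarrow>\<^sub>0 int) set ring" where
  "pres_group S E = (let Q = free_Abelian_group S Mod generate (free_Abelian_group S) E in
     \<lparr>carrier = carrier Q, mult = undefined, one = undefined, zero = one Q, add = mult Q\<rparr>)"

definition free_ext :: "('t, 'z) ring_scheme \<Rightarrow> ('s \<Rightarrow> 't) \<Rightarrow> ('s \<Rightarrow>\<^sub>0 int) \<Rightarrow> 't" where
  "free_ext T g u = (\<Oplus>\<^bsub>T\<^esub>s\<in>Poly_Mapping.keys u. [Poly_Mapping.lookup u s] \<cdot>\<^bsub>T\<^esub> g s)"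

text \<open>The additive map to \<open>T\<close> induced by a map \<open>g\<close> on generators that respects the relations;
  its value on a coset \<open>C\<close> is the only element of the image of \<open>C\<close> under \<open>free_ext T g\<close>.\<close>

definition pres_lift :: "('t, 'z) ring_scheme \<Rightarrow> ('s \<Rightarrow> 't) \<Rightarrow> ('s \<Rightarrow>\<^sub>0 int) set \<Rightarrow> 't" where
  "pres_lift T g C = the_elem (free_ext T g ` C)"


section \<open>Bimodules and tensor products\<close>

record ('b, 'l) bimodule = "('b, 'l) module" +
  rsmult :: "'l \<Rightarrow> 'b \<Rightarrow> 'l"

definition tensor_gens ::
    "('b, 'l, 'z) bimodule_scheme \<Rightarrow> ('b, 'm, 'v) module_scheme \<Rightarrow> ('l \<times> 'm) set" where
  "tensor_gens L M = carrier L \<times> carrier M"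

definition tensor_rels :: "('b, 'y) ring_scheme \<Rightarrow> ('b, 'l, 'z) bimodule_scheme \<Rightarrow>
    ('b, 'm, 'v) module_scheme \<Rightarrow> ('l \<times> 'm \<Rightarrow>\<^sub>0 int) set" where
  "tensor_rels B L M =
     {frag_of (k \<oplus>\<^bsub>L\<^esub> l, x) - frag_of (k, x) - frag_of (l, x) |k l x.
        k \<in> carrier L \<and> l \<in> carrier L \<and> x \<in> carrier M} \<union>
     {frag_of (l, x \<oplus>\<^bsub>M\<^esub> y) - frag_of (l, x) - frag_of (l, y) |l x y.
        l \<in> carrier L \<and> x \<in> carrier M \<and> y \<in> carrier M} \<union>
     {frag_of (rsmult L l b, x) - frag_of (l, b \<odot>\<^bsub>M\<^esub> x) |l b x.
        l \<in> carrier L \<and> b \<in> carrier B \<and> x \<in> carrier M}"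

definition tens :: "('b, 'y) ring_scheme \<Rightarrow> ('b, 'l, 'z) bimodule_scheme \<Rightarrow>
    ('b, 'm, 'v) module_scheme \<Rightarrow> 'l \<Rightarrow> 'm \<Rightarrow> ('l \<times> 'm \<Rightarrow>\<^sub>0 int) set" where
  "tens B L M l x = pres_class (tensor_gens L M) (tensor_rels B L M) (l, x)"

definition tensor :: "('b, 'y) ring_scheme \<Rightarrow> ('b, 'l, 'z) bimodule_scheme \<Rightarrow>
    ('b, 'm, 'v) module_scheme \<Rightarrow> ('b, ('l \<times> 'm \<Rightarrow>\<^sub>0 int) set) module" where
  "tensor B L M = (let G = pres_group (tensor_gens L M) (tensor_rels B L M) in
     \<lparr>carrier = carrier G, mult = undefined, one = undefined, zero = zero G, add = add G,
      smult = (\<lambda>b. pres_lift G (\<lambda>(l, x). tens B L M (b \<odot>\<^bsub>L\<^esub> l) x))\<rparr>)"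

definition tensor_map :: "('b, 'y) ring_scheme \<Rightarrow> ('b, 'l, 'z) bimodule_scheme \<Rightarrow>
    ('b, 'm, 'v) module_scheme \<Rightarrow> ('b, 'n, 'u) module_scheme \<Rightarrow> ('m \<Rightarrow> 'n) \<Rightarrow>
    ('l \<times> 'm \<Rightarrow>\<^sub>0 int) set \<Rightarrow> ('l \<times> 'n \<Rightarrow>\<^sub>0 int) set" where
  "tensor_map B L M N f =
     (\<lambda>t\<in>carrier (tensor B L M). pres_lift (tensor B L N) (\<lambda>(l, x). tens B L N l (f x)) t)"

definition tensor_functor :: "('b, 'y) ring_scheme \<Rightarrow> ('b, 'l, 'z) bimodule_scheme \<Rightarrow>
    (('b, 'm) module, 'm \<Rightarrow> 'm,
     ('b, ('l \<times> 'm \<Rightarrow>\<^sub>0 int) set) module,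
     ('l \<times> 'm \<Rightarrow>\<^sub>0 int) set \<Rightarrow> ('l \<times> 'm \<Rightarrow>\<^sub>0 int) set) ftor" where
  "tensor_functor B L = \<lparr>fob = (\<lambda>M. tensor B L M), far = (\<lambda>M N f. tensor_map B L M N f)\<rparr>"

text \<open>Flatness of \<open>L\<close> as a right module, tested on left modules with carrier in the type
  \<^typ>\<open>'n\<close>; flatness proper means this for arbitrary \<^typ>\<open>'n\<close>. Similarly, preservation of
  finite limits by \<open>tensor_functor\<close> should be stated for an arbitrary infinite type: over such
  a type \<open>Mod_cat\<close> is closed under finite limits up to isomorphism, so that limits in it are
  limits of modules, whereas a finite type has no room for finite products.\<close>

definition flat_right ::
    "'n itself \<Rightarrow> ('b, 'y) ring_scheme \<Rightarrow> ('b, 'l, 'z) bimodule_scheme \<Rightarrow> bool" where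
  "flat_right U B L \<longleftrightarrow> (\<forall>(M :: ('b, 'n) module) (N :: ('b, 'n) module). \<forall>f\<in>mod_hom B M N.
     left_module B M \<and> left_module B N \<and> inj_on f (carrier M) \<longrightarrow>
     inj_on (tensor_map B L M N f) (carrier (tensor B L M)))"


section \<open>Comodules over a bimodule with comultiplication and counit\<close>

text \<open>The comultiplication of the comonad \<open>L \<otimes> -\<close> induced by a comultiplication \<open>\<Delta>\<close> on \<open>L\<close>: the
  composite of \<open>\<Delta> \<otimes> M\<close> with the associativity isomorphism to \<open>L \<otimes> (L \<otimes> M)\<close>.\<close>

definition comonad_comult :: "('b, 'y) ring_scheme \<Rightarrow> ('b, 'l, 'z) bimodule_scheme \<Rightarrow>
    ('l \<Rightarrow> ('l \<times> 'l \<Rightarrow>\<^sub>0 int) set) \<Rightarrow> ('b, 'm, 'v) module_scheme \<Rightarrow>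
    ('l \<times> 'm \<Rightarrow>\<^sub>0 int) set \<Rightarrow> ('l \<times> ('l \<times> 'm \<Rightarrow>\<^sub>0 int) set \<Rightarrow>\<^sub>0 int) set" where
  "comonad_comult B L \<Delta> M = (let T = tensor B L (tensor B L M) in
     pres_lift T (\<lambda>(l, x).
       pres_lift T (\<lambda>(k, k'). tens B L (tensor B L M) k (tens B L M k' x)) (\<Delta> l)))"

definition comonad_counit ::
    "('l \<Rightarrow> 'b) \<Rightarrow> ('b, 'm, 'v) module_scheme \<Rightarrow> ('l \<times> 'm \<Rightarrow>\<^sub>0 int) set \<Rightarrow> 'm" where
  "comonad_counit \<epsilon> M = pres_lift M (\<lambda>(l, x). \<epsilon> l \<odot>\<^bsub>M\<^esub> x)"

definition is_comodule :: "('b, 'y) ring_scheme \<Rightarrow> ('b, 'l, 'z) bimodule_scheme \<Rightarrow>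
    ('l \<Rightarrow> ('l \<times> 'l \<Rightarrow>\<^sub>0 int) set) \<Rightarrow> ('l \<Rightarrow> 'b) \<Rightarrow>
    ('b, 'm, 'v) module_scheme \<Rightarrow> ('m \<Rightarrow> ('l \<times> 'm \<Rightarrow>\<^sub>0 int) set) \<Rightarrow> bool" where
  "is_comodule B L \<Delta> \<epsilon> M \<rho> \<longleftrightarrow> left_module B M \<and> \<rho> \<in> mod_hom B M (tensor B L M) \<and>
     (\<forall>x\<in>carrier M.
        comonad_comult B L \<Delta> M (\<rho> x) = tensor_map B L M (tensor B L M) \<rho> (\<rho> x)) \<and>
     (\<forall>x\<in>carrier M. comonad_counit \<epsilon> M (\<rho> x) = x)"

definition Rep_cat :: "('b, 'y) ring_scheme \<Rightarrow> ('b, 'l, 'z) bimodule_scheme \<Rightarrow>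
    ('l \<Rightarrow> ('l \<times> 'l \<Rightarrow>\<^sub>0 int) set) \<Rightarrow> ('l \<Rightarrow> 'b) \<Rightarrow>
    (('b, 'm) module \<times> ('m \<Rightarrow> ('l \<times> 'm \<Rightarrow>\<^sub>0 int) set), 'm \<Rightarrow> 'm) cat" where
  "Rep_cat B L \<Delta> \<epsilon> = \<lparr>Ob = {(M, \<rho>). is_comodule B L \<Delta> \<epsilon> M \<rho> \<and> fg_projective B M},
     Ar = (\<lambda>(M, \<rho>) (N, \<sigma>). {f \<in> mod_hom B M N.
        \<forall>x\<in>carrier M. tensor_map B L M N f (\<rho> x) = \<sigma> (f x)}),
     Cmp = (\<lambda>(M, \<rho>) (N, \<sigma>) (P, \<tau>) g f. compose (carrier M) g f),
     Idn = (\<lambda>(M, \<rho>). \<lambda>x\<in>carrier M. x)\<rparr>"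


section \<open>The coend bimodule of a fibre functor\<close>

type_synonym ('o, 'a, 'b, 'm) fibre = "('o, 'a, ('b, 'm) module, 'm \<Rightarrow> 'm) ftor"
type_synonym ('o, 'b, 'm) coend_gen = "'o \<times> 'm \<times> ('m \<Rightarrow> 'b)"
type_synonym ('o, 'b, 'm) coend_elt = "(('o, 'b, 'm) coend_gen \<Rightarrow>\<^sub>0 int) set"

text \<open>A generator \<open>(X, m, \<phi>)\<close> stands for \<open>m \<otimes> \<phi>\<close> in the summand \<open>w(X) \<otimes>\<^sub>R w(X)\<^sup>\<or>\<close>. The first three
  families of relations present the direct sum of these tensor products over \<open>R\<close>, the last
  one is dinaturality. Since elements of \<open>Hom(X, Y) \<otimes>\<^sub>R w(X) \<otimes>\<^sub>R w(Y)\<^sup>\<or>\<close> are sums of pure tensors,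
  the result is the coend over the linear category.\<close>

definition coend_gens :: "('r, 'b) module \<Rightarrow> ('o, 'a, 'r) lin_cat \<Rightarrow> ('o, 'a, 'b, 'm) fibre \<Rightarrow>
    ('o, 'b, 'm) coend_gen set" where
  "coend_gens B A w = {(X, m, \<phi>). X \<in> LOb A \<and> m \<in> carrier (fob w X) \<and> \<phi> \<in> dual B (fob w X)}"

definition coend_rels :: "'r ring \<Rightarrow> ('r, 'b) module \<Rightarrow> ('o, 'a, 'r) lin_cat \<Rightarrow>
    ('o, 'a, 'b, 'm) fibre \<Rightarrow> (('o, 'b, 'm) coend_gen \<Rightarrow>\<^sub>0 int) set" where
  "coend_rels R B A w =
     {frag_of (X, m \<oplus>\<^bsub>fob w X\<^esub> n, \<phi>) - frag_of (X, m, \<phi>) - frag_of (X, n, \<phi>) |X m n \<phi>.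
        X \<in> LOb A \<and> m \<in> carrier (fob w X) \<and> n \<in> carrier (fob w X) \<and> \<phi> \<in> dual B (fob w X)} \<union>
     {frag_of (X, m, \<lambda>x\<in>carrier (fob w X). \<phi> x \<oplus>\<^bsub>B\<^esub> \<psi> x) - frag_of (X, m, \<phi>) - frag_of (X, m, \<psi>)
        |X m \<phi> \<psi>. X \<in> LOb A \<and> m \<in> carrier (fob w X) \<and>
        \<phi> \<in> dual B (fob w X) \<and> \<psi> \<in> dual B (fob w X)} \<union>
     {frag_of (X, scalar B r \<odot>\<^bsub>fob w X\<^esub> m, \<phi>)
        - frag_of (X, m, \<lambda>x\<in>carrier (fob w X). scalar B r \<otimes>\<^bsub>B\<^esub> \<phi> x)
        |X r m \<phi>. X \<in> LOb A \<and> r \<in> carrier R \<and> m \<in> carrier (fob w X) \<and> \<phi> \<in> dual B (fob w X)} \<union>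
     {frag_of (Y, far w X Y f m, \<phi>) - frag_of (X, m, compose (carrier (fob w X)) \<phi> (far w X Y f))
        |X Y f m \<phi>. X \<in> LOb A \<and> Y \<in> LOb A \<and> f \<in> carrier (LHom A X Y) \<and>
        m \<in> carrier (fob w X) \<and> \<phi> \<in> dual B (fob w Y)}"

definition coend_class :: "'r ring \<Rightarrow> ('r, 'b) module \<Rightarrow> ('o, 'a, 'r) lin_cat \<Rightarrow>
    ('o, 'a, 'b, 'm) fibre \<Rightarrow> 'o \<Rightarrow> 'm \<Rightarrow> ('m \<Rightarrow> 'b) \<Rightarrow> ('o, 'b, 'm) coend_elt" where
  "coend_class R B A w X m \<phi> = pres_class (coend_gens B A w) (coend_rels R B A w) (X, m, \<phi>)"

definition coend_bimodule :: "'r ring \<Rightarrow> ('r, 'b) module \<Rightarrow> ('o, 'a, 'r) lin_cat \<Rightarrow>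
    ('o, 'a, 'b, 'm) fibre \<Rightarrow> ('b, ('o, 'b, 'm) coend_elt) bimodule" where
  "coend_bimodule R B A w = (let G = pres_group (coend_gens B A w) (coend_rels R B A w) in
     \<lparr>carrier = carrier G, mult = undefined, one = undefined, zero = zero G, add = add G,
      smult = (\<lambda>b. pres_lift G (\<lambda>(X, m, \<phi>). coend_class R B A w X (b \<odot>\<^bsub>fob w X\<^esub> m) \<phi>)),
      rsmult = (\<lambda>l b. pres_lift G (\<lambda>(X, m, \<phi>).
        coend_class R B A w X m (\<lambda>x\<in>carrier (fob w X). \<phi> x \<otimes>\<^bsub>B\<^esub> b)) l)\<rparr>)"

definition coend_comult :: "'r ring \<Rightarrow> ('r, 'b) module \<Rightarrow> ('o, 'a, 'r) lin_cat \<Rightarrow>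
    ('o, 'a, 'b, 'm) fibre \<Rightarrow> ('o, 'b, 'm) coend_elt \<Rightarrow>
    (('o, 'b, 'm) coend_elt \<times> ('o, 'b, 'm) coend_elt \<Rightarrow>\<^sub>0 int) set" where
  "coend_comult R B A w = (let L = coend_bimodule R B A w; T = tensor B L L in
     pres_lift T (\<lambda>(X, m, \<phi>). let (n, e, d) = dual_basis B (fob w X) in
       \<Oplus>\<^bsub>T\<^esub>i\<in>{..<n}. tens B L L (coend_class R B A w X m (d i)) (coend_class R B A w X (e i) \<phi>)))"

definition coend_counit :: "('r, 'b) module \<Rightarrow> ('o, 'b, 'm) coend_elt \<Rightarrow> 'b" where
  "coend_counit B = pres_lift B (\<lambda>(X, m, \<phi>). \<phi> m)"

definition Rep :: "'r ring \<Rightarrow> ('r, 'b) module \<Rightarrow> ('o, 'a, 'r) lin_cat \<Rightarrow> ('o, 'a, 'b, 'm) fibre \<Rightarrow>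
    (('b, 'm) module \<times> ('m \<Rightarrow> (('o, 'b, 'm) coend_elt \<times> 'm \<Rightarrow>\<^sub>0 int) set), 'm \<Rightarrow> 'm) cat" where
  "Rep R B A w =
     Rep_cat B (coend_bimodule R B A w) (coend_comult R B A w) (coend_counit B)"

definition canonical_coaction :: "'r ring \<Rightarrow> ('r, 'b) module \<Rightarrow> ('o, 'a, 'r) lin_cat \<Rightarrow>
    ('o, 'a, 'b, 'm) fibre \<Rightarrow> 'o \<Rightarrow> 'm \<Rightarrow> (('o, 'b, 'm) coend_elt \<times> 'm \<Rightarrow>\<^sub>0 int) set" where
  "canonical_coaction R B A w X = (let L = coend_bimodule R B A w; M = fob w X in
     (\<lambda>m\<in>carrier M. let (n, e, d) = dual_basis B M in
       \<Oplus>\<^bsub>tensor B L M\<^esub>i\<in>{..<n}. tens B L M (coend_class R B A w X m (d i)) (e i)))"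

definition tannaka_unit :: "'r ring \<Rightarrow> ('r, 'b) module \<Rightarrow> ('o, 'a, 'r) lin_cat \<Rightarrow>
    ('o, 'a, 'b, 'm) fibre \<Rightarrow> ('o, 'a,
      ('b, 'm) module \<times> ('m \<Rightarrow> (('o, 'b, 'm) coend_elt \<times> 'm \<Rightarrow>\<^sub>0 int) set), 'm \<Rightarrow> 'm) ftor" where
  "tannaka_unit R B A w =
     \<lparr>fob = (\<lambda>X. (fob w X, canonical_coaction R B A w X)), far = far w\<rparr>"

definition elements_cat ::
    "('o, 'a, 'r) lin_cat \<Rightarrow> ('o, 'a, 'b, 'm) fibre \<Rightarrow> ('o \<times> 'm, 'a) cat" where
  "elements_cat A w = \<lparr>Ob = {(X, x). X \<in> LOb A \<and> x \<in> carrier (fob w X)},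
     Ar = (\<lambda>(X, x) (Y, y). {f \<in> carrier (LHom A X Y). far w X Y f x = y}),
     Cmp = (\<lambda>(X, x) (Y, y) (Z, z) g f. LCmp A X Y Z g f),
     Idn = (\<lambda>(X, x). LIdn A X)\<rparr>"

end

(* For a module M write theta M X x h for the element of L \<otimes> M given by x \<in> w(X) and a homomorphism
   h : w(X) \<rightarrow> M, namely the sum of [x \<otimes> e_i^*] \<otimes> h(e_i) over a dual basis of w(X). It is additive in x
   and in h and dinatural in X. When the category of elements of w is cofiltered, every element of
   L \<otimes> M has this form, and theta M X x h = 0 if and only if h vanishes after composition with w(f) for
   some f : (Z, z) \<rightarrow> (X, x): thus L \<otimes> M is the filtered colimit of the left exact functors Hom(w(X), M),
   which gives flatness and the preservation of finite limits.

   The comultiplication of theta M X x h is theta (L \<otimes> M) X x (y \<mapsto> theta M X y h) and its counit is h(x).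
   Hence, for a comodule (M, \<rho>), coassociativity of \<rho>(m) = theta M X x h says that h becomes a comodule map
   after a refinement, and counitality says that it hits m. A finite biproduct of such maps is a
   surjective comodule map p : w(Z) \<rightarrow> M; its kernel is finitely generated, and by the vanishing criterion
   it is the image of w(k) for some k : K \<rightarrow> Z. So M is a cokernel of w(k), and the assumption on cokernels
   gives M = w(coker k). Fullness follows in the same way from a comodule map g : w(X) \<rightarrow> w(Y), covering
   X by pairs a : Z \<rightarrow> X, b : Z \<rightarrow> Y with g \<circ> w(a) = w(b). *)
theory Submission
  imports Defs
begin


section \<open>Additive maps\<close>

text \<open>The obstacle is to draw conclusions from an equation in \<open>L\<close> \<otimes> M.
  This group is given by generators and relations, so equations are easy to prove in it, but
  extracting information from theta M X x h = 0 needs a homomorphism into a group where vanishing is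
  understood. The filtered colimit of the groups Hom(w(X), M) is that group. It is presented in
  turn, with every formal sum that dies on a common refinement as a relator; cofilteredness makes
  these sums a subgroup, so vanishing of a class can be read off directly. Refinements treat one
  element at a time, whereas surjections and generating sets involve several elements at once.
  Biproducts in \<open>A\<close> combine finitely many of them, and finitely many are enough because
  M is projective: p has a section \<sigma>, and 1 - \<sigma> p maps w(Z) onto the kernel of p,
  which is therefore generated by the images of a dual basis. The same section provides the
  factorizations that exhibit M as the cokernel of w(k).\<close>

definition additive :: "('g, 'x) ring_scheme \<Rightarrow> ('h, 'y) ring_scheme \<Rightarrow> ('g \<Rightarrow> 'h) set" where
  "additive G H = {f \<in> carrier G \<rightarrow> carrier H.
     \<forall>x\<in>carrier G. \<forall>y\<in>carrier G. f (x \<oplus>\<^bsub>G\<^esub> y) = f x \<oplus>\<^bsub>H\<^esub> f y}"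

lemma additiveI:
  assumes "\<And>x. x \<in> carrier G \<Longrightarrow> f x \<in> carrier H"
    and "\<And>x y. \<lbrakk>x \<in> carrier G; y \<in> carrier G\<rbrakk> \<Longrightarrow> f (x \<oplus>\<^bsub>G\<^esub> y) = f x \<oplus>\<^bsub>H\<^esub> f y"
  shows "f \<in> additive G H"
  using assms by (auto simp: additive_def)

lemma additive_closed: "\<lbrakk>f \<in> additive G H; x \<in> carrier G\<rbrakk> \<Longrightarrow> f x \<in> carrier H"
  by (auto simp: additive_def)

lemma additive_add:
  "\<lbrakk>f \<in> additive G H; x \<in> carrier G; y \<in> carrier G\<rbrakk> \<Longrightarrow> f (x \<oplus>\<^bsub>G\<^esub> y) = f x \<oplus>\<^bsub>H\<^esub> f y"
  by (auto simp: additive_def)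

lemma additive_zero:
  assumes "abelian_group G" "abelian_group H" "f \<in> additive G H"
  shows "f \<zero>\<^bsub>G\<^esub> = \<zero>\<^bsub>H\<^esub>"
proof -
  interpret G: abelian_group G by fact
  interpret H: abelian_group H by fact
  have "f \<zero>\<^bsub>G\<^esub> \<oplus>\<^bsub>H\<^esub> f \<zero>\<^bsub>G\<^esub> = f \<zero>\<^bsub>G\<^esub> \<oplus>\<^bsub>H\<^esub> \<zero>\<^bsub>H\<^esub>"
    using additive_add[OF assms(3), of "\<zero>\<^bsub>G\<^esub>" "\<zero>\<^bsub>G\<^esub>"] additive_closed[OF assms(3), of "\<zero>\<^bsub>G\<^esub>"]
    by simp
  then show ?thesis using additive_closed[OF assms(3), of "\<zero>\<^bsub>G\<^esub>"] by simp
qed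

lemma additive_inv:
  assumes "abelian_group G" "abelian_group H" "f \<in> additive G H" "x \<in> carrier G"
  shows "f (\<ominus>\<^bsub>G\<^esub> x) = \<ominus>\<^bsub>H\<^esub> f x"
proof -
  interpret G: abelian_group G by fact
  interpret H: abelian_group H by fact
  have "f (\<ominus>\<^bsub>G\<^esub> x) \<oplus>\<^bsub>H\<^esub> f x = \<zero>\<^bsub>H\<^esub>"
    using additive_add[OF assms(3), of "\<ominus>\<^bsub>G\<^esub> x" x] assms(4) additive_zero[OF assms(1-3)]
    by (simp add: G.l_neg)
  then show ?thesis
    using assms(4) additive_closed[OF assms(3)] H.minus_equality by (metis G.a_inv_closed)
qed

lemma additive_minus:
  assumes "abelian_group G" "abelian_group H" "f \<in> additive G H" "x \<in> carrier G" "y \<in> carrier G"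
  shows "f (x \<ominus>\<^bsub>G\<^esub> y) = f x \<ominus>\<^bsub>H\<^esub> f y"
proof -
  interpret G: abelian_group G by fact
  show ?thesis
    using assms additive_inv[OF assms(1-3)] additive_add[OF assms(3)]
    by (simp add: a_minus_def)
qed

lemma additive_finsum:
  assumes "abelian_group G" "abelian_group H" "f \<in> additive G H"
    and "u \<in> I \<rightarrow> carrier G"
  shows "f (\<Oplus>\<^bsub>G\<^esub>i\<in>I. u i) = (\<Oplus>\<^bsub>H\<^esub>i\<in>I. f (u i))"
proof -
  interpret G: abelian_group G by fact
  interpret H: abelian_group H by fact
  show ?thesis
  proof (cases "finite I")
    case True
    then show ?thesis using assms(4)
    proof (induction I)
      case empty
      then show ?case using additive_zero[OF assms(1-3)] by simp
    next
      case (insert i I)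
      have "(\<lambda>i. f (u i)) \<in> insert i I \<rightarrow> carrier H"
        using insert.prems additive_closed[OF assms(3)] by auto
      then show ?case
        using insert additive_add[OF assms(3)] by (simp add: Pi_def)
    qed
  qed (use additive_zero[OF assms(1-3)] in simp)
qed

lemma (in abelian_group) eq_iff_minus_zero:
  "\<lbrakk>x \<in> carrier G; y \<in> carrier G\<rbrakk> \<Longrightarrow> x = y \<longleftrightarrow> x \<ominus> y = \<zero>"
  by (metis a_minus_def add.inv_closed local.minus_minus minus_equality r_neg)

section \<open>Presentations of abelian groups\<close>

text \<open>Addition can change the support of a formal sum, so additivity of
  \<open>free_ext\<close> is proved termwise over a common finite index set; the extra terms have
  coefficient 0.\<close>

lemma (in abelian_group) free_ext_superset:
  assumes "finite K" "Poly_Mapping.keys u \<subseteq> K" "g \<in> K \<rightarrow> carrier G"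
  shows "free_ext G g u = (\<Oplus>s\<in>K. [Poly_Mapping.lookup u s] \<cdot> g s)"
  unfolding free_ext_def
proof (rule add.finprod_mono_neutral_cong_left)
  show "\<And>i. i \<in> K - Poly_Mapping.keys u \<Longrightarrow> [Poly_Mapping.lookup u i] \<cdot> g i = \<zero>"
    by (simp add: in_keys_iff add_pow_def)
qed (use assms in \<open>auto intro: add.int_pow_closed\<close>)

lemma (in abelian_group) free_ext_closed:
  "\<lbrakk>Poly_Mapping.keys u \<subseteq> S; g \<in> S \<rightarrow> carrier G\<rbrakk> \<Longrightarrow> free_ext G g u \<in> carrier G"
  unfolding free_ext_def by (rule finsum_closed) auto

lemma (in abelian_group) free_ext_add:
  assumes "Poly_Mapping.keys u \<subseteq> S" "Poly_Mapping.keys v \<subseteq> S" "g \<in> S \<rightarrow> carrier G"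
  shows "free_ext G g (u + v) = free_ext G g u \<oplus> free_ext G g v"
proof -
  let ?K = "Poly_Mapping.keys u \<union> Poly_Mapping.keys v"
  have g: "g \<in> ?K \<rightarrow> carrier G" using assms by auto
  have "free_ext G g (u + v) = (\<Oplus>s\<in>?K. [Poly_Mapping.lookup (u + v) s] \<cdot> g s)"
    using g Poly_Mapping.keys_add[of u v] by (intro free_ext_superset) auto
  also have "\<dots> = (\<Oplus>s\<in>?K. [Poly_Mapping.lookup u s] \<cdot> g s \<oplus> [Poly_Mapping.lookup v s] \<cdot> g s)"
    using g by (intro finsum_cong') (auto simp: lookup_add add.int_pow_mult Pi_def)
  also have "\<dots> = (\<Oplus>s\<in>?K. [Poly_Mapping.lookup u s] \<cdot> g s) \<oplus> (\<Oplus>s\<in>?K. [Poly_Mapping.lookup v s] \<cdot> g s)"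
    using g by (intro finsum_addf) auto
  also have "\<dots> = free_ext G g u \<oplus> free_ext G g v"
    using g by (simp add: free_ext_superset[of ?K])
  finally show ?thesis .
qed

lemma (in abelian_group) free_ext_zero [simp]: "free_ext G g 0 = \<zero>"
  by (simp add: free_ext_def)

lemma (in abelian_group) free_ext_of [simp]:
  "g s \<in> carrier G \<Longrightarrow> free_ext G g (frag_of s) = g s"
  by (simp add: free_ext_def keys_frag_of add.finprod_singleton lookup_frag_of)

lemma (in abelian_group) free_ext_uminus:
  assumes "Poly_Mapping.keys u \<subseteq> S" "g \<in> S \<rightarrow> carrier G"
  shows "free_ext G g (- u) = \<ominus> free_ext G g u"
proof -
  have "free_ext G g (- u) \<oplus> free_ext G g u = \<zero>"
    using free_ext_add[of "- u" S u g] assms by simp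
  then show ?thesis
    using free_ext_closed[of u S g] free_ext_closed[of "- u" S g] assms
    by (metis keys_minus minus_equality)
qed

lemma (in abelian_group) free_ext_diff:
  assumes "Poly_Mapping.keys u \<subseteq> S" "Poly_Mapping.keys v \<subseteq> S" "g \<in> S \<rightarrow> carrier G"
  shows "free_ext G g (u - v) = free_ext G g u \<ominus> free_ext G g v"
  using free_ext_add[of u S "- v" g] free_ext_uminus[of v S g] assms
  by (simp add: a_minus_def)

text \<open>The relators of the tensor product and of the coend have two shapes only, a - b - c for
  additivity and a - b for identifications. This lemma and the next reduce the check of a relator to
  one equation in the target.\<close>

lemma (in abelian_group) free_ext_rel3:
  assumes "a \<in> S" "b \<in> S" "c \<in> S" "g \<in> S \<rightarrow> carrier G" "g a = g b \<oplus> g c"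
  shows "free_ext G g (frag_of a - frag_of b - frag_of c) = \<zero>"
proof -
  have c: "g a \<in> carrier G" "g b \<in> carrier G" "g c \<in> carrier G" using assms by auto
  have "free_ext G g (frag_of a - frag_of b - frag_of c) = g a \<ominus> g b \<ominus> g c"
    using assms c Poly_Mapping.keys_diff[of "frag_of a" "frag_of b"]
    by (subst free_ext_diff[where S=S], auto simp: keys_frag_of)
       (subst free_ext_diff[where S=S], auto simp: keys_frag_of)
  also have "\<dots> = (g b \<oplus> g c) \<oplus> \<ominus> (g b \<oplus> g c)"
    using assms(5) c by (simp add: a_minus_def a_assoc minus_add)
  also have "\<dots> = \<zero>" using c by (simp only: r_neg a_closed)
  finally show ?thesis .
qed

lemma (in abelian_group) free_ext_rel2:
  assumes "a \<in> S" "b \<in> S" "g \<in> S \<rightarrow> carrier G" "g a = g b"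
  shows "free_ext G g (frag_of a - frag_of b) = \<zero>"
  using assms free_ext_diff[of "frag_of a" S "frag_of b" g]
  by (auto simp: keys_frag_of a_minus_def r_neg Pi_def)

text \<open>Only carrier, zero and addition are compared with \<open>pres_group\<close>, so that the
  module and bimodule records built on such a group are covered as well, whatever actions they
  carry.\<close>

definition presents :: "'s set \<Rightarrow> ('s \<Rightarrow>\<^sub>0 int) set \<Rightarrow> (('s \<Rightarrow>\<^sub>0 int) set, 'z) ring_scheme \<Rightarrow> bool" where
  "presents S E G \<longleftrightarrow> E \<subseteq> carrier (free_Abelian_group S) \<and>
     carrier G = carrier (pres_group S E) \<and> zero G = zero (pres_group S E) \<and>
     add G = add (pres_group S E)"

locale presentation =
  fixes S :: "'s set" and E :: "('s \<Rightarrow>\<^sub>0 int) set" and G :: "(('s \<Rightarrow>\<^sub>0 int) set, 'z) ring_scheme"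
  assumes pres: "presents S E G"
begin

abbreviation "F \<equiv> free_Abelian_group S"
abbreviation "N \<equiv> generate F E"

definition coset :: "('s \<Rightarrow>\<^sub>0 int) \<Rightarrow> ('s \<Rightarrow>\<^sub>0 int) set" where "coset u = N #>\<^bsub>F\<^esub> u"

lemma E_sub: "E \<subseteq> carrier F" using pres by (simp add: presents_def)

sublocale Fr: comm_group F by (rule abelian_free_Abelian_group)

lemma E_keys: "e \<in> E \<Longrightarrow> Poly_Mapping.keys e \<subseteq> S" using subsetD[OF E_sub] by simp

lemma N_subgroup: "subgroup N F"
  by (rule Fr.generate_is_subgroup[OF E_sub])

sublocale N: normal N F
  by (rule Fr.subgroup_imp_normal[OF N_subgroup])

lemma carrier_eq: "carrier G = coset ` {u. Poly_Mapping.keys u \<subseteq> S}"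
  using pres by (auto simp: presents_def pres_group_def FactGroup_def RCOSETS_def coset_def)

lemma zero_eq: "\<zero>\<^bsub>G\<^esub> = N"
  using pres by (auto simp: presents_def pres_group_def FactGroup_def)

lemma coset_add:
  "\<lbrakk>Poly_Mapping.keys u \<subseteq> S; Poly_Mapping.keys v \<subseteq> S\<rbrakk> \<Longrightarrow> coset u \<oplus>\<^bsub>G\<^esub> coset v = coset (u + v)"
  using pres N.rcos_sum[of u v]
  by (auto simp: presents_def pres_group_def FactGroup_def coset_def)

lemma coset_zero: "coset 0 = \<zero>\<^bsub>G\<^esub>"
  unfolding zero_eq coset_def using Fr.coset_mult_one[OF N.subset] by simp

lemma coset_eq_zero_iff:
  assumes "Poly_Mapping.keys u \<subseteq> S" shows "coset u = \<zero>\<^bsub>G\<^esub> \<longleftrightarrow> u \<in> N"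
  unfolding zero_eq coset_def
  using assms Fr.coset_join1[OF _ _ N_subgroup, of u] Fr.coset_join2[OF _ N_subgroup, of u] by auto

lemma keys_add_subset:
  "\<lbrakk>Poly_Mapping.keys u \<subseteq> S; Poly_Mapping.keys v \<subseteq> S\<rbrakk> \<Longrightarrow> Poly_Mapping.keys (u + v) \<subseteq> S"
  using Poly_Mapping.keys_add[of u v] by blast

lemma carrier_cases:
  assumes "x \<in> carrier G" obtains u where "x = coset u" "Poly_Mapping.keys u \<subseteq> S"
  using assms by (auto simp: carrier_eq)

lemma coset_closed: "Poly_Mapping.keys u \<subseteq> S \<Longrightarrow> coset u \<in> carrier G"
  by (auto simp: carrier_eq)

lemma abelian_group: "abelian_group G"
proof (rule abelian_groupI)
  show "\<zero>\<^bsub>G\<^esub> \<in> carrier G" by (simp add: coset_zero[symmetric] coset_closed)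
next
  fix x y assume "x \<in> carrier G" "y \<in> carrier G"
  then show "x \<oplus>\<^bsub>G\<^esub> y \<in> carrier G" "x \<oplus>\<^bsub>G\<^esub> y = y \<oplus>\<^bsub>G\<^esub> x"
    by (metis carrier_cases coset_add coset_closed keys_add_subset, metis carrier_cases coset_add add.commute)
next
  fix x y z assume "x \<in> carrier G" "y \<in> carrier G" "z \<in> carrier G"
  then obtain u v t where "x = coset u" "Poly_Mapping.keys u \<subseteq> S" "y = coset v" "Poly_Mapping.keys v \<subseteq> S"
      "z = coset t" "Poly_Mapping.keys t \<subseteq> S"
    by (metis carrier_cases)
  then show "x \<oplus>\<^bsub>G\<^esub> y \<oplus>\<^bsub>G\<^esub> z = x \<oplus>\<^bsub>G\<^esub> (y \<oplus>\<^bsub>G\<^esub> z)"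
    by (simp add: coset_add keys_add_subset add.assoc)
next
  fix x assume "x \<in> carrier G"
  then obtain u where u: "x = coset u" "Poly_Mapping.keys u \<subseteq> S" by (rule carrier_cases)
  then show "\<zero>\<^bsub>G\<^esub> \<oplus>\<^bsub>G\<^esub> x = x" by (simp add: coset_zero[symmetric] coset_add)
  show "\<exists>y\<in>carrier G. y \<oplus>\<^bsub>G\<^esub> x = \<zero>\<^bsub>G\<^esub>"
    using u by (intro bexI[of _ "coset (- u)"]) (auto simp: coset_closed coset_add coset_zero)
qed

lemma cls_eq: "pres_class S E s = coset (frag_of s)"
  by (simp add: coset_def pres_class_def)

lemma cls_closed: "s \<in> S \<Longrightarrow> pres_class S E s \<in> carrier G"
  by (auto simp: cls_eq carrier_eq keys_frag_of)

lemma cls_zero_iff: "s \<in> S \<Longrightarrow> pres_class S E s = \<zero>\<^bsub>G\<^esub> \<longleftrightarrow> frag_of s \<in> N"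
  by (simp add: cls_eq coset_eq_zero_iff keys_frag_of)

lemma cls_rel2:
  assumes "frag_of a - frag_of b \<in> E" "a \<in> S" "b \<in> S"
  shows "pres_class S E a = pres_class S E b"
proof -
  have "coset (frag_of a - frag_of b) = \<zero>\<^bsub>G\<^esub>"
    using assms E_keys generate.incl[of _ E F] by (subst coset_eq_zero_iff) auto
  then have "coset (frag_of b + (frag_of a - frag_of b)) = coset (frag_of b)"
    using assms E_keys abelian_group coset_add[of "frag_of b" "frag_of a - frag_of b"]
    by (auto simp: keys_frag_of abelian_monoid.r_zero abelian_group.axioms(1) cls_closed[unfolded cls_eq])
  then show ?thesis by (simp add: cls_eq)
qed

lemma cls_rel3:
  assumes "frag_of a - frag_of b - frag_of c \<in> E" "a \<in> S" "b \<in> S" "c \<in> S"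
  shows "pres_class S E a = pres_class S E b \<oplus>\<^bsub>G\<^esub> pres_class S E c"
proof -
  let ?r = "frag_of a - frag_of b - frag_of c"
  have k: "Poly_Mapping.keys (frag_of b + frag_of c :: 's \<Rightarrow>\<^sub>0 int) \<subseteq> S"
    using assms Poly_Mapping.keys_add[of "frag_of b :: 's \<Rightarrow>\<^sub>0 int" "frag_of c"] by (auto simp: keys_frag_of)
  have "coset ?r = \<zero>\<^bsub>G\<^esub>"
    using assms E_keys generate.incl[of _ E F] by (subst coset_eq_zero_iff) auto
  then have "coset ((frag_of b + frag_of c) + ?r) = coset (frag_of b + frag_of c)"
    using assms E_keys abelian_group coset_add[of "frag_of b + frag_of c" ?r] k
    by (auto simp: carrier_eq abelian_monoid.r_zero abelian_group.axioms(1))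
  then show ?thesis using assms by (simp add: cls_eq coset_add keys_frag_of)
qed

text \<open>Formal sums arise from generators by differences, hence the case for inverses. It
  disappears where the inverse of a generator is again a generator: the induction is then run for a
  property of x and of its inverse together.\<close>

lemma induct [consumes 1, case_names gen zero add inv]:
  assumes "x \<in> carrier G"
    and gen: "\<And>s. s \<in> S \<Longrightarrow> P (pres_class S E s)"
    and zero: "P \<zero>\<^bsub>G\<^esub>"
    and add: "\<And>x y. \<lbrakk>x \<in> carrier G; y \<in> carrier G; P x; P y\<rbrakk> \<Longrightarrow> P (x \<oplus>\<^bsub>G\<^esub> y)"
    and inv: "\<And>x. \<lbrakk>x \<in> carrier G; P x\<rbrakk> \<Longrightarrow> P (\<ominus>\<^bsub>G\<^esub> x)"
  shows "P x"
proof -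
  interpret G: abelian_group G by (rule abelian_group)
  obtain u where u: "x = coset u" "Poly_Mapping.keys u \<subseteq> S" using assms(1) by (auto simp: carrier_eq)
  have inv_c: "\<ominus>\<^bsub>G\<^esub> coset v = coset (- v)" if "Poly_Mapping.keys v \<subseteq> S" for v
    by (rule G.minus_equality) (use that in \<open>auto simp: carrier_eq coset_add coset_zero\<close>)
  have "P (coset u) \<and> Poly_Mapping.keys u \<subseteq> S" using u(2)
  proof (induction u rule: frag_induction)
    case zero then show ?case using assms(3) by (simp add: coset_zero)
  next
    case (one s) then show ?case using gen by (simp add: cls_eq keys_frag_of)
  next
    case (diff a b)
    then have "coset (a - b) = coset a \<oplus>\<^bsub>G\<^esub> (\<ominus>\<^bsub>G\<^esub> coset b)"
      by (simp add: inv_c coset_add)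
    moreover have "P (coset a \<oplus>\<^bsub>G\<^esub> (\<ominus>\<^bsub>G\<^esub> coset b))"
      using diff by (intro add inv) (auto simp: coset_closed)
    ultimately show ?case using diff Poly_Mapping.keys_diff[of a b] by auto
  qed
  then show ?thesis using u by simp
qed

text \<open>Universal property of the presentation. As \<open>free_ext T g\<close> kills the
  relators, it kills the subgroup that they generate and is constant on each coset; the image from
  which \<open>pres_lift\<close> takes its value is therefore a singleton.\<close>

lemma lift:
  assumes T: "abelian_group T" and g: "g \<in> S \<rightarrow> carrier T"
    and rel: "\<And>e. e \<in> E \<Longrightarrow> free_ext T g e = \<zero>\<^bsub>T\<^esub>"
  shows pres_lift_additive: "pres_lift T g \<in> additive G T"
    and pres_lift_class: "s \<in> S \<Longrightarrow> pres_lift T g (pres_class S E s) = g s"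
proof -
  interpret T: abelian_group T by fact
  have N0: "free_ext T g u = \<zero>\<^bsub>T\<^esub> \<and> Poly_Mapping.keys u \<subseteq> S" if "u \<in> N" for u
    using that
  proof (induction u rule: generate.induct)
    case (eng h1 h2)
    then show ?case using g Poly_Mapping.keys_add[of h1 h2] by (auto simp: T.free_ext_add[where S=S])
  next
    case (inv h)
    then have "Poly_Mapping.keys h \<subseteq> S" using E_keys by auto
    with inv show ?case using g rel by (auto simp: T.free_ext_uminus[where S=S])
  qed (use E_keys rel in auto)
  have val: "pres_lift T g (coset u) = free_ext T g u" if u: "Poly_Mapping.keys u \<subseteq> S" for u
  proof -
    have "free_ext T g (n + u) = free_ext T g u" if "n \<in> N" for n
      using N0[OF that] u g T.free_ext_closed[OF u g] by (simp add: T.free_ext_add[where S=S])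
    moreover have "0 \<in> N" using generate.one[of F E] by simp
    ultimately have "free_ext T g ` coset u = {free_ext T g u}"
      by (auto simp: coset_def r_coset_def image_iff)
    then show ?thesis by (simp add: pres_lift_def)
  qed
  show "pres_lift T g \<in> additive G T"
  proof (rule additiveI)
    fix x assume "x \<in> carrier G"
    then show "pres_lift T g x \<in> carrier T"
      using T.free_ext_closed[OF _ g] by (auto simp: carrier_eq val)
  next
    fix x y assume "x \<in> carrier G" "y \<in> carrier G"
    then obtain u v where uv: "x = coset u" "y = coset v" "Poly_Mapping.keys u \<subseteq> S" "Poly_Mapping.keys v \<subseteq> S"
      by (auto simp: carrier_eq)
    then have "Poly_Mapping.keys (u + v) \<subseteq> S" using Poly_Mapping.keys_add[of u v] by auto
    with uv show "pres_lift T g (x \<oplus>\<^bsub>G\<^esub> y) = pres_lift T g x \<oplus>\<^bsub>T\<^esub> pres_lift T g y"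
      using g by (simp add: coset_add val T.free_ext_add[where S=S])
  qed
  show "pres_lift T g (pres_class S E s) = g s" if "s \<in> S"
    using that g val[of "frag_of s"] by (auto simp: cls_eq keys_frag_of Pi_def)
qed

end

section \<open>Modules over a noncommutative ring\<close>

lemma mod_homI:
  assumes "f \<in> extensional (carrier M)" "\<And>x. x \<in> carrier M \<Longrightarrow> f x \<in> carrier N"
    and "\<And>x y. \<lbrakk>x \<in> carrier M; y \<in> carrier M\<rbrakk> \<Longrightarrow> f (x \<oplus>\<^bsub>M\<^esub> y) = f x \<oplus>\<^bsub>N\<^esub> f y"
    and "\<And>b x. \<lbrakk>b \<in> carrier B; x \<in> carrier M\<rbrakk> \<Longrightarrow> f (b \<odot>\<^bsub>M\<^esub> x) = b \<odot>\<^bsub>N\<^esub> f x"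
  shows "f \<in> mod_hom B M N"
  using assms by (auto simp: mod_hom_def PiE_def)

lemma mod_homD:
  assumes "f \<in> mod_hom B M N"
  shows mod_hom_ext: "f \<in> extensional (carrier M)"
    and mod_hom_closed: "x \<in> carrier M \<Longrightarrow> f x \<in> carrier N"
    and mod_hom_add: "\<lbrakk>x \<in> carrier M; y \<in> carrier M\<rbrakk> \<Longrightarrow> f (x \<oplus>\<^bsub>M\<^esub> y) = f x \<oplus>\<^bsub>N\<^esub> f y"
    and mod_hom_smult: "\<lbrakk>b \<in> carrier B; x \<in> carrier M\<rbrakk> \<Longrightarrow> f (b \<odot>\<^bsub>M\<^esub> x) = b \<odot>\<^bsub>N\<^esub> f x"
  using assms by (auto simp: mod_hom_def PiE_def)

lemma mod_hom_additive: "f \<in> mod_hom B M N \<Longrightarrow> f \<in> additive M N"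
  by (auto simp: mod_hom_def additive_def)

lemma mod_hom_eqI:
  assumes "f \<in> mod_hom B M N" "g \<in> mod_hom B M N'" "\<And>x. x \<in> carrier M \<Longrightarrow> f x = g x"
  shows "f = g"
  using assms by (blast intro: extensionalityI mod_hom_ext)

lemma mod_hom_id: "(\<lambda>x\<in>carrier M. x) \<in> mod_hom B M M" if "left_module B M"
proof -
  interpret left_module B M by fact
  show ?thesis by (rule mod_homI) (auto simp: smult_closed)
qed

lemma mod_hom_comp:
  assumes "left_module B M" "f \<in> mod_hom B M N" "g \<in> mod_hom B N P"
  shows "compose (carrier M) g f \<in> mod_hom B M P"
proof -
  interpret left_module B M by fact
  show ?thesis
    by (rule mod_homI)
      (use assms(2,3) in \<open>auto simp: compose_def smult_closed mod_homD\<close>)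
qed

context left_module
begin

lemma abelian_group: "abelian_group M" ..

lemma smult_additive: "b \<in> carrier B \<Longrightarrow> (\<lambda>x. b \<odot>\<^bsub>M\<^esub> x) \<in> additive M M"
  by (auto simp: additive_def smult_closed smult_r_distr)

lemma smult_additive_left: "x \<in> carrier M \<Longrightarrow> (\<lambda>b. b \<odot>\<^bsub>M\<^esub> x) \<in> additive B M"
  by (auto simp: additive_def smult_closed smult_l_distr)

lemma smult_zero_right: "b \<in> carrier B \<Longrightarrow> b \<odot>\<^bsub>M\<^esub> \<zero>\<^bsub>M\<^esub> = \<zero>\<^bsub>M\<^esub>"
  using additive_zero[OF abelian_group abelian_group smult_additive] by simp

lemma smult_zero_left: "x \<in> carrier M \<Longrightarrow> \<zero>\<^bsub>B\<^esub> \<odot>\<^bsub>M\<^esub> x = \<zero>\<^bsub>M\<^esub>"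
  using additive_zero[OF B.is_abelian_group abelian_group smult_additive_left] by simp

lemma smult_finsum:
  "\<lbrakk>b \<in> carrier B; u \<in> I \<rightarrow> carrier M\<rbrakk> \<Longrightarrow> b \<odot>\<^bsub>M\<^esub> (\<Oplus>\<^bsub>M\<^esub>i\<in>I. u i) = (\<Oplus>\<^bsub>M\<^esub>i\<in>I. b \<odot>\<^bsub>M\<^esub> u i)"
  by (rule additive_finsum[OF abelian_group abelian_group smult_additive])

end

section \<open>Pointwise operations on homomorphisms, functionals and rank one maps\<close>

definition hom_add :: "('b, 'm, 'z) module_scheme \<Rightarrow> ('b, 'n, 'v) module_scheme \<Rightarrow>
    ('m \<Rightarrow> 'n) \<Rightarrow> ('m \<Rightarrow> 'n) \<Rightarrow> 'm \<Rightarrow> 'n" where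
  "hom_add M N f g = (\<lambda>x\<in>carrier M. f x \<oplus>\<^bsub>N\<^esub> g x)"

definition hom_zero :: "('b, 'm, 'z) module_scheme \<Rightarrow> ('b, 'n, 'v) module_scheme \<Rightarrow> 'm \<Rightarrow> 'n" where
  "hom_zero M N = (\<lambda>x\<in>carrier M. \<zero>\<^bsub>N\<^esub>)"

definition hom_minus :: "('b, 'm, 'z) module_scheme \<Rightarrow> ('b, 'n, 'v) module_scheme \<Rightarrow>
    ('m \<Rightarrow> 'n) \<Rightarrow> ('m \<Rightarrow> 'n) \<Rightarrow> 'm \<Rightarrow> 'n" where
  "hom_minus M N f g = (\<lambda>x\<in>carrier M. f x \<ominus>\<^bsub>N\<^esub> g x)"

lemma mod_hom_hom_add:
  assumes "left_module B M" "left_module B N" "f \<in> mod_hom B M N" "g \<in> mod_hom B M N"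
  shows "hom_add M N f g \<in> mod_hom B M N"
proof -
  interpret M: left_module B M by fact
  interpret N: left_module B N by fact
  show ?thesis unfolding hom_add_def
    by (rule mod_homI)
      (use assms(3,4) in \<open>auto simp: mod_homD M.smult_closed N.smult_r_distr N.M.a_ac\<close>)
qed

lemma mod_hom_hom_zero:
  assumes "left_module B M" "left_module B N"
  shows "hom_zero M N \<in> mod_hom B M N"
proof -
  interpret M: left_module B M by fact
  interpret N: left_module B N by fact
  show ?thesis unfolding hom_zero_def
    by (rule mod_homI) (auto simp: M.smult_closed N.smult_zero_right)
qed

lemma mod_hom_hom_minus:
  assumes "left_module B M" "left_module B N" "f \<in> mod_hom B M N" "g \<in> mod_hom B M N"
  shows "hom_minus M N f g \<in> mod_hom B M N"
proof -
  interpret M: left_module B M by fact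
  interpret N: left_module B N by fact
  have inv: "b \<odot>\<^bsub>N\<^esub> (\<ominus>\<^bsub>N\<^esub> y) = \<ominus>\<^bsub>N\<^esub> (b \<odot>\<^bsub>N\<^esub> y)" if "b \<in> carrier B" "y \<in> carrier N" for b y
    using additive_inv[OF N.abelian_group N.abelian_group N.smult_additive] that by simp
  show ?thesis unfolding hom_minus_def
    by (rule mod_homI)
      (use assms(3,4) in \<open>auto simp: a_minus_def mod_homD M.smult_closed N.smult_closed N.smult_r_distr
         N.M.a_ac N.M.minus_add inv\<close>)
qed

lemma hom_minus_zero_iff:
  assumes "left_module B N" "f \<in> mod_hom B M N" "g \<in> mod_hom B M N" "x \<in> carrier M"
  shows "hom_minus M N f g x = \<zero>\<^bsub>N\<^esub> \<longleftrightarrow> f x = g x"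
  using assms abelian_group.eq_iff_minus_zero[OF left_module.abelian_group[OF assms(1)], of "f x" "g x"]
  by (auto simp: hom_minus_def mod_homD)

lemma left_module_left_regular: "ring B \<Longrightarrow> left_module B (left_regular B)"
proof -
  assume "ring B"
  then interpret ring B .
  have "abelian_group (left_regular B)"
    unfolding left_regular_def
    by (rule abelian_groupI) (auto simp: a_ac intro: l_neg a_inv_closed)
  then show ?thesis
    by (intro left_module.intro left_module_axioms.intro \<open>ring B\<close>)
      (auto simp: left_regular_def l_distr r_distr m_assoc)
qed

lemma left_regular_simps [simp]:
  "carrier (left_regular B) = carrier B" "add (left_regular B) = add B"
  "smult (left_regular B) = mult B" "zero (left_regular B) = zero B"
  by (auto simp: left_regular_def)

lemma dualD:
  assumes "\<phi> \<in> dual B M"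
  shows dual_closed: "x \<in> carrier M \<Longrightarrow> \<phi> x \<in> carrier B"
    and dual_add: "\<lbrakk>x \<in> carrier M; y \<in> carrier M\<rbrakk> \<Longrightarrow> \<phi> (x \<oplus>\<^bsub>M\<^esub> y) = \<phi> x \<oplus>\<^bsub>B\<^esub> \<phi> y"
    and dual_smult: "\<lbrakk>b \<in> carrier B; x \<in> carrier M\<rbrakk> \<Longrightarrow> \<phi> (b \<odot>\<^bsub>M\<^esub> x) = b \<otimes>\<^bsub>B\<^esub> \<phi> x"
  using mod_homD[OF assms[unfolded dual_def]] by auto

text \<open>The image of \<phi> \<otimes> y under the canonical map from the dual of M tensored with
  N to Hom(M, N), an isomorphism when M is finitely generated projective.\<close>

definition rank_one :: "('b, 'm, 'z) module_scheme \<Rightarrow> ('b, 'n, 'v) module_scheme \<Rightarrow>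
    ('m \<Rightarrow> 'b) \<Rightarrow> 'n \<Rightarrow> 'm \<Rightarrow> 'n" where
  "rank_one M N \<phi> y = (\<lambda>x\<in>carrier M. \<phi> x \<odot>\<^bsub>N\<^esub> y)"

lemma mod_hom_rank_one:
  assumes "left_module B M" "left_module B N" "\<phi> \<in> dual B M" "y \<in> carrier N"
  shows "rank_one M N \<phi> y \<in> mod_hom B M N"
proof -
  interpret M: left_module B M by fact
  interpret N: left_module B N by fact
  show ?thesis unfolding rank_one_def
    by (rule mod_homI)
      (use assms(3,4) in \<open>auto simp: dualD M.smult_closed N.smult_closed N.smult_l_distr N.smult_assoc\<close>)
qed

section \<open>The category of left modules\<close>

lemma ordinary_Mod_cat [simp]:
  "Ob (ordinary (Mod_cat B)) = {M. left_module B M}"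
  "Ar (ordinary (Mod_cat B)) = mod_hom B"
  "Cmp (ordinary (Mod_cat B)) M N P g f = compose (carrier M) g f"
  "Idn (ordinary (Mod_cat B)) M = (\<lambda>x\<in>carrier M. x)"
  by (auto simp: ordinary_def Mod_cat_def)

lemma category_Mod_cat: "category (ordinary (Mod_cat B))"
proof
  fix M assume "M \<in> Ob (ordinary (Mod_cat B))"
  then show "Idn (ordinary (Mod_cat B)) M \<in> Ar (ordinary (Mod_cat B)) M M"
    by (simp add: mod_hom_id)
next
  fix X Y f assume "f \<in> Ar (ordinary (Mod_cat B)) X Y"
  then have "f \<in> carrier X \<rightarrow> carrier Y" "f \<in> extensional (carrier X)"
    by (auto simp: mod_homD)
  then show "Cmp (ordinary (Mod_cat B)) X X Y f (Idn (ordinary (Mod_cat B)) X) = f"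
    "Cmp (ordinary (Mod_cat B)) X Y Y (Idn (ordinary (Mod_cat B)) Y) f = f"
    by (simp_all add: compose_Id Id_compose)
next
  fix W X Y Z f g h
  assume "f \<in> Ar (ordinary (Mod_cat B)) W X"
  then have "f \<in> carrier W \<rightarrow> carrier X" by (auto simp: mod_homD)
  then show "Cmp (ordinary (Mod_cat B)) W X Z (Cmp (ordinary (Mod_cat B)) X Y Z h g) f =
        Cmp (ordinary (Mod_cat B)) W Y Z h (Cmp (ordinary (Mod_cat B)) W X Y g f)"
    by (simp add: compose_assoc)
next
  fix X Y Z f g
  assume "X \<in> Ob (ordinary (Mod_cat B))" "f \<in> Ar (ordinary (Mod_cat B)) X Y"
    "g \<in> Ar (ordinary (Mod_cat B)) Y Z"
  then show "Cmp (ordinary (Mod_cat B)) X Y Z g f \<in> Ar (ordinary (Mod_cat B)) X Z"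
    by (simp add: mod_hom_comp)
qed

section \<open>Finitely generated projective modules\<close>

lemma is_dual_basisD:
  assumes "is_dual_basis B M (n, e, d)"
  shows dual_basis_elt: "i < n \<Longrightarrow> e i \<in> carrier M"
    and dual_basis_fun: "i < n \<Longrightarrow> d i \<in> dual B M"
    and dual_basis_expand: "x \<in> carrier M \<Longrightarrow> x = (\<Oplus>\<^bsub>M\<^esub>i\<in>{..<n}. d i x \<odot>\<^bsub>M\<^esub> e i)"
  using assms by (auto simp: is_dual_basis_def)

lemma dual_basis_hom_expand:
  assumes "left_module B M" "left_module B N" "is_dual_basis B M (n, e, d)"
    and h: "h \<in> mod_hom B M N" and x: "x \<in> carrier M"
  shows "h x = (\<Oplus>\<^bsub>N\<^esub>i\<in>{..<n}. d i x \<odot>\<^bsub>N\<^esub> h (e i))"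
proof -
  interpret M: left_module B M by fact
  interpret N: left_module B N by fact
  note db = is_dual_basisD[OF assms(3)]
  have d: "d i x \<in> carrier B" if "i < n" for i
    using dual_closed[OF db(2)[OF that] x] .
  have "h x = h (\<Oplus>\<^bsub>M\<^esub>i\<in>{..<n}. d i x \<odot>\<^bsub>M\<^esub> e i)"
    by (rule arg_cong[OF db(3)[OF x]])
  also have "\<dots> = (\<Oplus>\<^bsub>N\<^esub>i\<in>{..<n}. h (d i x \<odot>\<^bsub>M\<^esub> e i))"
    using db(1) d by (intro additive_finsum[OF M.abelian_group N.abelian_group mod_hom_additive[OF h]])
      (auto intro!: M.smult_closed)
  also have "\<dots> = (\<Oplus>\<^bsub>N\<^esub>i\<in>{..<n}. d i x \<odot>\<^bsub>N\<^esub> h (e i))"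
    using db(1) d by (intro N.M.finsum_cong')
      (auto simp: mod_homD[OF h] intro!: N.smult_closed)
  finally show ?thesis .
qed

text \<open>The free module from which M splits off may have infinite rank. Finitely many generators
  have images under \<open>i\<close> of finite support, so the whole image lives on a finite set
  \<open>K\<close> of coordinates. The coordinate functions in \<open>K\<close> and the images under
  \<open>p\<close> of the unit vectors form a dual basis.\<close>

lemma fg_projective_dual_basis:
  fixes B :: "('b, 'y) ring_scheme" and M :: "('b, 'm, 'z) module_scheme"
  assumes "fg_projective B M"
  shows "\<exists>t. is_dual_basis B M t"
proof -
  interpret M: left_module B M using assms by (simp add: fg_projective_def)
  obtain S where S: "finite S" "S \<subseteq> carrier M"
    and gen: "\<And>x. x \<in> carrier M \<Longrightarrow> \<exists>c\<in>S \<rightarrow> carrier B. x = (\<Oplus>\<^bsub>M\<^esub>s\<in>S. c s \<odot>\<^bsub>M\<^esub> s)"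
    using assms by (auto simp: fg_projective_def finitely_generated_def)
  obtain X :: "'m set" and i p where i: "i \<in> mod_hom B M (free_module B X)"
    and p: "p \<in> mod_hom B (free_module B X) M" and pi: "\<And>x. x \<in> carrier M \<Longrightarrow> p (i x) = x"
    using assms by (auto simp: fg_projective_def projective_def)
  let ?F = "free_module B X"
  define K where "K = (\<Union>s\<in>S. {t\<in>X. i s t \<noteq> \<zero>\<^bsub>B\<^esub>})"
  have iF: "i x \<in> X \<rightarrow>\<^sub>E carrier B" "finite {t\<in>X. i x t \<noteq> \<zero>\<^bsub>B\<^esub>}" if "x \<in> carrier M" for x
    using mod_hom_closed[OF i that] by (auto simp: free_module_def)
  have K: "finite K" "K \<subseteq> X" using S iF by (auto simp: K_def subset_iff)
  have i_add: "i (x \<oplus>\<^bsub>M\<^esub> y) t = i x t \<oplus>\<^bsub>B\<^esub> i y t" if "x \<in> carrier M" "y \<in> carrier M" "t \<in> X" for x y t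
    using mod_hom_add[OF i that(1,2)] that(3) by (simp add: free_module_def)
  have i_smult: "i (b \<odot>\<^bsub>M\<^esub> x) t = b \<otimes>\<^bsub>B\<^esub> i x t" if "b \<in> carrier B" "x \<in> carrier M" "t \<in> X" for b x t
    using mod_hom_smult[OF i that(1,2)] that(3) by (simp add: free_module_def)
  define d where "d t = (\<lambda>x\<in>carrier M. i x t)" for t
  define \<delta> where "\<delta> t = (\<lambda>s\<in>X. if s = t then \<one>\<^bsub>B\<^esub> else \<zero>\<^bsub>B\<^esub>)" for t
  have d: "d t \<in> dual B M" if "t \<in> X" for t
    unfolding dual_def d_def
    by (rule mod_homI) (use that iF in \<open>auto simp: i_add i_smult M.smult_closed\<close>)
  have \<delta>: "\<delta> t \<in> carrier ?F" for t
    by (auto simp: \<delta>_def free_module_def)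
  have supp: "i x t = \<zero>\<^bsub>B\<^esub>" if "x \<in> carrier M" "t \<in> X" "t \<notin> K" for x t
  proof -
    obtain c where c: "c \<in> S \<rightarrow> carrier B" "x = (\<Oplus>\<^bsub>M\<^esub>s\<in>S. c s \<odot>\<^bsub>M\<^esub> s)"
      using gen \<open>x \<in> carrier M\<close> by blast
    have add: "(\<lambda>x. i x t) \<in> additive M B"
      by (rule additiveI) (use that iF in \<open>auto simp: i_add\<close>)
    have "i x t = (\<Oplus>\<^bsub>B\<^esub>s\<in>S. i (c s \<odot>\<^bsub>M\<^esub> s) t)"
      unfolding c(2)
      using additive_finsum[OF M.abelian_group M.B.is_abelian_group add, of "\<lambda>s. c s \<odot>\<^bsub>M\<^esub> s" S] c S
      by (auto simp: Pi_def subset_iff M.smult_closed)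
    also have "\<dots> = (\<Oplus>\<^bsub>B\<^esub>s\<in>S. \<zero>\<^bsub>B\<^esub>)"
      using c S that by (intro M.B.finsum_cong') (auto simp: i_smult subset_iff K_def Pi_def)
    finally show ?thesis by simp
  qed
  \<comment> \<open>The truncation of \<open>i x\<close> to the coordinates in \<open>J\<close>.
    Induction on \<open>J\<close> evaluates \<open>p\<close> on it one unit vector at a time, and
    for \<open>J = K\<close> nothing is cut off.\<close>
  define cut where "cut x J = (\<lambda>s\<in>X. if s \<in> J then i x s else \<zero>\<^bsub>B\<^esub>)" for x J
  have cut: "cut x J \<in> carrier ?F" if "x \<in> carrier M" for x J
    using iF[OF that] by (auto simp: cut_def free_module_def PiE_iff elim!: finite_subset[rotated])
  have dM: "d t x \<in> carrier B" if "x \<in> carrier M" "t \<in> X" for x t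
    using dual_closed[OF d[OF that(2)] that(1)] .
  have p_cut: "p (cut x J) = (\<Oplus>\<^bsub>M\<^esub>t\<in>J. d t x \<odot>\<^bsub>M\<^esub> p (\<delta> t))"
    if x: "x \<in> carrier M" and "finite J" "J \<subseteq> X" for x J
    using that(2,3)
  proof (induction J)
    case empty
    \<comment> \<open>The empty truncation is the zero vector, hence the zero multiple of itself;
      homogeneity of \<open>p\<close> then gives its value there.\<close>
    have "cut x {} = \<zero>\<^bsub>B\<^esub> \<odot>\<^bsub>?F\<^esub> cut x {}"
      by (auto simp: cut_def free_module_def)
    then have "p (cut x {}) = \<zero>\<^bsub>B\<^esub> \<odot>\<^bsub>M\<^esub> p (cut x {})"
      using mod_hom_smult[OF p M.B.zero_closed cut[OF x, of "{}"]] by simp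
    then show ?case
      using mod_hom_closed[OF p cut[OF x]] by (simp add: M.smult_zero_left)
  next
    case (insert t J)
    have "cut x (insert t J) = (d t x \<odot>\<^bsub>?F\<^esub> \<delta> t) \<oplus>\<^bsub>?F\<^esub> cut x J"
      using insert dM[OF x] iF[OF x] x by (auto simp: cut_def free_module_def \<delta>_def d_def fun_eq_iff PiE_iff)
    moreover have "d t x \<odot>\<^bsub>?F\<^esub> \<delta> t \<in> carrier ?F"
      using insert dM[OF x, of t] by (auto simp: free_module_def \<delta>_def intro: finite_subset[of _ "{t}"])
    ultimately have "p (cut x (insert t J)) = d t x \<odot>\<^bsub>M\<^esub> p (\<delta> t) \<oplus>\<^bsub>M\<^esub> p (cut x J)"
      using insert dM[OF x, of t] by (simp add: mod_hom_add[OF p] mod_hom_smult[OF p] cut[OF x] \<delta>)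
    then show ?case
      using insert dM[OF x] mod_hom_closed[OF p \<delta>]
      by (subst M.M.finsum_insert) (auto intro!: M.smult_closed)
  qed
  have exp: "x = (\<Oplus>\<^bsub>M\<^esub>t\<in>K. d t x \<odot>\<^bsub>M\<^esub> p (\<delta> t))" if x: "x \<in> carrier M" for x
  proof -
    have "cut x K = i x"
      using supp[OF x] iF(1)[OF x] by (auto simp: cut_def fun_eq_iff PiE_iff extensional_def)
    then show ?thesis using p_cut[OF x K] pi[OF x] by simp
  qed
  obtain f where f: "bij_betw f {..<card K} K"
    using K(1) by (metis ex_bij_betw_nat_finite atLeast0LessThan)
  have "is_dual_basis B M (card K, \<lambda>j. p (\<delta> (f j)), \<lambda>j. d (f j))"
    unfolding is_dual_basis_def split_conv
  proof (intro conjI ballI)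
    show "(\<lambda>j. p (\<delta> (f j))) \<in> {..<card K} \<rightarrow> carrier M"
      using \<delta> mod_hom_closed[OF p] by auto
    show "(\<lambda>j. d (f j)) \<in> {..<card K} \<rightarrow> dual B M"
      using d K f by (auto simp: bij_betw_def)
    show "x = (\<Oplus>\<^bsub>M\<^esub>j\<in>{..<card K}. d (f j) x \<odot>\<^bsub>M\<^esub> p (\<delta> (f j)))" if "x \<in> carrier M" for x
    proof -
      have "(\<Oplus>\<^bsub>M\<^esub>t\<in>f ` {..<card K}. d t x \<odot>\<^bsub>M\<^esub> p (\<delta> t)) = (\<Oplus>\<^bsub>M\<^esub>j\<in>{..<card K}. d (f j) x \<odot>\<^bsub>M\<^esub> p (\<delta> (f j)))"
        using f dM[OF that] K mod_hom_closed[OF p \<delta>]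
        by (intro M.M.finsum_reindex) (auto simp: bij_betw_def intro!: M.smult_closed)
      then show ?thesis using exp[OF that] f by (simp add: bij_betw_def)
    qed
  qed
  then show ?thesis ..
qed

section \<open>Tensor products\<close>

lemma rel3_in_free:
  "\<lbrakk>a \<in> S; b \<in> S; c \<in> S\<rbrakk> \<Longrightarrow> frag_of a - frag_of b - frag_of c \<in> carrier (free_Abelian_group S)"
  using Poly_Mapping.keys_diff[of "frag_of a - frag_of b" "frag_of c"]
    Poly_Mapping.keys_diff[of "frag_of a" "frag_of b"]
  by (auto simp: keys_frag_of)

lemma rel2_in_free: "\<lbrakk>a \<in> S; b \<in> S\<rbrakk> \<Longrightarrow> frag_of a - frag_of b \<in> carrier (free_Abelian_group S)"
  using Poly_Mapping.keys_diff[of "frag_of a" "frag_of b"] by (auto simp: keys_frag_of)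

lemma presentation_pres_group:
  "E \<subseteq> carrier (free_Abelian_group S) \<Longrightarrow> presentation S E (pres_group S E)"
  by (simp add: presentation_def presents_def)

lemma additive_cong_ring:
  "\<lbrakk>carrier G = carrier G'; add G = add G'; carrier H = carrier H'; add H = add H'\<rbrakk>
    \<Longrightarrow> additive G H = additive G' H'"
  by (simp add: additive_def)

text \<open>The commuting of the two actions is what lets left multiplication on \<open>L\<close>
  respect the balancing relators of \<open>L\<close> \<otimes> M.\<close>

locale bimod = left_module B L
  for B :: "('b, 'y) ring_scheme" and L :: "('b, 'l, 'z) bimodule_scheme" +
  assumes rsmult_closed: "\<lbrakk>l \<in> carrier L; b \<in> carrier B\<rbrakk> \<Longrightarrow> rsmult L l b \<in> carrier L"
    and smult_rsmult: "\<lbrakk>b \<in> carrier B; c \<in> carrier B; l \<in> carrier L\<rbrakk>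
      \<Longrightarrow> rsmult L (b \<odot>\<^bsub>L\<^esub> l) c = b \<odot>\<^bsub>L\<^esub> rsmult L l c"

locale tensor_product = bimod B L + M: left_module B M
  for B :: "('b, 'y) ring_scheme" and L :: "('b, 'l, 'z) bimodule_scheme"
    and M :: "('b, 'm, 'v) module_scheme"
begin

lemma tensor_rels_in_free: "tensor_rels B L M \<subseteq> carrier (free_Abelian_group (tensor_gens L M))"
  unfolding tensor_rels_def
  by (intro Un_least subsetI; elim CollectE exE conjE; simp only:; intro rel3_in_free rel2_in_free)
    (auto simp: tensor_gens_def rsmult_closed M.smult_closed)

sublocale T: presentation "tensor_gens L M" "tensor_rels B L M" "tensor B L M"
  by (simp add: presentation_def presents_def tensor_rels_in_free tensor_def Let_def)

sublocale T: abelian_group "tensor B L M" by (rule T.abelian_group)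

lemma tens_closed: "\<lbrakk>l \<in> carrier L; x \<in> carrier M\<rbrakk> \<Longrightarrow> tens B L M l x \<in> carrier (tensor B L M)"
  unfolding tens_def by (rule T.cls_closed) (simp add: tensor_gens_def)

lemma tens_additive_left: "x \<in> carrier M \<Longrightarrow> (\<lambda>l. tens B L M l x) \<in> additive L (tensor B L M)"
  unfolding tens_def
  by (intro additiveI T.cls_closed T.cls_rel3)
    (auto simp: tensor_rels_def tensor_gens_def)

lemma tens_additive_right: "l \<in> carrier L \<Longrightarrow> (\<lambda>x. tens B L M l x) \<in> additive M (tensor B L M)"
  unfolding tens_def
  by (intro additiveI T.cls_closed T.cls_rel3)
    (auto simp: tensor_rels_def tensor_gens_def)

lemma tens_balanced:
  "\<lbrakk>l \<in> carrier L; b \<in> carrier B; x \<in> carrier M\<rbrakk>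
    \<Longrightarrow> tens B L M (rsmult L l b) x = tens B L M l (b \<odot>\<^bsub>M\<^esub> x)"
  unfolding tens_def
  by (rule T.cls_rel2)
    (auto simp: tensor_rels_def tensor_gens_def rsmult_closed M.smult_closed)

text \<open>Every tensor is a sum of pure tensors: a sign moves into the left factor, and zero is
  itself a pure tensor. Proving the property for t and for its negative simultaneously absorbs the
  case of inverses.\<close>

lemma tensor_induct [consumes 1, case_names tens add]:
  assumes "t \<in> carrier (tensor B L M)"
    and tens: "\<And>l x. \<lbrakk>l \<in> carrier L; x \<in> carrier M\<rbrakk> \<Longrightarrow> P (tens B L M l x)"
    and add: "\<And>s t. \<lbrakk>s \<in> carrier (tensor B L M); t \<in> carrier (tensor B L M); P s; P t\<rbrakk>
      \<Longrightarrow> P (s \<oplus>\<^bsub>tensor B L M\<^esub> t)"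
  shows "P t"
proof -
  have neg: "\<ominus>\<^bsub>tensor B L M\<^esub> tens B L M l x = tens B L M (\<ominus>\<^bsub>L\<^esub> l) x"
    if "l \<in> carrier L" "x \<in> carrier M" for l x
    using additive_inv[OF abelian_group T.abelian_group tens_additive_left] that by simp
  have zero: "\<zero>\<^bsub>tensor B L M\<^esub> = tens B L M \<zero>\<^bsub>L\<^esub> \<zero>\<^bsub>M\<^esub>"
    using additive_zero[OF abelian_group T.abelian_group tens_additive_left] by simp
  have "P t \<and> P (\<ominus>\<^bsub>tensor B L M\<^esub> t)" using assms(1)
  proof (induction rule: T.induct)
    case (gen s)
    then obtain l x where lx: "s = (l, x)" "l \<in> carrier L" "x \<in> carrier M"
      by (auto simp: tensor_gens_def)
    have "pres_class (tensor_gens L M) (tensor_rels B L M) s = tens B L M l x"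
      by (simp add: tens_def lx)
    then show ?case using tens neg lx by simp
  next
    case zero
    have neg_zero: "\<ominus>\<^bsub>tensor B L M\<^esub> \<zero>\<^bsub>tensor B L M\<^esub> = \<zero>\<^bsub>tensor B L M\<^esub>"
      by (rule T.minus_equality) (rule T.l_zero T.zero_closed)+
    show ?case using tens[of "\<zero>\<^bsub>L\<^esub>" "\<zero>\<^bsub>M\<^esub>"] by (simp add: neg_zero \<open>\<zero>\<^bsub>tensor B L M\<^esub> = _\<close>[symmetric])
  next
    case (add x y)
    then show ?case using assms(3) by (simp add: T.minus_add)
  qed simp
  then show ?thesis ..
qed

lemma tensor_eqI:
  assumes "abelian_group H" "f \<in> additive (tensor B L M) H" "g \<in> additive (tensor B L M) H"
    and "\<And>l x. \<lbrakk>l \<in> carrier L; x \<in> carrier M\<rbrakk> \<Longrightarrow> f (tens B L M l x) = g (tens B L M l x)"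
    and "t \<in> carrier (tensor B L M)"
  shows "f t = g t"
  using assms(5)
  by (induction rule: tensor_induct)
    (auto simp: assms(4) additive_add[OF assms(2)] additive_add[OF assms(3)])

lemma tensor_lift:
  assumes "abelian_group H"
    and closed: "\<And>l x. \<lbrakk>l \<in> carrier L; x \<in> carrier M\<rbrakk> \<Longrightarrow> g l x \<in> carrier H"
    and add_l: "\<And>k l x. \<lbrakk>k \<in> carrier L; l \<in> carrier L; x \<in> carrier M\<rbrakk>
      \<Longrightarrow> g (k \<oplus>\<^bsub>L\<^esub> l) x = g k x \<oplus>\<^bsub>H\<^esub> g l x"
    and add_r: "\<And>l x y. \<lbrakk>l \<in> carrier L; x \<in> carrier M; y \<in> carrier M\<rbrakk>
      \<Longrightarrow> g l (x \<oplus>\<^bsub>M\<^esub> y) = g l x \<oplus>\<^bsub>H\<^esub> g l y"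
    and balanced: "\<And>l b x. \<lbrakk>l \<in> carrier L; b \<in> carrier B; x \<in> carrier M\<rbrakk>
      \<Longrightarrow> g (rsmult L l b) x = g l (b \<odot>\<^bsub>M\<^esub> x)"
  shows tensor_lift_additive: "pres_lift H (\<lambda>(l, x). g l x) \<in> additive (tensor B L M) H"
    and tensor_lift_tens: "\<lbrakk>l \<in> carrier L; x \<in> carrier M\<rbrakk>
      \<Longrightarrow> pres_lift H (\<lambda>(l, x). g l x) (tens B L M l x) = g l x"
proof -
  interpret H: abelian_group H by fact
  let ?g = "\<lambda>(l, x). g l x"
  have g: "?g \<in> tensor_gens L M \<rightarrow> carrier H" by (auto simp: tensor_gens_def closed)
  have rel: "free_ext H ?g e = \<zero>\<^bsub>H\<^esub>" if "e \<in> tensor_rels B L M" for e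
    using that unfolding tensor_rels_def
    by (elim UnE CollectE exE conjE; simp only:;
        intro H.free_ext_rel3[OF _ _ _ g] H.free_ext_rel2[OF _ _ g])
      (auto simp: tensor_gens_def add_l add_r balanced rsmult_closed M.smult_closed)
  show "pres_lift H ?g \<in> additive (tensor B L M) H"
    by (rule T.pres_lift_additive[OF assms(1) g rel])
  show "pres_lift H ?g (tens B L M l x) = g l x" if "l \<in> carrier L" "x \<in> carrier M"
    unfolding tens_def using T.pres_lift_class[OF assms(1) g rel, of "(l, x)"] that
    by (simp add: tensor_gens_def)
qed

text \<open>The action in the record \<open>tensor\<close> is a lift into the bare group
  \<open>pres_group\<close>, since the record is only being defined at that point. The universal
  property is therefore used with \<open>pres_group\<close> as target and carried back along the
  equality of carriers and additions.\<close>

lemma smult_tensor: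
  assumes "b \<in> carrier B"
  shows smult_tensor_additive: "(\<lambda>t. b \<odot>\<^bsub>tensor B L M\<^esub> t) \<in> additive (tensor B L M) (tensor B L M)"
    and smult_tens: "\<lbrakk>l \<in> carrier L; x \<in> carrier M\<rbrakk>
      \<Longrightarrow> b \<odot>\<^bsub>tensor B L M\<^esub> tens B L M l x = tens B L M (b \<odot>\<^bsub>L\<^esub> l) x"
proof -
  let ?G = "pres_group (tensor_gens L M) (tensor_rels B L M)"
  interpret G: presentation "tensor_gens L M" "tensor_rels B L M" ?G
    by (rule presentation_pres_group[OF tensor_rels_in_free])
  have eq: "carrier (tensor B L M) = carrier ?G" "add (tensor B L M) = add ?G"
    by (simp_all add: tensor_def Let_def)
  have sm: "smult (tensor B L M) b = pres_lift ?G (\<lambda>(l, x). tens B L M (b \<odot>\<^bsub>L\<^esub> l) x)"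
    by (simp add: tensor_def Let_def)
  note A = tensor_lift[of ?G "\<lambda>l x. tens B L M (b \<odot>\<^bsub>L\<^esub> l) x", OF G.abelian_group]
  have 1: "tens B L M (b \<odot>\<^bsub>L\<^esub> l) x \<in> carrier ?G" if "l \<in> carrier L" "x \<in> carrier M" for l x
    using that assms tens_closed smult_closed by (simp add: eq[symmetric])
  have 2: "tens B L M (b \<odot>\<^bsub>L\<^esub> (k \<oplus>\<^bsub>L\<^esub> l)) x = tens B L M (b \<odot>\<^bsub>L\<^esub> k) x \<oplus>\<^bsub>?G\<^esub> tens B L M (b \<odot>\<^bsub>L\<^esub> l) x"
    if "k \<in> carrier L" "l \<in> carrier L" "x \<in> carrier M" for k l x
    using that assms additive_add[OF tens_additive_left] smult_closed
    by (simp add: eq[symmetric] smult_r_distr)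
  have 3: "tens B L M (b \<odot>\<^bsub>L\<^esub> l) (x \<oplus>\<^bsub>M\<^esub> y) = tens B L M (b \<odot>\<^bsub>L\<^esub> l) x \<oplus>\<^bsub>?G\<^esub> tens B L M (b \<odot>\<^bsub>L\<^esub> l) y"
    if "l \<in> carrier L" "x \<in> carrier M" "y \<in> carrier M" for l x y
    using that assms additive_add[OF tens_additive_right] smult_closed by (simp add: eq[symmetric])
  have 4: "tens B L M (b \<odot>\<^bsub>L\<^esub> rsmult L l c) x = tens B L M (b \<odot>\<^bsub>L\<^esub> l) (c \<odot>\<^bsub>M\<^esub> x)"
    if "l \<in> carrier L" "c \<in> carrier B" "x \<in> carrier M" for l c x
    using that assms tens_balanced[of "b \<odot>\<^bsub>L\<^esub> l" c x] smult_closed by (simp add: smult_rsmult)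
  show "(\<lambda>t. b \<odot>\<^bsub>tensor B L M\<^esub> t) \<in> additive (tensor B L M) (tensor B L M)"
    using A(1)[OF 1 2 3 4] additive_cong_ring[OF refl refl eq, of "tensor B L M"] by (simp add: sm)
  show "b \<odot>\<^bsub>tensor B L M\<^esub> tens B L M l x = tens B L M (b \<odot>\<^bsub>L\<^esub> l) x"
    if "l \<in> carrier L" "x \<in> carrier M"
    using A(2)[OF 1 2 3 4 that] by (simp add: sm)
qed

lemma left_module_tensor: "left_module B (tensor B L M)"
proof (intro left_module.intro left_module_axioms.intro)
  let ?T = "tensor B L M"
  show "ring B" ..
  show "Ring.abelian_group ?T" by (rule T.abelian_group)
  show cl: "b \<odot>\<^bsub>?T\<^esub> t \<in> carrier ?T" if "b \<in> carrier B" "t \<in> carrier ?T" for b t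
    using additive_closed[OF smult_tensor_additive] that by blast
  show dist: "b \<odot>\<^bsub>?T\<^esub> (s \<oplus>\<^bsub>?T\<^esub> t) = b \<odot>\<^bsub>?T\<^esub> s \<oplus>\<^bsub>?T\<^esub> b \<odot>\<^bsub>?T\<^esub> t"
    if "b \<in> carrier B" "s \<in> carrier ?T" "t \<in> carrier ?T" for b s t
    using additive_add[OF smult_tensor_additive] that by blast
  show "(b \<oplus>\<^bsub>B\<^esub> c) \<odot>\<^bsub>?T\<^esub> t = b \<odot>\<^bsub>?T\<^esub> t \<oplus>\<^bsub>?T\<^esub> c \<odot>\<^bsub>?T\<^esub> t"
    if bc: "b \<in> carrier B" "c \<in> carrier B" and "t \<in> carrier ?T" for b c t
    using that(3)
  proof (induction rule: tensor_induct)
    case (tens l x)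
    then show ?case using bc
      by (simp add: smult_tens smult_l_distr additive_add[OF tens_additive_left] smult_closed)
  next
    case (add s t)
    then show ?case using bc by (simp add: dist cl T.a_ac)
  qed
  show "(b \<otimes>\<^bsub>B\<^esub> c) \<odot>\<^bsub>?T\<^esub> t = b \<odot>\<^bsub>?T\<^esub> (c \<odot>\<^bsub>?T\<^esub> t)"
    if bc: "b \<in> carrier B" "c \<in> carrier B" and "t \<in> carrier ?T" for b c t
    using that(3)
    by (induction rule: tensor_induct)
      (use bc in \<open>auto simp: smult_tens smult_assoc smult_closed dist cl\<close>)
  show "\<one>\<^bsub>B\<^esub> \<odot>\<^bsub>?T\<^esub> t = t" if "t \<in> carrier ?T" for t
    using that by (induction rule: tensor_induct) (auto simp: smult_tens smult_one dist)
qed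

end

lemma tensor_productI: "bimod B L \<Longrightarrow> left_module B M \<Longrightarrow> tensor_product B L M"
  by (simp add: tensor_product_def)

context bimod
begin

lemma tensor_map:
  assumes "left_module B M" "left_module B N" and f: "f \<in> mod_hom B M N"
  shows tensor_map_hom: "tensor_map B L M N f \<in> mod_hom B (tensor B L M) (tensor B L N)"
    and tensor_map_tens: "\<lbrakk>l \<in> carrier L; x \<in> carrier M\<rbrakk>
      \<Longrightarrow> tensor_map B L M N f (tens B L M l x) = tens B L N l (f x)"
proof -
  interpret M: tensor_product B L M using assms(1) bimod_axioms by (rule tensor_productI[rotated])
  interpret N: tensor_product B L N using assms(2) bimod_axioms by (rule tensor_productI[rotated])
  have A: "tens B L N l (f x) \<in> carrier (tensor B L N)"
    if "l \<in> carrier L" "x \<in> carrier M" for l x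
    using that f by (simp add: N.tens_closed mod_homD[OF f])
  let ?g = "pres_lift (tensor B L N) (\<lambda>(l, x). tens B L N l (f x))"
  have g: "?g \<in> additive (tensor B L M) (tensor B L N)"
    by (rule M.tensor_lift_additive[OF N.T.abelian_group])
      (auto simp: A mod_homD[OF f] additive_add[OF N.tens_additive_left]
        additive_add[OF N.tens_additive_right] N.tens_balanced)
  have gt: "?g (tens B L M l x) = tens B L N l (f x)" if "l \<in> carrier L" "x \<in> carrier M" for l x
    by (rule M.tensor_lift_tens[OF N.T.abelian_group])
      (auto simp: that A mod_homD[OF f] additive_add[OF N.tens_additive_left]
        additive_add[OF N.tens_additive_right] N.tens_balanced)
  interpret TM: left_module B "tensor B L M" by (rule M.left_module_tensor)
  interpret TN: left_module B "tensor B L N" by (rule N.left_module_tensor)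
  have sm: "?g (b \<odot>\<^bsub>tensor B L M\<^esub> t) = b \<odot>\<^bsub>tensor B L N\<^esub> ?g t"
    if b: "b \<in> carrier B" and "t \<in> carrier (tensor B L M)" for b t
    using that(2)
  proof (induction rule: M.tensor_induct)
    case (tens l x)
    then show ?case using b by (simp add: M.smult_tens N.smult_tens gt smult_closed mod_homD[OF f])
  next
    case (add s t)
    then show ?case using b
      by (simp add: TM.smult_r_distr TN.smult_r_distr additive_add[OF g] additive_closed[OF g] TM.smult_closed)
  qed
  show "tensor_map B L M N f \<in> mod_hom B (tensor B L M) (tensor B L N)"
    unfolding tensor_map_def
    by (rule mod_homI) (auto simp: sm additive_add[OF g] additive_closed[OF g] TM.smult_closed)
  show "tensor_map B L M N f (tens B L M l x) = tens B L N l (f x)"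
    if "l \<in> carrier L" "x \<in> carrier M"
    using that by (simp add: tensor_map_def gt M.tens_closed)
qed

end

lemma is_functor_tensor:
  fixes B :: "('r, 'b) module" and L :: "('b, 'l, 'z) bimodule_scheme"
  assumes bimod_axioms: "bimod B L"
  shows "is_functor (ordinary (Mod_cat B :: (('b, 'n) module, 'n \<Rightarrow> 'n, 'r) lin_cat))
    (ordinary (Mod_cat B)) (tensor_functor B L)"
proof -
  interpret bimod B L by fact
  show ?thesis
  proof (intro is_functor.intro is_functor_axioms.intro category_Mod_cat)
    fix M assume "M \<in> Ob (ordinary (Mod_cat B))"
    then interpret M: tensor_product B L M
      using bimod_axioms by (simp add: tensor_productI)
    have M: "left_module B M" ..
    note id = mod_hom_id[OF M]
    show "fob (tensor_functor B L) M \<in> Ob (ordinary (Mod_cat B))"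
      by (simp add: tensor_functor_def M.left_module_tensor)
    have "tensor_map B L M M (\<lambda>x\<in>carrier M. x) = (\<lambda>t\<in>carrier (tensor B L M). t)"
    proof (rule mod_hom_eqI[OF tensor_map_hom[OF M M id] mod_hom_id[OF M.left_module_tensor]])
      fix t assume "t \<in> carrier (tensor B L M)"
      then show "tensor_map B L M M (\<lambda>x\<in>carrier M. x) t = (\<lambda>t\<in>carrier (tensor B L M). t) t"
        by (rule M.tensor_eqI[OF M.T.abelian_group mod_hom_additive[OF tensor_map_hom[OF M M id]]
            mod_hom_additive[OF mod_hom_id[OF M.left_module_tensor]], rotated])
          (simp add: tensor_map_tens[OF M M id] M.tens_closed)
    qed
    then show "far (tensor_functor B L) M M (Idn (ordinary (Mod_cat B)) M)
        = Idn (ordinary (Mod_cat B)) (fob (tensor_functor B L) M)"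
      by (simp add: tensor_functor_def)
  next
    fix M N f assume "M \<in> Ob (ordinary (Mod_cat B))" "N \<in> Ob (ordinary (Mod_cat B))"
      "f \<in> Ar (ordinary (Mod_cat B)) M N"
    then show "far (tensor_functor B L) M N f
        \<in> Ar (ordinary (Mod_cat B)) (fob (tensor_functor B L) M) (fob (tensor_functor B L) N)"
      by (simp add: tensor_functor_def tensor_map_hom)
  next
    fix M N P f g assume "M \<in> Ob (ordinary (Mod_cat B))" "N \<in> Ob (ordinary (Mod_cat B))"
      "P \<in> Ob (ordinary (Mod_cat B))"
      "f \<in> Ar (ordinary (Mod_cat B)) M N" "g \<in> Ar (ordinary (Mod_cat B)) N P"
    then have m: "left_module B M" "left_module B N" "left_module B P"
      and f: "f \<in> mod_hom B M N" and g: "g \<in> mod_hom B N P" by auto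
    interpret M: tensor_product B L M using m bimod_axioms by (simp add: tensor_productI)
    interpret P: tensor_product B L P using m bimod_axioms by (simp add: tensor_productI)
    note gf = mod_hom_comp[OF m(1) f g]
    have c: "compose (carrier (tensor B L M)) (tensor_map B L N P g) (tensor_map B L M N f)
        \<in> mod_hom B (tensor B L M) (tensor B L P)"
      by (rule mod_hom_comp[OF M.left_module_tensor tensor_map_hom[OF m(1,2) f] tensor_map_hom[OF m(2,3) g]])
    have "tensor_map B L M P (compose (carrier M) g f)
       = compose (carrier (tensor B L M)) (tensor_map B L N P g) (tensor_map B L M N f)"
    proof (rule mod_hom_eqI[OF tensor_map_hom[OF m(1,3) gf] c])
      fix t assume "t \<in> carrier (tensor B L M)"
      then show "tensor_map B L M P (compose (carrier M) g f) t
         = compose (carrier (tensor B L M)) (tensor_map B L N P g) (tensor_map B L M N f) t"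
        by (rule M.tensor_eqI[OF P.T.abelian_group mod_hom_additive[OF tensor_map_hom[OF m(1,3) gf]]
            mod_hom_additive[OF c], rotated])
          (simp add: tensor_map_tens m f g gf M.tens_closed compose_eq mod_homD[OF f])
    qed
    then show "far (tensor_functor B L) M P (Cmp (ordinary (Mod_cat B)) M N P g f) =
        Cmp (ordinary (Mod_cat B)) (fob (tensor_functor B L) M) (fob (tensor_functor B L) N)
          (fob (tensor_functor B L) P) (far (tensor_functor B L) N P g) (far (tensor_functor B L) M N f)"
      by (simp add: tensor_functor_def)
  qed
qed

section \<open>The coend bimodule\<close>

locale fibre_functor =
  fixes R :: "'r ring" and B :: "('r, 'b) module"
    and A :: "('o, 'a, 'r) lin_cat" and w :: "('o, 'a, 'b, 'm) fibre"
  assumes algebra_B: "assoc_algebra R B"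
    and additive_A: "additive_linear_category R A"
    and linear_w: "linear_functor R A (Mod_cat B) w"
    and fgp: "X \<in> LOb A \<Longrightarrow> fg_projective B (fob w X)"
begin

sublocale Balg: assoc_algebra R B by (rule algebra_B)
sublocale A: additive_linear_category R A by (rule additive_A)
sublocale w: linear_functor R A "Mod_cat B" w by (rule linear_w)

abbreviation "W \<equiv> fob w"
abbreviation "L \<equiv> coend_bimodule R B A w"
abbreviation "cl \<equiv> coend_class R B A w"

lemma ring_B: "ring B" ..

lemma ordinary_A [simp]: "Ob (ordinary A) = LOb A" "Ar (ordinary A) X Y = carrier (LHom A X Y)"
  "Cmp (ordinary A) = LCmp A" "Idn (ordinary A) = LIdn A"
  by (simp_all add: ordinary_def)

lemma W_module: "X \<in> LOb A \<Longrightarrow> left_module B (W X)"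
  using fgp by (simp add: fg_projective_def)

lemma W_smult_closed:
  "\<lbrakk>X \<in> LOb A; b \<in> carrier B; x \<in> carrier (W X)\<rbrakk> \<Longrightarrow> b \<odot>\<^bsub>W X\<^esub> x \<in> carrier (W X)"
  using left_module.smult_closed[OF W_module] by blast

lemma W_abelian_group: "X \<in> LOb A \<Longrightarrow> abelian_group (W X)"
  using W_module by (rule left_module.abelian_group)

lemma W_add_closed:
  "\<lbrakk>X \<in> LOb A; x \<in> carrier (W X); y \<in> carrier (W X)\<rbrakk> \<Longrightarrow> x \<oplus>\<^bsub>W X\<^esub> y \<in> carrier (W X)"
  using abelian_groupE(1)[OF W_abelian_group] by blast

lemma far_hom:
  "\<lbrakk>X \<in> LOb A; Y \<in> LOb A; f \<in> carrier (LHom A X Y)\<rbrakk> \<Longrightarrow> far w X Y f \<in> mod_hom B (W X) (W Y)"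
  using w.far_closed by simp

lemma far_W_closed:
  "\<lbrakk>X \<in> LOb A; Y \<in> LOb A; f \<in> carrier (LHom A X Y); x \<in> carrier (W X)\<rbrakk>
    \<Longrightarrow> far w X Y f x \<in> carrier (W Y)"
  using mod_hom_closed[OF far_hom] by blast

lemma far_id: "\<lbrakk>X \<in> LOb A; x \<in> carrier (W X)\<rbrakk> \<Longrightarrow> far w X X (LIdn A X) x = x"
  using w.far_Idn[of X] by simp

lemma far_comp:
  "\<lbrakk>X \<in> LOb A; Y \<in> LOb A; Z \<in> LOb A; f \<in> carrier (LHom A X Y); g \<in> carrier (LHom A Y Z);
    x \<in> carrier (W X)\<rbrakk> \<Longrightarrow> far w X Z (LCmp A X Y Z g f) x = far w Y Z g (far w X Y f x)"
  using w.far_Cmp[of X Y Z f g] by (simp add: compose_def)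

lemma far_compose:
  "\<lbrakk>X \<in> LOb A; Y \<in> LOb A; Z \<in> LOb A; f \<in> carrier (LHom A X Y); g \<in> carrier (LHom A Y Z)\<rbrakk>
    \<Longrightarrow> far w X Z (LCmp A X Y Z g f) = compose (carrier (W X)) (far w Y Z g) (far w X Y f)"
  using w.far_Cmp[of X Y Z f g] by simp

lemma far_add:
  "\<lbrakk>X \<in> LOb A; Y \<in> LOb A; f \<in> carrier (LHom A X Y); g \<in> carrier (LHom A X Y); x \<in> carrier (W X)\<rbrakk>
    \<Longrightarrow> far w X Y (f \<oplus>\<^bsub>LHom A X Y\<^esub> g) x = far w X Y f x \<oplus>\<^bsub>W Y\<^esub> far w X Y g x"
  using w.far_add[of X Y f g] by (simp add: Mod_cat_def)

lemma far_smult: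
  "\<lbrakk>X \<in> LOb A; Y \<in> LOb A; r \<in> carrier R; f \<in> carrier (LHom A X Y); x \<in> carrier (W X)\<rbrakk>
    \<Longrightarrow> far w X Y (r \<odot>\<^bsub>LHom A X Y\<^esub> f) x = scalar B r \<odot>\<^bsub>W Y\<^esub> far w X Y f x"
  using w.far_smult[of X Y r f] by (simp add: Mod_cat_def)

lemma LHom_abelian_group:
  assumes "X \<in> LOb A" "Y \<in> LOb A" shows "abelian_group (LHom A X Y)"
  by (rule module.axioms(2)[OF A.LHom_module[OF assms]])

lemma LHom_zero_closed: "\<lbrakk>X \<in> LOb A; Y \<in> LOb A\<rbrakk> \<Longrightarrow> \<zero>\<^bsub>LHom A X Y\<^esub> \<in> carrier (LHom A X Y)"
  using abelian_groupE(2)[OF LHom_abelian_group] .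

lemma LHom_add_closed:
  "\<lbrakk>X \<in> LOb A; Y \<in> LOb A; f \<in> carrier (LHom A X Y); g \<in> carrier (LHom A X Y)\<rbrakk>
    \<Longrightarrow> f \<oplus>\<^bsub>LHom A X Y\<^esub> g \<in> carrier (LHom A X Y)"
  using abelian_groupE(1)[OF LHom_abelian_group] .

lemma LIdn_closed: "X \<in> LOb A \<Longrightarrow> LIdn A X \<in> carrier (LHom A X X)"
  using A.Idn_closed[of X] by simp

lemma LCmp_closed:
  "\<lbrakk>X \<in> LOb A; Y \<in> LOb A; Z \<in> LOb A; f \<in> carrier (LHom A X Y); g \<in> carrier (LHom A Y Z)\<rbrakk>
    \<Longrightarrow> LCmp A X Y Z g f \<in> carrier (LHom A X Z)"
  using A.Cmp_closed[of X Y Z f g] by simp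

lemma far_zero:
  assumes "X \<in> LOb A" "Y \<in> LOb A" "x \<in> carrier (W X)"
  shows "far w X Y \<zero>\<^bsub>LHom A X Y\<^esub> x = \<zero>\<^bsub>W Y\<^esub>"
proof -
  have "(\<lambda>f. far w X Y f x) \<in> additive (LHom A X Y) (W Y)"
    by (rule additiveI) (use assms in \<open>auto intro: far_W_closed far_add\<close>)
  then show ?thesis
    using additive_zero[OF LHom_abelian_group W_abelian_group] assms by blast
qed

lemma scalar_closed: "r \<in> carrier R \<Longrightarrow> scalar B r \<in> carrier B"
  by (simp add: scalar_def Balg.smult_closed)

lemma scalar_central:
  "\<lbrakk>r \<in> carrier R; b \<in> carrier B\<rbrakk> \<Longrightarrow> scalar B r \<otimes>\<^bsub>B\<^esub> b = b \<otimes>\<^bsub>B\<^esub> scalar B r"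
  by (simp add: scalar_def Balg.smult_mult_left Balg.smult_mult_right)

section \<open>Functionals on the modules w(X)\<close>

lemma dual_hom_add:
  assumes "X \<in> LOb A" "\<phi> \<in> dual B (W X)" "\<psi> \<in> dual B (W X)"
  shows "(\<lambda>x\<in>carrier (W X). \<phi> x \<oplus>\<^bsub>B\<^esub> \<psi> x) \<in> dual B (W X)"
  using mod_hom_hom_add[OF W_module left_module_left_regular[OF ring_B], of X \<phi> \<psi>] assms
  by (simp add: hom_add_def dual_def)

text \<open>Multiplying the values of a functional on the left preserves \<open>B\<close>-linearity
  here because \<open>scalar B r\<close> is central.\<close>

lemma dual_scalar:
  assumes X: "X \<in> LOb A" and "r \<in> carrier R" and \<phi>: "\<phi> \<in> dual B (W X)"
  shows "(\<lambda>x\<in>carrier (W X). scalar B r \<otimes>\<^bsub>B\<^esub> \<phi> x) \<in> dual B (W X)"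
  unfolding dual_def
proof (rule mod_homI)
  fix b x assume bx: "b \<in> carrier B" "x \<in> carrier (W X)"
  have "scalar B r \<otimes>\<^bsub>B\<^esub> (b \<otimes>\<^bsub>B\<^esub> \<phi> x) = b \<otimes>\<^bsub>B\<^esub> (scalar B r \<otimes>\<^bsub>B\<^esub> \<phi> x)"
    using assms bx scalar_closed dual_closed[OF \<phi>]
    by (metis Balg.m_assoc scalar_central)
  then show "(\<lambda>x\<in>carrier (W X). scalar B r \<otimes>\<^bsub>B\<^esub> \<phi> x) (b \<odot>\<^bsub>W X\<^esub> x) =
      b \<odot>\<^bsub>left_regular B\<^esub> (\<lambda>x\<in>carrier (W X). scalar B r \<otimes>\<^bsub>B\<^esub> \<phi> x) x"
    using bx by (simp add: W_smult_closed[OF X] dual_smult[OF \<phi>])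
qed (use assms in \<open>auto simp: W_add_closed dualD[OF \<phi>] scalar_closed Balg.r_distr\<close>)

lemma dual_compose:
  "\<lbrakk>X \<in> LOb A; Y \<in> LOb A; f \<in> carrier (LHom A X Y); \<phi> \<in> dual B (W Y)\<rbrakk>
    \<Longrightarrow> compose (carrier (W X)) \<phi> (far w X Y f) \<in> dual B (W X)"
  unfolding dual_def by (rule mod_hom_comp[OF W_module far_hom])

definition dual_rmult :: "'o \<Rightarrow> ('m \<Rightarrow> 'b) \<Rightarrow> 'b \<Rightarrow> 'm \<Rightarrow> 'b" where
  "dual_rmult X \<phi> b = (\<lambda>x\<in>carrier (W X). \<phi> x \<otimes>\<^bsub>B\<^esub> b)"

lemma dual_rmult_closed:
  assumes X: "X \<in> LOb A" and \<phi>: "\<phi> \<in> dual B (W X)" and b: "b \<in> carrier B"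
  shows "dual_rmult X \<phi> b \<in> dual B (W X)"
  unfolding dual_def dual_rmult_def
  by (rule mod_homI)
    (use assms in \<open>auto simp: W_add_closed W_smult_closed dualD[OF \<phi>] Balg.l_distr Balg.m_assoc\<close>)

section \<open>Generators, universal property and bimodule structure of the coend\<close>

lemma coend_rels_in_free: "coend_rels R B A w \<subseteq> carrier (free_Abelian_group (coend_gens B A w))"
  unfolding coend_rels_def
  by (intro Un_least subsetI; elim CollectE exE conjE; simp only:; intro rel3_in_free rel2_in_free)
    (auto simp: coend_gens_def W_add_closed W_smult_closed dual_hom_add dual_scalar scalar_closed
      dual_compose far_W_closed)

sublocale L: presentation "coend_gens B A w" "coend_rels R B A w" L
  by (simp add: presentation_def presents_def coend_rels_in_free coend_bimodule_def Let_def)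

sublocale L: abelian_group L by (rule L.abelian_group)

lemma cl_closed:
  "\<lbrakk>X \<in> LOb A; m \<in> carrier (W X); \<phi> \<in> dual B (W X)\<rbrakk> \<Longrightarrow> cl X m \<phi> \<in> carrier L"
  unfolding coend_class_def by (rule L.cls_closed) (simp add: coend_gens_def)

lemma cl_add_left:
  "\<lbrakk>X \<in> LOb A; m \<in> carrier (W X); n \<in> carrier (W X); \<phi> \<in> dual B (W X)\<rbrakk>
    \<Longrightarrow> cl X (m \<oplus>\<^bsub>W X\<^esub> n) \<phi> = cl X m \<phi> \<oplus>\<^bsub>L\<^esub> cl X n \<phi>"
  unfolding coend_class_def
  by (rule L.cls_rel3) (auto simp: coend_gens_def coend_rels_def W_add_closed)

lemma cl_add_right:
  "\<lbrakk>X \<in> LOb A; m \<in> carrier (W X); \<phi> \<in> dual B (W X); \<psi> \<in> dual B (W X)\<rbrakk>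
    \<Longrightarrow> cl X m (\<lambda>x\<in>carrier (W X). \<phi> x \<oplus>\<^bsub>B\<^esub> \<psi> x) = cl X m \<phi> \<oplus>\<^bsub>L\<^esub> cl X m \<psi>"
  unfolding coend_class_def
  by (rule L.cls_rel3) (auto simp: coend_gens_def coend_rels_def dual_hom_add)

lemma cl_dinatural:
  assumes "X \<in> LOb A" "Y \<in> LOb A" "f \<in> carrier (LHom A X Y)" "m \<in> carrier (W X)" "\<phi> \<in> dual B (W Y)"
  shows "cl Y (far w X Y f m) \<phi> = cl X m (compose (carrier (W X)) \<phi> (far w X Y f))"
  unfolding coend_class_def
proof (rule L.cls_rel2)
  show "frag_of (Y, far w X Y f m, \<phi>) - frag_of (X, m, compose (carrier (W X)) \<phi> (far w X Y f))
      \<in> coend_rels R B A w"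
    unfolding coend_rels_def using assms by blast
qed (use assms in \<open>auto simp: coend_gens_def far_W_closed dual_compose\<close>)

text \<open>The relators for scalars of \<open>R\<close> are respected as a consequence of
  dinaturality at the endomorphism r id of X: by linearity of \<open>w\<close>, it acts on w(X) as
  \<open>scalar B r\<close>.\<close>

lemma coend_lift:
  assumes H: "abelian_group H"
    and closed: "\<And>X m \<phi>. \<lbrakk>X \<in> LOb A; m \<in> carrier (W X); \<phi> \<in> dual B (W X)\<rbrakk> \<Longrightarrow> g X m \<phi> \<in> carrier H"
    and add_l: "\<And>X m n \<phi>. \<lbrakk>X \<in> LOb A; m \<in> carrier (W X); n \<in> carrier (W X); \<phi> \<in> dual B (W X)\<rbrakk>
      \<Longrightarrow> g X (m \<oplus>\<^bsub>W X\<^esub> n) \<phi> = g X m \<phi> \<oplus>\<^bsub>H\<^esub> g X n \<phi>"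
    and add_r: "\<And>X m \<phi> \<psi>. \<lbrakk>X \<in> LOb A; m \<in> carrier (W X); \<phi> \<in> dual B (W X); \<psi> \<in> dual B (W X)\<rbrakk>
      \<Longrightarrow> g X m (\<lambda>x\<in>carrier (W X). \<phi> x \<oplus>\<^bsub>B\<^esub> \<psi> x) = g X m \<phi> \<oplus>\<^bsub>H\<^esub> g X m \<psi>"
    and dinat: "\<And>X Y f m \<phi>. \<lbrakk>X \<in> LOb A; Y \<in> LOb A; f \<in> carrier (LHom A X Y); m \<in> carrier (W X);
        \<phi> \<in> dual B (W Y)\<rbrakk>
      \<Longrightarrow> g Y (far w X Y f m) \<phi> = g X m (compose (carrier (W X)) \<phi> (far w X Y f))"
  shows coend_lift_additive: "pres_lift H (\<lambda>(X, m, \<phi>). g X m \<phi>) \<in> additive L H"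
    and coend_lift_cl: "\<lbrakk>X \<in> LOb A; m \<in> carrier (W X); \<phi> \<in> dual B (W X)\<rbrakk>
      \<Longrightarrow> pres_lift H (\<lambda>(X, m, \<phi>). g X m \<phi>) (cl X m \<phi>) = g X m \<phi>"
proof -
  interpret H: abelian_group H by fact
  let ?g = "\<lambda>(X, m, \<phi>). g X m \<phi>"
  have g: "?g \<in> coend_gens B A w \<rightarrow> carrier H" by (auto simp: coend_gens_def closed)
  have scal: "g X (scalar B r \<odot>\<^bsub>W X\<^esub> m) \<phi> = g X m (\<lambda>x\<in>carrier (W X). scalar B r \<otimes>\<^bsub>B\<^esub> \<phi> x)"
    if "X \<in> LOb A" "r \<in> carrier R" "m \<in> carrier (W X)" and \<phi>: "\<phi> \<in> dual B (W X)" for X r m \<phi>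
  proof -
    let ?f = "r \<odot>\<^bsub>LHom A X X\<^esub> LIdn A X"
    have f: "?f \<in> carrier (LHom A X X)"
      using that LIdn_closed by (intro module.smult_closed[OF A.LHom_module]) auto
    have v: "far w X X ?f x = scalar B r \<odot>\<^bsub>W X\<^esub> x" if "x \<in> carrier (W X)" for x
      using far_smult[of X X r "LIdn A X" x] \<open>X \<in> LOb A\<close> \<open>r \<in> carrier R\<close> that LIdn_closed far_id by simp
    have "compose (carrier (W X)) \<phi> (far w X X ?f) = (\<lambda>x\<in>carrier (W X). scalar B r \<otimes>\<^bsub>B\<^esub> \<phi> x)"
      using that by (auto simp: compose_def v dual_smult[OF \<phi>] scalar_closed cong: restrict_cong)
    then show ?thesis
      using dinat[of X X ?f m \<phi>] that f v by simp
  qed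
  have rel: "free_ext H ?g e = \<zero>\<^bsub>H\<^esub>" if "e \<in> coend_rels R B A w" for e
    using that unfolding coend_rels_def
    by (elim UnE CollectE exE conjE; simp only:;
        intro H.free_ext_rel3[OF _ _ _ g] H.free_ext_rel2[OF _ _ g])
      (auto simp: coend_gens_def W_add_closed W_smult_closed dual_hom_add dual_scalar scalar_closed
        dual_compose far_W_closed add_l add_r scal dinat)
  show "pres_lift H ?g \<in> additive L H"
    by (rule L.pres_lift_additive[OF H g rel])
  show "pres_lift H ?g (cl X m \<phi>) = g X m \<phi>"
    if "X \<in> LOb A" "m \<in> carrier (W X)" "\<phi> \<in> dual B (W X)"
    unfolding coend_class_def using L.pres_lift_class[OF H g rel, of "(X, m, \<phi>)"] that
    by (simp add: coend_gens_def)
qed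

lemma cl_additive_left:
  "\<lbrakk>X \<in> LOb A; \<phi> \<in> dual B (W X)\<rbrakk> \<Longrightarrow> (\<lambda>m. cl X m \<phi>) \<in> additive (W X) L"
  by (intro additiveI cl_closed cl_add_left)

lemma L_induct [consumes 1, case_names cl zero add]:
  assumes "l \<in> carrier L"
    and cl: "\<And>X m \<phi>. \<lbrakk>X \<in> LOb A; m \<in> carrier (W X); \<phi> \<in> dual B (W X)\<rbrakk> \<Longrightarrow> P (cl X m \<phi>)"
    and zero: "P \<zero>\<^bsub>L\<^esub>"
    and add: "\<And>k l. \<lbrakk>k \<in> carrier L; l \<in> carrier L; P k; P l\<rbrakk> \<Longrightarrow> P (k \<oplus>\<^bsub>L\<^esub> l)"
  shows "P l"
proof -
  have neg: "\<ominus>\<^bsub>L\<^esub> cl X m \<phi> = cl X (\<ominus>\<^bsub>W X\<^esub> m) \<phi>"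
    if "X \<in> LOb A" "m \<in> carrier (W X)" "\<phi> \<in> dual B (W X)" for X m \<phi>
    using additive_inv[OF W_abelian_group L.abelian_group cl_additive_left] that by simp
  have "P l \<and> P (\<ominus>\<^bsub>L\<^esub> l)" using assms(1)
  proof (induction rule: L.induct)
    case (gen s)
    then obtain X m \<phi> where s: "s = (X, m, \<phi>)" "X \<in> LOb A" "m \<in> carrier (W X)" "\<phi> \<in> dual B (W X)"
      by (auto simp: coend_gens_def)
    have "pres_class (coend_gens B A w) (coend_rels R B A w) s = cl X m \<phi>"
      by (simp add: coend_class_def s)
    moreover have "\<ominus>\<^bsub>W X\<^esub> m \<in> carrier (W X)"
      using s abelian_group.a_inv_closed[OF W_abelian_group] by blast
    ultimately show ?case using cl neg s by simp
  next
    case zero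
    have neg_zero: "\<ominus>\<^bsub>L\<^esub> \<zero>\<^bsub>L\<^esub> = \<zero>\<^bsub>L\<^esub>"
      by (rule L.minus_equality) (rule L.l_zero L.zero_closed)+
    show ?case using assms(3) by (simp add: neg_zero)
  next
    case (add x y)
    then show ?case using assms(4) by (simp add: L.minus_add)
  qed simp
  then show ?thesis ..
qed

lemma L_eqI:
  assumes H: "abelian_group H" and f: "f \<in> additive L H" and g: "g \<in> additive L H"
    and "\<And>X m \<phi>. \<lbrakk>X \<in> LOb A; m \<in> carrier (W X); \<phi> \<in> dual B (W X)\<rbrakk> \<Longrightarrow> f (cl X m \<phi>) = g (cl X m \<phi>)"
    and "l \<in> carrier L"
  shows "f l = g l"
  using assms(5)
  by (induction rule: L_induct)
    (auto simp: assms(4) additive_add[OF f] additive_add[OF g] additive_zero[OF L.abelian_group H f]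
      additive_zero[OF L.abelian_group H g])

text \<open>Left multiplication acts on the factor w(X), right multiplication on the functional. The
  first respects dinaturality because w(f) is \<open>B\<close>-linear, the second because
  multiplying values on the right commutes with precomposition. As for the tensor product, the lifts
  are taken into the bare group \<open>pres_group\<close>.\<close>

lemma coend_smult:
  assumes b: "b \<in> carrier B"
  shows coend_smult_additive: "(\<lambda>l. b \<odot>\<^bsub>L\<^esub> l) \<in> additive L L"
    and coend_smult_cl: "\<lbrakk>X \<in> LOb A; m \<in> carrier (W X); \<phi> \<in> dual B (W X)\<rbrakk>
      \<Longrightarrow> b \<odot>\<^bsub>L\<^esub> cl X m \<phi> = cl X (b \<odot>\<^bsub>W X\<^esub> m) \<phi>"
    and coend_rsmult_additive: "(\<lambda>l. rsmult L l b) \<in> additive L L"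
    and coend_rsmult_cl: "\<lbrakk>X \<in> LOb A; m \<in> carrier (W X); \<phi> \<in> dual B (W X)\<rbrakk>
      \<Longrightarrow> rsmult L (cl X m \<phi>) b = cl X m (dual_rmult X \<phi> b)"
proof -
  let ?G = "pres_group (coend_gens B A w) (coend_rels R B A w)"
  interpret G: presentation "coend_gens B A w" "coend_rels R B A w" ?G
    by (rule presentation_pres_group[OF coend_rels_in_free])
  have eq: "carrier L = carrier ?G" "add L = add ?G"
    by (simp_all add: coend_bimodule_def Let_def)
  have sm: "smult L b = pres_lift ?G (\<lambda>(X, m, \<phi>). cl X (b \<odot>\<^bsub>W X\<^esub> m) \<phi>)"
    by (simp add: coend_bimodule_def Let_def)
  have rs: "(\<lambda>l. rsmult L l b) = pres_lift ?G (\<lambda>(X, m, \<phi>). cl X m (dual_rmult X \<phi> b))"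
    by (simp add: coend_bimodule_def Let_def dual_rmult_def)
  have sm_dinat: "cl Y (b \<odot>\<^bsub>W Y\<^esub> far w X Y f m) \<phi>
      = cl X (b \<odot>\<^bsub>W X\<^esub> m) (compose (carrier (W X)) \<phi> (far w X Y f))"
    if "X \<in> LOb A" "Y \<in> LOb A" "f \<in> carrier (LHom A X Y)" "m \<in> carrier (W X)" "\<phi> \<in> dual B (W Y)"
    for X Y f m \<phi>
    using cl_dinatural[of X Y f "b \<odot>\<^bsub>W X\<^esub> m" \<phi>] that b mod_hom_smult[OF far_hom, of X Y f b m]
    by (simp add: W_smult_closed)
  have rs_dinat: "cl Y (far w X Y f m) (dual_rmult Y \<phi> b)
      = cl X m (dual_rmult X (compose (carrier (W X)) \<phi> (far w X Y f)) b)"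
    if "X \<in> LOb A" "Y \<in> LOb A" "f \<in> carrier (LHom A X Y)" "m \<in> carrier (W X)" "\<phi> \<in> dual B (W Y)"
    for X Y f m \<phi>
  proof -
    have "compose (carrier (W X)) (dual_rmult Y \<phi> b) (far w X Y f)
        = dual_rmult X (compose (carrier (W X)) \<phi> (far w X Y f)) b"
      using that by (auto simp: compose_def dual_rmult_def fun_eq_iff far_W_closed)
    then show ?thesis
      using cl_dinatural[of X Y f m "dual_rmult Y \<phi> b"] that b by (simp add: dual_rmult_closed)
  qed
  have sm_add: "cl X (b \<odot>\<^bsub>W X\<^esub> (m \<oplus>\<^bsub>W X\<^esub> n)) \<phi> = cl X (b \<odot>\<^bsub>W X\<^esub> m) \<phi> \<oplus>\<^bsub>L\<^esub> cl X (b \<odot>\<^bsub>W X\<^esub> n) \<phi>"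
    if "X \<in> LOb A" "m \<in> carrier (W X)" "n \<in> carrier (W X)" "\<phi> \<in> dual B (W X)" for X m n \<phi>
    using that b by (simp add: left_module.smult_r_distr[OF W_module] cl_add_left W_smult_closed)
  have rs_add: "cl X m (dual_rmult X (\<lambda>x\<in>carrier (W X). \<phi> x \<oplus>\<^bsub>B\<^esub> \<psi> x) b)
      = cl X m (dual_rmult X \<phi> b) \<oplus>\<^bsub>L\<^esub> cl X m (dual_rmult X \<psi> b)"
    if "X \<in> LOb A" "m \<in> carrier (W X)" "\<phi> \<in> dual B (W X)" "\<psi> \<in> dual B (W X)" for X m \<phi> \<psi>
  proof -
    have "dual_rmult X (\<lambda>x\<in>carrier (W X). \<phi> x \<oplus>\<^bsub>B\<^esub> \<psi> x) b
        = (\<lambda>x\<in>carrier (W X). dual_rmult X \<phi> b x \<oplus>\<^bsub>B\<^esub> dual_rmult X \<psi> b x)"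
      using b by (auto simp: dual_rmult_def fun_eq_iff Balg.l_distr dualD[OF that(3)] dualD[OF that(4)])
    then show ?thesis using that b by (simp add: cl_add_right dual_rmult_closed)
  qed
  have "pres_lift ?G (\<lambda>(X, m, \<phi>). cl X (b \<odot>\<^bsub>W X\<^esub> m) \<phi>) \<in> additive L ?G"
    by (rule coend_lift_additive[OF G.abelian_group], fold eq)
      (use b in \<open>auto simp: cl_closed W_smult_closed sm_add sm_dinat cl_add_right\<close>)
  then show "(\<lambda>l. b \<odot>\<^bsub>L\<^esub> l) \<in> additive L L"
    using additive_cong_ring[OF refl refl eq, of L] by (simp add: sm)
  show "b \<odot>\<^bsub>L\<^esub> cl X m \<phi> = cl X (b \<odot>\<^bsub>W X\<^esub> m) \<phi>"
    if "X \<in> LOb A" "m \<in> carrier (W X)" "\<phi> \<in> dual B (W X)" unfolding sm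
    by (rule coend_lift_cl[OF G.abelian_group], fold eq)
      (use b that in \<open>auto simp: cl_closed W_smult_closed sm_add sm_dinat cl_add_right\<close>)
  have "pres_lift ?G (\<lambda>(X, m, \<phi>). cl X m (dual_rmult X \<phi> b)) \<in> additive L ?G"
    by (rule coend_lift_additive[OF G.abelian_group], fold eq)
      (use b in \<open>auto simp: cl_closed dual_rmult_closed rs_add rs_dinat cl_add_left\<close>)
  then show "(\<lambda>l. rsmult L l b) \<in> additive L L"
    using additive_cong_ring[OF refl refl eq, of L] by (simp add: rs)
  show "rsmult L (cl X m \<phi>) b = cl X m (dual_rmult X \<phi> b)"
    if "X \<in> LOb A" "m \<in> carrier (W X)" "\<phi> \<in> dual B (W X)"
    unfolding rs[THEN fun_cong]
    by (rule coend_lift_cl[OF G.abelian_group], fold eq)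
      (use b that in \<open>auto simp: cl_closed dual_rmult_closed rs_add rs_dinat cl_add_left\<close>)
qed

lemma bimod_L: "bimod B L"
proof (intro bimod.intro left_module.intro left_module_axioms.intro bimod_axioms.intro)
  show "ring B" by (rule ring_B)
  show "Ring.abelian_group L" by (rule L.abelian_group)
  show cl: "b \<odot>\<^bsub>L\<^esub> l \<in> carrier L" if "b \<in> carrier B" "l \<in> carrier L" for b l
    using additive_closed[OF coend_smult_additive] that by blast
  show dist: "b \<odot>\<^bsub>L\<^esub> (k \<oplus>\<^bsub>L\<^esub> l) = b \<odot>\<^bsub>L\<^esub> k \<oplus>\<^bsub>L\<^esub> b \<odot>\<^bsub>L\<^esub> l"
    if "b \<in> carrier B" "k \<in> carrier L" "l \<in> carrier L" for b k l
    using additive_add[OF coend_smult_additive] that by blast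
  have zero: "b \<odot>\<^bsub>L\<^esub> \<zero>\<^bsub>L\<^esub> = \<zero>\<^bsub>L\<^esub>" if "b \<in> carrier B" for b
    using additive_zero[OF L.abelian_group L.abelian_group coend_smult_additive[OF that]] .
  have rzero: "rsmult L \<zero>\<^bsub>L\<^esub> b = \<zero>\<^bsub>L\<^esub>" if "b \<in> carrier B" for b
    using additive_zero[OF L.abelian_group L.abelian_group coend_rsmult_additive[OF that]] .
  have rdist: "rsmult L (k \<oplus>\<^bsub>L\<^esub> l) b = rsmult L k b \<oplus>\<^bsub>L\<^esub> rsmult L l b"
    if "b \<in> carrier B" "k \<in> carrier L" "l \<in> carrier L" for b k l
    using additive_add[OF coend_rsmult_additive] that by blast
  show rcl: "rsmult L l b \<in> carrier L" if "l \<in> carrier L" "b \<in> carrier B" for b l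
    using additive_closed[OF coend_rsmult_additive] that by blast
  show "(b \<oplus>\<^bsub>B\<^esub> c) \<odot>\<^bsub>L\<^esub> l = b \<odot>\<^bsub>L\<^esub> l \<oplus>\<^bsub>L\<^esub> c \<odot>\<^bsub>L\<^esub> l"
    if bc: "b \<in> carrier B" "c \<in> carrier B" and "l \<in> carrier L" for b c l
    using that(3)
  proof (induction rule: L_induct)
    case (cl X m \<phi>)
    then show ?case using bc
      by (simp add: coend_smult_cl left_module.smult_l_distr[OF W_module] cl_add_left W_smult_closed)
  next
    case (add s t)
    then show ?case using bc by (simp add: dist cl L.a_ac)
  qed (use bc zero in simp)
  show "(b \<otimes>\<^bsub>B\<^esub> c) \<odot>\<^bsub>L\<^esub> l = b \<odot>\<^bsub>L\<^esub> (c \<odot>\<^bsub>L\<^esub> l)"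
    if bc: "b \<in> carrier B" "c \<in> carrier B" and "l \<in> carrier L" for b c l
    using that(3)
    by (induction rule: L_induct)
      (use bc in \<open>auto simp: coend_smult_cl left_module.smult_assoc[OF W_module] W_smult_closed dist cl zero\<close>)
  show "\<one>\<^bsub>B\<^esub> \<odot>\<^bsub>L\<^esub> l = l" if "l \<in> carrier L" for l
    using that by (induction rule: L_induct)
      (auto simp: coend_smult_cl left_module.smult_one[OF W_module] dist zero)
  show "rsmult L (b \<odot>\<^bsub>L\<^esub> l) c = b \<odot>\<^bsub>L\<^esub> rsmult L l c"
    if bc: "b \<in> carrier B" "c \<in> carrier B" and "l \<in> carrier L" for b c l
    using that(3)
    by (induction rule: L_induct)
      (use bc in \<open>auto simp: coend_smult_cl coend_rsmult_cl dual_rmult_closed W_smult_closed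
        dist cl rcl rdist zero rzero\<close>)
qed

sublocale bimod B L by (rule bimod_L)

end

section \<open>Elements of the tensor product as homomorphisms at elements\<close>

definition hom_sum :: "('b, 'm, 'z) module_scheme \<Rightarrow> ('b, 'n, 'v) module_scheme \<Rightarrow>
    'i set \<Rightarrow> ('i \<Rightarrow> 'm \<Rightarrow> 'n) \<Rightarrow> 'm \<Rightarrow> 'n" where
  "hom_sum M N I k = (\<lambda>x\<in>carrier M. \<Oplus>\<^bsub>N\<^esub>i\<in>I. k i x)"

lemma hom_sum_empty: "left_module B N \<Longrightarrow> hom_sum M N {} k = hom_zero M N"
proof -
  assume "left_module B N"
  then interpret N: left_module B N .
  show ?thesis by (simp add: hom_sum_def hom_zero_def restrict_def)
qed

lemma hom_sum_insert:
  assumes N: "left_module B N" and "finite I" "i \<notin> I" "\<And>j. j \<in> insert i I \<Longrightarrow> k j \<in> mod_hom B M N"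
  shows "hom_sum M N (insert i I) k = hom_add M N (k i) (hom_sum M N I k)"
proof -
  interpret N: left_module B N by fact
  show ?thesis
  proof
    fix x
    show "hom_sum M N (insert i I) k x = hom_add M N (k i) (hom_sum M N I k) x"
    proof (cases "x \<in> carrier M")
      case True
      have "(\<lambda>j. k j x) \<in> I \<rightarrow> carrier N" "k i x \<in> carrier N"
        using assms(4) True by (auto intro: mod_hom_closed)
      then show ?thesis using True assms(2,3) by (simp add: hom_sum_def hom_add_def)
    qed (simp add: hom_sum_def hom_add_def)
  qed
qed

lemma mod_hom_hom_sum:
  assumes "left_module B M" "left_module B N" "finite I" "\<And>i. i \<in> I \<Longrightarrow> k i \<in> mod_hom B M N"
  shows "hom_sum M N I k \<in> mod_hom B M N"
  using assms(3,4)
proof (induction I)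
  case empty
  show ?case using mod_hom_hom_zero[OF assms(1,2)] by (simp add: hom_sum_empty[OF assms(2)])
next
  case (insert i I)
  then show ?case
    by (subst hom_sum_insert[OF assms(2)]) (auto intro: mod_hom_hom_add[OF assms(1,2)])
qed

text \<open>\<open>F\<close> is given on homomorphisms only through \<open>hom_add\<close>, so its
  compatibility with finite sums is proved by induction. The empty sum is handled by cancellation:
  the value at the zero map is equal to its own double.\<close>

lemma hom_sum_map:
  assumes M: "left_module B M" and N: "left_module B N" and H: "abelian_group H"
    and closed: "\<And>h. h \<in> mod_hom B M N \<Longrightarrow> F h \<in> carrier H"
    and add: "\<And>h k. \<lbrakk>h \<in> mod_hom B M N; k \<in> mod_hom B M N\<rbrakk> \<Longrightarrow> F (hom_add M N h k) = F h \<oplus>\<^bsub>H\<^esub> F k"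
    and "finite I" "\<And>i. i \<in> I \<Longrightarrow> k i \<in> mod_hom B M N"
  shows "F (hom_sum M N I k) = (\<Oplus>\<^bsub>H\<^esub>i\<in>I. F (k i))"
  using assms(6,7)
proof (induction I)
  case empty
  interpret N: left_module B N by fact
  interpret H: abelian_group H by fact
  have z: "hom_zero M N \<in> mod_hom B M N" by (rule mod_hom_hom_zero[OF M N])
  have "hom_add M N (hom_zero M N) (hom_zero M N) = hom_zero M N"
    by (auto simp: hom_add_def hom_zero_def)
  then have "F (hom_zero M N) \<oplus>\<^bsub>H\<^esub> F (hom_zero M N) = F (hom_zero M N) \<oplus>\<^bsub>H\<^esub> \<zero>\<^bsub>H\<^esub>"
    using add[OF z z] closed[OF z] by simp
  then have "F (hom_zero M N) = \<zero>\<^bsub>H\<^esub>" using closed[OF z] by simp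
  then show ?case by (simp add: hom_sum_empty[OF N])
next
  case (insert i I)
  interpret H: abelian_group H by fact
  have "F (hom_sum M N (insert i I) k) = F (k i) \<oplus>\<^bsub>H\<^esub> F (hom_sum M N I k)"
    using insert by (subst hom_sum_insert[OF N]) (auto simp: add mod_hom_hom_sum[OF M N])
  then show ?case using insert closed by (simp add: Pi_def)
qed

text \<open>The rank one maps span: this is the surjectivity half of the identification of Hom(M, N)
  with the dual of M tensored with N.\<close>

lemma hom_sum_dual_basis:
  assumes M: "left_module B M" and N: "left_module B N" and db: "is_dual_basis B M (n, e, d)"
    and h: "h \<in> mod_hom B M N"
  shows "hom_sum M N {..<n} (\<lambda>i. rank_one M N (d i) (h (e i))) = h"
proof (rule mod_hom_eqI[OF mod_hom_hom_sum[OF M N] h])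
  fix x assume x: "x \<in> carrier M"
  then show "hom_sum M N {..<n} (\<lambda>i. rank_one M N (d i) (h (e i))) x = h x"
    using dual_basis_hom_expand[OF M N db h x] by (simp add: hom_sum_def rank_one_def)
next
  fix i assume "i \<in> {..<n}"
  then show "rank_one M N (d i) (h (e i)) \<in> mod_hom B M N"
    using is_dual_basisD[OF db] by (intro mod_hom_rank_one[OF M N]) (auto intro: mod_hom_closed[OF h])
qed simp

context fibre_functor
begin

abbreviation "T M \<equiv> tensor B L M"

definition bas_n where "bas_n X = fst (dual_basis B (W X))"
definition bas_e where "bas_e X = fst (snd (dual_basis B (W X)))"
definition bas_d where "bas_d X = snd (snd (dual_basis B (W X)))"

lemma dual_basis_eq: "dual_basis B (W X) = (bas_n X, bas_e X, bas_d X)"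
  by (simp add: bas_n_def bas_e_def bas_d_def)

lemma is_dual_basis_bas: "X \<in> LOb A \<Longrightarrow> is_dual_basis B (W X) (bas_n X, bas_e X, bas_d X)"
  using someI_ex[OF fg_projective_dual_basis[OF fgp]]
  by (simp add: dual_basis_eq[symmetric] dual_basis_def)

lemma bas_e_closed: "\<lbrakk>X \<in> LOb A; i < bas_n X\<rbrakk> \<Longrightarrow> bas_e X i \<in> carrier (W X)"
  using is_dual_basisD(1)[OF is_dual_basis_bas] .

lemma bas_d_dual: "\<lbrakk>X \<in> LOb A; i < bas_n X\<rbrakk> \<Longrightarrow> bas_d X i \<in> dual B (W X)"
  using is_dual_basisD(2)[OF is_dual_basis_bas] .

text \<open>After identifying Hom(w(X), M) with the dual of w(X) tensored with M, this is the
  structure map of \<open>L\<close> \<otimes> M, viewed as a coend, at the object X.\<close>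

definition theta :: "('b, 'n, 'v) module_scheme \<Rightarrow> 'o \<Rightarrow> 'm \<Rightarrow> ('m \<Rightarrow> 'n) \<Rightarrow>
    (('o, 'b, 'm) coend_elt \<times> 'n \<Rightarrow>\<^sub>0 int) set" where
  "theta M X x h = (\<Oplus>\<^bsub>T M\<^esub>i\<in>{..<bas_n X}. tens B L M (cl X x (bas_d X i)) (h (bas_e X i)))"

lemma tensor_productI': "left_module B M \<Longrightarrow> tensor_product B L M"
  by (rule tensor_productI[OF bimod_L])

lemma T_module: "left_module B M \<Longrightarrow> left_module B (T M)"
  by (rule tensor_product.left_module_tensor[OF tensor_productI'])

lemma T_abelian_group: "left_module B M \<Longrightarrow> abelian_group (T M)"
  by (rule left_module.abelian_group[OF T_module])

lemma theta_term_closed: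
  assumes "left_module B M" "X \<in> LOb A" "x \<in> carrier (W X)" "h \<in> mod_hom B (W X) M" "i < bas_n X"
  shows "tens B L M (cl X x (bas_d X i)) (h (bas_e X i)) \<in> carrier (T M)"
  using assms
  by (intro tensor_product.tens_closed[OF tensor_productI'] cl_closed mod_hom_closed[OF assms(4)]
      bas_e_closed bas_d_dual)

lemma theta_closed:
  assumes "left_module B M" "X \<in> LOb A" "x \<in> carrier (W X)" "h \<in> mod_hom B (W X) M"
  shows "theta M X x h \<in> carrier (T M)"
  unfolding theta_def
  using theta_term_closed[OF assms] T_abelian_group[OF assms(1)]
  by (intro abelian_monoid.finsum_closed abelian_group.axioms(1)) auto

lemma theta_add_left:
  assumes M: "left_module B M" and X: "X \<in> LOb A" "x \<in> carrier (W X)" "y \<in> carrier (W X)"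
    and h: "h \<in> mod_hom B (W X) M"
  shows "theta M X (x \<oplus>\<^bsub>W X\<^esub> y) h = theta M X x h \<oplus>\<^bsub>T M\<^esub> theta M X y h"
proof -
  interpret M: tensor_product B L M by (rule tensor_productI'[OF M])
  have "theta M X (x \<oplus>\<^bsub>W X\<^esub> y) h
      = (\<Oplus>\<^bsub>T M\<^esub>i\<in>{..<bas_n X}. tens B L M (cl X x (bas_d X i)) (h (bas_e X i))
          \<oplus>\<^bsub>T M\<^esub> tens B L M (cl X y (bas_d X i)) (h (bas_e X i)))"
    unfolding theta_def using assms
    by (intro M.T.finsum_cong')
      (auto simp: cl_add_left bas_d_dual cl_closed additive_add[OF M.tens_additive_left]
        mod_hom_closed[OF h] bas_e_closed intro!: M.T.a_closed theta_term_closed)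
  also have "\<dots> = theta M X x h \<oplus>\<^bsub>T M\<^esub> theta M X y h"
    unfolding theta_def using assms by (intro M.T.finsum_addf) (auto intro: theta_term_closed)
  finally show ?thesis .
qed

lemma theta_hom_add:
  assumes M: "left_module B M" and X: "X \<in> LOb A" "x \<in> carrier (W X)"
    and h: "h \<in> mod_hom B (W X) M" and k: "k \<in> mod_hom B (W X) M"
  shows "theta M X x (hom_add (W X) M h k) = theta M X x h \<oplus>\<^bsub>T M\<^esub> theta M X x k"
proof -
  interpret M: tensor_product B L M by (rule tensor_productI'[OF M])
  have "theta M X x (hom_add (W X) M h k)
      = (\<Oplus>\<^bsub>T M\<^esub>i\<in>{..<bas_n X}. tens B L M (cl X x (bas_d X i)) (h (bas_e X i))
          \<oplus>\<^bsub>T M\<^esub> tens B L M (cl X x (bas_d X i)) (k (bas_e X i)))"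
    unfolding theta_def using assms
    by (intro M.T.finsum_cong')
      (auto simp: bas_d_dual cl_closed additive_add[OF M.tens_additive_right] hom_add_def
        mod_hom_closed[OF h] mod_hom_closed[OF k] bas_e_closed intro!: M.T.a_closed theta_term_closed)
  also have "\<dots> = theta M X x h \<oplus>\<^bsub>T M\<^esub> theta M X x k"
    unfolding theta_def using assms by (intro M.T.finsum_addf) (auto intro: theta_term_closed)
  finally show ?thesis .
qed

lemma theta_hom_sum:
  assumes M: "left_module B M" and X: "X \<in> LOb A" "x \<in> carrier (W X)"
    and "finite I" "\<And>i. i \<in> I \<Longrightarrow> k i \<in> mod_hom B (W X) M"
  shows "theta M X x (hom_sum (W X) M I k) = (\<Oplus>\<^bsub>T M\<^esub>i\<in>I. theta M X x (k i))"
  by (rule hom_sum_map[OF W_module[OF X(1)] M T_abelian_group[OF M], where F = "theta M X x"])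
    (use assms in \<open>simp_all add: theta_closed theta_hom_add\<close>)

lemma theta_zero:
  assumes M: "left_module B M" and X: "X \<in> LOb A" "x \<in> carrier (W X)"
  shows "theta M X x (hom_zero (W X) M) = \<zero>\<^bsub>T M\<^esub>"
proof -
  interpret TM: left_module B "T M" by (rule T_module[OF M])
  interpret M: left_module B M by (rule M)
  show ?thesis
    using theta_hom_sum[OF M X, of "{}" "\<lambda>_. undefined"] by (simp add: hom_sum_empty[OF M])
qed

lemma theta_hom_minus:
  assumes M: "left_module B M" and X: "X \<in> LOb A" "x \<in> carrier (W X)"
    and h: "h \<in> mod_hom B (W X) M" and k: "k \<in> mod_hom B (W X) M"
  shows "theta M X x (hom_minus (W X) M h k) = theta M X x h \<ominus>\<^bsub>T M\<^esub> theta M X x k"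
proof -
  interpret TM: left_module B "T M" by (rule T_module[OF M])
  interpret M: left_module B M by (rule M)
  note W = W_module[OF X(1)]
  have m: "hom_minus (W X) M h k \<in> mod_hom B (W X) M" by (rule mod_hom_hom_minus[OF W M h k])
  have "hom_add (W X) M (hom_minus (W X) M h k) k = h"
  proof (rule mod_hom_eqI[OF mod_hom_hom_add[OF W M m k] h])
    fix y assume "y \<in> carrier (W X)"
    then show "hom_add (W X) M (hom_minus (W X) M h k) k y = h y"
      by (simp add: hom_add_def hom_minus_def a_minus_def M.M.a_assoc M.M.l_neg
          mod_hom_closed[OF h] mod_hom_closed[OF k])
  qed
  then have "theta M X x h = theta M X x (hom_minus (W X) M h k) \<oplus>\<^bsub>T M\<^esub> theta M X x k"
    using theta_hom_add[OF M X m k] by simp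
  then show ?thesis
    using theta_closed[OF M X m] theta_closed[OF M X k]
    by (simp add: a_minus_def TM.M.a_assoc TM.M.r_neg)
qed

text \<open>The functional is expanded as the sum of the products of the d i with \<phi>(e i), and
  these scalars are moved across the tensor sign onto m. Since \<phi> is arbitrary here, the choice
  of dual basis in \<open>theta\<close> ceases to matter.\<close>

lemma tens_cl_eq_theta:
  assumes M: "left_module B M" and X: "X \<in> LOb A" "x \<in> carrier (W X)"
    and \<phi>: "\<phi> \<in> dual B (W X)" and m: "m \<in> carrier M"
  shows "tens B L M (cl X x \<phi>) m = theta M X x (rank_one (W X) M \<phi> m)"
proof -
  interpret M: tensor_product B L M by (rule tensor_productI'[OF M])
  note W = W_module[OF X(1)] and lr = left_module_left_regular[OF ring_B]
  let ?e = "bas_e X" and ?d = "bas_d X" and ?I = "{..<bas_n X}"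
  have \<phi>e: "\<phi> (?e i) \<in> carrier B" if "i < bas_n X" for i
    using dual_closed[OF \<phi> bas_e_closed[OF X(1) that]] .
  have r: "rank_one (W X) (left_regular B) (?d i) (\<phi> (?e i)) = dual_rmult X (?d i) (\<phi> (?e i))" for i
    by (simp add: rank_one_def dual_rmult_def)
  have "cl X x \<phi> = cl X x (hom_sum (W X) (left_regular B) ?I (\<lambda>i. dual_rmult X (?d i) (\<phi> (?e i))))"
    using hom_sum_dual_basis[OF W lr is_dual_basis_bas[OF X(1)] \<phi>[unfolded dual_def]]
    by (simp add: r)
  also have "\<dots> = (\<Oplus>\<^bsub>L\<^esub>i\<in>?I. cl X x (dual_rmult X (?d i) (\<phi> (?e i))))"
    by (rule hom_sum_map[OF W lr L.abelian_group, where F = "cl X x"])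
      (use X \<phi>e in \<open>auto simp: dual_def[symmetric] hom_add_def cl_add_right cl_closed
        dual_rmult_closed bas_d_dual\<close>)
  finally have "tens B L M (cl X x \<phi>) m
      = (\<Oplus>\<^bsub>T M\<^esub>i\<in>?I. tens B L M (cl X x (dual_rmult X (?d i) (\<phi> (?e i)))) m)"
    using additive_finsum[OF L.abelian_group M.T.abelian_group M.tens_additive_left[OF m],
        of "\<lambda>i. cl X x (dual_rmult X (?d i) (\<phi> (?e i)))" ?I] X \<phi>e
    by (simp add: Pi_def cl_closed dual_rmult_closed bas_d_dual)
  also have "\<dots> = theta M X x (rank_one (W X) M \<phi> m)"
    unfolding theta_def
  proof (rule M.T.finsum_cong')
    fix i assume "i \<in> ?I"
    then have i: "i < bas_n X" by simp
    have "tens B L M (cl X x (dual_rmult X (?d i) (\<phi> (?e i)))) m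
        = tens B L M (rsmult L (cl X x (?d i)) (\<phi> (?e i))) m"
      by (simp add: coend_rsmult_cl \<phi>e i X bas_d_dual)
    also have "\<dots> = tens B L M (cl X x (?d i)) (\<phi> (?e i) \<odot>\<^bsub>M\<^esub> m)"
      using i X m \<phi>e by (simp add: M.tens_balanced cl_closed bas_d_dual)
    finally show "tens B L M (cl X x (dual_rmult X (?d i) (\<phi> (?e i)))) m
        = tens B L M (cl X x (?d i)) (rank_one (W X) M \<phi> m (?e i))"
      using i X by (simp add: rank_one_def bas_e_closed)
  qed (use mod_hom_rank_one[OF W M \<phi> m] in \<open>auto intro: theta_term_closed[OF M X]\<close>)
  finally show ?thesis .
qed

text \<open>The dual basis of w(Y) expands h after w(f) into rank one maps with functionals (d i)
  after w(f). These need not belong to the chosen dual basis of w(X), which is why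
  \<open>tens_cl_eq_theta\<close> is stated for all functionals; what remains is dinaturality of the
  coend classes.\<close>

lemma theta_dinatural:
  assumes M: "left_module B M" and X: "X \<in> LOb A" "x \<in> carrier (W X)" and Y: "Y \<in> LOb A"
    and f: "f \<in> carrier (LHom A X Y)" and h: "h \<in> mod_hom B (W Y) M"
  shows "theta M Y (far w X Y f x) h = theta M X x (compose (carrier (W X)) h (far w X Y f))"
proof -
  interpret M: tensor_product B L M by (rule tensor_productI'[OF M])
  note WX = W_module[OF X(1)] and WY = W_module[OF Y]
  let ?e = "bas_e Y" and ?d = "bas_d Y" and ?I = "{..<bas_n Y}"
  let ?c = "\<lambda>\<phi>. compose (carrier (W X)) \<phi> (far w X Y f)"
  note hf = mod_hom_comp[OF WX far_hom[OF X(1) Y f] h]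
  have r: "rank_one (W X) M (?c (?d i)) (h (?e i)) \<in> mod_hom B (W X) M" if "i < bas_n Y" for i
    using that Y X f by (intro mod_hom_rank_one[OF WX M] dual_compose bas_d_dual mod_hom_closed[OF h] bas_e_closed)
  have "theta M Y (far w X Y f x) h
     = (\<Oplus>\<^bsub>T M\<^esub>i\<in>?I. theta M X x (rank_one (W X) M (?c (?d i)) (h (?e i))))"
    unfolding theta_def[of M Y]
  proof (rule M.T.finsum_cong')
    fix i assume "i \<in> ?I"
    then have i: "i < bas_n Y" by simp
    show "tens B L M (cl Y (far w X Y f x) (?d i)) (h (?e i))
        = theta M X x (rank_one (W X) M (?c (?d i)) (h (?e i)))"
      using i X Y f by (simp add: cl_dinatural bas_d_dual tens_cl_eq_theta[OF M X] dual_compose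
          mod_hom_closed[OF h] bas_e_closed)
  qed (use r theta_closed[OF M X] in auto)
  also have "\<dots> = theta M X x (hom_sum (W X) M ?I (\<lambda>i. rank_one (W X) M (?c (?d i)) (h (?e i))))"
    by (rule theta_hom_sum[symmetric, OF M X]) (use r in auto)
  also have "hom_sum (W X) M ?I (\<lambda>i. rank_one (W X) M (?c (?d i)) (h (?e i))) = ?c h"
  proof (rule mod_hom_eqI[OF mod_hom_hom_sum[OF WX M] hf])
    fix y assume y: "y \<in> carrier (W X)"
    then show "hom_sum (W X) M ?I (\<lambda>i. rank_one (W X) M (?c (?d i)) (h (?e i))) y = ?c h y"
      using dual_basis_hom_expand[OF WY M is_dual_basis_bas[OF Y] h far_W_closed[OF X(1) Y f y]]
      by (simp add: hom_sum_def rank_one_def compose_def)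
  qed (use r in auto)
  finally show ?thesis .
qed

lemma theta_smult:
  assumes M: "left_module B M" and X: "X \<in> LOb A" "x \<in> carrier (W X)"
    and h: "h \<in> mod_hom B (W X) M" and b: "b \<in> carrier B"
  shows "b \<odot>\<^bsub>T M\<^esub> theta M X x h = theta M X (b \<odot>\<^bsub>W X\<^esub> x) h"
proof -
  interpret M: tensor_product B L M by (rule tensor_productI'[OF M])
  interpret TM: left_module B "T M" by (rule T_module[OF M])
  have "b \<odot>\<^bsub>T M\<^esub> theta M X x h
     = (\<Oplus>\<^bsub>T M\<^esub>i\<in>{..<bas_n X}. b \<odot>\<^bsub>T M\<^esub> tens B L M (cl X x (bas_d X i)) (h (bas_e X i)))"
    unfolding theta_def by (rule TM.smult_finsum) (use assms in \<open>auto intro: theta_term_closed\<close>)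
  also have "\<dots> = theta M X (b \<odot>\<^bsub>W X\<^esub> x) h"
    unfolding theta_def using assms
    by (intro M.T.finsum_cong')
      (auto simp: M.smult_tens cl_closed bas_d_dual bas_e_closed mod_hom_closed[OF h] coend_smult_cl
        intro!: theta_term_closed W_smult_closed)
  finally show ?thesis .
qed

lemma tensor_map_theta:
  assumes M: "left_module B M" and N: "left_module B N" and k: "k \<in> mod_hom B M N"
    and X: "X \<in> LOb A" "x \<in> carrier (W X)" and h: "h \<in> mod_hom B (W X) M"
  shows "tensor_map B L M N k (theta M X x h) = theta N X x (compose (carrier (W X)) k h)"
proof -
  interpret N: tensor_product B L N by (rule tensor_productI'[OF N])
  note kh = mod_hom_comp[OF W_module[OF X(1)] h k]
  have "tensor_map B L M N k (theta M X x h)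
     = (\<Oplus>\<^bsub>T N\<^esub>i\<in>{..<bas_n X}. tensor_map B L M N k (tens B L M (cl X x (bas_d X i)) (h (bas_e X i))))"
    unfolding theta_def
    by (rule additive_finsum[OF T_abelian_group[OF M] N.T.abelian_group
          mod_hom_additive[OF tensor_map_hom[OF M N k]]])
      (use theta_term_closed[OF M X h] in auto)
  also have "\<dots> = theta N X x (compose (carrier (W X)) k h)"
    unfolding theta_def using theta_term_closed[OF N X kh] X
    by (intro N.T.finsum_cong')
      (auto simp: tensor_map_tens[OF M N k] cl_closed bas_d_dual mod_hom_closed[OF h] bas_e_closed compose_eq)
  finally show ?thesis .
qed

end

lemma (in abelian_group) free_ext_cong:
  assumes "\<And>t. t \<in> Poly_Mapping.keys u \<Longrightarrow> g t = g' t" "g' \<in> Poly_Mapping.keys u \<rightarrow> carrier G"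
  shows "free_ext G g u = free_ext G g' u"
  unfolding free_ext_def using assms by (intro finsum_cong') auto

section \<open>Cofiltered categories of elements\<close>

locale cofiltered_fibre_functor = fibre_functor R B A w
  for R :: "'r ring" and B :: "('r, 'b) module"
    and A :: "('o, 'a, 'r) lin_cat" and w :: "('o, 'a, 'b, 'm) fibre" +
  assumes cofiltered: "cofiltered (elements_cat A w)"
begin

section \<open>Common refinements of finitely many elements and arrows\<close>

definition elt :: "'o \<Rightarrow> 'm \<Rightarrow> bool" where "elt X x \<longleftrightarrow> X \<in> LOb A \<and> x \<in> carrier (W X)"

definition elt_arrow :: "'o \<Rightarrow> 'm \<Rightarrow> 'o \<Rightarrow> 'm \<Rightarrow> 'a \<Rightarrow> bool" where
  "elt_arrow X x Y y f \<longleftrightarrow> elt X x \<and> elt Y y \<and> f \<in> carrier (LHom A X Y) \<and> far w X Y f x = y"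

lemma elt_arrow_comp:
  "\<lbrakk>elt_arrow X x Y y f; elt_arrow Y y Z z g\<rbrakk> \<Longrightarrow> elt_arrow X x Z z (LCmp A X Y Z g f)"
  by (auto simp: elt_arrow_def elt_def LCmp_closed far_comp)

lemma elt_arrow_id: "elt X x \<Longrightarrow> elt_arrow X x X x (LIdn A X)"
  by (auto simp: elt_arrow_def elt_def LIdn_closed far_id)

lemma elt_nonempty: obtains X x where "elt X x"
  using cofiltered by (auto simp: cofiltered_def elements_cat_def elt_def)

lemma elt_span:
  assumes "elt X x" "elt Y y"
  obtains Z z f g where "elt_arrow Z z X x f" "elt_arrow Z z Y y g"
proof -
  have "\<exists>Z\<in>Ob (elements_cat A w). Ar (elements_cat A w) Z (X, x) \<noteq> {} \<and> Ar (elements_cat A w) Z (Y, y) \<noteq> {}"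
    using cofiltered assms by (simp add: cofiltered_def elements_cat_def elt_def)
  then show ?thesis
    using assms by (auto simp: elements_cat_def elt_arrow_def elt_def intro: that)
qed

lemma elt_equalize:
  assumes "elt_arrow X x Y y f" "elt_arrow X x Y y g"
  obtains Z z h where "elt_arrow Z z X x h" "LCmp A Z X Y f h = LCmp A Z X Y g h"
proof -
  let ?C = "elements_cat A w"
  have "(X, x) \<in> Ob ?C" "(Y, y) \<in> Ob ?C" "f \<in> Ar ?C (X, x) (Y, y)" "g \<in> Ar ?C (X, x) (Y, y)"
    using assms by (auto simp: elements_cat_def elt_arrow_def elt_def)
  then have "\<exists>Z\<in>Ob ?C. \<exists>h\<in>Ar ?C Z (X, x). Cmp ?C Z (X, x) (Y, y) f h = Cmp ?C Z (X, x) (Y, y) g h"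
    using cofiltered unfolding cofiltered_def by blast
  then show ?thesis
    using assms by (auto simp: elements_cat_def elt_arrow_def elt_def intro: that)
qed

lemma elt_cone:
  assumes "finite K" "\<And>t. t \<in> K \<Longrightarrow> elt (X t) (x t)"
  obtains Z z a where "elt Z z" "\<And>t. t \<in> K \<Longrightarrow> elt_arrow Z z (X t) (x t) (a t)"
  using assms
proof (induction K arbitrary: thesis)
  case empty
  then show ?case by (metis elt_nonempty empty_iff)
next
  case (insert s K)
  obtain Z z a where Z: "elt Z z" "\<And>t. t \<in> K \<Longrightarrow> elt_arrow Z z (X t) (x t) (a t)"
    using insert.IH insert.prems(2) by blast
  obtain Z' z' f g where f: "elt_arrow Z' z' Z z f" and g: "elt_arrow Z' z' (X s) (x s) g"
    using elt_span[OF Z(1) insert.prems(2)] by blast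
  show ?case
  proof (rule insert.prems(1))
    show "elt Z' z'" using f by (simp add: elt_arrow_def)
    show "elt_arrow Z' z' (X t) (x t) (if t = s then g else LCmp A Z' Z (X t) (a t) f)" if "t \<in> insert s K" for t
      using that g elt_arrow_comp[OF f Z(2)] by auto
  qed
qed

text \<open>The pairs are equalized one after the other; equalities already achieved survive
  precomposition with later arrows.\<close>

lemma elt_equalize_finite:
  assumes "finite K" "elt Z z"
    and "\<And>t. t \<in> K \<Longrightarrow> elt_arrow Z z (X t) (x t) (a t) \<and> elt_arrow Z z (X t) (x t) (a' t)"
  obtains Z' z' h where "elt_arrow Z' z' Z z h"
    "\<And>t. t \<in> K \<Longrightarrow> LCmp A Z' Z (X t) (a t) h = LCmp A Z' Z (X t) (a' t) h"
  using assms
proof (induction K arbitrary: thesis)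
  case empty
  then show ?case by (metis elt_arrow_id empty_iff)
next
  case (insert s K)
  obtain Z' z' h where h: "elt_arrow Z' z' Z z h"
    "\<And>t. t \<in> K \<Longrightarrow> LCmp A Z' Z (X t) (a t) h = LCmp A Z' Z (X t) (a' t) h"
    using insert.IH insert.prems(2,3) by (metis insertCI)
  have s: "elt_arrow Z z (X s) (x s) (a s)" "elt_arrow Z z (X s) (x s) (a' s)"
    using insert.prems(3) by auto
  obtain Z'' z'' k where k: "elt_arrow Z'' z'' Z' z' k"
    "LCmp A Z'' Z' (X s) (LCmp A Z' Z (X s) (a s) h) k = LCmp A Z'' Z' (X s) (LCmp A Z' Z (X s) (a' s) h) k"
    using elt_equalize[OF elt_arrow_comp[OF h(1) s(1)] elt_arrow_comp[OF h(1) s(2)]] by blast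
  have assoc: "LCmp A Z'' Z (X t) f (LCmp A Z'' Z' Z h k) = LCmp A Z'' Z' (X t) (LCmp A Z' Z (X t) f h) k"
    if "elt_arrow Z z (X t) (x t) f" for t f
    using A.Cmp_assoc[of Z'' Z' Z "X t" k h f] that h(1) k(1) by (simp add: elt_arrow_def elt_def)
  show ?case
  proof (rule insert.prems(1))
    show "elt_arrow Z'' z'' Z z (LCmp A Z'' Z' Z h k)"
      by (rule elt_arrow_comp[OF k(1) h(1)])
    show "LCmp A Z'' Z (X t) (a t) (LCmp A Z'' Z' Z h k) = LCmp A Z'' Z (X t) (a' t) (LCmp A Z'' Z' Z h k)"
      if "t \<in> insert s K" for t
      using that insert.prems(3)[OF that] k(2) h(2) by (auto simp: assoc)
  qed
qed

text \<open>The colimit of \<open>Hom(w(X), M)\<close> over the opposite of the category of elements, presented by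
  the triples \<open>(X, x, h)\<close> with \<open>h : w(X) \<rightarrow> M\<close>: a formal sum of triples is null when it has a
  common refinement on which the sum of the homomorphisms vanishes.\<close>

definition triples :: "('b, 'n, 'v) module_scheme \<Rightarrow> ('o \<times> 'm \<times> ('m \<Rightarrow> 'n)) set" where
  "triples M = {(X, x, h). elt X x \<and> h \<in> mod_hom B (W X) M}"

definition refines :: "'o \<Rightarrow> 'm \<Rightarrow> ('o \<times> 'm \<times> ('m \<Rightarrow> 'n)) set \<Rightarrow>
    ('o \<times> 'm \<times> ('m \<Rightarrow> 'n) \<Rightarrow> 'a) \<Rightarrow> bool" where
  "refines Z z K a \<longleftrightarrow> elt Z z \<and> (\<forall>t\<in>K. elt_arrow Z z (fst t) (fst (snd t)) (a t))"

text \<open>The triple is the last argument so that \<open>pull Z a y\<close> can serve as a map on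
  generators in \<open>free_ext\<close>.\<close>

definition pull :: "'o \<Rightarrow> ('o \<times> 'm \<times> ('m \<Rightarrow> 'n) \<Rightarrow> 'a) \<Rightarrow> 'm \<Rightarrow> 'o \<times> 'm \<times> ('m \<Rightarrow> 'n) \<Rightarrow> 'n" where
  "pull Z a y t = snd (snd t) (far w Z (fst t) (a t) y)"

definition null_sum :: "('b, 'n, 'v) module_scheme \<Rightarrow> ('o \<times> 'm \<times> ('m \<Rightarrow> 'n) \<Rightarrow>\<^sub>0 int) \<Rightarrow> bool" where
  "null_sum M u \<longleftrightarrow> Poly_Mapping.keys u \<subseteq> triples M \<and>
     (\<exists>Z z a. refines Z z (Poly_Mapping.keys u) a \<and>
        (\<forall>y\<in>carrier (W Z). free_ext M (pull Z a y) u = \<zero>\<^bsub>M\<^esub>))"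

lemma refines_compose:
  assumes "refines Z z K a" "elt_arrow Z' z' Z z h"
  shows "refines Z' z' K (\<lambda>t. LCmp A Z' Z (fst t) (a t) h)"
  using assms elt_arrow_comp by (auto simp: refines_def elt_arrow_def)

lemma pull_compose:
  assumes "refines Z z K a" "elt_arrow Z' z' Z z h" "t \<in> K" "y \<in> carrier (W Z')"
  shows "pull Z' (\<lambda>t. LCmp A Z' Z (fst t) (a t) h) y t = pull Z a (far w Z' Z h y) t"
  using assms by (auto simp: refines_def elt_arrow_def elt_def pull_def far_comp)

lemma pull_closed:
  assumes "K \<subseteq> triples M" "refines Z z K a" "y \<in> carrier (W Z)"
  shows "pull Z a y \<in> K \<rightarrow> carrier M"
proof
  fix t assume t: "t \<in> K"
  then obtain X x h where "t = (X, x, h)" "h \<in> mod_hom B (W X) M" using assms(1) by (auto simp: triples_def)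
  moreover have "elt_arrow Z z (fst t) (fst (snd t)) (a t)"
    using t assms(2) by (simp add: refines_def)
  ultimately show "pull Z a y t \<in> carrier M"
    using assms(3) by (auto simp: pull_def elt_arrow_def elt_def far_W_closed mod_hom_closed)
qed

lemma null_sumI:
  assumes "Poly_Mapping.keys u \<subseteq> K" "K \<subseteq> triples M" "refines Z z K a"
    and "\<And>y. y \<in> carrier (W Z) \<Longrightarrow> free_ext M (pull Z a y) u = \<zero>\<^bsub>M\<^esub>"
  shows "null_sum M u"
proof -
  have "refines Z z (Poly_Mapping.keys u) a"
    using assms(1,3) unfolding refines_def by blast
  then show ?thesis unfolding null_sum_def using assms(1,2,4) by blast
qed

text \<open>This is where cofilteredness is essential. The two refinements are first brought over
  one element; a triple in both supports then carries two arrows from that element, and these have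
  to be equalized before a single family can refine the union of the supports.\<close>

lemma null_sum_add:
  assumes M: "left_module B M" and u: "null_sum M u" and v: "null_sum M v"
  shows "null_sum M (u + v)"
proof -
  interpret M: left_module B M by fact
  let ?Ku = "Poly_Mapping.keys u" and ?Kv = "Poly_Mapping.keys v"
  obtain Z z a where a: "refines Z z ?Ku a" "\<And>y. y \<in> carrier (W Z) \<Longrightarrow> free_ext M (pull Z a y) u = \<zero>\<^bsub>M\<^esub>"
    using u by (auto simp: null_sum_def)
  obtain Z' z' a' where a': "refines Z' z' ?Kv a'" "\<And>y. y \<in> carrier (W Z') \<Longrightarrow> free_ext M (pull Z' a' y) v = \<zero>\<^bsub>M\<^esub>"
    using v by (auto simp: null_sum_def)
  have tr: "?Ku \<subseteq> triples M" "?Kv \<subseteq> triples M" using u v by (auto simp: null_sum_def)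
  obtain P p f g where f: "elt_arrow P p Z z f" and g: "elt_arrow P p Z' z' g"
    using elt_span a(1) a'(1) by (metis refines_def)
  let ?b = "\<lambda>t. LCmp A P Z (fst t) (a t) f" and ?b' = "\<lambda>t. LCmp A P Z' (fst t) (a' t) g"
  have b: "refines P p ?Ku ?b" and b': "refines P p ?Kv ?b'"
    by (rule refines_compose[OF a(1) f], rule refines_compose[OF a'(1) g])
  \<comment> \<open>The arrows of \<open>?b\<close> and \<open>?b'\<close> at a common triple have
    the same source and target elements, so finitely many equalizations suffice.\<close>
  obtain Q q h where h: "elt_arrow Q q P p h"
    and hh: "\<And>t. t \<in> ?Ku \<inter> ?Kv \<Longrightarrow> LCmp A Q P (fst t) (?b t) h = LCmp A Q P (fst t) (?b' t) h"
    by (rule elt_equalize_finite[of "?Ku \<inter> ?Kv" P p fst "\<lambda>t. fst (snd t)" ?b ?b'])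
      (use b b' in \<open>auto simp: refines_def\<close>)
  let ?c = "\<lambda>t. LCmp A Q P (fst t) (?b t) h" and ?c' = "\<lambda>t. LCmp A Q P (fst t) (?b' t) h"
  \<comment> \<open>On the overlap \<open>?c\<close> and \<open>?c'\<close> now agree, so this
    family restricts to \<open>?c\<close> on the first support and to \<open>?c'\<close> on the
    second.\<close>
  let ?d = "\<lambda>t. if t \<in> ?Ku then ?c t else ?c' t"
  have c: "refines Q q ?Ku ?c" and c': "refines Q q ?Kv ?c'"
    by (rule refines_compose[OF b h], rule refines_compose[OF b' h])
  have d: "refines Q q (?Ku \<union> ?Kv) ?d"
    using c c' by (auto simp: refines_def)
  have keys: "Poly_Mapping.keys (u + v) \<subseteq> ?Ku \<union> ?Kv" by (rule Poly_Mapping.keys_add)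
  have "free_ext M (pull Q ?d y) (u + v) = \<zero>\<^bsub>M\<^esub>" if y: "y \<in> carrier (W Q)" for y
  proof -
    have yZ: "far w P Z f (far w Q P h y) \<in> carrier (W Z)" "far w P Z' g (far w Q P h y) \<in> carrier (W Z')"
      using h f g y by (auto simp: elt_arrow_def elt_def intro!: far_W_closed)
    have "free_ext M (pull Q ?d y) (u + v) = free_ext M (pull Q ?d y) u \<oplus>\<^bsub>M\<^esub> free_ext M (pull Q ?d y) v"
      using pull_closed[OF _ d y] tr by (intro M.M.free_ext_add[of _ "?Ku \<union> ?Kv"]) auto
    also have "free_ext M (pull Q ?d y) u = free_ext M (pull Z a (far w P Z f (far w Q P h y))) u"
    proof (rule M.M.free_ext_cong)
      fix t assume t: "t \<in> ?Ku"
      then have "pull Q ?d y t = pull Q ?c y t" by (simp add: pull_def)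
      also have "\<dots> = pull P ?b (far w Q P h y) t" by (rule pull_compose[OF b h t y])
      also have "\<dots> = pull Z a (far w P Z f (far w Q P h y)) t"
        using h y by (intro pull_compose[OF a(1) f t]) (auto simp: elt_arrow_def elt_def intro: far_W_closed)
      finally show "pull Q ?d y t = pull Z a (far w P Z f (far w Q P h y)) t" .
    qed (rule pull_closed[OF tr(1) a(1) yZ(1)])
    also have "\<dots> = \<zero>\<^bsub>M\<^esub>"
      by (rule a(2)[OF yZ(1)])
    also have "free_ext M (pull Q ?d y) v = free_ext M (pull Z' a' (far w P Z' g (far w Q P h y))) v"
    proof (rule M.M.free_ext_cong)
      fix t assume t: "t \<in> ?Kv"
      then have "pull Q ?d y t = pull Q ?c' y t" using hh[of t] by (simp add: pull_def)
      also have "\<dots> = pull P ?b' (far w Q P h y) t" by (rule pull_compose[OF b' h t y])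
      also have "\<dots> = pull Z' a' (far w P Z' g (far w Q P h y)) t"
        using h y by (intro pull_compose[OF a'(1) g t]) (auto simp: elt_arrow_def elt_def intro: far_W_closed)
      finally show "pull Q ?d y t = pull Z' a' (far w P Z' g (far w Q P h y)) t" .
    qed (rule pull_closed[OF tr(2) a'(1) yZ(2)])
    also have "\<dots> = \<zero>\<^bsub>M\<^esub>"
      by (rule a'(2)[OF yZ(2)])
    finally show ?thesis by simp
  qed
  then show ?thesis using null_sumI[OF keys _ d] tr by auto
qed

lemma null_sum_uminus:
  assumes M: "left_module B M" and u: "null_sum M u"
  shows "null_sum M (- u)"
proof -
  interpret M: left_module B M by fact
  obtain Z z a where a: "refines Z z (Poly_Mapping.keys u) a"
    "\<And>y. y \<in> carrier (W Z) \<Longrightarrow> free_ext M (pull Z a y) u = \<zero>\<^bsub>M\<^esub>"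
    using u by (auto simp: null_sum_def)
  have tr: "Poly_Mapping.keys u \<subseteq> triples M" using u by (auto simp: null_sum_def)
  have "free_ext M (pull Z a y) (- u) = \<zero>\<^bsub>M\<^esub>" if "y \<in> carrier (W Z)" for y
    using M.M.free_ext_uminus[OF subset_refl pull_closed[OF tr a(1) that]] a(2)[OF that] by simp
  then show ?thesis using a(1) tr by (auto simp: null_sum_def)
qed

lemma null_sum_zero: "left_module B M \<Longrightarrow> null_sum M 0"
proof -
  assume "left_module B M"
  then interpret M: left_module B M .
  obtain X x where "elt X x" by (rule elt_nonempty)
  then show ?thesis by (auto simp: null_sum_def refines_def)
qed

text \<open>Taking all null sums as relators, and not a generating family of them, makes the
  relators a subgroup already. A class in the quotient then vanishes exactly when its representative
  has a refinement that kills it.\<close>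

definition null_sums :: "('b, 'n, 'v) module_scheme \<Rightarrow> ('o \<times> 'm \<times> ('m \<Rightarrow> 'n) \<Rightarrow>\<^sub>0 int) set" where
  "null_sums M = {u. null_sum M u}"

abbreviation "C M \<equiv> pres_group (triples M) (null_sums M)"
abbreviation "tcl M t \<equiv> pres_class (triples M) (null_sums M) t"

lemma presentation_C: "presentation (triples M) (null_sums M) (C M)"
  by (rule presentation_pres_group) (auto simp: null_sums_def null_sum_def)

lemma tcl_zero_iff:
  assumes M: "left_module B M" and t: "t \<in> triples M"
  shows "tcl M t = \<zero>\<^bsub>C M\<^esub> \<longleftrightarrow> null_sum M (frag_of t)"
proof -
  interpret C: presentation "triples M" "null_sums M" "C M" by (rule presentation_C)
  have "null_sum M u" if "u \<in> C.N" for u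
    using that
  proof (induction rule: generate.induct)
    case one
    then show ?case by (simp add: null_sum_zero[OF M])
  next
    case (inv h)
    then show ?case using C.E_keys[OF inv] by (simp add: null_sums_def null_sum_uminus[OF M])
  next
    case (eng h1 h2)
    then show ?case by (simp add: null_sum_add[OF M])
  qed (simp add: null_sums_def)
  then show ?thesis
    using C.cls_zero_iff[OF t] by (auto simp: null_sums_def intro: generate.incl)
qed

lemma null_sum_rel3:
  assumes M: "left_module B M" and t: "t1 \<in> triples M" "t2 \<in> triples M" "t3 \<in> triples M"
    and a: "refines Z z {t1, t2, t3} a"
    and eq: "\<And>y. y \<in> carrier (W Z) \<Longrightarrow> pull Z a y t1 = pull Z a y t2 \<oplus>\<^bsub>M\<^esub> pull Z a y t3"
  shows "frag_of t1 - frag_of t2 - frag_of t3 \<in> null_sums M"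
proof -
  interpret M: left_module B M by fact
  let ?u = "frag_of t1 - frag_of t2 - frag_of t3" and ?S = "{t1, t2, t3}"
  have keys: "Poly_Mapping.keys ?u \<subseteq> ?S" using rel3_in_free[of t1 ?S t2 t3] by simp
  have "free_ext M (pull Z a y) ?u = \<zero>\<^bsub>M\<^esub>" if y: "y \<in> carrier (W Z)" for y
    by (rule M.M.free_ext_rel3[of _ ?S]) (use pull_closed[OF _ a y] t eq[OF y] in auto)
  then show ?thesis
    using null_sumI[OF keys _ a] t by (auto simp: null_sums_def)
qed

lemma null_sum_rel2:
  assumes M: "left_module B M" and t: "t1 \<in> triples M" "t2 \<in> triples M"
    and a: "refines Z z {t1, t2} a"
    and eq: "\<And>y. y \<in> carrier (W Z) \<Longrightarrow> pull Z a y t1 = pull Z a y t2"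
  shows "frag_of t1 - frag_of t2 \<in> null_sums M"
proof -
  interpret M: left_module B M by fact
  let ?u = "frag_of t1 - frag_of t2" and ?S = "{t1, t2}"
  have keys: "Poly_Mapping.keys ?u \<subseteq> ?S" using rel2_in_free[of t1 ?S t2] by simp
  have "free_ext M (pull Z a y) ?u = \<zero>\<^bsub>M\<^esub>" if y: "y \<in> carrier (W Z)" for y
    by (rule M.M.free_ext_rel2[of _ ?S]) (use pull_closed[OF _ a y] t eq[OF y] in auto)
  then show ?thesis
    using null_sumI[OF keys _ a] t by (auto simp: null_sums_def)
qed

text \<open>The three triples share X but carry different elements. Over a common element (Z, z),
  the arrow to (X, x + y) and the sum of the arrows to (X, x) and (X, y) both send z to x + y; after
  equalizing them, additivity of \<open>w\<close> on arrows and of h gives the relation. The linear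
  structure of \<open>A\<close> enters the colimit here.\<close>

lemma tcl_add_elt:
  assumes M: "left_module B M" and X: "elt X x" "elt X y" and h: "h \<in> mod_hom B (W X) M"
  shows "tcl M (X, x \<oplus>\<^bsub>W X\<^esub> y, h) = tcl M (X, x, h) \<oplus>\<^bsub>C M\<^esub> tcl M (X, y, h)"
proof -
  interpret C: presentation "triples M" "null_sums M" "C M" by (rule presentation_C)
  have XO: "X \<in> LOb A" using X by (simp add: elt_def)
  let ?t1 = "(X, x \<oplus>\<^bsub>W X\<^esub> y, h)" and ?t2 = "(X, x, h)" and ?t3 = "(X, y, h)"
  let ?S = "{?t1, ?t2, ?t3}"
  have t: "?t1 \<in> triples M" "?t2 \<in> triples M" "?t3 \<in> triples M"
    using X h by (auto simp: triples_def elt_def W_add_closed)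
  obtain Z z a where Z: "elt Z z" "\<And>t. t \<in> ?S \<Longrightarrow> elt_arrow Z z (fst t) (fst (snd t)) (a t)"
    by (rule elt_cone[of ?S fst "\<lambda>t. fst (snd t)"]) (use t in \<open>auto simp: triples_def\<close>)
  have a: "elt_arrow Z z X (x \<oplus>\<^bsub>W X\<^esub> y) (a ?t1)" "elt_arrow Z z X x (a ?t2)" "elt_arrow Z z X y (a ?t3)"
    using Z(2)[of ?t1] Z(2)[of ?t2] Z(2)[of ?t3] by auto
  have s: "elt_arrow Z z X (x \<oplus>\<^bsub>W X\<^esub> y) (a ?t2 \<oplus>\<^bsub>LHom A Z X\<^esub> a ?t3)"
    using a by (auto simp: elt_arrow_def elt_def LHom_add_closed far_add)
  obtain Q q k where k: "elt_arrow Q q Z z k"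
    "LCmp A Q Z X (a ?t1) k = LCmp A Q Z X (a ?t2 \<oplus>\<^bsub>LHom A Z X\<^esub> a ?t3) k"
    by (rule elt_equalize[OF a(1) s])
  have ref: "refines Z z ?S a" using Z by (auto simp: refines_def)
  show ?thesis
  proof (rule C.cls_rel3[OF null_sum_rel3[OF M t refines_compose[OF ref k(1)]] t])
    fix v assume v: "v \<in> carrier (W Q)"
    let ?v = "far w Q Z k v"
    have Q: "Q \<in> LOb A" "Z \<in> LOb A" "k \<in> carrier (LHom A Q Z)" "?v \<in> carrier (W Z)"
      using k v by (auto simp: elt_arrow_def elt_def intro: far_W_closed)
    have ah: "a ?t1 \<in> carrier (LHom A Z X)" "a ?t2 \<in> carrier (LHom A Z X)" "a ?t3 \<in> carrier (LHom A Z X)"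
      using a by (auto simp: elt_arrow_def)
    have "far w Z X (a ?t1) ?v = far w Q X (LCmp A Q Z X (a ?t1) k) v"
      using Q ah XO v by (simp add: far_comp)
    also have "\<dots> = far w Z X (a ?t2 \<oplus>\<^bsub>LHom A Z X\<^esub> a ?t3) ?v"
      unfolding k(2) using Q ah XO v by (simp add: far_comp LHom_add_closed)
    also have "\<dots> = far w Z X (a ?t2) ?v \<oplus>\<^bsub>W X\<^esub> far w Z X (a ?t3) ?v"
      using Q ah XO by (simp add: far_add)
    finally have "h (far w Z X (a ?t1) ?v) = h (far w Z X (a ?t2) ?v) \<oplus>\<^bsub>M\<^esub> h (far w Z X (a ?t3) ?v)"
      using Q ah XO by (simp add: mod_hom_add[OF h] far_W_closed)
    then show "pull Q (\<lambda>t. LCmp A Q Z (fst t) (a t) k) v ?t1 =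
        pull Q (\<lambda>t. LCmp A Q Z (fst t) (a t) k) v ?t2 \<oplus>\<^bsub>M\<^esub> pull Q (\<lambda>t. LCmp A Q Z (fst t) (a t) k) v ?t3"
      using Q ah XO v by (simp add: pull_def far_comp)
  qed
qed

lemma tcl_add_hom:
  assumes M: "left_module B M" and X: "elt X x" and h: "h \<in> mod_hom B (W X) M" and k: "k \<in> mod_hom B (W X) M"
  shows "tcl M (X, x, hom_add (W X) M h k) = tcl M (X, x, h) \<oplus>\<^bsub>C M\<^esub> tcl M (X, x, k)"
proof -
  interpret C: presentation "triples M" "null_sums M" "C M" by (rule presentation_C)
  have XO: "X \<in> LOb A" using X by (simp add: elt_def)
  let ?t1 = "(X, x, hom_add (W X) M h k)" and ?t2 = "(X, x, h)" and ?t3 = "(X, x, k)"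
  have t: "?t1 \<in> triples M" "?t2 \<in> triples M" "?t3 \<in> triples M"
    using X h k XO by (auto simp: triples_def mod_hom_hom_add[OF W_module M])
  have "refines X x {?t1, ?t2, ?t3} (\<lambda>_. LIdn A X)"
    using elt_arrow_id[OF X] X by (auto simp: refines_def)
  then show ?thesis
    by (intro C.cls_rel3[OF null_sum_rel3[OF M t] t]) (auto simp: pull_def far_id XO hom_add_def)
qed

text \<open>Both triples are refined by (X, x), through f and through the identity. A refining
  family assigns one arrow to each triple, so this choice is possible when the triples differ; when
  they coincide, their classes do as well.\<close>

lemma tcl_dinatural:
  assumes M: "left_module B M" and f: "elt_arrow X x Y y f" and h: "h \<in> mod_hom B (W Y) M"
  shows "tcl M (Y, y, h) = tcl M (X, x, compose (carrier (W X)) h (far w X Y f))"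
proof (cases "(Y, y, h) = (X, x, compose (carrier (W X)) h (far w X Y f))")
  case False
  interpret C: presentation "triples M" "null_sums M" "C M" by (rule presentation_C)
  let ?t1 = "(Y, y, h)" and ?t2 = "(X, x, compose (carrier (W X)) h (far w X Y f))"
  have X: "elt X x" "elt Y y" "X \<in> LOb A" "Y \<in> LOb A" "f \<in> carrier (LHom A X Y)"
    using f by (auto simp: elt_arrow_def elt_def)
  have t: "?t1 \<in> triples M" "?t2 \<in> triples M"
    using h X by (auto simp: triples_def intro: mod_hom_comp[OF W_module far_hom])
  show ?thesis
    by (rule C.cls_rel2[OF null_sum_rel2[OF M t, of X x "\<lambda>t. if t = ?t1 then f else LIdn A X"] t])
      (use False X f elt_arrow_id[OF X(1)] in \<open>auto simp: refines_def pull_def far_id compose_eq\<close>)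
next
  case True
  then show ?thesis by (rule arg_cong)
qed


section \<open>Comparing the tensor product with the colimit\<close>

lemma tcl_closed:
  "\<lbrakk>elt X x; h \<in> mod_hom B (W X) M\<rbrakk> \<Longrightarrow> tcl M (X, x, h) \<in> carrier (C M)"
  by (rule presentation.cls_closed[OF presentation_C]) (simp add: triples_def)

lemma C_abelian_group: "abelian_group (C M)"
  by (rule presentation.abelian_group[OF presentation_C])

lemma rank_one_add_left:
  assumes M: "left_module B M" and X: "X \<in> LOb A" and \<phi>: "\<phi> \<in> dual B (W X)" and \<psi>: "\<psi> \<in> dual B (W X)"
    and m: "m \<in> carrier M"
  shows "rank_one (W X) M (\<lambda>x\<in>carrier (W X). \<phi> x \<oplus>\<^bsub>B\<^esub> \<psi> x) m
    = hom_add (W X) M (rank_one (W X) M \<phi> m) (rank_one (W X) M \<psi> m)"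
proof -
  interpret M: left_module B M by fact
  show ?thesis using m
    by (auto simp: rank_one_def hom_add_def fun_eq_iff M.smult_l_distr dual_closed[OF \<phi>] dual_closed[OF \<psi>])
qed

lemma rank_one_add_right:
  assumes M: "left_module B M" and X: "X \<in> LOb A" and \<phi>: "\<phi> \<in> dual B (W X)"
    and m: "m \<in> carrier M" "n \<in> carrier M"
  shows "rank_one (W X) M \<phi> (m \<oplus>\<^bsub>M\<^esub> n) = hom_add (W X) M (rank_one (W X) M \<phi> m) (rank_one (W X) M \<phi> n)"
proof -
  interpret M: left_module B M by fact
  show ?thesis using m
    by (auto simp: rank_one_def hom_add_def fun_eq_iff M.smult_r_distr dual_closed[OF \<phi>])
qed

lemma rank_one_balanced:
  assumes M: "left_module B M" and X: "X \<in> LOb A" and \<phi>: "\<phi> \<in> dual B (W X)"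
    and b: "b \<in> carrier B" and m: "m \<in> carrier M"
  shows "rank_one (W X) M (dual_rmult X \<phi> b) m = rank_one (W X) M \<phi> (b \<odot>\<^bsub>M\<^esub> m)"
proof -
  interpret M: left_module B M by fact
  show ?thesis using m b
    by (auto simp: rank_one_def dual_rmult_def fun_eq_iff M.smult_assoc dual_closed[OF \<phi>])
qed

text \<open>The additive map from \<open>L \<otimes> M\<close> to the colimit that sends \<open>theta M X x h\<close> to the class of
  \<open>(X, x, h)\<close>.\<close>

definition to_colim_left where
  "to_colim_left M m = pres_lift (C M) (\<lambda>(X, x, \<phi>). tcl M (X, x, rank_one (W X) M \<phi> m))"

definition to_colim where
  "to_colim M = pres_lift (C M) (\<lambda>(l, m). to_colim_left M m l)"

lemma to_colim_left:
  assumes M: "left_module B M" and m: "m \<in> carrier M"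
  shows to_colim_left_additive: "to_colim_left M m \<in> additive L (C M)"
    and to_colim_left_cl: "\<lbrakk>X \<in> LOb A; x \<in> carrier (W X); \<phi> \<in> dual B (W X)\<rbrakk>
      \<Longrightarrow> to_colim_left M m (cl X x \<phi>) = tcl M (X, x, rank_one (W X) M \<phi> m)"
proof -
  have r: "rank_one (W X) M \<phi> m \<in> mod_hom B (W X) M" if "X \<in> LOb A" "\<phi> \<in> dual B (W X)" for X \<phi>
    using that m by (intro mod_hom_rank_one[OF W_module M])
  have 1: "tcl M (X, x, rank_one (W X) M \<phi> m) \<in> carrier (C M)"
    if "X \<in> LOb A" "x \<in> carrier (W X)" "\<phi> \<in> dual B (W X)" for X x \<phi>
    using that r by (intro tcl_closed) (auto simp: elt_def)
  have 2: "tcl M (X, x \<oplus>\<^bsub>W X\<^esub> y, rank_one (W X) M \<phi> m)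
      = tcl M (X, x, rank_one (W X) M \<phi> m) \<oplus>\<^bsub>C M\<^esub> tcl M (X, y, rank_one (W X) M \<phi> m)"
    if "X \<in> LOb A" "x \<in> carrier (W X)" "y \<in> carrier (W X)" "\<phi> \<in> dual B (W X)" for X x y \<phi>
    using that r by (intro tcl_add_elt[OF M]) (auto simp: elt_def)
  have 3: "tcl M (X, x, rank_one (W X) M (\<lambda>x\<in>carrier (W X). \<phi> x \<oplus>\<^bsub>B\<^esub> \<psi> x) m)
      = tcl M (X, x, rank_one (W X) M \<phi> m) \<oplus>\<^bsub>C M\<^esub> tcl M (X, x, rank_one (W X) M \<psi> m)"
    if "X \<in> LOb A" "x \<in> carrier (W X)" "\<phi> \<in> dual B (W X)" "\<psi> \<in> dual B (W X)" for X x \<phi> \<psi>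
    unfolding rank_one_add_left[OF M that(1,3,4) m]
    using that r by (intro tcl_add_hom[OF M]) (auto simp: elt_def)
  have 4: "tcl M (Y, far w X Y f x, rank_one (W Y) M \<phi> m)
      = tcl M (X, x, rank_one (W X) M (compose (carrier (W X)) \<phi> (far w X Y f)) m)"
    if "X \<in> LOb A" "Y \<in> LOb A" "f \<in> carrier (LHom A X Y)" "x \<in> carrier (W X)" "\<phi> \<in> dual B (W Y)"
    for X Y f x \<phi>
  proof -
    have "compose (carrier (W X)) (rank_one (W Y) M \<phi> m) (far w X Y f)
        = rank_one (W X) M (compose (carrier (W X)) \<phi> (far w X Y f)) m"
      using that by (auto simp: compose_def rank_one_def fun_eq_iff far_W_closed)
    then show ?thesis
      using tcl_dinatural[OF M, of X x Y "far w X Y f x" f "rank_one (W Y) M \<phi> m"] that r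
      by (simp add: elt_arrow_def elt_def far_W_closed)
  qed
  show "to_colim_left M m \<in> additive L (C M)" unfolding to_colim_left_def
    by (rule coend_lift_additive[OF C_abelian_group 1 2 3 4])
  show "to_colim_left M m (cl X x \<phi>) = tcl M (X, x, rank_one (W X) M \<phi> m)"
    if "X \<in> LOb A" "x \<in> carrier (W X)" "\<phi> \<in> dual B (W X)"
    unfolding to_colim_left_def
    by (rule coend_lift_cl[OF C_abelian_group 1 2 3 4 that])
qed

text \<open>Additivity and balance in m are equalities between additive maps on \<open>L\<close>, so
  they are tested on the generators of the coend. There they come down to the corresponding
  identities between rank one maps.\<close>

lemma to_colim:
  assumes M: "left_module B M"
  shows to_colim_additive: "to_colim M \<in> additive (T M) (C M)"
    and to_colim_tens: "\<lbrakk>l \<in> carrier L; m \<in> carrier M\<rbrakk>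
      \<Longrightarrow> to_colim M (tens B L M l m) = to_colim_left M m l"
proof -
  interpret M: tensor_product B L M by (rule tensor_productI'[OF M])
  interpret C: abelian_group "C M" by (rule C_abelian_group)
  note addl = to_colim_left_additive[OF M]
  have 1: "to_colim_left M m l \<in> carrier (C M)" if "l \<in> carrier L" "m \<in> carrier M" for l m
    using additive_closed[OF addl[OF that(2)] that(1)] .
  have 2: "to_colim_left M m (k \<oplus>\<^bsub>L\<^esub> l) = to_colim_left M m k \<oplus>\<^bsub>C M\<^esub> to_colim_left M m l"
    if "k \<in> carrier L" "l \<in> carrier L" "m \<in> carrier M" for k l m
    using additive_add[OF addl[OF that(3)] that(1,2)] .
  have 3: "to_colim_left M (m \<oplus>\<^bsub>M\<^esub> n) l = to_colim_left M m l \<oplus>\<^bsub>C M\<^esub> to_colim_left M n l"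
    if l: "l \<in> carrier L" and m: "m \<in> carrier M" and n: "n \<in> carrier M" for l m n
  proof (rule L_eqI[OF C_abelian_group addl _ _ l, where g = "\<lambda>l. to_colim_left M m l \<oplus>\<^bsub>C M\<^esub> to_colim_left M n l"])
    show "m \<oplus>\<^bsub>M\<^esub> n \<in> carrier M" using m n by simp
    show "(\<lambda>l. to_colim_left M m l \<oplus>\<^bsub>C M\<^esub> to_colim_left M n l) \<in> additive L (C M)"
      using m n by (intro additiveI) (auto simp: 1 2 C.a_ac)
    fix X x \<phi> assume X: "X \<in> LOb A" "x \<in> carrier (W X)" "\<phi> \<in> dual B (W X)"
    show "to_colim_left M (m \<oplus>\<^bsub>M\<^esub> n) (cl X x \<phi>)
        = to_colim_left M m (cl X x \<phi>) \<oplus>\<^bsub>C M\<^esub> to_colim_left M n (cl X x \<phi>)"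
      using X m n by (simp add: to_colim_left_cl[OF M] rank_one_add_right[OF M]
          tcl_add_hom[OF M] elt_def mod_hom_rank_one[OF W_module M])
  qed
  have 4: "to_colim_left M m (rsmult L l b) = to_colim_left M (b \<odot>\<^bsub>M\<^esub> m) l"
    if l: "l \<in> carrier L" and b: "b \<in> carrier B" and m: "m \<in> carrier M" for l b m
  proof (rule L_eqI[OF C_abelian_group _ addl _ l, where f = "\<lambda>l. to_colim_left M m (rsmult L l b)"])
    show "b \<odot>\<^bsub>M\<^esub> m \<in> carrier M" using b m by (simp add: M.M.smult_closed)
    show "(\<lambda>l. to_colim_left M m (rsmult L l b)) \<in> additive L (C M)"
      using b m additive_closed[OF coend_rsmult_additive[OF b]] additive_add[OF coend_rsmult_additive[OF b]]
      by (intro additiveI) (auto simp: 1 2)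
    fix X x \<phi> assume X: "X \<in> LOb A" "x \<in> carrier (W X)" "\<phi> \<in> dual B (W X)"
    then show "to_colim_left M m (rsmult L (cl X x \<phi>) b) = to_colim_left M (b \<odot>\<^bsub>M\<^esub> m) (cl X x \<phi>)"
      using b m by (simp add: coend_rsmult_cl to_colim_left_cl[OF M] dual_rmult_closed
          M.M.smult_closed rank_one_balanced[OF M])
  qed
  show "to_colim M \<in> additive (T M) (C M)" unfolding to_colim_def
    by (rule M.tensor_lift_additive[OF C_abelian_group 1 2 3 4])
  show "to_colim M (tens B L M l m) = to_colim_left M m l"
    if "l \<in> carrier L" "m \<in> carrier M" unfolding to_colim_def
    by (rule M.tensor_lift_tens[OF C_abelian_group 1 2 3 4 that])
qed

text \<open>Each term of \<open>theta\<close> goes to the class of a rank one map at (X, x). Classes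
  at a fixed element are additive in the homomorphism, and the rank one maps add up to h by the dual
  basis expansion.\<close>

lemma to_colim_theta:
  assumes M: "left_module B M" and X: "X \<in> LOb A" "x \<in> carrier (W X)" and h: "h \<in> mod_hom B (W X) M"
  shows "to_colim M (theta M X x h) = tcl M (X, x, h)"
proof -
  interpret C: abelian_group "C M" by (rule C_abelian_group)
  note W = W_module[OF X(1)]
  let ?r = "\<lambda>i. rank_one (W X) M (bas_d X i) (h (bas_e X i))"
  have he: "h (bas_e X i) \<in> carrier M" if "i < bas_n X" for i
    using mod_hom_closed[OF h bas_e_closed[OF X(1) that]] .
  have r: "?r i \<in> mod_hom B (W X) M" if "i < bas_n X" for i
    using that X he by (intro mod_hom_rank_one[OF W M] bas_d_dual)
  have "to_colim M (theta M X x h)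
     = (\<Oplus>\<^bsub>C M\<^esub>i\<in>{..<bas_n X}. to_colim M (tens B L M (cl X x (bas_d X i)) (h (bas_e X i))))"
    unfolding theta_def
    by (rule additive_finsum[OF T_abelian_group[OF M] C_abelian_group to_colim_additive[OF M]])
      (use theta_term_closed[OF M X h] in auto)
  also have "\<dots> = (\<Oplus>\<^bsub>C M\<^esub>i\<in>{..<bas_n X}. tcl M (X, x, ?r i))"
    using X r he by (intro C.finsum_cong')
      (auto simp: to_colim_tens[OF M] cl_closed bas_d_dual to_colim_left_cl[OF M] elt_def
        intro!: tcl_closed)
  also have "\<dots> = tcl M (X, x, hom_sum (W X) M {..<bas_n X} ?r)"
    by (rule hom_sum_map[symmetric, OF W M C_abelian_group, where F = "\<lambda>h. tcl M (X, x, h)"])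
      (use X r in \<open>simp_all add: tcl_closed elt_def tcl_add_hom[OF M]\<close>)
  also have "hom_sum (W X) M {..<bas_n X} ?r = h"
    by (rule hom_sum_dual_basis[OF W M is_dual_basis_bas[OF X(1)] h])
  finally show ?thesis .
qed

text \<open>The image of the given equation under \<open>to_colim\<close> says that a single
  generator with coefficient 1 is null, and a refinement that kills this formal sum kills h
  itself.\<close>

lemma theta_eq_zeroD:
  assumes M: "left_module B M" and X: "elt X x" and h: "h \<in> mod_hom B (W X) M"
    and zero: "theta M X x h = \<zero>\<^bsub>T M\<^esub>"
  obtains Z z f where "elt_arrow Z z X x f" "\<And>y. y \<in> carrier (W Z) \<Longrightarrow> h (far w Z X f y) = \<zero>\<^bsub>M\<^esub>"
proof -
  interpret M: left_module B M by fact
  have t: "(X, x, h) \<in> triples M" using X h by (simp add: triples_def)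
  have "tcl M (X, x, h) = \<zero>\<^bsub>C M\<^esub>"
    using to_colim_theta[OF M _ _ h, of x] X zero
      additive_zero[OF T_abelian_group[OF M] C_abelian_group to_colim_additive[OF M]]
    by (simp add: elt_def)
  then have "null_sum M (frag_of (X, x, h))" using tcl_zero_iff[OF M t] by simp
  then obtain Z z a where a: "refines Z z {(X, x, h)} a"
    "\<And>y. y \<in> carrier (W Z) \<Longrightarrow> free_ext M (pull Z a y) (frag_of (X, x, h)) = \<zero>\<^bsub>M\<^esub>"
    by (auto simp: null_sum_def keys_frag_of)
  let ?f = "a (X, x, h)"
  have f: "elt_arrow Z z X x ?f" using a(1) by (simp add: refines_def)
  have "h (far w Z X ?f y) = \<zero>\<^bsub>M\<^esub>" if y: "y \<in> carrier (W Z)" for y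
  proof -
    have "h (far w Z X ?f y) \<in> carrier M"
      using f y by (intro mod_hom_closed[OF h] far_W_closed) (auto simp: elt_arrow_def elt_def)
    then show ?thesis using a(2)[OF y] by (simp add: M.M.free_ext_of pull_def)
  qed
  with f show ?thesis by (rule that)
qed

lemma theta_eqD:
  assumes M: "left_module B M" and X: "elt X x"
    and h: "h \<in> mod_hom B (W X) M" and k: "k \<in> mod_hom B (W X) M"
    and eq: "theta M X x h = theta M X x k"
  obtains Z z f where "elt_arrow Z z X x f"
    "\<And>y. y \<in> carrier (W Z) \<Longrightarrow> h (far w Z X f y) = k (far w Z X f y)"
proof -
  interpret TM: left_module B "T M" by (rule T_module[OF M])
  have X': "X \<in> LOb A" "x \<in> carrier (W X)" using X by (auto simp: elt_def)
  have m: "hom_minus (W X) M h k \<in> mod_hom B (W X) M"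
    by (rule mod_hom_hom_minus[OF W_module[OF X'(1)] M h k])
  have "theta M X x (hom_minus (W X) M h k) = \<zero>\<^bsub>T M\<^esub>"
    using theta_hom_minus[OF M X' h k] eq theta_closed[OF M X' k] by (simp add: a_minus_def TM.M.r_neg)
  then obtain Z z f where f: "elt_arrow Z z X x f"
    and 0: "\<And>y. y \<in> carrier (W Z) \<Longrightarrow> hom_minus (W X) M h k (far w Z X f y) = \<zero>\<^bsub>M\<^esub>"
    using theta_eq_zeroD[OF M X m] by blast
  have "h (far w Z X f y) = k (far w Z X f y)" if "y \<in> carrier (W Z)" for y
    using 0[OF that] hom_minus_zero_iff[OF M h k, of "far w Z X f y"] that f
    by (auto simp: elt_arrow_def elt_def far_W_closed)
  with f show ?thesis by (rule that)
qed

section \<open>Elements of the tensor product and flatness\<close>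

lemma theta_pull:
  assumes M: "left_module B M" and f: "elt_arrow Z z X x f" and h: "h \<in> mod_hom B (W X) M"
  shows "compose (carrier (W Z)) h (far w Z X f) \<in> mod_hom B (W Z) M"
    and "theta M X x h = theta M Z z (compose (carrier (W Z)) h (far w Z X f))"
  using f theta_dinatural[OF M, of Z z X f h] h
  by (auto simp: elt_arrow_def elt_def intro: mod_hom_comp[OF W_module far_hom])

text \<open>Pure tensors of coend generators come from rank one maps. A sum of two thetas is again
  one: both are pulled back to a common element by dinaturality, and there the homomorphisms can be
  added.\<close>

lemma theta_cases:
  assumes M: "left_module B M" and t: "t \<in> carrier (T M)"
  obtains X x h where "elt X x" "h \<in> mod_hom B (W X) M" "t = theta M X x h"
proof -
  interpret M: tensor_product B L M by (rule tensor_productI'[OF M])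
  define Q where "Q t \<longleftrightarrow> (\<exists>X x h. elt X x \<and> h \<in> mod_hom B (W X) M \<and> t = theta M X x h)" for t
  have add: "Q (s \<oplus>\<^bsub>T M\<^esub> t)" if s: "Q s" and t: "Q t" for s t
  proof -
    obtain X x h where X: "elt X x" "h \<in> mod_hom B (W X) M" "s = theta M X x h" using s by (auto simp: Q_def)
    obtain Y y k where Y: "elt Y y" "k \<in> mod_hom B (W Y) M" "t = theta M Y y k" using t by (auto simp: Q_def)
    obtain Z z f g where f: "elt_arrow Z z X x f" and g: "elt_arrow Z z Y y g"
      using elt_span[OF X(1) Y(1)] by blast
    let ?h = "compose (carrier (W Z)) h (far w Z X f)" and ?k = "compose (carrier (W Z)) k (far w Z Y g)"
    have Z: "elt Z z" "Z \<in> LOb A" "z \<in> carrier (W Z)" using f by (auto simp: elt_arrow_def elt_def)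
    have "s \<oplus>\<^bsub>T M\<^esub> t = theta M Z z (hom_add (W Z) M ?h ?k)"
      using theta_pull[OF M f X(2)] theta_pull[OF M g Y(2)] X(3) Y(3) Z
      by (simp add: theta_hom_add[OF M])
    moreover have "hom_add (W Z) M ?h ?k \<in> mod_hom B (W Z) M"
      using theta_pull(1)[OF M f X(2)] theta_pull(1)[OF M g Y(2)] Z
      by (intro mod_hom_hom_add[OF W_module M])
    ultimately show ?thesis using Z by (auto simp: Q_def)
  qed
  have zero: "Q \<zero>\<^bsub>T M\<^esub>"
  proof -
    obtain X x where X: "elt X x" by (rule elt_nonempty)
    then have "theta M X x (hom_zero (W X) M) = \<zero>\<^bsub>T M\<^esub>" "hom_zero (W X) M \<in> mod_hom B (W X) M"
      by (simp_all add: elt_def theta_zero[OF M] mod_hom_hom_zero[OF W_module M])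
    with X show ?thesis unfolding Q_def by metis
  qed
  have "Q (tens B L M l m)" if l: "l \<in> carrier L" and m: "m \<in> carrier M" for l m
    using l
  proof (induction rule: L_induct)
    case (cl X x \<phi>)
    then show ?case unfolding Q_def
      using tens_cl_eq_theta[OF M, of X x \<phi> m] m mod_hom_rank_one[OF W_module M, of X \<phi> m]
      by (auto simp: elt_def)
  next
    case zero
    then show ?case
      using \<open>Q \<zero>\<^bsub>T M\<^esub>\<close> additive_zero[OF L.abelian_group M.T.abelian_group M.tens_additive_left[OF m]] by simp
  next
    case (add k l)
    then show ?case
      using additive_add[OF M.tens_additive_left[OF m]] \<open>\<And>s t. \<lbrakk>Q s; Q t\<rbrakk> \<Longrightarrow> Q (s \<oplus>\<^bsub>T M\<^esub> t)\<close> by simp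
  qed
  with t have "Q t" by (induction rule: M.tensor_induct) (auto intro: add)
  then show ?thesis using that by (auto simp: Q_def)
qed

text \<open>An element of the kernel is some theta M X x h for which f after h vanishes on a
  refinement. As f is injective, h vanishes on the same refinement, so the element is zero.\<close>

theorem flat_L:
  fixes U :: "'n itself"
  shows "flat_right U B L"
  unfolding flat_right_def
proof (intro allI ballI impI; elim conjE)
  fix M N :: "('b, 'n) module" and f
  assume f: "f \<in> mod_hom B M N" and M: "left_module B M" and N: "left_module B N"
    and inj: "inj_on f (carrier M)"
  interpret M: left_module B M by (rule M)
  interpret N: left_module B N by (rule N)
  interpret TM: left_module B "T M" by (rule T_module[OF M])
  interpret TN: left_module B "T N" by (rule T_module[OF N])
  let ?F = "tensor_map B L M N f"
  note F = mod_hom_additive[OF tensor_map_hom[OF M N f]]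
  have ker: "t = \<zero>\<^bsub>T M\<^esub>" if t: "t \<in> carrier (T M)" and Ft: "?F t = \<zero>\<^bsub>T N\<^esub>" for t
  proof -
    obtain X x h where X: "elt X x" and h: "h \<in> mod_hom B (W X) M" and th: "t = theta M X x h"
      by (rule theta_cases[OF M t])
    have X': "X \<in> LOb A" "x \<in> carrier (W X)" using X by (auto simp: elt_def)
    note fh = mod_hom_comp[OF W_module[OF X'(1)] h f]
    have "theta N X x (compose (carrier (W X)) f h) = \<zero>\<^bsub>T N\<^esub>"
      using Ft th tensor_map_theta[OF M N f X' h] by simp
    then obtain Z z g where g: "elt_arrow Z z X x g"
      and 0: "\<And>y. y \<in> carrier (W Z) \<Longrightarrow> compose (carrier (W X)) f h (far w Z X g y) = \<zero>\<^bsub>N\<^esub>"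
      using theta_eq_zeroD[OF N X fh] by blast
    have "h (far w Z X g y) = \<zero>\<^bsub>M\<^esub>" if y: "y \<in> carrier (W Z)" for y
    proof -
      have gy: "far w Z X g y \<in> carrier (W X)"
        using g y by (auto simp: elt_arrow_def elt_def far_W_closed)
      then have "f (h (far w Z X g y)) = f \<zero>\<^bsub>M\<^esub>"
        using 0[OF y] additive_zero[OF M.abelian_group N.abelian_group mod_hom_additive[OF f]]
        by (simp add: compose_eq)
      then show ?thesis using inj gy mod_hom_closed[OF h] by (auto simp: inj_on_eq_iff)
    qed
    then have "compose (carrier (W Z)) h (far w Z X g) = hom_zero (W Z) M"
      by (auto simp: compose_def hom_zero_def)
    then show ?thesis
      using th theta_pull(2)[OF M g h] theta_zero[OF M] g by (simp add: elt_arrow_def elt_def)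
  qed
  show "inj_on ?F (carrier (T M))"
  proof (rule inj_onI)
    fix s t assume s: "s \<in> carrier (T M)" and t: "t \<in> carrier (T M)" and eq: "?F s = ?F t"
    have "?F (s \<ominus>\<^bsub>T M\<^esub> t) = \<zero>\<^bsub>T N\<^esub>"
      using additive_minus[OF TM.abelian_group TN.abelian_group F s t] eq
        additive_closed[OF F t] by (simp add: a_minus_def TN.M.r_neg)
    then show "s = t" using ker[of "s \<ominus>\<^bsub>T M\<^esub> t"] s t TM.M.eq_iff_minus_zero[of s t] by simp
  qed
qed

end

section \<open>Finite limits of modules\<close>

definition compatible_family :: "('j, 'u) cat \<Rightarrow> ('j, 'u, ('b, 'n) module, 'n \<Rightarrow> 'n) ftor \<Rightarrow> ('j \<Rightarrow> 'n) \<Rightarrow> bool" where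
  "compatible_family J G y \<longleftrightarrow> (\<forall>j\<in>Ob J. y j \<in> carrier (fob G j)) \<and>
     (\<forall>i\<in>Ob J. \<forall>j\<in>Ob J. \<forall>u\<in>Ar J i j. far G i j u (y i) = y j)"

text \<open>The universal property is tested on single elements instead of modules, so it does not
  depend on the carrier type of the test modules. This permits factoring maps out of w(Y), whose
  carrier type differs from that of the diagram.\<close>

definition elementwise_limit :: "('j, 'u) cat \<Rightarrow> ('j, 'u, ('b, 'n) module, 'n \<Rightarrow> 'n) ftor \<Rightarrow>
    ('b, 'n) module \<Rightarrow> ('j \<Rightarrow> 'n \<Rightarrow> 'n) \<Rightarrow> bool" where
  "elementwise_limit J G P \<pi> \<longleftrightarrow>
     (\<forall>y. compatible_family J G y \<longrightarrow> (\<exists>!p. p \<in> carrier P \<and> (\<forall>j\<in>Ob J. \<pi> j p = y j)))"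

lemma elementwise_limitD:
  "\<lbrakk>elementwise_limit J G P \<pi>; compatible_family J G y\<rbrakk>
    \<Longrightarrow> \<exists>!p. p \<in> carrier P \<and> (\<forall>j\<in>Ob J. \<pi> j p = y j)"
  by (simp add: elementwise_limit_def)

locale module_cone =
  fixes B :: "('r, 'b) module" and J :: "('j, 'u) cat"
    and G :: "('j, 'u, ('b, 'n) module, 'n \<Rightarrow> 'n) ftor"
    and P :: "('b, 'n) module" and \<pi> :: "'j \<Rightarrow> 'n \<Rightarrow> 'n"
  assumes functor_G: "is_functor J (ordinary (Mod_cat B)) G"
    and cone: "is_cone J (ordinary (Mod_cat B)) G P \<pi>"
begin

lemma G_module: "j \<in> Ob J \<Longrightarrow> left_module B (fob G j)"
  using is_functor.fob_closed[OF functor_G] by simp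

lemma G_hom: "\<lbrakk>i \<in> Ob J; j \<in> Ob J; u \<in> Ar J i j\<rbrakk> \<Longrightarrow> far G i j u \<in> mod_hom B (fob G i) (fob G j)"
  using is_functor.far_closed[OF functor_G] by simp

lemma P_module: "left_module B P"
  using cone by (simp add: is_cone_def)

lemma \<pi>_hom: "j \<in> Ob J \<Longrightarrow> \<pi> j \<in> mod_hom B P (fob G j)"
  using cone by (simp add: is_cone_def)

lemma \<pi>_natural:
  assumes "i \<in> Ob J" "j \<in> Ob J" "u \<in> Ar J i j" "p \<in> carrier P"
  shows "far G i j u (\<pi> i p) = \<pi> j p"
proof -
  have "compose (carrier P) (far G i j u) (\<pi> i) = \<pi> j"
    using cone assms by (simp add: is_cone_def)
  then show ?thesis using assms(4) by (metis compose_eq)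
qed

lemma compatible_\<pi>: "p \<in> carrier P \<Longrightarrow> compatible_family J G (\<lambda>j. \<pi> j p)"
  by (auto simp: compatible_family_def \<pi>_natural mod_hom_closed[OF \<pi>_hom])

text \<open>The choice is made elementwise; uniqueness makes it linear, since both sides of each
  linearity equation have the same components.\<close>

lemma factor:
  fixes Q :: "('b, 'q, 'v) module_scheme"
  assumes lim: "elementwise_limit J G P \<pi>" and Q: "left_module B Q"
    and \<sigma>: "\<And>j. j \<in> Ob J \<Longrightarrow> \<sigma> j \<in> mod_hom B Q (fob G j)"
    and nat: "\<And>i j u q. \<lbrakk>i \<in> Ob J; j \<in> Ob J; u \<in> Ar J i j; q \<in> carrier Q\<rbrakk> \<Longrightarrow> far G i j u (\<sigma> i q) = \<sigma> j q"
  obtains h where "h \<in> mod_hom B Q P" "\<And>j q. \<lbrakk>j \<in> Ob J; q \<in> carrier Q\<rbrakk> \<Longrightarrow> \<pi> j (h q) = \<sigma> j q"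
proof -
  interpret Q: left_module B Q by fact
  interpret P: left_module B P by (rule P_module)
  have ex1: "\<exists>!p. p \<in> carrier P \<and> (\<forall>j\<in>Ob J. \<pi> j p = \<sigma> j q)" if "q \<in> carrier Q" for q
  proof -
    have "compatible_family J G (\<lambda>j. \<sigma> j q)"
      using that by (auto simp: compatible_family_def nat intro: mod_hom_closed[OF \<sigma>])
    with lim show ?thesis by (rule elementwise_limitD)
  qed
  define h where "h = (\<lambda>q\<in>carrier Q. THE p. p \<in> carrier P \<and> (\<forall>j\<in>Ob J. \<pi> j p = \<sigma> j q))"
  have h: "h q \<in> carrier P \<and> (\<forall>j\<in>Ob J. \<pi> j (h q) = \<sigma> j q)" if "q \<in> carrier Q" for q
    using theI'[OF ex1[OF that]] that by (simp add: h_def)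
  have uniq: "p = h q" if "q \<in> carrier Q" "p \<in> carrier P" "\<And>j. j \<in> Ob J \<Longrightarrow> \<pi> j p = \<sigma> j q" for p q
    using ex1[OF that(1)] h[OF that(1)] that(2,3) by blast
  have "h \<in> mod_hom B Q P"
  proof (rule mod_homI)
    show "h \<in> extensional (carrier Q)" by (simp add: h_def)
    show "h q \<in> carrier P" if "q \<in> carrier Q" for q using h[OF that] by simp
    fix q r assume qr: "q \<in> carrier Q" "r \<in> carrier Q"
    show "h (q \<oplus>\<^bsub>Q\<^esub> r) = h q \<oplus>\<^bsub>P\<^esub> h r"
      by (rule uniq[symmetric]) (use qr h in \<open>auto simp: mod_hom_add[OF \<pi>_hom] mod_hom_add[OF \<sigma>]\<close>)
  next
    fix b q assume bq: "b \<in> carrier B" "q \<in> carrier Q"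
    show "h (b \<odot>\<^bsub>Q\<^esub> q) = b \<odot>\<^bsub>P\<^esub> h q"
      by (rule uniq[symmetric])
        (use bq h in \<open>auto simp: mod_hom_smult[OF \<pi>_hom] mod_hom_smult[OF \<sigma>] Q.smult_closed P.smult_closed\<close>)
  qed
  then show ?thesis using that h by blast
qed

lemma elementwise_limit_unique:
  assumes "elementwise_limit J G P \<pi>" "p \<in> carrier P" "p' \<in> carrier P"
    and "\<And>j. j \<in> Ob J \<Longrightarrow> \<pi> j p = \<pi> j p'"
  shows "p = p'"
proof -
  have "\<exists>!q. q \<in> carrier P \<and> (\<forall>j\<in>Ob J. \<pi> j q = \<pi> j p)"
    using assms(1) compatible_\<pi>[OF assms(2)] by (rule elementwise_limitD)
  then show ?thesis using assms(2-4) by metis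
qed

lemma elementwise_imp_limit:
  assumes lim: "elementwise_limit J G P \<pi>"
  shows "is_limit J (ordinary (Mod_cat B)) G P \<pi>"
  unfolding is_limit_def
proof (intro conjI allI impI cone)
  fix Q \<sigma> assume "is_cone J (ordinary (Mod_cat B)) G Q \<sigma>"
  then interpret Q: module_cone B J G Q \<sigma> by (rule module_cone.intro[OF functor_G])
  obtain h where h: "h \<in> mod_hom B Q P" "\<And>j q. \<lbrakk>j \<in> Ob J; q \<in> carrier Q\<rbrakk> \<Longrightarrow> \<pi> j (h q) = \<sigma> j q"
    using factor[OF lim Q.P_module Q.\<pi>_hom Q.\<pi>_natural] by blast
  show "\<exists>!h. h \<in> Ar (ordinary (Mod_cat B)) Q P \<and>
      (\<forall>j\<in>Ob J. Cmp (ordinary (Mod_cat B)) Q P (fob G j) (\<pi> j) h = \<sigma> j)"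
  proof (rule ex1I[of _ h])
    have "compose (carrier Q) (\<pi> j) h = \<sigma> j" if "j \<in> Ob J" for j
      by (rule mod_hom_eqI[OF mod_hom_comp[OF Q.P_module h(1) \<pi>_hom[OF that]] Q.\<pi>_hom[OF that]])
        (use h(2)[OF that] in \<open>simp add: compose_eq\<close>)
    then show "h \<in> Ar (ordinary (Mod_cat B)) Q P \<and>
        (\<forall>j\<in>Ob J. Cmp (ordinary (Mod_cat B)) Q P (fob G j) (\<pi> j) h = \<sigma> j)"
      using h(1) by simp
  next
    fix k assume k: "k \<in> Ar (ordinary (Mod_cat B)) Q P \<and>
        (\<forall>j\<in>Ob J. Cmp (ordinary (Mod_cat B)) Q P (fob G j) (\<pi> j) k = \<sigma> j)"
    then have k': "k \<in> mod_hom B Q P" by simp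
    have kj: "\<pi> j (k q) = \<sigma> j q" if "j \<in> Ob J" "q \<in> carrier Q" for j q
    proof -
      have "compose (carrier Q) (\<pi> j) k = \<sigma> j" using k that(1) by simp
      then show ?thesis using that(2) by (metis compose_eq)
    qed
    show "k = h"
    proof (rule mod_hom_eqI[OF k' h(1)])
      fix q assume q: "q \<in> carrier Q"
      show "k q = h q"
        by (rule elementwise_limit_unique[OF lim]) (use q k' h kj in \<open>auto intro: mod_hom_closed\<close>)
    qed
  qed
qed

end

text \<open>For an infinite type the square has the same cardinality, so coordinates can be absorbed
  one at a time. This gives room in the type for a module whose elements are families.\<close>

lemma inj_PiE_infinite:
  assumes "finite I"
  shows "\<exists>e :: ('i \<Rightarrow> 'n::infinite) \<Rightarrow> 'n. inj_on e (I \<rightarrow>\<^sub>E UNIV)"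
  using assms
proof (induction I)
  case empty
  then show ?case by (auto simp: inj_on_def)
next
  case (insert i I)
  obtain e :: "('i \<Rightarrow> 'n) \<Rightarrow> 'n" where e: "inj_on e (I \<rightarrow>\<^sub>E UNIV)" using insert by blast
  obtain p :: "'n \<times> 'n \<Rightarrow> 'n" where p: "inj p"
    using card_of_Times_same_infinite[OF infinite_UNIV[where 'a = 'n]]
    unfolding UNIV_Times_UNIV card_of_ordIso[symmetric] by (auto simp: bij_betw_def)
  have "inj_on (\<lambda>y. p (y i, e (restrict y I))) (insert i I \<rightarrow>\<^sub>E UNIV)"
  proof (rule inj_onI)
    fix y y' :: "'i \<Rightarrow> 'n"
    assume y: "y \<in> insert i I \<rightarrow>\<^sub>E UNIV" "y' \<in> insert i I \<rightarrow>\<^sub>E UNIV"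
      and "p (y i, e (restrict y I)) = p (y' i, e (restrict y' I))"
    then have i: "y i = y' i" and "e (restrict y I) = e (restrict y' I)"
      using p by (auto dest: injD)
    then have r: "restrict y I = restrict y' I"
      by (intro inj_onD[OF e]) auto
    show "y = y'"
    proof (rule PiE_ext[OF y])
      fix k assume "k \<in> insert i I"
      then show "y k = y' k" using i fun_cong[OF r, of k] by (auto split: if_splits)
    qed
  qed
  then show ?case by blast
qed

text \<open>The submodule of the product of the \<open>G j\<close> consisting of the compatible families has a copy
  with carrier in \<^typ>\<open>'n\<close>; testing the universal property on it gives the elementwise statement.\<close>

lemma (in module_cone) limit_imp_elementwise:
  fixes e :: "('j \<Rightarrow> 'n) \<Rightarrow> 'n"
  assumes lim: "is_limit J (ordinary (Mod_cat B)) G P \<pi>"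
    and e: "inj_on e (Ob J \<rightarrow>\<^sub>E UNIV)"
  shows "elementwise_limit J G P \<pi>"
proof -
  define K where "K = {y \<in> extensional (Ob J). compatible_family J G y}"
  define d where "d = inv_into K e"
  have KE: "K \<subseteq> Ob J \<rightarrow>\<^sub>E UNIV" by (auto simp: K_def PiE_def)
  have de: "d (e y) = y" if "y \<in> K" for y
    unfolding d_def using inj_on_subset[OF e KE] that by (rule inv_into_f_f)
  define plus where "plus y y' = (\<lambda>j\<in>Ob J. y j \<oplus>\<^bsub>fob G j\<^esub> y' j)" for y y'
  define scale where "scale b y = (\<lambda>j\<in>Ob J. b \<odot>\<^bsub>fob G j\<^esub> y j)" for b and y :: "'j \<Rightarrow> 'n"
  define null where "null = (\<lambda>j\<in>Ob J. \<zero>\<^bsub>fob G j\<^esub>)"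
  define S :: "('b, 'n) module" where "S = \<lparr>carrier = e ` K, mult = undefined, one = undefined, zero = e null,
      add = (\<lambda>s t. e (plus (d s) (d t))), smult = (\<lambda>b s. e (scale b (d s)))\<rparr>"
  have Kj: "y j \<in> carrier (fob G j)" if "y \<in> K" "j \<in> Ob J" for y j
    using that by (auto simp: K_def compatible_family_def)
  have Ku: "far G i j u (y i) = y j" if "y \<in> K" "i \<in> Ob J" "j \<in> Ob J" "u \<in> Ar J i j" for y i j u
    using that by (auto simp: K_def compatible_family_def)
  note ab = left_module.abelian_group[OF G_module]
  note [simp] = abelian_groupE(1,2)[OF ab] left_module.smult_closed[OF G_module]
  have KI: "restrict y (Ob J) \<in> K"
    if "\<And>j. j \<in> Ob J \<Longrightarrow> y j \<in> carrier (fob G j)"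
      "\<And>i j u. \<lbrakk>i \<in> Ob J; j \<in> Ob J; u \<in> Ar J i j\<rbrakk> \<Longrightarrow> far G i j u (y i) = y j" for y
    using that by (simp add: K_def compatible_family_def)
  have plusK: "plus y y' \<in> K" if "y \<in> K" "y' \<in> K" for y y'
    unfolding plus_def
    by (rule KI) (use that in \<open>simp_all add: Kj Ku mod_hom_add[OF G_hom]\<close>)
  have scaleK: "scale b y \<in> K" if "b \<in> carrier B" "y \<in> K" for b y
    unfolding scale_def
    by (rule KI) (use that in \<open>simp_all add: Kj Ku mod_hom_smult[OF G_hom]\<close>)
  have nullK: "null \<in> K"
    unfolding null_def
    by (rule KI) (simp_all add: additive_zero[OF ab ab mod_hom_additive[OF G_hom]])
  have Kext: "y = y'" if "y \<in> K" "y' \<in> K" "\<And>j. j \<in> Ob J \<Longrightarrow> y j = y' j" for y y'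
    using that by (intro extensionalityI[of _ "Ob J"]) (auto simp: K_def)
  have S: "left_module B S"
  proof (intro left_module.intro left_module_axioms.intro)
    show "ring B" using P_module by (simp add: left_module_def)
    show "abelian_group S"
    proof (rule abelian_groupI; unfold S_def; simp; (elim imageE)?)
      show "e null \<in> e ` K" using nullK by blast
    next
      fix s t y y' assume "s = e y" "y \<in> K" "t = e y'" "y' \<in> K"
      then show "e (plus (d s) (d t)) \<in> e ` K" by (simp add: de plusK)
    next
      fix s t r y1 y2 y3 assume *: "s = e y1" "y1 \<in> K" "t = e y2" "y2 \<in> K" "r = e y3" "y3 \<in> K"
      have "plus (plus y1 y2) y3 = plus y1 (plus y2 y3)"
        using * by (intro Kext plusK) (auto simp: plus_def Kj abelian_groupE(3)[OF ab])
      then show "e (plus (d (e (plus (d s) (d t)))) (d r)) = e (plus (d s) (d (e (plus (d t) (d r)))))"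
        using * by (simp add: de plusK)
    next
      fix s t y1 y2 assume *: "s = e y1" "y1 \<in> K" "t = e y2" "y2 \<in> K"
      have "plus y1 y2 = plus y2 y1"
        using * by (intro Kext plusK) (auto simp: plus_def Kj abelian_groupE(4)[OF ab])
      then show "e (plus (d s) (d t)) = e (plus (d t) (d s))" using * by (simp add: de)
    next
      fix s y assume *: "s = e y" "y \<in> K"
      have "plus null y = y"
        using * by (intro Kext plusK nullK) (auto simp: plus_def null_def Kj abelian_groupE(5)[OF ab])
      then show "e (plus (d (e null)) (d s)) = s" using * by (simp add: de nullK)
    next
      fix s y assume *: "s = e y" "y \<in> K"
      \<comment> \<open>Negation is scaling by -1, so compatibility of the negated family comes from
        \<open>scaleK\<close>.\<close>
      define v where "v = scale (\<ominus>\<^bsub>B\<^esub> \<one>\<^bsub>B\<^esub>) y"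
      interpret P: left_module B P by (rule P_module)
      have v: "v \<in> K" unfolding v_def using * by (intro scaleK) auto
      have "plus v y = null"
      proof (intro Kext plusK nullK v *)
        fix j assume j: "j \<in> Ob J"
        interpret Gj: left_module B "fob G j" by (rule G_module[OF j])
        have "(\<ominus>\<^bsub>B\<^esub> \<one>\<^bsub>B\<^esub>) \<odot>\<^bsub>fob G j\<^esub> y j \<oplus>\<^bsub>fob G j\<^esub> \<one>\<^bsub>B\<^esub> \<odot>\<^bsub>fob G j\<^esub> y j = \<zero>\<^bsub>fob G j\<^esub>"
          using Kj[OF *(2) j] by (subst Gj.smult_l_distr[symmetric]) (auto simp: P.B.l_neg Gj.smult_zero_left)
        then show "plus v y j = null j"
          using j Kj[OF *(2) j] by (simp add: plus_def null_def v_def scale_def Gj.smult_one)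
      qed
      then show "\<exists>t\<in>K. e (plus (d (e t)) (d s)) = e null"
        using * v by (intro bexI[of _ v]) (auto simp: de)
    qed
    show "b \<odot>\<^bsub>S\<^esub> s \<in> carrier S" if "b \<in> carrier B" "s \<in> carrier S" for b s
      using that by (auto simp: S_def de scaleK)
    show "(b \<oplus>\<^bsub>B\<^esub> c) \<odot>\<^bsub>S\<^esub> s = b \<odot>\<^bsub>S\<^esub> s \<oplus>\<^bsub>S\<^esub> c \<odot>\<^bsub>S\<^esub> s"
      if "b \<in> carrier B" "c \<in> carrier B" "s \<in> carrier S" for b c s
      using that by (auto simp: S_def de scaleK intro!: arg_cong[where f = e])
        (auto simp: scale_def plus_def Kj left_module.smult_l_distr[OF G_module])
    show "b \<odot>\<^bsub>S\<^esub> (s \<oplus>\<^bsub>S\<^esub> t) = b \<odot>\<^bsub>S\<^esub> s \<oplus>\<^bsub>S\<^esub> b \<odot>\<^bsub>S\<^esub> t"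
      if "b \<in> carrier B" "s \<in> carrier S" "t \<in> carrier S" for b s t
      using that by (auto simp: S_def de scaleK plusK intro!: arg_cong[where f = e])
        (auto simp: scale_def plus_def Kj left_module.smult_r_distr[OF G_module])
    show "(b \<otimes>\<^bsub>B\<^esub> c) \<odot>\<^bsub>S\<^esub> s = b \<odot>\<^bsub>S\<^esub> (c \<odot>\<^bsub>S\<^esub> s)"
      if "b \<in> carrier B" "c \<in> carrier B" "s \<in> carrier S" for b c s
      using that by (auto simp: S_def de scaleK plusK intro!: arg_cong[where f = e])
        (auto simp: scale_def Kj left_module.smult_assoc[OF G_module])
    show "\<one>\<^bsub>B\<^esub> \<odot>\<^bsub>S\<^esub> s = s" if s: "s \<in> carrier S" for s
    proof -
      interpret P: left_module B P by (rule P_module)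
      obtain y where y: "s = e y" "y \<in> K" using s by (auto simp: S_def)
      have "scale \<one>\<^bsub>B\<^esub> y = y"
        using y by (intro Kext scaleK) (auto simp: scale_def Kj left_module.smult_one[OF G_module])
      then show ?thesis using y by (simp add: S_def de)
    qed
  qed
  define \<sigma> where "\<sigma> j = (\<lambda>s\<in>carrier S. d s j)" for j
  have \<sigma>_hom: "\<sigma> j \<in> mod_hom B S (fob G j)" if "j \<in> Ob J" for j
  proof -
    interpret S: left_module B S by (rule S)
    show ?thesis unfolding \<sigma>_def
    proof (rule mod_homI)
      show "restrict (\<lambda>s. d s j) (carrier S) x \<in> carrier (fob G j)" if "x \<in> carrier S" for x
        using that Kj \<open>j \<in> Ob J\<close> by (auto simp: S_def de)
      show "restrict (\<lambda>s. d s j) (carrier S) (x \<oplus>\<^bsub>S\<^esub> y)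
          = restrict (\<lambda>s. d s j) (carrier S) x \<oplus>\<^bsub>fob G j\<^esub> restrict (\<lambda>s. d s j) (carrier S) y"
        if xy: "x \<in> carrier S" "y \<in> carrier S" for x y
      proof -
        have "d (x \<oplus>\<^bsub>S\<^esub> y) j = d x j \<oplus>\<^bsub>fob G j\<^esub> d y j"
          using xy \<open>j \<in> Ob J\<close> by (auto simp: S_def de plusK) (simp add: plus_def)
        then show ?thesis using xy S.M.a_closed[OF xy] by simp
      qed
      show "restrict (\<lambda>s. d s j) (carrier S) (b \<odot>\<^bsub>S\<^esub> x) = b \<odot>\<^bsub>fob G j\<^esub> restrict (\<lambda>s. d s j) (carrier S) x"
        if xb: "b \<in> carrier B" "x \<in> carrier S" for b x
      proof -
        have "d (b \<odot>\<^bsub>S\<^esub> x) j = b \<odot>\<^bsub>fob G j\<^esub> d x j"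
          using xb \<open>j \<in> Ob J\<close> by (auto simp: S_def de scaleK) (simp add: scale_def)
        then show ?thesis using xb S.smult_closed[OF xb] by simp
      qed
    qed simp
  qed
  have "is_cone J (ordinary (Mod_cat B)) G S \<sigma>"
    unfolding is_cone_def
  proof (intro conjI ballI; simp)
    show "left_module B S" by (rule S)
    show "\<sigma> j \<in> mod_hom B S (fob G j)" if "j \<in> Ob J" for j by (rule \<sigma>_hom[OF that])
    show "compose (carrier S) (far G i j u) (\<sigma> i) = \<sigma> j"
      if "i \<in> Ob J" "j \<in> Ob J" "u \<in> Ar J i j" for i j u
      using that Ku by (auto simp: compose_def \<sigma>_def S_def de fun_eq_iff)
  qed
  then have "\<exists>!h. h \<in> mod_hom B S P \<and> (\<forall>j\<in>Ob J. compose (carrier S) (\<pi> j) h = \<sigma> j)"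
    using lim unfolding is_limit_def by simp
  then obtain h where h: "h \<in> mod_hom B S P" and h\<sigma>: "\<And>j. j \<in> Ob J \<Longrightarrow> compose (carrier S) (\<pi> j) h = \<sigma> j"
    by blast
  have hj: "\<pi> j (h (e y)) = y j" if "y \<in> K" "j \<in> Ob J" for y j
  proof -
    have "e y \<in> carrier S" using that by (simp add: S_def)
    then show ?thesis using fun_cong[OF h\<sigma>[OF that(2)], of "e y"] that by (simp add: compose_eq \<sigma>_def de)
  qed
  define k where "k = (\<lambda>p\<in>carrier P. e (\<lambda>j\<in>Ob J. \<pi> j p))"
  interpret P: left_module B P by (rule P_module)
  have \<pi>K: "(\<lambda>j\<in>Ob J. \<pi> j p) \<in> K" if "p \<in> carrier P" for p
    using compatible_\<pi>[OF that] by (auto simp: K_def compatible_family_def)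
  have k: "k \<in> mod_hom B P S"
  proof (rule mod_homI)
    show "k p \<in> carrier S" if "p \<in> carrier P" for p
      using that \<pi>K by (simp add: k_def S_def)
    show "k (p \<oplus>\<^bsub>P\<^esub> q) = k p \<oplus>\<^bsub>S\<^esub> k q" if "p \<in> carrier P" "q \<in> carrier P" for p q
      using that by (auto simp: k_def S_def de \<pi>K plus_def mod_hom_add[OF \<pi>_hom] intro!: arg_cong[where f = e])
    show "k (b \<odot>\<^bsub>P\<^esub> p) = b \<odot>\<^bsub>S\<^esub> k p" if "b \<in> carrier B" "p \<in> carrier P" for b p
      using that by (auto simp: k_def S_def de \<pi>K scale_def mod_hom_smult[OF \<pi>_hom] P.smult_closed
          intro!: arg_cong[where f = e])
  qed (simp add: k_def)
  \<comment> \<open>Existence comes from \<open>h\<close>, which realizes every compatible family.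
    For uniqueness, \<open>h\<close> after \<open>k\<close> and the identity are endomorphisms of P
    that commute with all \<pi> j, hence equal; so an element is recovered from its
    components.\<close>
  have "compose (carrier P) h k = (\<lambda>p\<in>carrier P. p)"
  proof -
    have "\<exists>!f. f \<in> mod_hom B P P \<and> (\<forall>j\<in>Ob J. compose (carrier P) (\<pi> j) f = \<pi> j)"
      using lim cone unfolding is_limit_def by simp
    moreover have "compose (carrier P) (\<pi> j) (compose (carrier P) h k) = \<pi> j" if "j \<in> Ob J" for j
      by (rule mod_hom_eqI[OF mod_hom_comp[OF P_module mod_hom_comp[OF P_module k h] \<pi>_hom[OF that]] \<pi>_hom[OF that]])
        (use that \<pi>K in \<open>simp add: compose_eq k_def hj\<close>)
    moreover have "compose (carrier P) (\<pi> j) (\<lambda>p\<in>carrier P. p) = \<pi> j" if "j \<in> Ob J" for j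
      by (rule compose_Id) (use \<pi>_hom[OF that] in \<open>auto simp: mod_homD\<close>)
    ultimately show ?thesis
      using mod_hom_comp[OF P_module k h] mod_hom_id[OF P_module] by blast
  qed
  then have hk: "h (e (\<lambda>j\<in>Ob J. \<pi> j p)) = p" if "p \<in> carrier P" for p
    using that by (metis compose_eq k_def restrict_apply')
  show ?thesis
    unfolding elementwise_limit_def
  proof (intro allI impI)
    fix y assume y: "compatible_family J G y"
    let ?y = "restrict y (Ob J)"
    have yK: "?y \<in> K" using y by (auto simp: K_def compatible_family_def)
    show "\<exists>!p. p \<in> carrier P \<and> (\<forall>j\<in>Ob J. \<pi> j p = y j)"
    proof (rule ex1I[of _ "h (e ?y)"])
      show "h (e ?y) \<in> carrier P \<and> (\<forall>j\<in>Ob J. \<pi> j (h (e ?y)) = y j)"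
        using hj[OF yK] yK mod_hom_closed[OF h, of "e ?y"] by (simp add: S_def)
      fix p assume "p \<in> carrier P \<and> (\<forall>j\<in>Ob J. \<pi> j p = y j)"
      then have p: "p \<in> carrier P" and "(\<lambda>j\<in>Ob J. \<pi> j p) = ?y" by auto
      then show "p = h (e ?y)" using hk[OF p] by simp
    qed
  qed
qed

section \<open>Preservation of finite limits\<close>

context cofiltered_fibre_functor
begin

text \<open>Each equation costs one refinement, and equations already achieved persist under further
  refinement. The modules may vary with the index while the element (X, x) is shared.\<close>

lemma theta_eq_finite:
  assumes "finite K" and X: "elt X x"
    and "\<And>t. t \<in> K \<Longrightarrow> left_module B (M t) \<and> h t \<in> mod_hom B (W X) (M t) \<and> k t \<in> mod_hom B (W X) (M t)
      \<and> theta (M t) X x (h t) = theta (M t) X x (k t)"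
  obtains Z z f where "elt_arrow Z z X x f"
    "\<And>t y. \<lbrakk>t \<in> K; y \<in> carrier (W Z)\<rbrakk> \<Longrightarrow> h t (far w Z X f y) = k t (far w Z X f y)"
  using assms(1,3)
proof (induction K arbitrary: thesis)
  case empty
  then show ?case using elt_arrow_id[OF X] by blast
next
  case (insert s K)
  obtain Z z f where f: "elt_arrow Z z X x f"
    "\<And>t y. \<lbrakk>t \<in> K; y \<in> carrier (W Z)\<rbrakk> \<Longrightarrow> h t (far w Z X f y) = k t (far w Z X f y)"
    using insert.IH insert.prems(2) by blast
  have s: "left_module B (M s)" "h s \<in> mod_hom B (W X) (M s)" "k s \<in> mod_hom B (W X) (M s)"
    "theta (M s) X x (h s) = theta (M s) X x (k s)"
    using insert.prems(2) by blast+
  have Z: "elt Z z" using f(1) by (simp add: elt_arrow_def)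
  have "theta (M s) Z z (compose (carrier (W Z)) (h s) (far w Z X f))
      = theta (M s) Z z (compose (carrier (W Z)) (k s) (far w Z X f))"
    using theta_pull(2)[OF s(1) f(1) s(2)] theta_pull(2)[OF s(1) f(1) s(3)] s(4) by simp
  then obtain Q q g where g: "elt_arrow Q q Z z g"
    and eq: "\<And>y. y \<in> carrier (W Q) \<Longrightarrow> compose (carrier (W Z)) (h s) (far w Z X f) (far w Q Z g y)
      = compose (carrier (W Z)) (k s) (far w Z X f) (far w Q Z g y)"
    using theta_eqD[OF s(1) Z theta_pull(1)[OF s(1) f(1) s(2)] theta_pull(1)[OF s(1) f(1) s(3)]] by blast
  have gy: "far w Q Z g y \<in> carrier (W Z)" "far w Q X (LCmp A Q Z X f g) y = far w Z X f (far w Q Z g y)"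
    if "y \<in> carrier (W Q)" for y
    using g f(1) that by (auto simp: elt_arrow_def elt_def far_W_closed far_comp)
  show ?case
  proof (rule insert.prems(1)[OF elt_arrow_comp[OF g f(1)]])
    fix t y assume "t \<in> insert s K" "y \<in> carrier (W Q)"
    then show "h t (far w Q X (LCmp A Q Z X f g) y) = k t (far w Q X (LCmp A Q Z X f g) y)"
      using f(2)[OF _ gy(1)] eq[of y] by (auto simp: gy compose_eq)
  qed
qed

text \<open>Each tensor is written as a theta at its own element, and a cone over these finitely
  many elements moves all of them to one place.\<close>

lemma theta_common:
  assumes "finite K" "\<And>t. t \<in> K \<Longrightarrow> left_module B (M t) \<and> s t \<in> carrier (T (M t))"
  obtains Z z h where "elt Z z" "\<And>t. t \<in> K \<Longrightarrow> h t \<in> mod_hom B (W Z) (M t)"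
    "\<And>t. t \<in> K \<Longrightarrow> s t = theta (M t) Z z (h t)"
proof -
  have "\<forall>t\<in>K. \<exists>X x h. elt X x \<and> h \<in> mod_hom B (W X) (M t) \<and> s t = theta (M t) X x h"
    using assms(2) theta_cases by metis
  then obtain X x h where h: "\<And>t. t \<in> K \<Longrightarrow> elt (X t) (x t) \<and> h t \<in> mod_hom B (W (X t)) (M t)
      \<and> s t = theta (M t) (X t) (x t) (h t)"
    by metis
  obtain Z z a where Z: "elt Z z" "\<And>t. t \<in> K \<Longrightarrow> elt_arrow Z z (X t) (x t) (a t)"
    using elt_cone[OF assms(1), of X x] h by metis
  show ?thesis
  proof (rule that[OF Z(1), of "\<lambda>t. compose (carrier (W Z)) (h t) (far w Z (X t) (a t))"])
    fix t assume t: "t \<in> K"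
    note P = theta_pull[OF conjunct1[OF assms(2)[OF t]] Z(2)[OF t], of "h t"]
    show "compose (carrier (W Z)) (h t) (far w Z (X t) (a t)) \<in> mod_hom B (W Z) (M t)"
      "s t = theta (M t) Z z (compose (carrier (W Z)) (h t) (far w Z (X t) (a t)))"
      using P h[OF t] by simp_all
  qed
qed

text \<open>The commutation of filtered colimits with finite limits, made explicit. A compatible
  family of tensors is represented at one element; since the diagram has finitely many arrows, one
  refinement turns it into a compatible family of homomorphisms, and these factor through P.\<close>

theorem preserves_finite_limits_L:
  "preserves_finite_limits (ordinary (Mod_cat B :: (('b, 'n::infinite) module, 'n \<Rightarrow> 'n, 'r) lin_cat))
    (ordinary (Mod_cat B)) (tensor_functor B L)"
  unfolding preserves_finite_limits_def
proof (intro conjI allI impI is_functor_tensor[OF bimod_L]; elim conjE)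
  fix J :: "(nat, nat) cat" and G :: "(nat, nat, ('b, 'n) module, 'n \<Rightarrow> 'n) ftor" and P \<pi>
  assume J: "finite_category J" and G: "is_functor J (ordinary (Mod_cat B)) G"
    and lim: "is_limit J (ordinary (Mod_cat B)) G P \<pi>"
  have finJ: "finite (Ob J)" and finA: "\<And>i j. \<lbrakk>i \<in> Ob J; j \<in> Ob J\<rbrakk> \<Longrightarrow> finite (Ar J i j)"
    using J by (auto simp: finite_category_def)
  interpret P: module_cone B J G P \<pi>
    using G lim by (intro module_cone.intro) (simp_all add: is_limit_def)
  obtain e :: "(nat \<Rightarrow> 'n) \<Rightarrow> 'n" where e: "inj_on e (Ob J \<rightarrow>\<^sub>E UNIV)"
    using inj_PiE_infinite[OF finJ] by blast
  have el: "elementwise_limit J G P \<pi>" by (rule P.limit_imp_elementwise[OF lim e])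
  let ?F = "tensor_functor B L" and ?M = "ordinary (Mod_cat B)"
  let ?G = "comp_functor ?F G" and ?\<pi> = "\<lambda>j. far ?F P (fob G j) (\<pi> j)"
  have fob: "fob ?G j = T (fob G j)" "fob ?F P = T P" for j
    by (simp_all add: comp_functor_def tensor_functor_def)
  have far: "far ?G i j u = tensor_map B L (fob G i) (fob G j) (far G i j u)" for i j u
    by (simp add: comp_functor_def tensor_functor_def)
  have \<pi>: "?\<pi> j = tensor_map B L P (fob G j) (\<pi> j)" for j
    by (simp add: tensor_functor_def)
  interpret F: is_functor ?M ?M ?F by (rule is_functor_tensor[OF bimod_L])
  interpret G: is_functor J ?M G by (rule G)
  have FG: "is_functor J ?M ?G"
  proof (intro is_functor.intro is_functor_axioms.intro)
    show "category J" "category ?M" by unfold_locales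
  qed (auto simp: comp_functor_def F.fob_closed[simplified] G.fob_closed[simplified] F.far_closed[simplified]
      G.far_closed[simplified] G.far_Idn F.far_Idn[simplified] G.far_Cmp F.far_Cmp[simplified])
  have "is_cone J ?M ?G (fob ?F P) ?\<pi>"
    unfolding is_cone_def
  proof (intro conjI ballI)
    fix i j u assume ij: "i \<in> Ob J" "j \<in> Ob J" "u \<in> Ar J i j"
    have "compose (carrier P) (far G i j u) (\<pi> i) = \<pi> j"
      using P.cone ij by (simp add: is_cone_def)
    then show "Cmp ?M (fob ?F P) (fob ?G i) (fob ?G j) (far ?G i j u) (?\<pi> i) = ?\<pi> j"
      using F.far_Cmp[of P "fob G i" "fob G j" "\<pi> i" "far G i j u"] ij
        P.P_module P.G_module P.\<pi>_hom P.G_hom by (simp add: comp_functor_def)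
  qed (use P.P_module P.G_module P.\<pi>_hom in \<open>simp_all add: fob \<pi> T_module tensor_map_hom\<close>)
  then interpret Q: module_cone B J ?G "fob ?F P" ?\<pi>
    by (rule module_cone.intro[OF FG])
  show "is_limit J ?M ?G (fob ?F P) ?\<pi>"
  proof (rule Q.elementwise_imp_limit, unfold elementwise_limit_def, intro allI impI)
    fix t assume "compatible_family J ?G t"
    then have tc: "\<And>j. j \<in> Ob J \<Longrightarrow> t j \<in> carrier (T (fob G j))"
      and tu: "\<And>i j u. \<lbrakk>i \<in> Ob J; j \<in> Ob J; u \<in> Ar J i j\<rbrakk>
        \<Longrightarrow> tensor_map B L (fob G i) (fob G j) (far G i j u) (t i) = t j"
      by (simp_all add: compatible_family_def fob far)
    obtain Z z h where Z: "elt Z z" and h: "\<And>j. j \<in> Ob J \<Longrightarrow> h j \<in> mod_hom B (W Z) (fob G j)"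
      and th: "\<And>j. j \<in> Ob J \<Longrightarrow> t j = theta (fob G j) Z z (h j)"
      using theta_common[OF finJ, of "fob G" t] P.G_module tc by metis
    have Z': "Z \<in> LOb A" "z \<in> carrier (W Z)" using Z by (auto simp: elt_def)
    \<comment> \<open>One equation per arrow u from i to j, between G(u) after \<open>h i\<close>
      and \<open>h j\<close>. Compatibility of the tensors only says that the two sides have equal
      thetas at this stage.\<close>
    let ?K = "SIGMA i:Ob J. SIGMA j:Ob J. Ar J i j"
    let ?Mt = "\<lambda>t. fob G (fst (snd t))" and ?hr = "\<lambda>t. h (fst (snd t))"
    let ?hl = "\<lambda>t. compose (carrier (W Z)) (far G (fst t) (fst (snd t)) (snd (snd t))) (h (fst t))"
    have finK: "finite ?K" using finJ finA by (intro finite_SigmaI)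
    have H: "left_module B (fob G j) \<and> compose (carrier (W Z)) (far G i j u) (h i) \<in> mod_hom B (W Z) (fob G j)
        \<and> h j \<in> mod_hom B (W Z) (fob G j)
        \<and> theta (fob G j) Z z (compose (carrier (W Z)) (far G i j u) (h i)) = theta (fob G j) Z z (h j)"
      if ij: "i \<in> Ob J" "j \<in> Ob J" "u \<in> Ar J i j" for i j u
      using tensor_map_theta[OF P.G_module[OF ij(1)] P.G_module[OF ij(2)] P.G_hom[OF ij] Z' h[OF ij(1)]]
        tu[OF ij] ij by (simp add: P.G_module h th mod_hom_comp[OF W_module[OF Z'(1)] h P.G_hom])
    have K: "left_module B (?Mt t) \<and> ?hl t \<in> mod_hom B (W Z) (?Mt t) \<and> ?hr t \<in> mod_hom B (W Z) (?Mt t)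
        \<and> theta (?Mt t) Z z (?hl t) = theta (?Mt t) Z z (?hr t)" if t: "t \<in> ?K" for t
    proof -
      obtain i j u where "t = (i, j, u)" "i \<in> Ob J" "j \<in> Ob J" "u \<in> Ar J i j" using t by auto
      then show ?thesis using H[of i j u] by simp
    qed
    obtain Y y f where f: "elt_arrow Y y Z z f"
      and eq': "\<And>t v. \<lbrakk>t \<in> ?K; v \<in> carrier (W Y)\<rbrakk> \<Longrightarrow> ?hl t (far w Y Z f v) = ?hr t (far w Y Z f v)"
      using theta_eq_finite[OF finK Z, of ?Mt ?hl ?hr, OF K] by blast
    have eq: "compose (carrier (W Z)) (far G i j u) (h i) (far w Y Z f v) = h j (far w Y Z f v)"
      if "i \<in> Ob J" "j \<in> Ob J" "u \<in> Ar J i j" "v \<in> carrier (W Y)" for i j u v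
      using eq'[of "(i, j, u)" v] that by simp
    have Y: "elt Y y" "Y \<in> LOb A" "y \<in> carrier (W Y)" using f by (auto simp: elt_arrow_def elt_def)
    let ?h = "\<lambda>j. compose (carrier (W Y)) (h j) (far w Y Z f)"
    have fv: "far w Y Z f v \<in> carrier (W Z)" if "v \<in> carrier (W Y)" for v
      using f that by (auto simp: elt_arrow_def elt_def far_W_closed)
    have hh: "?h j \<in> mod_hom B (W Y) (fob G j)" "t j = theta (fob G j) Y y (?h j)" if "j \<in> Ob J" for j
      using theta_pull[OF P.G_module[OF that] f h[OF that]] th[OF that] by auto
    have nat: "far G i j u (?h i v) = ?h j v" if "i \<in> Ob J" "j \<in> Ob J" "u \<in> Ar J i j" "v \<in> carrier (W Y)" for i j u v
      using eq[OF that] fv[OF that(4)] that(4) by (simp add: compose_eq)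
    obtain k where k: "k \<in> mod_hom B (W Y) P" "\<And>j v. \<lbrakk>j \<in> Ob J; v \<in> carrier (W Y)\<rbrakk> \<Longrightarrow> \<pi> j (k v) = ?h j v"
      by (rule P.factor[OF el W_module[OF Y(2)], of ?h]) (use hh nat in auto)
    have kj: "compose (carrier (W Y)) (\<pi> j) k = ?h j" if "j \<in> Ob J" for j
      by (rule mod_hom_eqI[OF mod_hom_comp[OF W_module[OF Y(2)] k(1) P.\<pi>_hom[OF that]] hh(1)[OF that]])
        (use k(2)[OF that] in \<open>simp add: compose_eq\<close>)
    show "\<exists>!p. p \<in> carrier (fob ?F P) \<and> (\<forall>j\<in>Ob J. ?\<pi> j p = t j)"
    proof (rule ex1I[of _ "theta P Y y k"])
      show "theta P Y y k \<in> carrier (fob ?F P) \<and> (\<forall>j\<in>Ob J. ?\<pi> j (theta P Y y k) = t j)"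
        using theta_closed[OF P.P_module Y(2,3) k(1)]
          tensor_map_theta[OF P.P_module P.G_module P.\<pi>_hom Y(2,3) k(1)] kj hh(2)
        by (simp add: fob \<pi>)
    next
      fix s assume "s \<in> carrier (fob ?F P) \<and> (\<forall>j\<in>Ob J. ?\<pi> j s = t j)"
      then have s: "s \<in> carrier (T P)" and sj: "\<And>j. j \<in> Ob J \<Longrightarrow> tensor_map B L P (fob G j) (\<pi> j) s = t j"
        by (auto simp: fob \<pi>)
      \<comment> \<open>Uniqueness: \<open>s\<close> and the candidate are represented over one
        element, where their projections to each \<open>fob G j\<close> have equal thetas. On a
        further refinement the two homomorphisms into P agree componentwise, hence agree.\<close>
      obtain X x g where X: "elt X x" and g: "g \<in> mod_hom B (W X) P" and sg: "s = theta P X x g"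
        by (rule theta_cases[OF P.P_module s])
      obtain V v a b where a: "elt_arrow V v X x a" and b: "elt_arrow V v Y y b"
        using elt_span[OF X Y(1)] by blast
      let ?g = "compose (carrier (W V)) g (far w V X a)" and ?k = "compose (carrier (W V)) k (far w V Y b)"
      note g' = theta_pull[OF P.P_module a g] and k' = theta_pull[OF P.P_module b k(1)]
      have V: "elt V v" "V \<in> LOb A" "v \<in> carrier (W V)" using a by (auto simp: elt_arrow_def elt_def)
      have "left_module B (fob G j) \<and> compose (carrier (W V)) (\<pi> j) ?g \<in> mod_hom B (W V) (fob G j)
          \<and> compose (carrier (W V)) (\<pi> j) ?k \<in> mod_hom B (W V) (fob G j)
          \<and> theta (fob G j) V v (compose (carrier (W V)) (\<pi> j) ?g) = theta (fob G j) V v (compose (carrier (W V)) (\<pi> j) ?k)"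
        if j: "j \<in> Ob J" for j
      proof -
        have "theta (fob G j) V v (compose (carrier (W V)) (\<pi> j) ?g) = t j"
          using tensor_map_theta[OF P.P_module P.G_module[OF j] P.\<pi>_hom[OF j] V(2,3) g'(1)] sj[OF j] sg g'(2) by simp
        moreover have "theta (fob G j) V v (compose (carrier (W V)) (\<pi> j) ?k) = t j"
          using tensor_map_theta[OF P.P_module P.G_module[OF j] P.\<pi>_hom[OF j] V(2,3) k'(1)] k'(2)
            tensor_map_theta[OF P.P_module P.G_module[OF j] P.\<pi>_hom[OF j] Y(2,3) k(1)] kj[OF j] hh(2)[OF j] by simp
        ultimately show ?thesis
          using P.G_module[OF j] mod_hom_comp[OF W_module[OF V(2)] g'(1) P.\<pi>_hom[OF j]]
            mod_hom_comp[OF W_module[OF V(2)] k'(1) P.\<pi>_hom[OF j]] by simp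
      qed
      then obtain U u c where c: "elt_arrow U u V v c"
        and ceq: "\<And>j y. \<lbrakk>j \<in> Ob J; y \<in> carrier (W U)\<rbrakk>
          \<Longrightarrow> compose (carrier (W V)) (\<pi> j) ?g (far w U V c y) = compose (carrier (W V)) (\<pi> j) ?k (far w U V c y)"
        using theta_eq_finite[OF finJ V(1), of "fob G" "\<lambda>j. compose (carrier (W V)) (\<pi> j) ?g"
            "\<lambda>j. compose (carrier (W V)) (\<pi> j) ?k"] by metis
      have cv: "far w U V c y \<in> carrier (W V)" if "y \<in> carrier (W U)" for y
        using c that by (auto simp: elt_arrow_def elt_def far_W_closed)
      have "?g (far w U V c y) = ?k (far w U V c y)" if y: "y \<in> carrier (W U)" for y
      proof (rule P.elementwise_limit_unique[OF el mod_hom_closed[OF g'(1) cv[OF y]] mod_hom_closed[OF k'(1) cv[OF y]]])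
        show "\<pi> j (?g (far w U V c y)) = \<pi> j (?k (far w U V c y))" if j: "j \<in> Ob J" for j
          using ceq[OF j y] by (simp only: compose_eq[OF cv[OF y]])
      qed
      then have "compose (carrier (W U)) ?g (far w U V c) = compose (carrier (W U)) ?k (far w U V c)"
        by (simp add: compose_def cong: restrict_cong)
      then show "s = theta P Y y k"
        using sg g'(2) k'(2) theta_pull(2)[OF P.P_module c g'(1)] theta_pull(2)[OF P.P_module c k'(1)] by simp
    qed
  qed
qed

end

section \<open>Comodules over the coend\<close>

context fibre_functor
begin

lemma L_module: "left_module B L" ..

section \<open>Comultiplication and counit\<close>

definition left_cl :: "'o \<Rightarrow> ('m \<Rightarrow> 'b) \<Rightarrow> 'm \<Rightarrow> ('o, 'b, 'm) coend_elt" where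
  "left_cl X \<phi> = (\<lambda>y\<in>carrier (W X). cl X y \<phi>)"

lemma left_cl_hom: "\<lbrakk>X \<in> LOb A; \<phi> \<in> dual B (W X)\<rbrakk> \<Longrightarrow> left_cl X \<phi> \<in> mod_hom B (W X) L"
  unfolding left_cl_def
  by (rule mod_homI) (simp_all add: cl_closed W_add_closed cl_add_left W_smult_closed coend_smult_cl)

text \<open>Written as a theta of the homomorphism y \<mapsto> [y \<otimes> \<phi>], the
  comultiplication inherits additivity and dinaturality, which is what its descent to the coend
  requires.\<close>

lemma comult_formula:
  assumes X: "X \<in> LOb A" and m: "m \<in> carrier (W X)" and \<phi>: "\<phi> \<in> dual B (W X)"
  shows "(\<Oplus>\<^bsub>T L\<^esub>i\<in>{..<bas_n X}. tens B L L (cl X m (bas_d X i)) (cl X (bas_e X i) \<phi>))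
    = theta L X m (left_cl X \<phi>)"
proof -
  interpret TL: tensor_product B L L by (rule tensor_productI'[OF L_module])
  show ?thesis unfolding theta_def
    using theta_term_closed[OF L_module X m left_cl_hom[OF X \<phi>]] X
    by (intro TL.T.finsum_cong') (auto simp: left_cl_def bas_e_closed)
qed

lemma comult_lift:
  shows coend_comult_additive: "coend_comult R B A w \<in> additive L (T L)"
    and coend_comult_cl: "\<lbrakk>X \<in> LOb A; m \<in> carrier (W X); \<phi> \<in> dual B (W X)\<rbrakk>
      \<Longrightarrow> coend_comult R B A w (cl X m \<phi>) = theta L X m (left_cl X \<phi>)"
proof -
  let ?g = "\<lambda>X m \<phi>. \<Oplus>\<^bsub>T L\<^esub>i\<in>{..<bas_n X}. tens B L L (cl X m (bas_d X i)) (cl X (bas_e X i) \<phi>)"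
  have eq: "coend_comult R B A w = pres_lift (T L) (\<lambda>(X, m, \<phi>). ?g X m \<phi>)"
    by (simp add: coend_comult_def Let_def dual_basis_eq)
  note L = L_module and LA = T_abelian_group[OF L_module]
  have 1: "?g X m \<phi> \<in> carrier (T L)" if "X \<in> LOb A" "m \<in> carrier (W X)" "\<phi> \<in> dual B (W X)" for X m \<phi>
    using that by (simp add: comult_formula theta_closed[OF L] left_cl_hom)
  have 2: "?g X (m \<oplus>\<^bsub>W X\<^esub> n) \<phi> = ?g X m \<phi> \<oplus>\<^bsub>T L\<^esub> ?g X n \<phi>"
    if "X \<in> LOb A" "m \<in> carrier (W X)" "n \<in> carrier (W X)" "\<phi> \<in> dual B (W X)" for X m n \<phi>
    using that by (simp add: comult_formula theta_add_left[OF L] left_cl_hom W_add_closed)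
  have 3: "?g X m (\<lambda>x\<in>carrier (W X). \<phi> x \<oplus>\<^bsub>B\<^esub> \<psi> x) = ?g X m \<phi> \<oplus>\<^bsub>T L\<^esub> ?g X m \<psi>"
    if "X \<in> LOb A" "m \<in> carrier (W X)" "\<phi> \<in> dual B (W X)" "\<psi> \<in> dual B (W X)" for X m \<phi> \<psi>
  proof -
    have "left_cl X (\<lambda>x\<in>carrier (W X). \<phi> x \<oplus>\<^bsub>B\<^esub> \<psi> x) = hom_add (W X) L (left_cl X \<phi>) (left_cl X \<psi>)"
      using that by (simp add: left_cl_def hom_add_def fun_eq_iff cl_add_right)
    then show ?thesis
      using that by (simp add: comult_formula dual_hom_add theta_hom_add[OF L] left_cl_hom)
  qed
  have 4: "?g Y (far w X Y f m) \<phi> = ?g X m (compose (carrier (W X)) \<phi> (far w X Y f))"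
    if "X \<in> LOb A" "Y \<in> LOb A" "f \<in> carrier (LHom A X Y)" "m \<in> carrier (W X)" "\<phi> \<in> dual B (W Y)"
    for X Y f m \<phi>
  proof -
    have c: "compose (carrier (W X)) (left_cl Y \<phi>) (far w X Y f)
        = left_cl X (compose (carrier (W X)) \<phi> (far w X Y f))"
    proof
      fix y
      show "compose (carrier (W X)) (left_cl Y \<phi>) (far w X Y f) y
          = left_cl X (compose (carrier (W X)) \<phi> (far w X Y f)) y"
      proof (cases "y \<in> carrier (W X)")
        case True
        then show ?thesis
          using cl_dinatural[OF that(1-3) True that(5)] far_W_closed[OF that(1-3) True]
          by (simp only: left_cl_def compose_eq restrict_apply if_True)
      qed (simp add: left_cl_def compose_def)
    qed
    show ?thesis
      unfolding comult_formula[OF that(2) far_W_closed[OF that(1-4)] that(5)]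
        comult_formula[OF that(1,4) dual_compose[OF that(1-3,5)]]
        theta_dinatural[OF L that(1,4,2,3) left_cl_hom[OF that(2,5)]] c ..
  qed
  show "coend_comult R B A w \<in> additive L (T L)" unfolding eq
    by (rule coend_lift_additive[OF LA 1 2 3 4])
  show "coend_comult R B A w (cl X m \<phi>) = theta L X m (left_cl X \<phi>)"
    if "X \<in> LOb A" "m \<in> carrier (W X)" "\<phi> \<in> dual B (W X)"
    unfolding eq
    by (rule trans[OF coend_lift_cl[where g = ?g, OF LA 1 2 3 4 that] comult_formula[OF that]])
qed

lemma counit_lift:
  shows coend_counit_additive: "coend_counit B \<in> additive L B"
    and coend_counit_cl: "\<lbrakk>X \<in> LOb A; m \<in> carrier (W X); \<phi> \<in> dual B (W X)\<rbrakk>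
      \<Longrightarrow> coend_counit B (cl X m \<phi>) = \<phi> m"
proof -
  have 1: "\<phi> m \<in> carrier B" if "X \<in> LOb A" "m \<in> carrier (W X)" "\<phi> \<in> dual B (W X)" for X m \<phi>
    using dual_closed[OF that(3,2)] .
  have 2: "\<phi> (m \<oplus>\<^bsub>W X\<^esub> n) = \<phi> m \<oplus>\<^bsub>B\<^esub> \<phi> n"
    if "X \<in> LOb A" "m \<in> carrier (W X)" "n \<in> carrier (W X)" "\<phi> \<in> dual B (W X)" for X m n \<phi>
    using dual_add[OF that(4,2,3)] .
  have 3: "(\<lambda>x\<in>carrier (W X). \<phi> x \<oplus>\<^bsub>B\<^esub> \<psi> x) m = \<phi> m \<oplus>\<^bsub>B\<^esub> \<psi> m"
    if "X \<in> LOb A" "m \<in> carrier (W X)" "\<phi> \<in> dual B (W X)" "\<psi> \<in> dual B (W X)" for X m \<phi> \<psi>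
    using that(2) by simp
  have 4: "\<phi> (far w X Y f m) = compose (carrier (W X)) \<phi> (far w X Y f) m"
    if "X \<in> LOb A" "Y \<in> LOb A" "f \<in> carrier (LHom A X Y)" "m \<in> carrier (W X)" "\<phi> \<in> dual B (W Y)"
    for X Y f m \<phi>
    using that(4) by (simp add: compose_eq)
  show "coend_counit B \<in> additive L B" unfolding coend_counit_def
    by (rule coend_lift_additive[where g = "\<lambda>X m \<phi>. \<phi> m", OF Balg.is_abelian_group])
      (fact 1, fact 2, fact 3, fact 4)
  show "coend_counit B (cl X m \<phi>) = \<phi> m"
    if "X \<in> LOb A" "m \<in> carrier (W X)" "\<phi> \<in> dual B (W X)" unfolding coend_counit_def
    by (rule coend_lift_cl[where g = "\<lambda>X m \<phi>. \<phi> m", OF Balg.is_abelian_group _ _ _ _ that])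
      (fact 1, fact 2, fact 3, fact 4)
qed

text \<open>Right linearity of the counit makes the pairing (l, y) \<mapsto>
  \<open>coend_counit B l\<close> y respect the balancing relators.\<close>

lemma coend_counit_rsmult:
  assumes l: "l \<in> carrier L" and b: "b \<in> carrier B"
  shows "coend_counit B (rsmult L l b) = coend_counit B l \<otimes>\<^bsub>B\<^esub> b"
proof (rule L_eqI[OF Balg.is_abelian_group _ _ _ l])
  show "(\<lambda>l. coend_counit B (rsmult L l b)) \<in> additive L B"
    by (rule additiveI)
      (simp_all add: additive_closed[OF coend_counit_additive] additive_add[OF coend_counit_additive]
        additive_add[OF coend_rsmult_additive[OF b]] rsmult_closed b)
  show "(\<lambda>l. coend_counit B l \<otimes>\<^bsub>B\<^esub> b) \<in> additive L B"
    by (rule additiveI)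
      (simp_all add: additive_closed[OF coend_counit_additive] additive_add[OF coend_counit_additive] b Balg.l_distr)
  show "coend_counit B (rsmult L (cl X m \<phi>) b) = coend_counit B (cl X m \<phi>) \<otimes>\<^bsub>B\<^esub> b"
    if "X \<in> LOb A" "m \<in> carrier (W X)" "\<phi> \<in> dual B (W X)" for X m \<phi>
    using that b by (simp add: coend_rsmult_cl coend_counit_cl dual_rmult_closed) (simp add: dual_rmult_def)
qed

lemma comonad_counit_theta:
  assumes M: "left_module B M" and X: "X \<in> LOb A" "x \<in> carrier (W X)" and h: "h \<in> mod_hom B (W X) M"
  shows "comonad_counit (coend_counit B) M (theta M X x h) = h x"
proof -
  interpret M: tensor_product B L M by (rule tensor_productI'[OF M])
  note e = additive_closed[OF coend_counit_additive]
  have 1: "coend_counit B l \<odot>\<^bsub>M\<^esub> y \<in> carrier M" if "l \<in> carrier L" "y \<in> carrier M" for l y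
    using that e by (simp add: M.M.smult_closed)
  have 2: "coend_counit B (k \<oplus>\<^bsub>L\<^esub> l) \<odot>\<^bsub>M\<^esub> y = coend_counit B k \<odot>\<^bsub>M\<^esub> y \<oplus>\<^bsub>M\<^esub> coend_counit B l \<odot>\<^bsub>M\<^esub> y"
    if "k \<in> carrier L" "l \<in> carrier L" "y \<in> carrier M" for k l y
    using that e by (simp add: additive_add[OF coend_counit_additive] M.M.smult_l_distr)
  have 3: "coend_counit B l \<odot>\<^bsub>M\<^esub> (y \<oplus>\<^bsub>M\<^esub> z) = coend_counit B l \<odot>\<^bsub>M\<^esub> y \<oplus>\<^bsub>M\<^esub> coend_counit B l \<odot>\<^bsub>M\<^esub> z"
    if "l \<in> carrier L" "y \<in> carrier M" "z \<in> carrier M" for l y z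
    using that e by (simp add: M.M.smult_r_distr)
  have 4: "coend_counit B (rsmult L l b) \<odot>\<^bsub>M\<^esub> y = coend_counit B l \<odot>\<^bsub>M\<^esub> (b \<odot>\<^bsub>M\<^esub> y)"
    if "l \<in> carrier L" "b \<in> carrier B" "y \<in> carrier M" for l b y
    using that e by (simp add: coend_counit_rsmult M.M.smult_assoc)
  let ?c = "comonad_counit (coend_counit B) M"
  have add: "?c \<in> additive (T M) M" unfolding comonad_counit_def
    by (rule M.tensor_lift_additive[OF M.M.abelian_group 1 2 3 4])
  have tens: "?c (tens B L M l y) = coend_counit B l \<odot>\<^bsub>M\<^esub> y" if "l \<in> carrier L" "y \<in> carrier M" for l y
    unfolding comonad_counit_def by (rule M.tensor_lift_tens[OF M.M.abelian_group 1 2 3 4 that])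
  have he: "h (bas_e X i) \<in> carrier M" if "i < bas_n X" for i
    using mod_hom_closed[OF h bas_e_closed[OF X(1) that]] .
  have "?c (theta M X x h) = (\<Oplus>\<^bsub>M\<^esub>i\<in>{..<bas_n X}. ?c (tens B L M (cl X x (bas_d X i)) (h (bas_e X i))))"
    unfolding theta_def
    by (rule additive_finsum[OF M.T.abelian_group M.M.abelian_group add])
      (use theta_term_closed[OF M X h] in auto)
  also have "\<dots> = (\<Oplus>\<^bsub>M\<^esub>i\<in>{..<bas_n X}. bas_d X i x \<odot>\<^bsub>M\<^esub> h (bas_e X i))"
    using X he dual_closed[OF bas_d_dual]
    by (intro M.M.M.finsum_cong') (auto simp: tens cl_closed bas_d_dual coend_counit_cl M.M.smult_closed)
  also have "\<dots> = h x"
    by (rule dual_basis_hom_expand[OF W_module[OF X(1)] M is_dual_basis_bas[OF X(1)] h X(2), symmetric])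
  finally show ?thesis .
qed

lemma theta_hom:
  assumes M: "left_module B M" and X: "X \<in> LOb A" and h: "h \<in> mod_hom B (W X) M"
  shows "(\<lambda>y\<in>carrier (W X). theta M X y h) \<in> mod_hom B (W X) (T M)"
  by (rule mod_homI)
    (use X h in \<open>simp_all add: theta_closed[OF M] theta_add_left[OF M] theta_smult[OF M] W_add_closed W_smult_closed\<close>)

text \<open>Comultiplying the term of index i gives the theta of the homomorphism v \<mapsto>
  [v \<otimes> d i] \<otimes> h(e i). All these thetas sit at the same element (X, x), and the sum
  of the homomorphisms is v \<mapsto> theta M X v h by definition.\<close>

lemma comonad_comult_theta:
  assumes M: "left_module B M" and X: "X \<in> LOb A" "x \<in> carrier (W X)" and h: "h \<in> mod_hom B (W X) M"
  shows "comonad_comult B L (coend_comult R B A w) M (theta M X x h)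
    = theta (T M) X x (\<lambda>y\<in>carrier (W X). theta M X y h)"
proof -
  interpret M: tensor_product B L M by (rule tensor_productI'[OF M])
  interpret TM: left_module B "T M" by (rule T_module[OF M])
  interpret TTM: tensor_product B L "T M" by (rule tensor_productI'[OF TM.left_module_axioms])
  interpret LL: tensor_product B L L by (rule tensor_productI'[OF L_module])
  note TMm = TM.left_module_axioms
  let ?TT = "T (T M)"
  \<comment> \<open>For fixed y, the map on \<open>L\<close> \<otimes> \<open>L\<close> that inserts
    y and reassociates, k \<otimes> k' \<mapsto> k \<otimes> (k' \<otimes> y). The comonad
    comultiplication is the lift of (l, y) \<mapsto> \<open>?i y (?D l)\<close>.\<close>
  let ?i = "\<lambda>y. pres_lift ?TT (\<lambda>(k, k'). tens B L (T M) k (tens B L M k' y))"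
  let ?D = "coend_comult R B A w"
  have i_add: "?i y \<in> additive (T L) ?TT" and i_tens: "\<And>k k'. \<lbrakk>k \<in> carrier L; k' \<in> carrier L\<rbrakk>
      \<Longrightarrow> ?i y (tens B L L k k') = tens B L (T M) k (tens B L M k' y)" if y: "y \<in> carrier M" for y
  proof -
    have 1: "tens B L (T M) k (tens B L M k' y) \<in> carrier ?TT" if "k \<in> carrier L" "k' \<in> carrier L" for k k'
      using that y by (simp add: TTM.tens_closed M.tens_closed)
    have 2: "tens B L (T M) (k \<oplus>\<^bsub>L\<^esub> l) (tens B L M k' y)
        = tens B L (T M) k (tens B L M k' y) \<oplus>\<^bsub>?TT\<^esub> tens B L (T M) l (tens B L M k' y)"
      if "k \<in> carrier L" "l \<in> carrier L" "k' \<in> carrier L" for k l k'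
      using that y by (simp add: additive_add[OF TTM.tens_additive_left] M.tens_closed)
    have 3: "tens B L (T M) k (tens B L M (k' \<oplus>\<^bsub>L\<^esub> l') y)
        = tens B L (T M) k (tens B L M k' y) \<oplus>\<^bsub>?TT\<^esub> tens B L (T M) k (tens B L M l' y)"
      if "k \<in> carrier L" "k' \<in> carrier L" "l' \<in> carrier L" for k k' l'
      using that y by (simp add: additive_add[OF M.tens_additive_left] additive_add[OF TTM.tens_additive_right] M.tens_closed)
    have 4: "tens B L (T M) (rsmult L k b) (tens B L M k' y) = tens B L (T M) k (tens B L M (b \<odot>\<^bsub>L\<^esub> k') y)"
      if "k \<in> carrier L" "b \<in> carrier B" "k' \<in> carrier L" for k b k'
      using that y by (simp add: TTM.tens_balanced M.tens_closed M.smult_tens)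
    show "?i y \<in> additive (T L) ?TT"
      by (rule LL.tensor_lift_additive[OF TTM.T.abelian_group 1 2 3 4])
    show "?i y (tens B L L k k') = tens B L (T M) k (tens B L M k' y)" if "k \<in> carrier L" "k' \<in> carrier L" for k k'
      by (rule LL.tensor_lift_tens[OF TTM.T.abelian_group 1 2 3 4 that])
  qed
  have tcl_hom: "(\<lambda>v\<in>carrier (W X). tens B L M (cl X v \<phi>) y) \<in> mod_hom B (W X) (T M)"
    if "X \<in> LOb A" "\<phi> \<in> dual B (W X)" "y \<in> carrier M" for X \<phi> y
    by (rule mod_homI)
      (use that in \<open>simp_all add: M.tens_closed cl_closed W_add_closed W_smult_closed cl_add_left
        additive_add[OF M.tens_additive_left] M.smult_tens coend_smult_cl\<close>)
  have i_cl: "?i y (?D (cl X m \<phi>)) = theta (T M) X m (\<lambda>v\<in>carrier (W X). tens B L M (cl X v \<phi>) y)"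
    if Xm: "X \<in> LOb A" "m \<in> carrier (W X)" and \<phi>: "\<phi> \<in> dual B (W X)" and y: "y \<in> carrier M" for X m \<phi> y
  proof -
    have "?i y (theta L X m (left_cl X \<phi>))
        = (\<Oplus>\<^bsub>?TT\<^esub>i\<in>{..<bas_n X}. ?i y (tens B L L (cl X m (bas_d X i)) (left_cl X \<phi> (bas_e X i))))"
      unfolding theta_def
      by (rule additive_finsum[OF LL.T.abelian_group TTM.T.abelian_group i_add[OF y]])
        (use theta_term_closed[OF L_module Xm left_cl_hom[OF Xm(1) \<phi>]] in auto)
    also have "\<dots> = theta (T M) X m (\<lambda>v\<in>carrier (W X). tens B L M (cl X v \<phi>) y)"
      unfolding theta_def
    proof (rule TTM.T.finsum_cong')
      show "(\<lambda>i. tens B L (T M) (cl X m (bas_d X i)) ((\<lambda>v\<in>carrier (W X). tens B L M (cl X v \<phi>) y) (bas_e X i)))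
          \<in> {..<bas_n X} \<rightarrow> carrier ?TT"
        using theta_term_closed[OF TMm Xm tcl_hom[OF Xm(1) \<phi> y]] by auto
      show "?i y (tens B L L (cl X m (bas_d X i)) (left_cl X \<phi> (bas_e X i)))
          = tens B L (T M) (cl X m (bas_d X i)) ((\<lambda>v\<in>carrier (W X). tens B L M (cl X v \<phi>) y) (bas_e X i))"
        if "i \<in> {..<bas_n X}" for i
        using that Xm \<phi> y by (simp add: i_tens cl_closed bas_d_dual bas_e_closed left_cl_def)
    qed simp
    finally show ?thesis using Xm \<phi> by (simp add: coend_comult_cl)
  qed
  have D: "?D l \<in> carrier (T L)" if "l \<in> carrier L" for l
    by (rule additive_closed[OF coend_comult_additive that])
  have 1: "?i y (?D l) \<in> carrier ?TT" if "l \<in> carrier L" "y \<in> carrier M" for l y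
    using additive_closed[OF i_add[OF that(2)] D[OF that(1)]] .
  have 2: "?i y (?D (k \<oplus>\<^bsub>L\<^esub> l)) = ?i y (?D k) \<oplus>\<^bsub>?TT\<^esub> ?i y (?D l)"
    if "k \<in> carrier L" "l \<in> carrier L" "y \<in> carrier M" for k l y
    using that by (simp add: additive_add[OF coend_comult_additive] additive_add[OF i_add] D)
  have 3: "?i (y \<oplus>\<^bsub>M\<^esub> z) (?D l) = ?i y (?D l) \<oplus>\<^bsub>?TT\<^esub> ?i z (?D l)"
    if l: "l \<in> carrier L" and yz: "y \<in> carrier M" "z \<in> carrier M" for l y z
  proof (rule LL.tensor_eqI[OF TTM.T.abelian_group i_add _ _ D[OF l],
        where g = "\<lambda>t. ?i y t \<oplus>\<^bsub>?TT\<^esub> ?i z t"])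
    show "y \<oplus>\<^bsub>M\<^esub> z \<in> carrier M" using yz by simp
    show "(\<lambda>t. ?i y t \<oplus>\<^bsub>?TT\<^esub> ?i z t) \<in> additive (T L) ?TT"
      by (rule additiveI)
        (simp_all add: additive_closed[OF i_add] additive_add[OF i_add] yz TTM.T.a_ac)
    show "?i (y \<oplus>\<^bsub>M\<^esub> z) (tens B L L k k') = ?i y (tens B L L k k') \<oplus>\<^bsub>?TT\<^esub> ?i z (tens B L L k k')"
      if "k \<in> carrier L" "k' \<in> carrier L" for k k'
      using that yz by (simp add: i_tens additive_add[OF M.tens_additive_right]
          additive_add[OF TTM.tens_additive_right] M.tens_closed)
  qed
  have 4: "?i y (?D (rsmult L l b)) = ?i (b \<odot>\<^bsub>M\<^esub> y) (?D l)"
    if l: "l \<in> carrier L" and b: "b \<in> carrier B" and y: "y \<in> carrier M" for l b y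
  proof (rule L_eqI[OF TTM.T.abelian_group _ _ _ l])
    have yb: "b \<odot>\<^bsub>M\<^esub> y \<in> carrier M" using b y by (simp add: M.M.smult_closed)
    show "(\<lambda>l. ?i y (?D (rsmult L l b))) \<in> additive L ?TT"
      by (rule additiveI) (simp_all add: 1 2 y b rsmult_closed additive_add[OF coend_rsmult_additive[OF b]])
    show "(\<lambda>l. ?i (b \<odot>\<^bsub>M\<^esub> y) (?D l)) \<in> additive L ?TT"
      by (rule additiveI) (simp_all add: 1 2 yb)
    show "?i y (?D (rsmult L (cl X m \<phi>) b)) = ?i (b \<odot>\<^bsub>M\<^esub> y) (?D (cl X m \<phi>))"
      if Xm: "X \<in> LOb A" "m \<in> carrier (W X)" and \<phi>: "\<phi> \<in> dual B (W X)" for X m \<phi>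
    proof -
      have "tens B L M (cl X v (dual_rmult X \<phi> b)) y = tens B L M (cl X v \<phi>) (b \<odot>\<^bsub>M\<^esub> y)"
        if "v \<in> carrier (W X)" for v
        using that Xm \<phi> b y M.tens_balanced[of "cl X v \<phi>" b y] by (simp add: coend_rsmult_cl cl_closed)
      then show ?thesis
        using Xm \<phi> b y yb by (simp add: coend_rsmult_cl i_cl dual_rmult_closed cong: restrict_cong)
    qed
  qed
  let ?c = "comonad_comult B L ?D M"
  have c_eq: "?c = pres_lift ?TT (\<lambda>(l, y). ?i y (?D l))"
    by (simp add: comonad_comult_def Let_def)
  have c_add: "?c \<in> additive (T M) ?TT" unfolding c_eq
    by (rule M.tensor_lift_additive[OF TTM.T.abelian_group 1 2 3 4])
  have c_tens: "?c (tens B L M l y) = ?i y (?D l)" if "l \<in> carrier L" "y \<in> carrier M" for l y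
    unfolding c_eq by (rule M.tensor_lift_tens[OF TTM.T.abelian_group 1 2 3 4 that])
  have he: "h (bas_e X i) \<in> carrier M" if "i < bas_n X" for i
    using mod_hom_closed[OF h bas_e_closed[OF X(1) that]] .
  let ?k = "\<lambda>i. \<lambda>v\<in>carrier (W X). tens B L M (cl X v (bas_d X i)) (h (bas_e X i))"
  have k: "?k i \<in> mod_hom B (W X) (T M)" if "i < bas_n X" for i
    using that X he by (simp add: tcl_hom bas_d_dual)
  have "?c (theta M X x h) = (\<Oplus>\<^bsub>?TT\<^esub>i\<in>{..<bas_n X}. ?c (tens B L M (cl X x (bas_d X i)) (h (bas_e X i))))"
    unfolding theta_def
    by (rule additive_finsum[OF M.T.abelian_group TTM.T.abelian_group c_add])
      (use theta_term_closed[OF M X h] in auto)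
  also have "\<dots> = (\<Oplus>\<^bsub>?TT\<^esub>i\<in>{..<bas_n X}. theta (T M) X x (?k i))"
  proof (rule TTM.T.finsum_cong')
    show "(\<lambda>i. theta (T M) X x (?k i)) \<in> {..<bas_n X} \<rightarrow> carrier ?TT"
      using theta_closed[OF TMm X k] by auto
  qed (use X he in \<open>simp_all add: c_tens cl_closed bas_d_dual i_cl\<close>)
  also have "\<dots> = theta (T M) X x (hom_sum (W X) (T M) {..<bas_n X} ?k)"
    by (rule theta_hom_sum[symmetric, OF TMm X]) (use k in auto)
  also have "hom_sum (W X) (T M) {..<bas_n X} ?k = (\<lambda>y\<in>carrier (W X). theta M X y h)"
  proof
    fix v
    show "hom_sum (W X) (T M) {..<bas_n X} ?k v = (\<lambda>y\<in>carrier (W X). theta M X y h) v"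
      by (cases "v \<in> carrier (W X)") (simp_all add: hom_sum_def theta_def)
  qed
  finally show ?thesis .
qed

section \<open>Canonical comodules and the maps out of them\<close>

abbreviation "idW X \<equiv> (\<lambda>x\<in>carrier (W X). x)"

lemma idW_hom: "X \<in> LOb A \<Longrightarrow> idW X \<in> mod_hom B (W X) (W X)"
  by (rule mod_hom_id[OF W_module])

lemma compose_idW: "h \<in> mod_hom B (W X) M \<Longrightarrow> compose (carrier (W X)) h (idW X) = h"
  by (rule compose_Id) (auto simp: mod_homD)

lemma canonical_coaction_eq:
  assumes X: "X \<in> LOb A"
  shows "canonical_coaction R B A w X = (\<lambda>x\<in>carrier (W X). theta (W X) X x (idW X))"
proof -
  interpret M: tensor_product B L "W X" by (rule tensor_productI'[OF W_module[OF X]])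
  have "(\<Oplus>\<^bsub>T (W X)\<^esub>i\<in>{..<bas_n X}. tens B L (W X) (cl X x (bas_d X i)) (bas_e X i)) = theta (W X) X x (idW X)"
    if "x \<in> carrier (W X)" for x
    unfolding theta_def using theta_term_closed[OF W_module[OF X] X that idW_hom[OF X]] X
    by (intro M.T.finsum_cong') (auto simp: bas_e_closed)
  then show ?thesis
    by (simp add: canonical_coaction_def Let_def dual_basis_eq cong: restrict_cong)
qed

abbreviation comodule where
  "comodule M \<rho> \<equiv> is_comodule B L (coend_comult R B A w) (coend_counit B) M \<rho>"

text \<open>The canonical coaction is theta at the identity. For this homomorphism, the formula for
  the comultiplication returns the theta of the coaction, and so does \<open>tensor_map\<close> of
  the coaction.\<close>

lemma comodule_canonical:
  assumes X: "X \<in> LOb A"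
  shows "comodule (W X) (canonical_coaction R B A w X)"
proof -
  note W = W_module[OF X] and id = idW_hom[OF X]
  have \<rho>: "canonical_coaction R B A w X \<in> mod_hom B (W X) (T (W X))"
    unfolding canonical_coaction_eq[OF X] by (rule theta_hom[OF W X id])
  show ?thesis unfolding is_comodule_def
  proof (intro conjI ballI W \<rho>)
    fix x assume x: "x \<in> carrier (W X)"
    have \<rho>x: "canonical_coaction R B A w X x = theta (W X) X x (idW X)"
      using x by (simp add: canonical_coaction_eq[OF X])
    show "comonad_comult B L (coend_comult R B A w) (W X) (canonical_coaction R B A w X x)
        = tensor_map B L (W X) (T (W X)) (canonical_coaction R B A w X) (canonical_coaction R B A w X x)"
      using tensor_map_theta[OF W T_module[OF W] \<rho> X x id] comonad_comult_theta[OF W X x id]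
      by (simp add: \<rho>x compose_idW[OF \<rho>]) (simp add: canonical_coaction_eq[OF X])
    show "comonad_counit (coend_counit B) (W X) (canonical_coaction R B A w X x) = x"
      using comonad_counit_theta[OF W X x id] x by (simp add: \<rho>x)
  qed
qed

text \<open>Comodule maps from the canonical comodule of X to M: \<open>L\<close> \<otimes> h sends
  the coaction of x to theta M X x h, so the condition can be stated without
  \<open>tensor_map\<close> and combined with the calculus of thetas.\<close>

definition comod_map where
  "comod_map M \<rho> X h \<longleftrightarrow> h \<in> mod_hom B (W X) M \<and> (\<forall>x\<in>carrier (W X). theta M X x h = \<rho> (h x))"

lemma tensor_map_canonical:
  assumes M: "left_module B M" and X: "X \<in> LOb A" "x \<in> carrier (W X)" and h: "h \<in> mod_hom B (W X) M"
  shows "tensor_map B L (W X) M h (canonical_coaction R B A w X x) = theta M X x h"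
  using tensor_map_theta[OF W_module[OF X(1)] M h X idW_hom[OF X(1)]] X
  by (simp add: canonical_coaction_eq compose_idW[OF h])

text \<open>Dinaturality of theta, applied to the identity of w(Y), expresses that w(f) commutes
  with the coactions.\<close>

lemma comod_map_far:
  assumes X: "X \<in> LOb A" and Y: "Y \<in> LOb A" and f: "f \<in> carrier (LHom A X Y)"
  shows "comod_map (W Y) (canonical_coaction R B A w Y) X (far w X Y f)"
proof -
  have "compose (carrier (W X)) (idW Y) (far w X Y f) = far w X Y f"
    by (rule Id_compose) (use far_hom[OF X Y f] in \<open>auto simp: mod_homD\<close>)
  then have "theta (W Y) X x (far w X Y f) = canonical_coaction R B A w Y (far w X Y f x)"
    if "x \<in> carrier (W X)" for x
    using theta_dinatural[OF W_module[OF Y] X that Y f idW_hom[OF Y]] far_W_closed[OF X Y f that]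
    by (simp add: canonical_coaction_eq[OF Y])
  then show ?thesis using far_hom[OF X Y f] by (simp add: comod_map_def)
qed

end

section \<open>Cokernels and finite covers\<close>

text \<open>Lifting the finitely many vectors of a dual basis along p is enough; the functionals of
  the dual basis extend these lifts linearly.\<close>

lemma fg_projective_section:
  fixes M :: "('b, 'm) module"
  assumes M: "fg_projective B M" and Z: "left_module B Z" and p: "p \<in> mod_hom B Z M"
    and surj: "p ` carrier Z = carrier M"
  obtains \<sigma> where "\<sigma> \<in> mod_hom B M Z" "\<And>x. x \<in> carrier M \<Longrightarrow> p (\<sigma> x) = x"
proof -
  have Mm: "left_module B M" using M by (simp add: fg_projective_def)
  interpret M: left_module B M by (rule Mm)
  interpret Z: left_module B Z by (rule Z)
  obtain n e d where db: "is_dual_basis B M (n, e, d)"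
    using fg_projective_dual_basis[OF M] by (metis prod_cases3)
  note D = is_dual_basisD[OF db]
  have "\<forall>i\<in>{..<n}. \<exists>t\<in>carrier Z. p t = e i"
    using D(1) surj by (metis imageE lessThan_iff)
  then obtain t where t: "\<And>i. i < n \<Longrightarrow> t i \<in> carrier Z" "\<And>i. i < n \<Longrightarrow> p (t i) = e i"
    by (metis lessThan_iff)
  let ?r = "\<lambda>i. rank_one M Z (d i) (t i)"
  have r: "?r i \<in> mod_hom B M Z" if "i < n" for i
    using that t D(2) by (intro mod_hom_rank_one[OF Mm Z])
  let ?\<sigma> = "hom_sum M Z {..<n} ?r"
  have \<sigma>: "?\<sigma> \<in> mod_hom B M Z" by (rule mod_hom_hom_sum[OF Mm Z]) (use r in auto)
  have "p (?\<sigma> x) = x" if x: "x \<in> carrier M" for x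
  proof -
    have dx: "d i x \<in> carrier B" if "i < n" for i using dual_closed[OF D(2)[OF that] x] .
    have "p (?\<sigma> x) = p (\<Oplus>\<^bsub>Z\<^esub>i\<in>{..<n}. ?r i x)" using x by (simp add: hom_sum_def)
    also have "\<dots> = (\<Oplus>\<^bsub>M\<^esub>i\<in>{..<n}. p (?r i x))"
      by (rule additive_finsum[OF Z.abelian_group M.abelian_group mod_hom_additive[OF p]])
        (use mod_hom_closed[OF r x] in auto)
    also have "\<dots> = (\<Oplus>\<^bsub>M\<^esub>i\<in>{..<n}. d i x \<odot>\<^bsub>M\<^esub> e i)"
      using x dx t D(1) by (intro M.M.finsum_cong') (auto simp: rank_one_def mod_hom_smult[OF p] M.smult_closed)
    also have "\<dots> = x" by (rule D(3)[OF x, symmetric])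
    finally show ?thesis .
  qed
  with \<sigma> show ?thesis by (rule that)
qed

lemma Mod_cat_simps [simp]:
  "LOb (Mod_cat B) = {M. left_module B M}" "carrier (LHom (Mod_cat B) M N) = mod_hom B M N"
  "LCmp (Mod_cat B) M N P g f = compose (carrier M) g f" "LIdn (Mod_cat B) M = (\<lambda>x\<in>carrier M. x)"
  "\<zero>\<^bsub>LHom (Mod_cat B) M N\<^esub> = hom_zero M N"
  by (simp_all add: Mod_cat_def hom_zero_def)

lemma compose_apply: "\<lbrakk>compose S g f = h; x \<in> S\<rbrakk> \<Longrightarrow> g (f x) = h x"
  by (auto simp: compose_eq)

text \<open>With a section \<sigma> of p, the factorization of g is g after \<sigma>. It is correct
  because z and \<sigma>(p z) differ by an element of the kernel of p, that is, of the image of k,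
  on which g vanishes.\<close>

lemma is_cokernel_Mod_cat:
  fixes M Z K :: "('b, 'm) module"
  assumes M: "fg_projective B M" and Z: "left_module B Z" and K: "left_module B K"
    and k: "k \<in> mod_hom B K Z" and p: "p \<in> mod_hom B Z M"
    and surj: "p ` carrier Z = carrier M"
    and pk: "\<And>x. x \<in> carrier K \<Longrightarrow> p (k x) = \<zero>\<^bsub>M\<^esub>"
    and ker: "\<And>z. \<lbrakk>z \<in> carrier Z; p z = \<zero>\<^bsub>M\<^esub>\<rbrakk> \<Longrightarrow> z \<in> k ` carrier K"
  shows "is_cokernel (Mod_cat B) K Z k M p"
proof -
  have Mm: "left_module B M" using M by (simp add: fg_projective_def)
  interpret M: left_module B M by (rule Mm)
  interpret Z: left_module B Z by (rule Z)
  obtain \<sigma> where \<sigma>: "\<sigma> \<in> mod_hom B M Z" "\<And>x. x \<in> carrier M \<Longrightarrow> p (\<sigma> x) = x"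
    using fg_projective_section[OF M Z p surj] by blast
  have zero: "compose (carrier K) p k = hom_zero K M"
    using pk by (auto simp: compose_def hom_zero_def)
  have univ: "\<exists>!h. h \<in> mod_hom B M N \<and> compose (carrier Z) h p = g"
    if N: "left_module B N" and g: "g \<in> mod_hom B Z N" and gk: "compose (carrier K) g k = hom_zero K N"
    for N :: "('b, 'm) module" and g
  proof -
    interpret N: left_module B N by (rule N)
    have gker: "g z = \<zero>\<^bsub>N\<^esub>" if "z \<in> carrier Z" "p z = \<zero>\<^bsub>M\<^esub>" for z
    proof -
      have "z \<in> k ` carrier K" by (rule ker[OF that])
      then obtain x where x: "x \<in> carrier K" "z = k x" by blast
      then show ?thesis using compose_apply[OF gk x(1)] by (simp add: hom_zero_def)
    qed
    have gs: "g (\<sigma> (p z)) = g z" if z: "z \<in> carrier Z" for z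
    proof -
      have pz: "p z \<in> carrier M" "\<sigma> (p z) \<in> carrier Z"
        using z mod_hom_closed[OF p] mod_hom_closed[OF \<sigma>(1)] by auto
      have "p (z \<ominus>\<^bsub>Z\<^esub> \<sigma> (p z)) = \<zero>\<^bsub>M\<^esub>"
        using additive_minus[OF Z.abelian_group M.abelian_group mod_hom_additive[OF p] z pz(2)] \<sigma>(2)[OF pz(1)] pz
        by (simp add: a_minus_def M.M.r_neg)
      then have "g (z \<ominus>\<^bsub>Z\<^esub> \<sigma> (p z)) = \<zero>\<^bsub>N\<^esub>" using z pz by (intro gker) auto
      then have "g z \<ominus>\<^bsub>N\<^esub> g (\<sigma> (p z)) = \<zero>\<^bsub>N\<^esub>"
        using additive_minus[OF Z.abelian_group N.abelian_group mod_hom_additive[OF g] z pz(2)] by simp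
      then show ?thesis
        using N.M.eq_iff_minus_zero[of "g z" "g (\<sigma> (p z))"] z pz mod_hom_closed[OF g] by simp
    qed
    show ?thesis
    proof (rule ex1I[of _ "compose (carrier M) g \<sigma>"])
      have h: "compose (carrier M) g \<sigma> \<in> mod_hom B M N" by (rule mod_hom_comp[OF Mm \<sigma>(1) g])
      have "compose (carrier Z) (compose (carrier M) g \<sigma>) p = g"
        by (rule mod_hom_eqI[OF mod_hom_comp[OF Z p h] g]) (simp add: compose_eq mod_hom_closed[OF p] gs)
      with h show "compose (carrier M) g \<sigma> \<in> mod_hom B M N
          \<and> compose (carrier Z) (compose (carrier M) g \<sigma>) p = g" ..
      fix h' assume h': "h' \<in> mod_hom B M N \<and> compose (carrier Z) h' p = g"
      show "h' = compose (carrier M) g \<sigma>"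
      proof (rule mod_hom_eqI[OF conjunct1[OF h'] h])
        fix x assume x: "x \<in> carrier M"
        have "g (\<sigma> x) = h' (p (\<sigma> x))"
          using compose_apply[OF conjunct2[OF h'] mod_hom_closed[OF \<sigma>(1) x]] by simp
        then show "h' x = compose (carrier M) g \<sigma> x" using x \<sigma>(2) by (simp add: compose_eq)
      qed
    qed
  qed
  show ?thesis unfolding is_cokernel_def using Mm p zero univ by simp
qed

section \<open>Covering modules by single objects\<close>

context fibre_functor
begin

text \<open>Maps hitting one element each are merged into one map that hits all of them. The family
  \<open>H\<close> stands for the property that has to survive merging: being a comodule map, coming
  from an arrow killed by p, or coming from an arrow that g carries to another arrow.\<close>

lemma finite_cover:
  fixes H :: "'o \<Rightarrow> ('m \<Rightarrow> 'n) set" and M :: "('b, 'n) module"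
  assumes M: "left_module B M"
    and hom: "\<And>X h. \<lbrakk>X \<in> LOb A; h \<in> H X\<rbrakk> \<Longrightarrow> h \<in> mod_hom B (W X) M"
    and zero: "\<And>X. X \<in> LOb A \<Longrightarrow> hom_zero (W X) M \<in> H X"
    and sum: "\<And>X Y P i j p q h k. \<lbrakk>X \<in> LOb A; Y \<in> LOb A; is_biproduct A X Y P i j p q; h \<in> H X; k \<in> H Y\<rbrakk>
      \<Longrightarrow> hom_add (W P) M (compose (carrier (W P)) h (far w P X p)) (compose (carrier (W P)) k (far w P Y q)) \<in> H P"
    and "finite S" and cover: "\<And>s. s \<in> S \<Longrightarrow> \<exists>X\<in>LOb A. \<exists>h\<in>H X. s \<in> h ` carrier (W X)"
  obtains P h where "P \<in> LOb A" "h \<in> H P" "S \<subseteq> h ` carrier (W P)"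
  using assms(5,6)
proof (induction S arbitrary: thesis)
  case empty
  obtain Z where "Z \<in> LOb A" using A.zero_object by (auto simp: has_zero_object_def)
  then show ?case using empty(1)[OF _ zero] by blast
next
  case (insert s S)
  interpret M: left_module B M by (rule M)
  obtain X h where X: "X \<in> LOb A" "h \<in> H X" "S \<subseteq> h ` carrier (W X)"
    using insert.IH insert.prems(2) by blast
  obtain Y k where Y: "Y \<in> LOb A" "k \<in> H Y" "s \<in> k ` carrier (W Y)"
    using insert.prems(2)[of s] by blast
  obtain P i j p q where bp: "is_biproduct A X Y P i j p q" using A.biproducts[OF X(1) Y(1)] by blast
  have P: "P \<in> LOb A" and i: "i \<in> carrier (LHom A X P)" and j: "j \<in> carrier (LHom A Y P)"
    and p: "p \<in> carrier (LHom A P X)" and q: "q \<in> carrier (LHom A P Y)"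
    and pi: "LCmp A X P X p i = LIdn A X" and qj: "LCmp A Y P Y q j = LIdn A Y"
    and pj: "LCmp A Y P X p j = \<zero>\<^bsub>LHom A Y X\<^esub>" and qi: "LCmp A X P Y q i = \<zero>\<^bsub>LHom A X Y\<^esub>"
    using bp by (auto simp: is_biproduct_def)
  note hX = hom[OF X(1,2)] and kY = hom[OF Y(1,2)]
  let ?g = "hom_add (W P) M (compose (carrier (W P)) h (far w P X p)) (compose (carrier (W P)) k (far w P Y q))"
  have g: "?g v = h (far w P X p v) \<oplus>\<^bsub>M\<^esub> k (far w P Y q v)" if "v \<in> carrier (W P)" for v
    using that by (simp add: hom_add_def compose_eq)
  have z: "h \<zero>\<^bsub>W X\<^esub> = \<zero>\<^bsub>M\<^esub>" "k \<zero>\<^bsub>W Y\<^esub> = \<zero>\<^bsub>M\<^esub>"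
    using additive_zero[OF W_abelian_group M.abelian_group mod_hom_additive] hX kY X(1) Y(1) by blast+
  \<comment> \<open>Along the first injection of the biproduct the second summand of
    \<open>?g\<close> vanishes, and symmetrically along the other, so the image of \<open>?g\<close>
    contains the images of h and k.\<close>
  have gi: "?g (far w X P i x) = h x" if x: "x \<in> carrier (W X)" for x
  proof -
    have "far w P X p (far w X P i x) = x"
      using far_comp[OF X(1) P X(1) i p x] pi far_id[OF X(1) x] by simp
    moreover have "far w P Y q (far w X P i x) = \<zero>\<^bsub>W Y\<^esub>"
      using far_comp[OF X(1) P Y(1) i q x] qi far_zero[OF X(1) Y(1) x] by simp
    ultimately show ?thesis
      using g[OF far_W_closed[OF X(1) P i x]] z mod_hom_closed[OF hX x] by simp
  qed
  have gj: "?g (far w Y P j y) = k y" if y: "y \<in> carrier (W Y)" for y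
  proof -
    have "far w P Y q (far w Y P j y) = y"
      using far_comp[OF Y(1) P Y(1) j q y] qj far_id[OF Y(1) y] by simp
    moreover have "far w P X p (far w Y P j y) = \<zero>\<^bsub>W X\<^esub>"
      using far_comp[OF Y(1) P X(1) j p y] pj far_zero[OF Y(1) X(1) y] by simp
    ultimately show ?thesis
      using g[OF far_W_closed[OF Y(1) P j y]] z mod_hom_closed[OF kY y] by simp
  qed
  show ?case
  proof (rule insert.prems(1)[OF P sum[OF X(1) Y(1) bp X(2) Y(2)]])
    show "insert s S \<subseteq> ?g ` carrier (W P)"
    proof
      fix t assume "t \<in> insert s S"
      then consider y where "y \<in> carrier (W Y)" "t = k y" | x where "x \<in> carrier (W X)" "t = h x"
        using X(3) Y(3) by auto
      then show "t \<in> ?g ` carrier (W P)"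
      proof cases
        case 1
        then show ?thesis using gj far_W_closed[OF Y(1) P j] by (metis imageI)
      next
        case 2
        then show ?thesis using gi far_W_closed[OF X(1) P i] by (metis imageI)
      qed
    qed
  qed
qed

text \<open>Images are submodules, so hitting the finitely many vectors of a dual basis yields
  surjectivity.\<close>

lemma fg_projective_cover:
  fixes H :: "'o \<Rightarrow> ('m \<Rightarrow> 'n) set" and M :: "('b, 'n) module"
  assumes M: "fg_projective B M"
    and hom: "\<And>X h. \<lbrakk>X \<in> LOb A; h \<in> H X\<rbrakk> \<Longrightarrow> h \<in> mod_hom B (W X) M"
    and zero: "\<And>X. X \<in> LOb A \<Longrightarrow> hom_zero (W X) M \<in> H X"
    and sum: "\<And>X Y P i j p q h k. \<lbrakk>X \<in> LOb A; Y \<in> LOb A; is_biproduct A X Y P i j p q; h \<in> H X; k \<in> H Y\<rbrakk>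
      \<Longrightarrow> hom_add (W P) M (compose (carrier (W P)) h (far w P X p)) (compose (carrier (W P)) k (far w P Y q)) \<in> H P"
    and cover: "\<And>x. x \<in> carrier M \<Longrightarrow> \<exists>X\<in>LOb A. \<exists>h\<in>H X. x \<in> h ` carrier (W X)"
  obtains P h where "P \<in> LOb A" "h \<in> H P" "h ` carrier (W P) = carrier M"
proof -
  have Mm: "left_module B M" using M by (simp add: fg_projective_def)
  interpret M: left_module B M by (rule Mm)
  obtain n e d where db: "is_dual_basis B M (n, e, d)"
    using fg_projective_dual_basis[OF M] by (metis prod_cases3)
  note D = is_dual_basisD[OF db]
  obtain P h where P: "P \<in> LOb A" "h \<in> H P" "e ` {..<n} \<subseteq> h ` carrier (W P)"
    by (rule finite_cover[OF Mm hom zero sum, where S = "e ` {..<n}"]) (use cover D(1) in auto)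
  interpret P: left_module B "W P" by (rule W_module[OF P(1)])
  note h = hom[OF P(1,2)]
  have "\<forall>i\<in>{..<n}. \<exists>t\<in>carrier (W P). h t = e i"
    using P(3) by (force simp: image_subset_iff image_iff)
  then obtain t where t: "\<And>i. i < n \<Longrightarrow> t i \<in> carrier (W P)" "\<And>i. i < n \<Longrightarrow> h (t i) = e i"
    by (metis lessThan_iff)
  have "x \<in> h ` carrier (W P)" if x: "x \<in> carrier M" for x
  proof
    have dx: "d i x \<in> carrier B" if "i < n" for i using dual_closed[OF D(2)[OF that] x] .
    let ?v = "\<Oplus>\<^bsub>W P\<^esub>i\<in>{..<n}. d i x \<odot>\<^bsub>W P\<^esub> t i"
    show "?v \<in> carrier (W P)" using t dx by (intro P.M.finsum_closed) (auto simp: P.smult_closed)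
    have "h ?v = (\<Oplus>\<^bsub>M\<^esub>i\<in>{..<n}. h (d i x \<odot>\<^bsub>W P\<^esub> t i))"
      by (rule additive_finsum[OF P.abelian_group M.abelian_group mod_hom_additive[OF h]])
        (use t dx in \<open>auto simp: P.smult_closed\<close>)
    also have "\<dots> = (\<Oplus>\<^bsub>M\<^esub>i\<in>{..<n}. d i x \<odot>\<^bsub>M\<^esub> e i)"
      using t dx D(1) by (intro M.M.finsum_cong') (auto simp: mod_hom_smult[OF h] M.smult_closed)
    also have "\<dots> = x" by (rule D(3)[OF x, symmetric])
    finally show "x = h ?v" ..
  qed
  then have "h ` carrier (W P) = carrier M" using mod_hom_closed[OF h] by auto
  with P(1,2) show ?thesis by (rule that)
qed

lemma compose_far:
  "\<lbrakk>X \<in> LOb A; Y \<in> LOb A; Z \<in> LOb A; f \<in> carrier (LHom A X Y); g \<in> carrier (LHom A Y Z)\<rbrakk>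
    \<Longrightarrow> compose (carrier (W X)) (far w Y Z g) (far w X Y f) = far w X Z (LCmp A X Y Z g f)"
  by (simp add: far_compose)

lemma hom_add_far:
  assumes "X \<in> LOb A" "Y \<in> LOb A" "f \<in> carrier (LHom A X Y)" "g \<in> carrier (LHom A X Y)"
  shows "hom_add (W X) (W Y) (far w X Y f) (far w X Y g) = far w X Y (f \<oplus>\<^bsub>LHom A X Y\<^esub> g)"
  by (rule mod_hom_eqI[OF mod_hom_hom_add[OF W_module W_module far_hom far_hom] far_hom])
    (use assms in \<open>simp_all add: far_add LHom_add_closed\<close>, simp add: hom_add_def)

lemma hom_zero_far: "\<lbrakk>X \<in> LOb A; Y \<in> LOb A\<rbrakk> \<Longrightarrow> hom_zero (W X) (W Y) = far w X Y \<zero>\<^bsub>LHom A X Y\<^esub>"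
  by (rule mod_hom_eqI[OF mod_hom_hom_zero[OF W_module W_module] far_hom])
    (simp_all add: far_zero LHom_zero_closed, simp add: hom_zero_def)

text \<open>The hypothesis \<open>cover\<close> treats kernel elements one at a time. As p splits,
  the kernel is a direct summand of w(Z), hence finitely generated, and covers of its generators can
  be merged into a single arrow.\<close>

lemma kernel_cover:
  fixes M :: "('b, 'm) module"
  assumes M: "fg_projective B M" and Z: "Z \<in> LOb A" and p: "p \<in> mod_hom B (W Z) M"
    and surj: "p ` carrier (W Z) = carrier M"
    and cover: "\<And>y. \<lbrakk>y \<in> carrier (W Z); p y = \<zero>\<^bsub>M\<^esub>\<rbrakk> \<Longrightarrow> \<exists>X\<in>LOb A. \<exists>k\<in>carrier (LHom A X Z).
      y \<in> far w X Z k ` carrier (W X) \<and> (\<forall>x\<in>carrier (W X). p (far w X Z k x) = \<zero>\<^bsub>M\<^esub>)"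
  obtains K k where "K \<in> LOb A" "k \<in> carrier (LHom A K Z)"
    "\<And>x. x \<in> carrier (W K) \<Longrightarrow> p (far w K Z k x) = \<zero>\<^bsub>M\<^esub>"
    "\<And>y. \<lbrakk>y \<in> carrier (W Z); p y = \<zero>\<^bsub>M\<^esub>\<rbrakk> \<Longrightarrow> y \<in> far w K Z k ` carrier (W K)"
proof -
  have Mm: "left_module B M" using M by (simp add: fg_projective_def)
  note WZ = W_module[OF Z]
  interpret M: left_module B M by (rule Mm)
  interpret Z: left_module B "W Z" by (rule WZ)
  obtain \<sigma> where \<sigma>: "\<sigma> \<in> mod_hom B M (W Z)" "\<And>x. x \<in> carrier M \<Longrightarrow> p (\<sigma> x) = x"
    using fg_projective_section[OF M WZ p surj] by blast
  \<comment> \<open>The projection 1 - \<sigma> p has values in the kernel of p and fixes it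
    pointwise, so the images of the dual basis vectors of w(Z) generate the kernel.\<close>
  let ?r = "hom_minus (W Z) (W Z) (idW Z) (compose (carrier (W Z)) \<sigma> p)"
  have \<sigma>p: "compose (carrier (W Z)) \<sigma> p \<in> mod_hom B (W Z) (W Z)"
    by (rule mod_hom_comp[OF WZ p \<sigma>(1)])
  have r: "?r \<in> mod_hom B (W Z) (W Z)"
    by (rule mod_hom_hom_minus[OF WZ WZ idW_hom[OF Z] \<sigma>p])
  have pc: "p v \<in> carrier M" "\<sigma> (p v) \<in> carrier (W Z)" if "v \<in> carrier (W Z)" for v
    using that mod_hom_closed[OF p] mod_hom_closed[OF \<sigma>(1)] by auto
  have rv: "?r v = v \<ominus>\<^bsub>W Z\<^esub> \<sigma> (p v)" if "v \<in> carrier (W Z)" for v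
    using that by (simp add: hom_minus_def compose_eq)
  have pr: "p (?r v) = \<zero>\<^bsub>M\<^esub>" if v: "v \<in> carrier (W Z)" for v
    using additive_minus[OF Z.abelian_group M.abelian_group mod_hom_additive[OF p] v pc(2)[OF v]]
      \<sigma>(2)[OF pc(1)[OF v]] pc[OF v] by (simp add: rv[OF v] a_minus_def M.M.r_neg)
  have r_ker: "?r v = v" if "v \<in> carrier (W Z)" "p v = \<zero>\<^bsub>M\<^esub>" for v
    using that additive_zero[OF M.abelian_group Z.abelian_group mod_hom_additive[OF \<sigma>(1)]]
    by (simp add: rv a_minus_def)
  \<comment> \<open>Maps that come from arrows into Z and are killed by p. Merging two of them over
    a biproduct gives the image of a sum of arrows, because \<open>w\<close> is additive.\<close>
  define H where "H X = {far w X Z k |k. k \<in> carrier (LHom A X Z) \<and> (\<forall>x\<in>carrier (W X). p (far w X Z k x) = \<zero>\<^bsub>M\<^esub>)}" for X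
  have p0: "p \<zero>\<^bsub>W Z\<^esub> = \<zero>\<^bsub>M\<^esub>"
    by (rule additive_zero[OF Z.abelian_group M.abelian_group mod_hom_additive[OF p]])
  let ?e = "bas_e Z" and ?d = "bas_d Z" and ?I = "{..<bas_n Z}"
  obtain K h where K: "K \<in> LOb A" "h \<in> H K" "(\<lambda>i. ?r (?e i)) ` ?I \<subseteq> h ` carrier (W K)"
  proof (rule finite_cover[OF WZ, of H "(\<lambda>i. ?r (?e i)) ` ?I"])
    show "h \<in> mod_hom B (W X) (W Z)" if "X \<in> LOb A" "h \<in> H X" for X h
      using that Z by (auto simp: H_def intro: far_hom)
    show "hom_zero (W X) (W Z) \<in> H X" if "X \<in> LOb A" for X
      unfolding H_def using that Z p0 by (auto simp: hom_zero_far LHom_zero_closed far_zero)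
    show "hom_add (W P) (W Z) (compose (carrier (W P)) h (far w P X pp)) (compose (carrier (W P)) k (far w P Y q)) \<in> H P"
      if X: "X \<in> LOb A" and Y: "Y \<in> LOb A" and bp: "is_biproduct A X Y P i j pp q" and h: "h \<in> H X" and k: "k \<in> H Y"
      for X Y P i j pp q h k
    proof -
      have P: "P \<in> LOb A" "pp \<in> carrier (LHom A P X)" "q \<in> carrier (LHom A P Y)"
        using bp by (auto simp: is_biproduct_def)
      obtain a where a: "h = far w X Z a" "a \<in> carrier (LHom A X Z)" "\<And>x. x \<in> carrier (W X) \<Longrightarrow> p (far w X Z a x) = \<zero>\<^bsub>M\<^esub>"
        using h by (auto simp: H_def)
      obtain b where b: "k = far w Y Z b" "b \<in> carrier (LHom A Y Z)" "\<And>y. y \<in> carrier (W Y) \<Longrightarrow> p (far w Y Z b y) = \<zero>\<^bsub>M\<^esub>"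
        using k by (auto simp: H_def)
      let ?c = "LCmp A P X Z a pp \<oplus>\<^bsub>LHom A P Z\<^esub> LCmp A P Y Z b q"
      have c1: "LCmp A P X Z a pp \<in> carrier (LHom A P Z)" and c2: "LCmp A P Y Z b q \<in> carrier (LHom A P Z)"
        using P X Y Z a b by (auto intro: LCmp_closed)
      have "hom_add (W P) (W Z) (compose (carrier (W P)) h (far w P X pp)) (compose (carrier (W P)) k (far w P Y q))
          = far w P Z ?c"
        using P X Y Z a b c1 c2 by (simp add: compose_far hom_add_far)
      moreover have "p (far w P Z ?c v) = \<zero>\<^bsub>M\<^esub>" if v: "v \<in> carrier (W P)" for v
        using far_add[OF P(1) Z c1 c2 v] far_comp[OF P(1) X Z P(2) a(2) v] far_comp[OF P(1) Y Z P(3) b(2) v]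
          mod_hom_add[OF p, of "far w X Z a (far w P X pp v)" "far w Y Z b (far w P Y q v)"]
          a(3)[OF far_W_closed[OF P(1) X P(2) v]] b(3)[OF far_W_closed[OF P(1) Y P(3) v]]
          far_W_closed[OF X Z a(2) far_W_closed[OF P(1) X P(2) v]] far_W_closed[OF Y Z b(2) far_W_closed[OF P(1) Y P(3) v]]
        by simp
      ultimately show ?thesis using LHom_add_closed[OF P(1) Z c1 c2] by (auto simp: H_def)
    qed
    show "\<exists>X\<in>LOb A. \<exists>h\<in>H X. s \<in> h ` carrier (W X)" if s: "s \<in> (\<lambda>i. ?r (?e i)) ` ?I" for s
    proof -
      obtain i where i: "i < bas_n Z" "s = ?r (?e i)" using s by auto
      have e: "?e i \<in> carrier (W Z)" using Z i by (simp add: bas_e_closed)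
      show ?thesis using cover[OF mod_hom_closed[OF r e] pr[OF e]] i(2) unfolding H_def by blast
    qed
  qed auto
  obtain k where k: "h = far w K Z k" "k \<in> carrier (LHom A K Z)" "\<And>x. x \<in> carrier (W K) \<Longrightarrow> p (far w K Z k x) = \<zero>\<^bsub>M\<^esub>"
    using K(2) by (auto simp: H_def)
  interpret K: left_module B "W K" by (rule W_module[OF K(1)])
  note kh = far_hom[OF K(1) Z k(2)]
  have "\<exists>t. t \<in> carrier (W K) \<and> far w K Z k t = ?r (?e i)" if i: "i \<in> ?I" for i
  proof -
    have "?r (?e i) \<in> far w K Z k ` carrier (W K)" using K(3) i unfolding k(1) by blast
    then show ?thesis by (elim imageE) (rule exI, rule conjI, assumption, rule sym)
  qed
  then have "\<exists>t. \<forall>i\<in>?I. t i \<in> carrier (W K) \<and> far w K Z k (t i) = ?r (?e i)"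
    by (intro bchoice ballI)
  then obtain t where t: "\<And>i. i < bas_n Z \<Longrightarrow> t i \<in> carrier (W K)" "\<And>i. i < bas_n Z \<Longrightarrow> far w K Z k (t i) = ?r (?e i)"
    by auto
  show ?thesis
  proof (rule that[OF K(1) k(2,3)])
    fix y assume y: "y \<in> carrier (W Z)" "p y = \<zero>\<^bsub>M\<^esub>"
    have dy: "?d i y \<in> carrier B" if "i < bas_n Z" for i using dual_closed[OF bas_d_dual[OF Z that] y(1)] .
    \<comment> \<open>y equals its own image under \<open>?r\<close>; the dual basis expansion of
      that image is a combination of the elements \<open>?r (?e i)\<close>, whose preimages are the
      t i.\<close>
    let ?v = "\<Oplus>\<^bsub>W K\<^esub>i\<in>?I. ?d i y \<odot>\<^bsub>W K\<^esub> t i"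
    have v: "?v \<in> carrier (W K)" using t dy by (intro K.M.finsum_closed) (auto simp: K.smult_closed)
    have "far w K Z k ?v = (\<Oplus>\<^bsub>W Z\<^esub>i\<in>?I. far w K Z k (?d i y \<odot>\<^bsub>W K\<^esub> t i))"
      by (rule additive_finsum[OF K.abelian_group Z.abelian_group mod_hom_additive[OF kh]])
        (use t dy in \<open>auto simp: K.smult_closed\<close>)
    also have "\<dots> = (\<Oplus>\<^bsub>W Z\<^esub>i\<in>?I. ?d i y \<odot>\<^bsub>W Z\<^esub> ?r (?e i))"
      using t dy mod_hom_closed[OF r bas_e_closed[OF Z]]
      by (intro Z.M.finsum_cong') (auto simp: mod_hom_smult[OF kh] Z.smult_closed)
    also have "\<dots> = ?r y"
      by (rule dual_basis_hom_expand[OF WZ WZ is_dual_basis_bas[OF Z] r y(1), symmetric])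
    finally have "y = far w K Z k ?v" unfolding r_ker[OF y] by (rule sym)
    then show "y \<in> far w K Z k ` carrier (W K)" using v by (rule image_eqI)
  qed
qed

end

section \<open>Fullness and essential surjectivity\<close>

locale tannakian_functor = cofiltered_fibre_functor R B A w
  for R :: "'r ring" and B :: "('r, 'b) module"
    and A :: "('o, 'a, 'r) lin_cat" and w :: "('o, 'a, 'b, 'm) fibre" +
  assumes faithful_w: "faithful_functor (ordinary A) (ordinary (Mod_cat B)) w"
    and reflects_w: "reflects_isos (ordinary A) (ordinary (Mod_cat B)) w"
    and cokernels_w: "\<lbrakk>X \<in> LOb A; Y \<in> LOb A; f \<in> carrier (LHom A X Y);
        is_cokernel (Mod_cat B) (fob w X) (fob w Y) (far w X Y f) Q q; fg_projective B Q\<rbrakk>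
      \<Longrightarrow> \<exists>C c. is_cokernel A X Y f C c \<and>
             is_cokernel (Mod_cat B) (fob w X) (fob w Y) (far w X Y f) (fob w C) (far w Y C c)"
begin

lemma far_inj:
  "\<lbrakk>X \<in> LOb A; Y \<in> LOb A; f \<in> carrier (LHom A X Y); g \<in> carrier (LHom A X Y); far w X Y f = far w X Y g\<rbrakk>
    \<Longrightarrow> f = g"
  using faithful_w by (simp add: faithful_functor_def inj_on_def)

text \<open>Both p and w(q) are cokernels of w(k), the first by construction of k and the second by
  preservation; s and s' are the comparison maps between them.\<close>

lemma cokernel_presentation:
  fixes M :: "('b, 'm) module"
  assumes M: "fg_projective B M" and Z: "Z \<in> LOb A" and p: "p \<in> mod_hom B (W Z) M"
    and surj: "p ` carrier (W Z) = carrier M"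
    and cover: "\<And>y. \<lbrakk>y \<in> carrier (W Z); p y = \<zero>\<^bsub>M\<^esub>\<rbrakk> \<Longrightarrow> \<exists>X\<in>LOb A. \<exists>k\<in>carrier (LHom A X Z).
      y \<in> far w X Z k ` carrier (W X) \<and> (\<forall>x\<in>carrier (W X). p (far w X Z k x) = \<zero>\<^bsub>M\<^esub>)"
  obtains K k Q q s s' where "K \<in> LOb A" "k \<in> carrier (LHom A K Z)"
    "\<forall>x\<in>carrier (W K). p (far w K Z k x) = \<zero>\<^bsub>M\<^esub>"
    "is_cokernel A K Z k Q q" "s \<in> mod_hom B (W Q) M" "s' \<in> mod_hom B M (W Q)"
    "\<forall>x\<in>carrier (W Q). s' (s x) = x" "\<forall>x\<in>carrier M. s (s' x) = x"
    "\<forall>z\<in>carrier (W Z). s (far w Z Q q z) = p z"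
proof -
  have Mm: "left_module B M" using M by (simp add: fg_projective_def)
  obtain K k where K: "K \<in> LOb A" "k \<in> carrier (LHom A K Z)"
    and pk: "\<And>x. x \<in> carrier (W K) \<Longrightarrow> p (far w K Z k x) = \<zero>\<^bsub>M\<^esub>"
    and ker: "\<And>y. \<lbrakk>y \<in> carrier (W Z); p y = \<zero>\<^bsub>M\<^esub>\<rbrakk> \<Longrightarrow> y \<in> far w K Z k ` carrier (W K)"
    using kernel_cover[OF M Z p surj cover] by blast
  have cM: "is_cokernel (Mod_cat B) (W K) (W Z) (far w K Z k) M p"
    by (rule is_cokernel_Mod_cat[OF M W_module[OF Z] W_module[OF K(1)] far_hom[OF K(1) Z K(2)] p surj pk ker])
  obtain Q q where Q: "is_cokernel A K Z k Q q"
    and cQ: "is_cokernel (Mod_cat B) (W K) (W Z) (far w K Z k) (W Q) (far w Z Q q)"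
    using cokernels_w[OF K(1) Z K(2) cM M] by blast
  have Q': "Q \<in> LOb A" "q \<in> carrier (LHom A Z Q)" using Q by (auto simp: is_cokernel_def)
  note qh = far_hom[OF Z Q'(1,2)] and WQ = W_module[OF Q'(1)]
  have uM: "\<exists>!h. h \<in> mod_hom B M N \<and> compose (carrier (W Z)) h p = g"
    if "left_module B N" "g \<in> mod_hom B (W Z) N" "compose (carrier (W K)) g (far w K Z k) = hom_zero (W K) N"
    for N :: "('b, 'm) module" and g
    using cM that unfolding is_cokernel_def by simp
  have uQ: "\<exists>!h. h \<in> mod_hom B (W Q) N \<and> compose (carrier (W Z)) h (far w Z Q q) = g"
    if "left_module B N" "g \<in> mod_hom B (W Z) N" "compose (carrier (W K)) g (far w K Z k) = hom_zero (W K) N"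
    for N :: "('b, 'm) module" and g
    using cQ that unfolding is_cokernel_def by simp
  have pz: "compose (carrier (W K)) p (far w K Z k) = hom_zero (W K) M"
    using cM by (simp add: is_cokernel_def)
  have qz: "compose (carrier (W K)) (far w Z Q q) (far w K Z k) = hom_zero (W K) (W Q)"
    using cQ by (simp add: is_cokernel_def)
  obtain s where s: "s \<in> mod_hom B (W Q) M" "compose (carrier (W Z)) s (far w Z Q q) = p"
    using uQ[OF Mm p pz] by blast
  obtain s' where s': "s' \<in> mod_hom B M (W Q)" "compose (carrier (W Z)) s' p = far w Z Q q"
    using uM[OF WQ qh qz] by blast
  have sq: "s (far w Z Q q z) = p z" "s' (p z) = far w Z Q q z" if "z \<in> carrier (W Z)" for z
    using compose_apply[OF s(2) that] compose_apply[OF s'(2) that] by auto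
  \<comment> \<open>This composite is the identity by surjectivity of p. The composite on w(Q) is
    treated by the uniqueness clause for the cokernel w(q), whose surjectivity has not been
    established.\<close>
  have "compose (carrier M) s s' = (\<lambda>x\<in>carrier M. x)"
  proof (rule mod_hom_eqI[OF mod_hom_comp[OF Mm s'(1) s(1)] mod_hom_id[OF Mm]])
    fix x assume x: "x \<in> carrier M"
    then obtain z where "z \<in> carrier (W Z)" "x = p z" using surj by blast
    then show "compose (carrier M) s s' x = (\<lambda>x\<in>carrier M. x) x" using x by (simp add: compose_eq sq)
  qed
  moreover have "compose (carrier (W Q)) s' s = idW Q"
  proof -
    have "compose (carrier (W Z)) (compose (carrier (W Q)) s' s) (far w Z Q q) = far w Z Q q"
      by (rule mod_hom_eqI[OF mod_hom_comp[OF W_module[OF Z] qh mod_hom_comp[OF WQ s(1) s'(1)]] qh])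
        (simp add: compose_eq sq mod_hom_closed[OF qh])
    moreover have "compose (carrier (W Z)) (idW Q) (far w Z Q q) = far w Z Q q"
      by (rule Id_compose) (use qh in \<open>auto simp: mod_homD\<close>)
    ultimately show ?thesis
      using uQ[OF WQ qh qz] mod_hom_comp[OF WQ s(1) s'(1)] idW_hom[OF Q'(1)] by blast
  qed
  ultimately have "\<forall>x\<in>carrier (W Q). s' (s x) = x" "\<forall>x\<in>carrier M. s (s' x) = x"
    using compose_apply[of "carrier (W Q)" s' s] compose_apply[of "carrier M" s s'] by fastforce+
  then show ?thesis using that[OF K _ Q s(1) s'(1)] pk sq(1) by simp
qed

text \<open>Both a and the zero arrow go from (Z, z) to (X, 0), so cofilteredness equalizes
  them.\<close>

lemma elt_kill:
  assumes X: "X \<in> LOb A" and Z: "Z \<in> LOb A" "z \<in> carrier (W Z)" and a: "a \<in> carrier (LHom A Z X)"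
    and zero: "far w Z X a z = \<zero>\<^bsub>W X\<^esub>"
  obtains Y y k where "elt_arrow Y y Z z k" "\<And>v. v \<in> carrier (W Y) \<Longrightarrow> far w Z X a (far w Y Z k v) = \<zero>\<^bsub>W X\<^esub>"
proof -
  have W0: "\<zero>\<^bsub>W X\<^esub> \<in> carrier (W X)" using abelian_groupE(2)[OF W_abelian_group[OF X]] .
  have "elt_arrow Z z X \<zero>\<^bsub>W X\<^esub> a" "elt_arrow Z z X \<zero>\<^bsub>W X\<^esub> \<zero>\<^bsub>LHom A Z X\<^esub>"
    using X Z a zero W0 by (auto simp: elt_arrow_def elt_def far_zero LHom_zero_closed)
  then obtain Y y k where k: "elt_arrow Y y Z z k"
    and eq: "LCmp A Y Z X a k = LCmp A Y Z X \<zero>\<^bsub>LHom A Z X\<^esub> k"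
    by (rule elt_equalize)
  have "far w Z X a (far w Y Z k v) = \<zero>\<^bsub>W X\<^esub>" if v: "v \<in> carrier (W Y)" for v
  proof -
    have Y: "Y \<in> LOb A" "k \<in> carrier (LHom A Y Z)" using k by (auto simp: elt_arrow_def elt_def)
    have "far w Z X a (far w Y Z k v) = far w Z X \<zero>\<^bsub>LHom A Z X\<^esub> (far w Y Z k v)"
      using far_comp[OF Y(1) Z(1) X Y(2) a v] far_comp[OF Y(1) Z(1) X Y(2) LHom_zero_closed[OF Z(1) X] v] eq by simp
    then show ?thesis using far_zero[OF Z(1) X far_W_closed[OF Y(1) Z(1) Y(2) v]] by simp
  qed
  with k show ?thesis by (rule that)
qed

text \<open>A cover a : Z \<rightarrow> X with a partner b : Z \<rightarrow> Y satisfying g w(a) =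
  w(b) is not yet an arrow X \<rightarrow> Y. Both a and b kill a cover k of the kernel of w(a), so
  both factor through the cokernel q of k, as a' and b'. The arrow a' is invertible, and g is the
  image of b' after the inverse of a'.\<close>

lemma comod_map_full:
  assumes X: "X \<in> LOb A" and Y: "Y \<in> LOb A" and g: "comod_map (W Y) (canonical_coaction R B A w Y) X g"
  shows "\<exists>f\<in>carrier (LHom A X Y). g = far w X Y f"
proof -
  note WX = W_module[OF X] and WY = W_module[OF Y]
  have gh: "g \<in> mod_hom B (W X) (W Y)"
    and gt: "\<And>x. x \<in> carrier (W X) \<Longrightarrow> theta (W Y) X x g = theta (W Y) Y (g x) (idW Y)"
    using g mod_hom_closed by (fastforce simp: comod_map_def canonical_coaction_eq[OF Y])+
  \<comment> \<open>The partner b is existentially quantified, so merging covers over biproducts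
    also merges the partners, with additivity of g ensuring the relation.\<close>
  define H where "H Z = {far w Z X a |a. a \<in> carrier (LHom A Z X) \<and>
      (\<exists>b\<in>carrier (LHom A Z Y). \<forall>z\<in>carrier (W Z). g (far w Z X a z) = far w Z Y b z)}" for Z
  obtain Z h where Z: "Z \<in> LOb A" "h \<in> H Z" "h ` carrier (W Z) = carrier (W X)"
  proof (rule fg_projective_cover[OF fgp[OF X], of H])
    show "h \<in> mod_hom B (W Z) (W X)" if "Z \<in> LOb A" "h \<in> H Z" for Z h
      using that X by (auto simp: H_def intro: far_hom)
    show "hom_zero (W Z) (W X) \<in> H Z" if Z: "Z \<in> LOb A" for Z
    proof -
      have "g \<zero>\<^bsub>W X\<^esub> = \<zero>\<^bsub>W Y\<^esub>"
        by (rule additive_zero[OF W_abelian_group[OF X] W_abelian_group[OF Y] mod_hom_additive[OF gh]])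
      then have "\<forall>z\<in>carrier (W Z). g (far w Z X \<zero>\<^bsub>LHom A Z X\<^esub> z) = far w Z Y \<zero>\<^bsub>LHom A Z Y\<^esub> z"
        using Z X Y by (simp add: far_zero)
      then show ?thesis
        unfolding H_def hom_zero_far[OF Z X] using LHom_zero_closed[OF Z X] LHom_zero_closed[OF Z Y] by blast
    qed
    show "hom_add (W P) (W X) (compose (carrier (W P)) h (far w P U p)) (compose (carrier (W P)) k (far w P V q)) \<in> H P"
      if U: "U \<in> LOb A" and V: "V \<in> LOb A" and bp: "is_biproduct A U V P i j p q" and h: "h \<in> H U" and k: "k \<in> H V"
      for U V P i j p q h k
    proof -
      have P: "P \<in> LOb A" "p \<in> carrier (LHom A P U)" "q \<in> carrier (LHom A P V)"
        using bp by (auto simp: is_biproduct_def)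
      obtain a b where a: "h = far w U X a" "a \<in> carrier (LHom A U X)" and b: "b \<in> carrier (LHom A U Y)"
        and ab: "\<And>z. z \<in> carrier (W U) \<Longrightarrow> g (far w U X a z) = far w U Y b z"
        using h by (auto simp: H_def)
      obtain a' b' where a': "k = far w V X a'" "a' \<in> carrier (LHom A V X)" and b': "b' \<in> carrier (LHom A V Y)"
        and ab': "\<And>z. z \<in> carrier (W V) \<Longrightarrow> g (far w V X a' z) = far w V Y b' z"
        using k by (auto simp: H_def)
      have c: "LCmp A P U X a p \<in> carrier (LHom A P X)" "LCmp A P V X a' q \<in> carrier (LHom A P X)"
        "LCmp A P U Y b p \<in> carrier (LHom A P Y)" "LCmp A P V Y b' q \<in> carrier (LHom A P Y)"
        using P U V X Y a a' b b' by (auto intro: LCmp_closed)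
      let ?c = "LCmp A P U X a p \<oplus>\<^bsub>LHom A P X\<^esub> LCmp A P V X a' q"
      let ?d = "LCmp A P U Y b p \<oplus>\<^bsub>LHom A P Y\<^esub> LCmp A P V Y b' q"
      have "g (far w P X ?c z) = far w P Y ?d z" if z: "z \<in> carrier (W P)" for z
      proof -
        have pz: "far w P U p z \<in> carrier (W U)" "far w P V q z \<in> carrier (W V)"
          using far_W_closed[OF P(1) U P(2) z] far_W_closed[OF P(1) V P(3) z] by auto
        have "far w P X ?c z = far w U X a (far w P U p z) \<oplus>\<^bsub>W X\<^esub> far w V X a' (far w P V q z)"
          using far_add[OF P(1) X c(1,2) z] far_comp[OF P(1) U X P(2) a(2) z] far_comp[OF P(1) V X P(3) a'(2) z] by simp
        then have "g (far w P X ?c z) = far w U Y b (far w P U p z) \<oplus>\<^bsub>W Y\<^esub> far w V Y b' (far w P V q z)"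
          using mod_hom_add[OF gh far_W_closed[OF U X a(2) pz(1)] far_W_closed[OF V X a'(2) pz(2)]] ab[OF pz(1)] ab'[OF pz(2)]
          by simp
        then show ?thesis
          using far_add[OF P(1) Y c(3,4) z] far_comp[OF P(1) U Y P(2) b z] far_comp[OF P(1) V Y P(3) b' z] by simp
      qed
      moreover have "hom_add (W P) (W X) (compose (carrier (W P)) h (far w P U p)) (compose (carrier (W P)) k (far w P V q))
          = far w P X ?c"
        using P U V X a a' c by (simp add: compose_far hom_add_far)
      ultimately show ?thesis
        unfolding H_def using LHom_add_closed[OF P(1) X c(1,2)] LHom_add_closed[OF P(1) Y c(3,4)] by blast
    qed
    show "\<exists>Z\<in>LOb A. \<exists>h\<in>H Z. x \<in> h ` carrier (W Z)" if x: "x \<in> carrier (W X)" for x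
    proof -
      have ex: "elt X x" and ey: "elt Y (g x)" using x X Y mod_hom_closed[OF gh] by (auto simp: elt_def)
      obtain P v a b where a: "elt_arrow P v X x a" and b: "elt_arrow P v Y (g x) b"
        using elt_span[OF ex ey] by blast
      have P: "elt P v" "P \<in> LOb A" "a \<in> carrier (LHom A P X)" "b \<in> carrier (LHom A P Y)"
        using a b by (auto simp: elt_arrow_def elt_def)
      note ga = theta_pull[OF WY a gh] and yb = theta_pull[OF WY b idW_hom[OF Y]]
      \<comment> \<open>Compatibility of g with the coactions equates theta of g at (X, x) with
        theta of the identity at (Y, g x). Pulled back to (P, v), both become thetas at one element,
        and a refinement makes g after w(a) equal to w(b).\<close>
      have eq: "theta (W Y) P v (compose (carrier (W P)) g (far w P X a))
          = theta (W Y) P v (compose (carrier (W P)) (idW Y) (far w P Y b))"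
        using ga(2) yb(2) gt[OF x] by simp
      obtain Z z c where c: "elt_arrow Z z P v c"
        and ceq: "\<And>y. y \<in> carrier (W Z) \<Longrightarrow> compose (carrier (W P)) g (far w P X a) (far w Z P c y)
          = compose (carrier (W P)) (idW Y) (far w P Y b) (far w Z P c y)"
        using theta_eqD[OF WY P(1) ga(1) yb(1) eq] by blast
      have Zc: "Z \<in> LOb A" "c \<in> carrier (LHom A Z P)" "z \<in> carrier (W Z)"
        using c by (auto simp: elt_arrow_def elt_def)
      let ?a = "LCmp A Z P X a c" and ?b = "LCmp A Z P Y b c"
      have "g (far w Z X ?a y) = far w Z Y ?b y" if y: "y \<in> carrier (W Z)" for y
      proof -
        have cy: "far w Z P c y \<in> carrier (W P)" using far_W_closed[OF Zc(1) P(2) Zc(2) y] .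
        then show ?thesis
          using ceq[OF y] far_comp[OF Zc(1) P(2) X Zc(2) P(3) y] far_comp[OF Zc(1) P(2) Y Zc(2) P(4) y]
            far_W_closed[OF P(2) Y P(4) cy] by (simp add: compose_eq)
      qed
      moreover have "?a \<in> carrier (LHom A Z X)" "?b \<in> carrier (LHom A Z Y)"
        using P Zc X Y by (auto intro: LCmp_closed)
      ultimately have "far w Z X ?a \<in> H Z" unfolding H_def by blast
      moreover have "far w Z X ?a z = x" using elt_arrow_comp[OF c a] by (simp add: elt_arrow_def)
      ultimately show ?thesis using Zc by blast
    qed
  qed auto
  obtain a b where a: "h = far w Z X a" "a \<in> carrier (LHom A Z X)" and b: "b \<in> carrier (LHom A Z Y)"
    and ab: "\<And>z. z \<in> carrier (W Z) \<Longrightarrow> g (far w Z X a z) = far w Z Y b z"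
    using Z(2) by (auto simp: H_def)
  have surj: "far w Z X a ` carrier (W Z) = carrier (W X)" using Z(3) a(1) by simp
  have cov: "\<exists>U\<in>LOb A. \<exists>k\<in>carrier (LHom A U Z).
      y \<in> far w U Z k ` carrier (W U) \<and> (\<forall>x\<in>carrier (W U). far w Z X a (far w U Z k x) = \<zero>\<^bsub>W X\<^esub>)"
    if y: "y \<in> carrier (W Z)" "far w Z X a y = \<zero>\<^bsub>W X\<^esub>" for y
  proof -
    obtain U u k where k: "elt_arrow U u Z y k" "\<And>v. v \<in> carrier (W U) \<Longrightarrow> far w Z X a (far w U Z k v) = \<zero>\<^bsub>W X\<^esub>"
      using elt_kill[OF X Z(1) y(1) a(2) y(2)] by blast
    then show ?thesis by (auto simp: elt_arrow_def elt_def intro!: bexI[of _ U] bexI[of _ k])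
  qed
  obtain K k Q q s s' where K: "K \<in> LOb A" "k \<in> carrier (LHom A K Z)"
    and ak': "\<forall>x\<in>carrier (W K). far w Z X a (far w K Z k x) = \<zero>\<^bsub>W X\<^esub>"
    and cok: "is_cokernel A K Z k Q q" and s: "s \<in> mod_hom B (W Q) (W X)" and s': "s' \<in> mod_hom B (W X) (W Q)"
    and ss': "\<forall>x\<in>carrier (W Q). s' (s x) = x" "\<forall>x\<in>carrier (W X). s (s' x) = x"
    and sq': "\<forall>z\<in>carrier (W Z). s (far w Z Q q z) = far w Z X a z"
    by (rule cokernel_presentation[OF fgp[OF X] Z(1) far_hom[OF Z(1) X a(2)] surj cov])
  note ak = bspec[OF ak'] and ss = bspec[OF ss'(1)] bspec[OF ss'(2)] and sq = bspec[OF sq']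
  have Q: "Q \<in> LOb A" "q \<in> carrier (LHom A Z Q)" using cok by (auto simp: is_cokernel_def)
  \<comment> \<open>Faithfulness transfers vanishing from modules to \<open>A\<close>. It is applied
    to both a and b, so that both factor through q.\<close>
  have kz: "LCmp A K Z V c k = \<zero>\<^bsub>LHom A K V\<^esub>"
    if V: "V \<in> LOb A" and c: "c \<in> carrier (LHom A Z V)"
      and 0: "\<And>x. x \<in> carrier (W K) \<Longrightarrow> far w Z V c (far w K Z k x) = \<zero>\<^bsub>W V\<^esub>" for V c
  proof (rule far_inj[OF K(1) V LCmp_closed[OF K(1) Z(1) V K(2) c] LHom_zero_closed[OF K(1) V]])
    show "far w K V (LCmp A K Z V c k) = far w K V \<zero>\<^bsub>LHom A K V\<^esub>"
      by (rule mod_hom_eqI[OF far_hom[OF K(1) V LCmp_closed[OF K(1) Z(1) V K(2) c]] far_hom[OF K(1) V LHom_zero_closed[OF K(1) V]]])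
        (use 0 K Z(1) V c in \<open>simp add: far_comp far_zero\<close>)
  qed
  have univ: "\<exists>!f. f \<in> carrier (LHom A Q V) \<and> LCmp A Z Q V f q = c"
    if "V \<in> LOb A" "c \<in> carrier (LHom A Z V)" "LCmp A K Z V c k = \<zero>\<^bsub>LHom A K V\<^esub>" for V c
    using cok that by (simp add: is_cokernel_def)
  obtain a' where a': "a' \<in> carrier (LHom A Q X)" "LCmp A Z Q X a' q = a"
    using univ[OF X a(2) kz[OF X a(2) ak]] by blast
  have bk: "far w Z Y b (far w K Z k x) = \<zero>\<^bsub>W Y\<^esub>" if x: "x \<in> carrier (W K)" for x
    using ab[OF far_W_closed[OF K(1) Z(1) K(2) x]] ak[OF x]
      additive_zero[OF W_abelian_group[OF X] W_abelian_group[OF Y] mod_hom_additive[OF gh]] by simp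
  obtain b' where b': "b' \<in> carrier (LHom A Q Y)" "LCmp A Z Q Y b' q = b"
    using univ[OF Y b kz[OF Y b bk]] by blast
  have aq: "far w Q X a' (far w Z Q q z) = far w Z X a z" and bq: "far w Q Y b' (far w Z Q q z) = far w Z Y b z"
    if "z \<in> carrier (W Z)" for z
    using far_comp[OF Z(1) Q(1) X Q(2) a'(1) that] far_comp[OF Z(1) Q(1) Y Q(2) b'(1) that] a'(2) b'(2) by auto
  \<comment> \<open>w(q) followed by s is the surjection w(a), and s is injective with inverse
    s'.\<close>
  have q_surj: "\<exists>z\<in>carrier (W Z). y = far w Z Q q z" if y: "y \<in> carrier (W Q)" for y
  proof -
    obtain z where z: "z \<in> carrier (W Z)" "s y = far w Z X a z"
      using surj mod_hom_closed[OF s y] by blast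
    have "y = s' (s (far w Z Q q z))" using z ss(1)[OF y] sq[OF z(1)] by simp
    also have "\<dots> = far w Z Q q z" by (rule ss(1)[OF far_W_closed[OF Z(1) Q z(1)]])
    finally show ?thesis using z by blast
  qed
  have a's: "far w Q X a' = s"
    by (rule mod_hom_eqI[OF far_hom[OF Q(1) X a'(1)] s]) (use q_surj aq sq in force)
  \<comment> \<open>The image of a' under \<open>w\<close> is the comparison isomorphism s;
    reflection of isomorphisms then provides the inverse of a' in \<open>A\<close>.\<close>
  have "is_iso (ordinary (Mod_cat B)) (W Q) (W X) (far w Q X a')"
  proof -
    have 1: "compose (carrier (W Q)) s' s = idW Q"
      by (rule mod_hom_eqI[OF mod_hom_comp[OF W_module[OF Q(1)] s s'] idW_hom[OF Q(1)]]) (simp add: compose_eq ss)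
    have 2: "compose (carrier (W X)) s s' = idW X"
      by (rule mod_hom_eqI[OF mod_hom_comp[OF WX s' s] idW_hom[OF X]]) (simp add: compose_eq ss)
    show ?thesis unfolding is_iso_def a's using s s' 1 2 by (auto intro!: bexI[of _ s'])
  qed
  then have "is_iso (ordinary A) Q X a'"
    using reflects_w Q X a' by (simp add: reflects_isos_def)
  then obtain c where c: "c \<in> carrier (LHom A X Q)" "LCmp A X Q X a' c = LIdn A X"
    by (auto simp: is_iso_def)
  let ?f = "LCmp A X Q Y b' c"
  have f: "?f \<in> carrier (LHom A X Y)" by (rule LCmp_closed[OF X Q(1) Y c(1) b'(1)])
  have "g = far w X Y ?f"
  proof (rule mod_hom_eqI[OF gh far_hom[OF X Y f]])
    fix x assume x: "x \<in> carrier (W X)"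
    obtain z where z: "z \<in> carrier (W Z)" "far w X Q c x = far w Z Q q z"
      using q_surj[OF far_W_closed[OF X Q(1) c(1) x]] by blast
    have "x = far w Q X a' (far w X Q c x)"
      using far_comp[OF X Q(1) X c(1) a'(1) x] c(2) far_id[OF X x] by simp
    then have "x = far w Z X a z" using z aq[OF z(1)] by simp
    then have "g x = far w Z Y b z" using ab[OF z(1)] by simp
    also have "\<dots> = far w Q Y b' (far w X Q c x)" using bq[OF z(1)] z(2) by simp
    also have "\<dots> = far w X Y ?f x" by (rule far_comp[OF X Q(1) Y c(1) b'(1) x, symmetric])
    finally show "g x = far w X Y ?f x" .
  qed
  with f show ?thesis by blast
qed

lemma comod_map_essentially_surjective:
  fixes M :: "('b, 'm) module"
  assumes com: "comodule M \<rho>" and M: "fg_projective B M"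
  obtains Q s s' where "Q \<in> LOb A" "comod_map M \<rho> Q s" "s' \<in> mod_hom B M (W Q)"
    "\<And>x. x \<in> carrier (W Q) \<Longrightarrow> s' (s x) = x" "\<And>x. x \<in> carrier M \<Longrightarrow> s (s' x) = x"
proof -
  have Mm: "left_module B M" using M by (simp add: fg_projective_def)
  note TMm = T_module[OF Mm]
  interpret M: left_module B M by (rule Mm)
  interpret TM: left_module B "T M" by (rule TMm)
  have \<rho>: "\<rho> \<in> mod_hom B M (T M)"
    and coassoc: "\<And>x. x \<in> carrier M \<Longrightarrow> comonad_comult B L (coend_comult R B A w) M (\<rho> x)
        = tensor_map B L M (T M) \<rho> (\<rho> x)"
    and counit: "\<And>x. x \<in> carrier M \<Longrightarrow> comonad_counit (coend_counit B) M (\<rho> x) = x"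
    using com by (auto simp: is_comodule_def)
  have \<rho>0: "\<rho> \<zero>\<^bsub>M\<^esub> = \<zero>\<^bsub>T M\<^esub>"
    by (rule additive_zero[OF M.abelian_group TM.abelian_group mod_hom_additive[OF \<rho>]])
  define H where "H X = {h. comod_map M \<rho> X h}" for X
  obtain Z p where Z: "Z \<in> LOb A" "p \<in> H Z" "p ` carrier (W Z) = carrier M"
  proof (rule fg_projective_cover[OF M, of H])
    show "h \<in> mod_hom B (W X) M" if "h \<in> H X" for X h
      using that by (simp add: H_def comod_map_def)
    show "hom_zero (W X) M \<in> H X" if X: "X \<in> LOb A" for X
      unfolding H_def comod_map_def
      using mod_hom_hom_zero[OF W_module[OF X] Mm] theta_zero[OF Mm X] \<rho>0 by (simp add: hom_zero_def)
    show "hom_add (W P) M (compose (carrier (W P)) h (far w P X p)) (compose (carrier (W P)) k (far w P Y q)) \<in> H P"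
      if X: "X \<in> LOb A" and Y: "Y \<in> LOb A" and bp: "is_biproduct A X Y P i j p q" and h: "h \<in> H X" and k: "k \<in> H Y"
      for X Y P i j p q h k
    proof -
      have P: "P \<in> LOb A" "p \<in> carrier (LHom A P X)" "q \<in> carrier (LHom A P Y)"
        using bp by (auto simp: is_biproduct_def)
      have hh: "h \<in> mod_hom B (W X) M" "\<And>x. x \<in> carrier (W X) \<Longrightarrow> theta M X x h = \<rho> (h x)"
        and kk: "k \<in> mod_hom B (W Y) M" "\<And>x. x \<in> carrier (W Y) \<Longrightarrow> theta M Y x k = \<rho> (k x)"
        using h k by (auto simp: H_def comod_map_def)
      let ?h = "compose (carrier (W P)) h (far w P X p)" and ?k = "compose (carrier (W P)) k (far w P Y q)"
      note WP = W_module[OF P(1)]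
      have h': "?h \<in> mod_hom B (W P) M" and k': "?k \<in> mod_hom B (W P) M"
        using mod_hom_comp[OF WP far_hom[OF P(1) X P(2)] hh(1)] mod_hom_comp[OF WP far_hom[OF P(1) Y P(3)] kk(1)] by auto
      have "theta M P v (hom_add (W P) M ?h ?k) = \<rho> (hom_add (W P) M ?h ?k v)" if v: "v \<in> carrier (W P)" for v
      proof -
        have pv: "far w P X p v \<in> carrier (W X)" "far w P Y q v \<in> carrier (W Y)"
          using far_W_closed[OF P(1) X P(2) v] far_W_closed[OF P(1) Y P(3) v] by auto
        have "theta M P v (hom_add (W P) M ?h ?k) = theta M P v ?h \<oplus>\<^bsub>T M\<^esub> theta M P v ?k"
          by (rule theta_hom_add[OF Mm P(1) v h' k'])
        also have "\<dots> = \<rho> (h (far w P X p v)) \<oplus>\<^bsub>T M\<^esub> \<rho> (k (far w P Y q v))"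
          using theta_dinatural[OF Mm P(1) v X P(2) hh(1)] theta_dinatural[OF Mm P(1) v Y P(3) kk(1)]
            hh(2)[OF pv(1)] kk(2)[OF pv(2)] by simp
        also have "\<dots> = \<rho> (h (far w P X p v) \<oplus>\<^bsub>M\<^esub> k (far w P Y q v))"
          by (rule mod_hom_add[OF \<rho> mod_hom_closed[OF hh(1) pv(1)] mod_hom_closed[OF kk(1) pv(2)], symmetric])
        finally show ?thesis using v by (simp add: hom_add_def compose_eq)
      qed
      then show ?thesis using mod_hom_hom_add[OF WP Mm h' k'] by (simp add: H_def comod_map_def)
    qed
    show "\<exists>X\<in>LOb A. \<exists>h\<in>H X. x \<in> h ` carrier (W X)" if x: "x \<in> carrier M" for x
    proof -
      obtain X y h where X: "elt X y" and h: "h \<in> mod_hom B (W X) M" and \<rho>x: "\<rho> x = theta M X y h"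
        by (rule theta_cases[OF Mm mod_hom_closed[OF \<rho> x]])
      have X': "X \<in> LOb A" "y \<in> carrier (W X)" using X by (auto simp: elt_def)
      let ?t = "\<lambda>v\<in>carrier (W X). theta M X v h" and ?r = "compose (carrier (W X)) \<rho> h"
      have t: "?t \<in> mod_hom B (W X) (T M)" by (rule theta_hom[OF Mm X'(1) h])
      have r: "?r \<in> mod_hom B (W X) (T M)" by (rule mod_hom_comp[OF W_module[OF X'(1)] h \<rho>])
      \<comment> \<open>Coassociativity at x compares two homomorphisms from w(X) to
        \<open>T M\<close>: \<open>?t\<close>, which computes thetas of h, and \<open>?r\<close>,
        which is \<rho> after h. Where a refinement makes them agree, the pullback of h satisfies
        \<open>comod_map\<close>.\<close>
      have "theta (T M) X y ?t = theta (T M) X y ?r"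
        using coassoc[OF x] comonad_comult_theta[OF Mm X' h] tensor_map_theta[OF Mm TMm \<rho> X' h] \<rho>x by simp
      then obtain Z z f where f: "elt_arrow Z z X y f"
        and eq: "\<And>v. v \<in> carrier (W Z) \<Longrightarrow> ?t (far w Z X f v) = ?r (far w Z X f v)"
        using theta_eqD[OF TMm X t r] by blast
      have Z: "Z \<in> LOb A" "z \<in> carrier (W Z)" "f \<in> carrier (LHom A Z X)" "far w Z X f z = y"
        using f by (auto simp: elt_arrow_def elt_def)
      let ?h = "compose (carrier (W Z)) h (far w Z X f)"
      note h' = theta_pull[OF Mm f h]
      have "theta M Z v ?h = \<rho> (?h v)" if v: "v \<in> carrier (W Z)" for v
        using eq[OF v] far_W_closed[OF Z(1) X'(1) Z(3) v] theta_dinatural[OF Mm Z(1) v X'(1) Z(3) h] v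
        by (simp add: compose_eq)
      then have "?h \<in> H Z" using h'(1) by (simp add: H_def comod_map_def)
      \<comment> \<open>Evaluation of the counit on \<rho> x, rewritten as theta M Z z
        \<open>?h\<close>.\<close>
      moreover have "?h z = x"
        using comonad_counit_theta[OF Mm Z(1,2) h'(1)] h'(2) \<rho>x counit[OF x] by simp
      ultimately show ?thesis using Z by blast
    qed
  qed auto
  have p: "p \<in> mod_hom B (W Z) M" and pt: "\<And>z. z \<in> carrier (W Z) \<Longrightarrow> theta M Z z p = \<rho> (p z)"
    using Z(2) by (auto simp: H_def comod_map_def)
  have cov: "\<exists>U\<in>LOb A. \<exists>k\<in>carrier (LHom A U Z).
      y \<in> far w U Z k ` carrier (W U) \<and> (\<forall>x\<in>carrier (W U). p (far w U Z k x) = \<zero>\<^bsub>M\<^esub>)"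
    if y: "y \<in> carrier (W Z)" "p y = \<zero>\<^bsub>M\<^esub>" for y
  proof -
    have "elt Z y" using Z y by (simp add: elt_def)
    \<comment> \<open>As p is a comodule map, this theta is \<rho> of p y = 0. The vanishing
      criterion then yields an arrow into Z that passes through y and is killed by p.\<close>
    moreover have "theta M Z y p = \<zero>\<^bsub>T M\<^esub>" using pt[OF y(1)] y(2) \<rho>0 by simp
    ultimately obtain U u k where k: "elt_arrow U u Z y k" "\<And>v. v \<in> carrier (W U) \<Longrightarrow> p (far w U Z k v) = \<zero>\<^bsub>M\<^esub>"
      using theta_eq_zeroD[OF Mm _ p] by blast
    then show ?thesis by (auto simp: elt_arrow_def elt_def intro!: bexI[of _ U] bexI[of _ k])
  qed
  obtain K k Q q s s' where "K \<in> LOb A" "k \<in> carrier (LHom A K Z)"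
    "\<forall>x\<in>carrier (W K). p (far w K Z k x) = \<zero>\<^bsub>M\<^esub>"
    and cok: "is_cokernel A K Z k Q q" and s: "s \<in> mod_hom B (W Q) M" and s': "s' \<in> mod_hom B M (W Q)"
    and ss': "\<forall>x\<in>carrier (W Q). s' (s x) = x" "\<forall>x\<in>carrier M. s (s' x) = x"
    and sq': "\<forall>z\<in>carrier (W Z). s (far w Z Q q z) = p z"
    by (rule cokernel_presentation[OF M Z(1) p Z(3) cov])
  note ss = bspec[OF ss'(1)] bspec[OF ss'(2)] and sq = bspec[OF sq']
  have Q: "Q \<in> LOb A" "q \<in> carrier (LHom A Z Q)" using cok by (auto simp: is_cokernel_def)
  \<comment> \<open>Compatibility with the coactions descends from p = s w(q) to s, since w(q) is
    surjective and theta is dinatural.\<close>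
  have "theta M Q y s = \<rho> (s y)" if y: "y \<in> carrier (W Q)" for y
  proof -
    obtain z where z: "z \<in> carrier (W Z)" "s y = p z" using Z(3) mod_hom_closed[OF s y] by blast
    have qz: "far w Z Q q z \<in> carrier (W Q)" by (rule far_W_closed[OF Z(1) Q z(1)])
    have "y = s' (s (far w Z Q q z))" using z ss(1)[OF y] sq[OF z(1)] by simp
    then have y: "y = far w Z Q q z" using ss(1)[OF qz] by simp
    have "compose (carrier (W Z)) s (far w Z Q q) = p"
      by (rule mod_hom_eqI[OF mod_hom_comp[OF W_module[OF Z(1)] far_hom[OF Z(1) Q] s] p]) (simp add: compose_eq sq)
    then show ?thesis
      using theta_dinatural[OF Mm Z(1) z(1) Q(1,2) s] pt[OF z(1)] sq[OF z(1)] y by simp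
  qed
  then have "comod_map M \<rho> Q s" using s by (simp add: comod_map_def)
  then show ?thesis using that[OF Q(1) _ s' ss] by blast
qed

end

section \<open>Fully faithful and essentially surjective functors\<close>

text \<open>The quasi-inverse chooses for each Y an object G Y with an isomorphism e Y from F(G Y)
  to Y, and on arrows takes preimages under F of conjugates. All its laws are verified after
  applying F, which is injective on arrows.\<close>

lemma (in is_functor) equivalence_if_fully_faithful_surjective:
  assumes faithful: "\<And>X Y. \<lbrakk>X \<in> Ob C; Y \<in> Ob C\<rbrakk> \<Longrightarrow> inj_on (far F X Y) (Ar C X Y)"
    and full: "\<And>X Y g. \<lbrakk>X \<in> Ob C; Y \<in> Ob C; g \<in> Ar D (fob F X) (fob F Y)\<rbrakk> \<Longrightarrow> g \<in> far F X Y ` Ar C X Y"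
    and surj: "\<And>Y. Y \<in> Ob D \<Longrightarrow> \<exists>X\<in>Ob C. \<exists>f. is_iso D (fob F X) Y f"
  shows "equivalence_of_categories C D F"
proof -
  define l where "l X Y g = inv_into (Ar C X Y) (far F X Y) g" for X Y g
  have l: "l X Y g \<in> Ar C X Y" "far F X Y (l X Y g) = g"
    if "X \<in> Ob C" "Y \<in> Ob C" "g \<in> Ar D (fob F X) (fob F Y)" for X Y g
    using full[OF that] by (auto simp: l_def inv_into_into f_inv_into_f)
  have eqI: "a = b" if "X \<in> Ob C" "Y \<in> Ob C" "a \<in> Ar C X Y" "b \<in> Ar C X Y" "far F X Y a = far F X Y b" for X Y a b
    by (rule inj_onD[OF faithful[OF that(1,2)] that(5,3,4)])
  have "\<forall>Y\<in>Ob D. \<exists>X f g. X \<in> Ob C \<and> f \<in> Ar D (fob F X) Y \<and> g \<in> Ar D Y (fob F X) \<and>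
      Cmp D (fob F X) Y (fob F X) g f = Idn D (fob F X) \<and> Cmp D Y (fob F X) Y f g = Idn D Y"
    using surj by (fastforce simp: is_iso_def)
  then obtain G e e' where G: "\<And>Y. Y \<in> Ob D \<Longrightarrow> G Y \<in> Ob C" and e: "\<And>Y. Y \<in> Ob D \<Longrightarrow> e Y \<in> Ar D (fob F (G Y)) Y"
    and e': "\<And>Y. Y \<in> Ob D \<Longrightarrow> e' Y \<in> Ar D Y (fob F (G Y))"
    and e'e: "\<And>Y. Y \<in> Ob D \<Longrightarrow> Cmp D (fob F (G Y)) Y (fob F (G Y)) (e' Y) (e Y) = Idn D (fob F (G Y))"
    and ee': "\<And>Y. Y \<in> Ob D \<Longrightarrow> Cmp D Y (fob F (G Y)) Y (e Y) (e' Y) = Idn D Y"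
    by metis
  define H where "H Y = fob F (G Y)" for Y
  have H: "H Y \<in> Ob D" if "Y \<in> Ob D" for Y using that G fob_closed by (simp add: H_def)
  note e = e[folded H_def] and e' = e'[folded H_def] and e'e = e'e[folded H_def] and ee' = ee'[folded H_def]
  \<comment> \<open>The conjugate of f by the chosen isomorphisms; its preimage under F becomes the
    value of the quasi-inverse at f.\<close>
  define m where "m Y Z f = Cmp D (H Y) Z (H Z) (e' Z) (Cmp D (H Y) Y Z f (e Y))" for Y Z f
  have m: "m Y Z f \<in> Ar D (H Y) (H Z)" if "Y \<in> Ob D" "Z \<in> Ob D" "f \<in> Ar D Y Z" for Y Z f
    unfolding m_def using that by (meson D.Cmp_closed H e e')
  have em: "Cmp D (H Y) (H Z) Z (e Z) (m Y Z f) = Cmp D (H Y) Y Z f (e Y)"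
    if Y: "Y \<in> Ob D" and Z: "Z \<in> Ob D" and f: "f \<in> Ar D Y Z" for Y Z f
  proof -
    have fe: "Cmp D (H Y) Y Z f (e Y) \<in> Ar D (H Y) Z" by (rule D.Cmp_closed[OF H[OF Y] Y Z e[OF Y] f])
    show ?thesis unfolding m_def
      using D.Cmp_assoc[OF H[OF Y] Z H[OF Z] Z fe e'[OF Z] e[OF Z]] ee'[OF Z] D.Cmp_Idn_left[OF H[OF Y] Z fe] by simp
  qed
  \<comment> \<open>As e Z is invertible, the naturality square determines its upper arrow;
    functoriality is obtained by recognizing identities and composites through this square.\<close>
  have m_unique: "a = m Y Z f"
    if Y: "Y \<in> Ob D" and Z: "Z \<in> Ob D" and f: "f \<in> Ar D Y Z" and a: "a \<in> Ar D (H Y) (H Z)"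
      and eq: "Cmp D (H Y) (H Z) Z (e Z) a = Cmp D (H Y) Y Z f (e Y)" for Y Z f a
    unfolding m_def eq[symmetric]
    using D.Cmp_assoc[OF H[OF Y] H[OF Z] Z H[OF Z] a e[OF Z] e'[OF Z]] e'e[OF Z] D.Cmp_Idn_left[OF H[OF Y] H[OF Z] a] by simp
  define GG where "GG = \<lparr>fob = G, far = (\<lambda>Y Z f. l (G Y) (G Z) (m Y Z f))\<rparr>"
  have g: "l (G Y) (G Z) (m Y Z f) \<in> Ar C (G Y) (G Z)" "far F (G Y) (G Z) (l (G Y) (G Z) (m Y Z f)) = m Y Z f"
    if "Y \<in> Ob D" "Z \<in> Ob D" "f \<in> Ar D Y Z" for Y Z f
    using l[OF G[OF that(1)] G[OF that(2)]] m[OF that] by (auto simp: H_def)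
  have functor_G: "is_functor D C GG"
  proof (intro is_functor.intro is_functor_axioms.intro)
    show "category D" "category C" by unfold_locales
    show "fob GG Y \<in> Ob C" if "Y \<in> Ob D" for Y using that G by (simp add: GG_def)
    show "far GG Y Z f \<in> Ar C (fob GG Y) (fob GG Z)" if "Y \<in> Ob D" "Z \<in> Ob D" "f \<in> Ar D Y Z" for Y Z f
      using g(1)[OF that] by (simp add: GG_def)
    show "far GG Y Y (Idn D Y) = Idn C (fob GG Y)" if Y: "Y \<in> Ob D" for Y
    proof -
      note I = D.Idn_closed[OF Y]
      have "Idn D (H Y) = m Y Y (Idn D Y)"
        using m_unique[OF Y Y I D.Idn_closed[OF H[OF Y]]] D.Cmp_Idn_right[OF H[OF Y] Y e[OF Y]] D.Cmp_Idn_left[OF H[OF Y] Y e[OF Y]]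
        by simp
      then show ?thesis unfolding GG_def
        using eqI[OF G[OF Y] G[OF Y] g(1)[OF Y Y I] C.Idn_closed[OF G[OF Y]]] g(2)[OF Y Y I] far_Idn[OF G[OF Y]]
        by (simp add: H_def)
    qed
    show "far GG X Z (Cmp D X Y Z b a) = Cmp C (fob GG X) (fob GG Y) (fob GG Z) (far GG Y Z b) (far GG X Y a)"
      if X: "X \<in> Ob D" and Y: "Y \<in> Ob D" and Z: "Z \<in> Ob D" and a: "a \<in> Ar D X Y" and b: "b \<in> Ar D Y Z" for X Y Z a b
    proof -
      note ba = D.Cmp_closed[OF X Y Z a b] and ma = m[OF X Y a] and mb = m[OF Y Z b]
      have "Cmp D (H X) (H Z) Z (e Z) (Cmp D (H X) (H Y) (H Z) (m Y Z b) (m X Y a))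
          = Cmp D (H X) (H Y) Z (Cmp D (H Y) (H Z) Z (e Z) (m Y Z b)) (m X Y a)"
        by (rule D.Cmp_assoc[OF H[OF X] H[OF Y] H[OF Z] Z ma mb e[OF Z], symmetric])
      also have "\<dots> = Cmp D (H X) Y Z b (Cmp D (H X) (H Y) Y (e Y) (m X Y a))"
        unfolding em[OF Y Z b] by (rule D.Cmp_assoc[OF H[OF X] H[OF Y] Y Z ma e[OF Y] b])
      also have "\<dots> = Cmp D (H X) X Z (Cmp D X Y Z b a) (e X)"
        unfolding em[OF X Y a] by (rule D.Cmp_assoc[OF H[OF X] X Y Z e[OF X] a b, symmetric])
      finally have "Cmp D (H X) (H Y) (H Z) (m Y Z b) (m X Y a) = m X Z (Cmp D X Y Z b a)"
        by (rule m_unique[OF X Z ba D.Cmp_closed[OF H[OF X] H[OF Y] H[OF Z] ma mb]])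
      moreover have "far F (G X) (G Z) (Cmp C (G X) (G Y) (G Z) (l (G Y) (G Z) (m Y Z b)) (l (G X) (G Y) (m X Y a)))
          = Cmp D (H X) (H Y) (H Z) (m Y Z b) (m X Y a)"
        using far_Cmp[OF G[OF X] G[OF Y] G[OF Z] g(1)[OF X Y a] g(1)[OF Y Z b]] g(2)[OF X Y a] g(2)[OF Y Z b]
        by (simp add: H_def)
      ultimately show ?thesis unfolding GG_def
        using eqI[OF G[OF X] G[OF Z] g(1)[OF X Z ba] C.Cmp_closed[OF G[OF X] G[OF Y] G[OF Z] g(1)[OF X Y a] g(1)[OF Y Z b]]]
          g(2)[OF X Z ba] by simp
    qed
  qed
  have counit: "nat_iso D D (comp_functor F GG) id_functor e"
    unfolding nat_iso_def
  proof (intro conjI ballI)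
    fix Y assume Y: "Y \<in> Ob D"
    show "is_iso D (fob (comp_functor F GG) Y) (fob id_functor Y) (e Y)"
      unfolding is_iso_def
      using e[OF Y] e'[OF Y] e'e[OF Y] ee'[OF Y]
      by (auto simp: comp_functor_def id_functor_def GG_def H_def[symmetric])
    fix Z f assume Z: "Z \<in> Ob D" and f: "f \<in> Ar D Y Z"
    show "Cmp D (fob (comp_functor F GG) Y) (fob (comp_functor F GG) Z) (fob id_functor Z) (e Z) (far (comp_functor F GG) Y Z f)
        = Cmp D (fob (comp_functor F GG) Y) (fob id_functor Y) (fob id_functor Z) (far id_functor Y Z f) (e Y)"
      using em[OF Y Z f] g(2)[OF Y Z f] by (simp add: comp_functor_def id_functor_def GG_def H_def[symmetric])
  qed
  \<comment> \<open>The unit is the preimage of the inverse isomorphism at F X, and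
    \<open>\<eta>'\<close>, the preimage of the isomorphism itself, will be its inverse.\<close>
  define \<eta> where "\<eta> X = l X (G (fob F X)) (e' (fob F X))" for X
  define \<eta>' where "\<eta>' X = l (G (fob F X)) X (e (fob F X))" for X
  have \<eta>: "\<eta> X \<in> Ar C X (G (fob F X))" "far F X (G (fob F X)) (\<eta> X) = e' (fob F X)"
    "\<eta>' X \<in> Ar C (G (fob F X)) X" "far F (G (fob F X)) X (\<eta>' X) = e (fob F X)" if X: "X \<in> Ob C" for X
    using l[OF X G[OF fob_closed[OF X]]] l[OF G[OF fob_closed[OF X]] X] e e' fob_closed[OF X]
    by (auto simp: \<eta>_def \<eta>'_def H_def)
  have unit: "nat_iso C C id_functor (comp_functor GG F) \<eta>"
    unfolding nat_iso_def
  proof (intro conjI ballI)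
    fix X assume X: "X \<in> Ob C"
    let ?FX = "fob F X"
    note FX = fob_closed[OF X] and GX = G[OF fob_closed[OF X]]
    have "Cmp C X (G ?FX) X (\<eta>' X) (\<eta> X) = Idn C X"
      by (rule eqI[OF X X C.Cmp_closed[OF X GX X \<eta>(1,3)[OF X]] C.Idn_closed[OF X]])
        (use far_Cmp[OF X GX X \<eta>(1,3)[OF X]] \<eta>(2,4)[OF X] ee'[OF FX] far_Idn[OF X] in \<open>simp add: H_def\<close>)
    moreover have "Cmp C (G ?FX) X (G ?FX) (\<eta> X) (\<eta>' X) = Idn C (G ?FX)"
      by (rule eqI[OF GX GX C.Cmp_closed[OF GX X GX \<eta>(3,1)[OF X]] C.Idn_closed[OF GX]])
        (use far_Cmp[OF GX X GX \<eta>(3,1)[OF X]] \<eta>(2,4)[OF X] e'e[OF FX] far_Idn[OF GX] in \<open>simp add: H_def\<close>)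
    ultimately show "is_iso C (fob id_functor X) (fob (comp_functor GG F) X) (\<eta> X)"
      unfolding is_iso_def using \<eta>[OF X] by (auto simp: comp_functor_def id_functor_def GG_def)
    fix Y f assume Y: "Y \<in> Ob C" and f: "f \<in> Ar C X Y"
    let ?FY = "fob F Y"
    note FY = fob_closed[OF Y] and GY = G[OF fob_closed[OF Y]] and Ff = far_closed[OF X Y f]
    note gf = g[OF FX FY Ff]
    have "Cmp D ?FX (H ?FX) (H ?FY) (m ?FX ?FY (far F X Y f)) (e' ?FX) = Cmp D ?FX ?FY (H ?FY) (e' ?FY) (far F X Y f)"
    proof -
      note fe = D.Cmp_closed[OF H[OF FX] FX FY e[OF FX] Ff]
      have "Cmp D ?FX (H ?FX) (H ?FY) (m ?FX ?FY (far F X Y f)) (e' ?FX)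
          = Cmp D ?FX ?FY (H ?FY) (e' ?FY) (Cmp D ?FX (H ?FX) ?FY (Cmp D (H ?FX) ?FX ?FY (far F X Y f) (e ?FX)) (e' ?FX))"
        unfolding m_def by (rule D.Cmp_assoc[OF FX H[OF FX] FY H[OF FY] e'[OF FX] fe e'[OF FY]])
      also have "Cmp D ?FX (H ?FX) ?FY (Cmp D (H ?FX) ?FX ?FY (far F X Y f) (e ?FX)) (e' ?FX) = far F X Y f"
        using D.Cmp_assoc[OF FX H[OF FX] FX FY e'[OF FX] e[OF FX] Ff] ee'[OF FX] D.Cmp_Idn_right[OF FX FY Ff] by simp
      finally show ?thesis .
    qed
    then have "Cmp C X Y (G ?FY) (\<eta> Y) f = Cmp C X (G ?FX) (G ?FY) (l (G ?FX) (G ?FY) (m ?FX ?FY (far F X Y f))) (\<eta> X)"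
      by (intro eqI[OF X GY C.Cmp_closed[OF X Y GY f \<eta>(1)[OF Y]] C.Cmp_closed[OF X GX GY \<eta>(1)[OF X] gf(1)]])
        (use far_Cmp[OF X Y GY f \<eta>(1)[OF Y]] far_Cmp[OF X GX GY \<eta>(1)[OF X] gf(1)] \<eta>(2)[OF X] \<eta>(2)[OF Y] gf(2)
          in \<open>simp add: H_def\<close>)
    then show "Cmp C (fob id_functor X) (fob id_functor Y) (fob (comp_functor GG F) Y) (\<eta> Y) (far id_functor X Y f)
        = Cmp C (fob id_functor X) (fob (comp_functor GG F) X) (fob (comp_functor GG F) Y) (far (comp_functor GG F) X Y f) (\<eta> X)"
      by (simp add: comp_functor_def id_functor_def GG_def)
  qed
  show ?thesis
    unfolding equivalence_of_categories_def using is_functor_axioms functor_G unit counit by blast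
qed

section \<open>Reconstruction\<close>

context fibre_functor
begin

lemma Rep_simps [simp]:
  "(M, \<rho>) \<in> Ob (Rep R B A w) \<longleftrightarrow> comodule M \<rho> \<and> fg_projective B M"
  "f \<in> Ar (Rep R B A w) (M, \<rho>) (N, \<sigma>) \<longleftrightarrow>
    f \<in> mod_hom B M N \<and> (\<forall>x\<in>carrier M. tensor_map B L M N f (\<rho> x) = \<sigma> (f x))"
  "Cmp (Rep R B A w) (M, \<rho>) (N, \<sigma>) (P, \<tau>) g f = compose (carrier M) g f"
  "Idn (Rep R B A w) (M, \<rho>) = (\<lambda>x\<in>carrier M. x)"
  by (simp_all add: Rep_def Rep_cat_def)

lemma comoduleD:
  assumes "comodule M \<rho>"
  shows comodule_module: "left_module B M" and coaction_closed: "x \<in> carrier M \<Longrightarrow> \<rho> x \<in> carrier (T M)"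
  using assms mod_hom_closed by (fastforce simp: is_comodule_def)+

lemma tensor_map_id:
  fixes M :: "('b, 'n) module"
  assumes "left_module B M" "t \<in> carrier (T M)"
  shows "tensor_map B L M M (\<lambda>x\<in>carrier M. x) t = t"
  using is_functor.far_Idn[OF is_functor_tensor[OF bimod_L], of M] assms by (simp add: tensor_functor_def)

lemma tensor_map_compose:
  fixes M N P :: "('b, 'n) module"
  assumes "left_module B M" "left_module B N" "left_module B P" "f \<in> mod_hom B M N" "g \<in> mod_hom B N P"
    and "t \<in> carrier (T M)"
  shows "tensor_map B L M P (compose (carrier M) g f) t = tensor_map B L N P g (tensor_map B L M N f t)"
  using is_functor.far_Cmp[OF is_functor_tensor[OF bimod_L], of M N P f g] assms
  by (simp add: tensor_functor_def compose_eq)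

lemma category_Rep: "category (Rep R B A w)"
proof
  fix X assume "X \<in> Ob (Rep R B A w)"
  then obtain M \<rho> where X: "X = (M, \<rho>)" "comodule M \<rho>" by (cases X) auto
  then show "Idn (Rep R B A w) X \<in> Ar (Rep R B A w) X X"
    by (simp add: mod_hom_id comodule_module tensor_map_id coaction_closed)
next
  fix X Y Z f g
  assume *: "X \<in> Ob (Rep R B A w)" "Y \<in> Ob (Rep R B A w)" "Z \<in> Ob (Rep R B A w)"
    "f \<in> Ar (Rep R B A w) X Y" "g \<in> Ar (Rep R B A w) Y Z"
  obtain M \<rho> N \<sigma> P \<tau> where XYZ: "X = (M, \<rho>)" "Y = (N, \<sigma>)" "Z = (P, \<tau>)" by (metis surj_pair)
  have c: "comodule M \<rho>" "comodule N \<sigma>" "comodule P \<tau>" and f: "f \<in> mod_hom B M N" and g: "g \<in> mod_hom B N P"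
    and nat: "\<And>x. x \<in> carrier M \<Longrightarrow> tensor_map B L M N f (\<rho> x) = \<sigma> (f x)"
      "\<And>y. y \<in> carrier N \<Longrightarrow> tensor_map B L N P g (\<sigma> y) = \<tau> (g y)"
    using * by (simp_all add: XYZ)
  note m = comodule_module[OF c(1)] comodule_module[OF c(2)] comodule_module[OF c(3)]
  have "tensor_map B L M P (compose (carrier M) g f) (\<rho> x) = \<tau> (compose (carrier M) g f x)"
    if x: "x \<in> carrier M" for x
    using tensor_map_compose[OF m f g coaction_closed[OF c(1) x]] nat(1)[OF x] nat(2)[OF mod_hom_closed[OF f x]] x
    by (simp add: compose_eq)
  then show "Cmp (Rep R B A w) X Y Z g f \<in> Ar (Rep R B A w) X Z"
    using mod_hom_comp[OF m(1) f g] by (simp add: XYZ)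
next
  fix X Y f assume "Y \<in> Ob (Rep R B A w)" "f \<in> Ar (Rep R B A w) X Y"
  moreover obtain M \<rho> N \<sigma> where "X = (M, \<rho>)" "Y = (N, \<sigma>)" by (metis surj_pair)
  ultimately show "Cmp (Rep R B A w) X X Y f (Idn (Rep R B A w) X) = f"
    "Cmp (Rep R B A w) X Y Y (Idn (Rep R B A w) Y) f = f"
    by (auto intro!: compose_Id Id_compose simp: mod_homD)
next
  fix V X Y Z f g h
  assume "Y \<in> Ob (Rep R B A w)" "Z \<in> Ob (Rep R B A w)" "f \<in> Ar (Rep R B A w) V X"
  moreover obtain K \<kappa> M \<rho> N \<sigma> P \<tau> where "V = (K, \<kappa>)" "X = (M, \<rho>)" "Y = (N, \<sigma>)" "Z = (P, \<tau>)"
    by (metis surj_pair)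
  ultimately show "Cmp (Rep R B A w) V X Z (Cmp (Rep R B A w) X Y Z h g) f =
        Cmp (Rep R B A w) V Y Z h (Cmp (Rep R B A w) V X Y g f)"
    by (auto intro!: compose_assoc[symmetric] simp: mod_hom_closed)
qed

lemma Rep_arrow_iff_comod_map:
  assumes "comodule M \<rho>" "X \<in> LOb A"
  shows "h \<in> Ar (Rep R B A w) (W X, canonical_coaction R B A w X) (M, \<rho>) \<longleftrightarrow> comod_map M \<rho> X h"
  using assms by (auto simp: comod_map_def tensor_map_canonical[OF comodule_module])

lemma is_functor_tannaka_unit: "is_functor (ordinary A) (Rep R B A w) (tannaka_unit R B A w)"
proof (intro is_functor.intro is_functor_axioms.intro category_Rep)
  show "category (ordinary A)" ..
next
  fix X Y f assume "X \<in> Ob (ordinary A)" "Y \<in> Ob (ordinary A)" "f \<in> Ar (ordinary A) X Y"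
  then show "far (tannaka_unit R B A w) X Y f
      \<in> Ar (Rep R B A w) (fob (tannaka_unit R B A w) X) (fob (tannaka_unit R B A w) Y)"
    using Rep_arrow_iff_comod_map[OF comodule_canonical, of Y X "far w X Y f"] comod_map_far[of X Y f]
    by (simp add: tannaka_unit_def del: Rep_simps)
next
  fix X assume "X \<in> Ob (ordinary A)"
  then show "far (tannaka_unit R B A w) X X (Idn (ordinary A) X) = Idn (Rep R B A w) (fob (tannaka_unit R B A w) X)"
    using w.far_Idn[of X] by (simp add: tannaka_unit_def)
qed (simp_all add: tannaka_unit_def comodule_canonical fgp far_compose)

end

context tannakian_functor
begin

theorem equivalence_tannaka_unit:
  "equivalence_of_categories (ordinary A) (Rep R B A w) (tannaka_unit R B A w)"
proof (rule is_functor.equivalence_if_fully_faithful_surjective[OF is_functor_tannaka_unit])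
  fix X Y assume XY: "X \<in> Ob (ordinary A)" "Y \<in> Ob (ordinary A)"
  then show "inj_on (far (tannaka_unit R B A w) X Y) (Ar (ordinary A) X Y)"
    using faithful_w by (simp add: faithful_functor_def tannaka_unit_def)
  fix g assume "g \<in> Ar (Rep R B A w) (fob (tannaka_unit R B A w) X) (fob (tannaka_unit R B A w) Y)"
  then have "comod_map (W Y) (canonical_coaction R B A w Y) X g"
    using XY Rep_arrow_iff_comod_map[OF comodule_canonical, of Y X g]
    by (simp add: tannaka_unit_def del: Rep_simps)
  then show "g \<in> far (tannaka_unit R B A w) X Y ` Ar (ordinary A) X Y"
    using comod_map_full[of X Y g] XY by (auto simp: tannaka_unit_def)
next
  fix V assume "V \<in> Ob (Rep R B A w)"
  then obtain M \<rho> where V: "V = (M, \<rho>)" and com: "comodule M \<rho>" and M: "fg_projective B M" by (cases V) auto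
  note Mm = comodule_module[OF com]
  obtain Q s s' where Q: "Q \<in> LOb A" and s: "comod_map M \<rho> Q s" and s': "s' \<in> mod_hom B M (W Q)"
    and ss: "\<And>x. x \<in> carrier (W Q) \<Longrightarrow> s' (s x) = x" "\<And>x. x \<in> carrier M \<Longrightarrow> s (s' x) = x"
    using comod_map_essentially_surjective[OF com M] by blast
  let ?c = "canonical_coaction R B A w Q"
  note WQ = W_module[OF Q] and cQ = comodule_canonical[OF Q]
  have sh: "s \<in> mod_hom B (W Q) M" using s by (simp add: comod_map_def)
  have sa: "s \<in> Ar (Rep R B A w) (W Q, ?c) (M, \<rho>)"
    using s by (simp only: Rep_arrow_iff_comod_map[OF com Q])
  have 1: "compose (carrier (W Q)) s' s = idW Q"
    by (rule mod_hom_eqI[OF mod_hom_comp[OF WQ sh s'] idW_hom[OF Q]]) (simp add: compose_eq ss)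
  have 2: "compose (carrier M) s s' = (\<lambda>x\<in>carrier M. x)"
    by (rule mod_hom_eqI[OF mod_hom_comp[OF Mm s' sh] mod_hom_id[OF Mm]]) (simp add: compose_eq ss)
  \<comment> \<open>The linear inverse of a comodule map is one too: \<rho> x is the image under
    \<open>L\<close> \<otimes> s of the coaction at s' x, and applying \<open>L\<close> \<otimes> s'
    cancels s.\<close>
  have "tensor_map B L M (W Q) s' (\<rho> x) = ?c (s' x)" if x: "x \<in> carrier M" for x
  proof -
    have y: "s' x \<in> carrier (W Q)" by (rule mod_hom_closed[OF s' x])
    have "\<rho> x = tensor_map B L (W Q) M s (?c (s' x))" using sa y ss(2)[OF x] by simp
    then have "tensor_map B L M (W Q) s' (\<rho> x) = tensor_map B L (W Q) (W Q) (idW Q) (?c (s' x))"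
      using tensor_map_compose[OF WQ Mm WQ sh s' coaction_closed[OF cQ y]] 1 by simp
    also have "\<dots> = ?c (s' x)" by (rule tensor_map_id[OF WQ coaction_closed[OF cQ y]])
    finally show ?thesis .
  qed
  then have "s' \<in> Ar (Rep R B A w) (M, \<rho>) (W Q, ?c)" using s' by simp
  then have "is_iso (Rep R B A w) (W Q, ?c) (M, \<rho>) s"
    unfolding is_iso_def using sa 1 2 by (intro conjI bexI[of _ s']) simp_all
  then show "\<exists>X\<in>Ob (ordinary A). \<exists>f. is_iso (Rep R B A w) (fob (tannaka_unit R B A w) X) V f"
    using Q V by (auto simp: tannaka_unit_def)
qed

end

theorem theorem8p2p3:
  fixes R :: "'r ring" and B :: "('r, 'b) module"
    and A :: "('o, 'a, 'r) lin_cat" and w :: "('o, 'a, ('b, 'm) module, 'm \<Rightarrow> 'm) ftor"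
  assumes "cring R" and "assoc_algebra R B"
    and "additive_linear_category R A"
    and "linear_functor R A (Mod_cat B) w"
    and "\<And>X. X \<in> LOb A \<Longrightarrow> fg_projective B (fob w X)"
    and "faithful_functor (ordinary A) (ordinary (Mod_cat B)) w"
    and "reflects_isos (ordinary A) (ordinary (Mod_cat B)) w"
    and "cofiltered (elements_cat A w)"
    and "\<And>X Y f. \<lbrakk>X \<in> LOb A; Y \<in> LOb A; f \<in> carrier (LHom A X Y);
        \<exists>Q q. is_cokernel (Mod_cat B) (fob w X) (fob w Y) (far w X Y f) Q q \<and> fg_projective B Q\<rbrakk>
      \<Longrightarrow> (\<exists>C c. is_cokernel A X Y f C c) \<and>
          (\<forall>C c. is_cokernel A X Y f C c \<longrightarrow>
             is_cokernel (Mod_cat B) (fob w X) (fob w Y) (far w X Y f) (fob w C) (far w Y C c))"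
  shows "equivalence_of_categories (ordinary A) (Rep R B A w) (tannaka_unit R B A w)
    \<and> preserves_finite_limits
        (ordinary (Mod_cat B :: (('b, 'n::infinite) module, 'n \<Rightarrow> 'n, 'r) lin_cat))
        (ordinary (Mod_cat B)) (tensor_functor B (coend_bimodule R B A w))
    \<and> flat_right TYPE('n) B (coend_bimodule R B A w)"
proof -
  interpret tannakian_functor R B A w
  proof (intro tannakian_functor.intro tannakian_functor_axioms.intro cofiltered_fibre_functor.intro
      cofiltered_fibre_functor_axioms.intro fibre_functor.intro)
    \<comment> \<open>Existence of a cokernel in \<open>A\<close> and preservation of every such
      cokernel combine to one that is preserved.\<close>
    show "\<exists>C c. is_cokernel A X Y f C c \<and>
        is_cokernel (Mod_cat B) (fob w X) (fob w Y) (far w X Y f) (fob w C) (far w Y C c)"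
      if "X \<in> LOb A" "Y \<in> LOb A" "f \<in> carrier (LHom A X Y)"
        "is_cokernel (Mod_cat B) (fob w X) (fob w Y) (far w X Y f) Q q" "fg_projective B Q" for X Y f Q q
      using assms(9)[OF that(1-3)] that(4,5) by blast
  qed (fact assms)+
  show ?thesis
    using equivalence_tannaka_unit preserves_finite_limits_L flat_L by blast
qed

end
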